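(* For every sofic subshift $X\subset\mathcal A^{\mathbb N}$, the box dimension of $K=R(X)$ exists. Write $\gamma=\dim_{\mathrm H}K$. Moreover: (i) If $\dim_{\mathrm H}K=\dim_{\mathrm B}K$, then $\mathcal H^\gamma(K)>0$ and $\mathcal H^\gamma$ is $\sigma$-finite on $K$; but $\mathcal H^\gamma(K)$ need not be finite, i.e. there exist a matrix $\Lambda$ and a sofic subshift $X$ of the described type with $\dim_{\mathrm H}K=\dim_{\mathrm B}K$ and $\mathcal H^\gamma(K)=\infty$. (ii) If $\dim_{\mathrm H}K<\dim_{\mathrm B}K$, then $\mathcal H^\gamma(K)$ may be positive and finite, or it may be infinite and $\sigma$-finite; i.e. there exist $\Lambda$ and a sofic subshift $X$ with $\dim_{\mathrm H}K<\dim_{\mathrm B}K$ and $0<\mathcal H^\gamma(K)<\infty$, and there exist $\Lambda$ and a sofic subshift $X$ with $\dim_{\mathrm H}K<\dim_{\mathrm B}K$, $\mathcal H^\gamma(K)=\infty$, and $\mathcal H^\gamma$ $\sigma$-finite on $K$.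
   Context: Let $\Lambda=\operatorname{diag}(m_1,\ldots,m_d)$ with integers $m_1\ge\cdots\ge m_d\ge2$ taking at least two distinct values, and let $\mathcal A=\prod_{r=1}^d\{0,1,\ldots,m_r-1\}\subset\mathbb Z^d$. Here $\mathbb N=\{1,2,\ldots\}$. A subshift $X\subset\mathcal A^{\mathbb N}$ is a nonempty closed set with $\sigma(X)\subseteq X$, where $\sigma$ is the left shift. It is sofic if it is presented by a finite vertex-labelled directed graph: there are a finite vertex set $V$, an edge set $E\subset V\times V$ and a label map $\ell:V\to\mathcal A$ such that $X=\{(\ell(v_k))_{k\ge1}: v_k\in V,\ (v_k,v_{k+1})\in E\text{ for every }k\ge1\}$. The coding map is $R(x)=\sum_{k=1}^\infty\Lambda^{-k}x_k$ for $x=(x_k)_{k\ge1}$. $\mathcal H^t$ is $t$-dimensional Hausdorff measure, $\dim_{\mathrm H}$ Hausdorff dimension; the box dimension $\dim_{\mathrm B}$ exists if lower and upper box dimensions agree. "$\mathcal H^\gamma$ is $\sigma$-finite on $K$" means that $K$ is a countable union of $\mathcal H^\gamma$-measurable sets of finite $\mathcal H^\gamma$-measure. *)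

theory Defs
  imports "HOL-Analysis.Analysis"
begin

section \<open>Hausdorff measure, Hausdorff dimension and box dimension in a metric space\<close>

context Metric_space
begin

definition ediam :: "'a set \<Rightarrow> ennreal" where
  "ediam U = (SUP x\<in>U. SUP y\<in>U. ennreal (d x y))"

(* |U|^t with the usual conventions: the empty set contributes 0, and |U|^0 = 1 for nonempty U.
   The case t = 0 is separate because 0 powr 0 = 0.  Only applied to sets of finite diameter. *)
definition diam_power :: "real \<Rightarrow> 'a set \<Rightarrow> ennreal" where
  "diam_power t U =
     (if U = {} then 0 else if t = 0 then 1 else ennreal (enn2real (ediam U) powr t))"

definition hausdorff_premeasure :: "real \<Rightarrow> real \<Rightarrow> 'a set \<Rightarrow> ennreal" where
  "hausdorff_premeasure \<delta> t S =
     (INF U\<in>{U :: nat \<Rightarrow> 'a set. (\<forall>i. U i \<subseteq> M \<and> ediam (U i) \<le> ennreal \<delta>) \<and> S \<subseteq> (\<Union>i. U i)}.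
        \<Sum>i. diam_power t (U i))"

definition hausdorff_measure :: "real \<Rightarrow> 'a set \<Rightarrow> ennreal" where
  "hausdorff_measure t S = (SUP \<delta>\<in>{0<..}. hausdorff_premeasure \<delta> t S)"

definition hausdorff_dim :: "'a set \<Rightarrow> ereal" where
  "hausdorff_dim S = (INF t\<in>{t. 0 \<le> t \<and> hausdorff_measure t S = 0}. ereal t)"

(* lambda_system M (Pow M) is the collection of Caratheodory-measurable subsets of M. *)
definition hausdorff_sigma_finite_on :: "real \<Rightarrow> 'a set \<Rightarrow> bool" where
  "hausdorff_sigma_finite_on t S \<longleftrightarrow>
     (\<exists>A :: nat \<Rightarrow> 'a set.
        (\<forall>i. A i \<in> lambda_system M (Pow M) (hausdorff_measure t) \<and> hausdorff_measure t (A i) < \<infinity>) \<and>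
        S = (\<Union>i. A i))"

(* The least number of sets of diameter at most \<delta> needed to cover S; intended for totally
   bounded S, where a finite cover exists for every \<delta> > 0. *)
definition covering_number :: "real \<Rightarrow> 'a set \<Rightarrow> nat" where
  "covering_number \<delta> S =
     (LEAST n. \<exists>F. finite F \<and> card F = n \<and> (\<forall>U\<in>F. U \<subseteq> M \<and> ediam U \<le> ennreal \<delta>) \<and> S \<subseteq> \<Union>F)"

definition lower_box_dim :: "'a set \<Rightarrow> ereal" where
  "lower_box_dim S =
     Liminf (at_right 0) (\<lambda>\<delta>. ereal (ln (real (covering_number \<delta> S)) / - ln \<delta>))"

definition upper_box_dim :: "'a set \<Rightarrow> ereal" where
  "upper_box_dim S =
     Limsup (at_right 0) (\<lambda>\<delta>. ereal (ln (real (covering_number \<delta> S)) / - ln \<delta>))"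

definition box_dim_exists :: "'a set \<Rightarrow> bool" where
  "box_dim_exists S \<longleftrightarrow> lower_box_dim S = upper_box_dim S"

(* Meaningful when box_dim_exists S; the common value is then also lower_box_dim S. *)
definition box_dim :: "'a set \<Rightarrow> ereal" where
  "box_dim S = upper_box_dim S"

end


section \<open>Euclidean space of variable dimension\<close>

(* Coordinates 1, ..., d are numbered 0, ..., d - 1; a point of R^d is an extensional function
   on {..<d}, so that the dimension can be quantified. *)

definition Rd :: "nat \<Rightarrow> (nat \<Rightarrow> real) set" where
  "Rd d = ({..<d} \<rightarrow>\<^sub>E UNIV)"

definition Rd_dist :: "nat \<Rightarrow> (nat \<Rightarrow> real) \<Rightarrow> (nat \<Rightarrow> real) \<Rightarrow> real" where
  "Rd_dist d x y = L2_set (\<lambda>i. x i - y i) {..<d}"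

interpretation Rd: Metric_space "Rd d" "Rd_dist d" for d :: nat
proof
  fix x y z :: "nat \<Rightarrow> real"
  show "0 \<le> Rd_dist d x y"
    by (simp add: Rd_dist_def)
  show "Rd_dist d x y = Rd_dist d y x"
    by (simp add: Rd_dist_def L2_set_def power2_commute)
  show "(Rd_dist d x y = 0) = (x = y)" if "x \<in> Rd d" "y \<in> Rd d"
    using that by (auto simp: Rd_dist_def Rd_def L2_set_eq_0_iff intro: PiE_ext)
  show "Rd_dist d x z \<le> Rd_dist d x y + Rd_dist d y z"
    using L2_set_triangle_ineq[of "\<lambda>i. x i - y i" "\<lambda>i. y i - z i" "{..<d}"]
    by (simp add: Rd_dist_def)
qed


section \<open>Sofic subshifts and self-affine sofic sets\<close>

(* The matrix diag(m_1, ..., m_d) is given by d and the diagonal m 0, ..., m (d - 1). *)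
definition admissible_diagonal :: "nat \<Rightarrow> (nat \<Rightarrow> int) \<Rightarrow> bool" where
  "admissible_diagonal d m \<longleftrightarrow>
     antimono_on {..<d} m \<and> (\<forall>r<d. 2 \<le> m r) \<and> (\<exists>r<d. \<exists>s<d. m r \<noteq> m s)"

definition digits :: "nat \<Rightarrow> (nat \<Rightarrow> int) \<Rightarrow> (nat \<Rightarrow> int) set" where
  "digits d m = (\<Pi>\<^sub>E r\<in>{..<d}. {0..m r - 1})"

(* A sequence (x_k) with k = 1, 2, ... is encoded as x :: nat => _ with x k standing for x_(k+1). *)

definition shift :: "(nat \<Rightarrow> 'a) \<Rightarrow> (nat \<Rightarrow> 'a)" where
  "shift x = (\<lambda>k. x (Suc k))"

definition subshift :: "'a set \<Rightarrow> (nat \<Rightarrow> 'a) set \<Rightarrow> bool" where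
  "subshift A X \<longleftrightarrow>
     X \<noteq> {} \<and> closedin (product_topology (\<lambda>_. discrete_topology A) UNIV) X \<and> shift ` X \<subseteq> X"

(* Vertices are natural numbers without loss of generality, the vertex set being finite. *)
definition sofic_subshift :: "'a set \<Rightarrow> (nat \<Rightarrow> 'a) set \<Rightarrow> bool" where
  "sofic_subshift A X \<longleftrightarrow>
     subshift A X \<and>
     (\<exists>(V :: nat set) E l. finite V \<and> E \<subseteq> V \<times> V \<and> l \<in> V \<rightarrow> A \<and>
        X = {\<lambda>k. l (v k) |v. \<forall>k. v k \<in> V \<and> (v k, v (Suc k)) \<in> E})"

(* Coordinatewise form of the sum over k \<ge> 1 of Lambda^(-k) x_k. *)
definition coding_map :: "nat \<Rightarrow> (nat \<Rightarrow> int) \<Rightarrow> (nat \<Rightarrow> nat \<Rightarrow> int) \<Rightarrow> nat \<Rightarrow> real" where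
  "coding_map d m x = (\<lambda>r\<in>{..<d}. \<Sum>k. of_int (x k r) / of_int (m r) ^ Suc k)"

definition sofic_set :: "nat \<Rightarrow> (nat \<Rightarrow> int) \<Rightarrow> (nat \<Rightarrow> nat \<Rightarrow> int) set \<Rightarrow> (nat \<Rightarrow> real) set" where
  "sofic_set d m X = coding_map d m ` X"

(* The value of the Hausdorff dimension (finite, as K is contained in R^d) as a real exponent. *)
definition dim_exponent :: "nat \<Rightarrow> (nat \<Rightarrow> real) set \<Rightarrow> real" where
  "dim_exponent d K = real_of_ereal (Rd.hausdorff_dim d K)"

end

theory Submission
  imports Defs
begin

text \<open>
  At scale \<open>exp (- t)\<close> a point of \<open>K\<close> is described by its first \<open>t / ln (m r)\<close> digits in each
  coordinate \<open>r\<close>, that is, by a word cut into \<open>d\<close> blocks of lengths about \<open>\<alpha> j * t\<close>, where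
  \<open>\<alpha> j = 1 / ln (m j) - 1 / ln (m (j - 1))\<close>, the block \<open>j\<close> being read through the projection to the
  coordinates \<open>\<ge> j\<close>.  If \<open>\<lambda>_j(C)\<close> is the growth rate of the number of projected words of a
  strongly connected component \<open>C\<close> of the graph, then the number of approximate cubes of \<open>K\<close> is
  \<open>exp (\<beta> t)\<close> up to a polynomial factor, where \<open>\<beta>\<close> is the maximum of \<open>\<Sum>j. \<alpha> j * ln \<lambda>_j(C_j)\<close> over
  the chains \<open>C_0 \<rightarrow> C_1 \<rightarrow> \<dots>\<close> of components.  This is the box dimension.

  Every path ends in a single component, so \<open>K\<close> is a countable union of contracted copies of the
  images of the components.  The image of \<open>C\<close> has finite \<open>D\<close>-dimensional measure for
  \<open>D = (\<Sum>j. \<alpha> j * ln \<lambda>_j(C)) \<le> \<beta>\<close>, which gives \<open>\<sigma>\<close>-finiteness.  For positivity there are two cases.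
  Either the numbers of lifts of projected words are bounded by a constant times
  \<open>(\<lambda>_0 / \<lambda>_j)^n\<close>; then the uniform measures on long words and the mass distribution principle
  give positive \<open>D\<close>-dimensional measure.  Or the uniform measures on the words of \<open>C\<close> and of one of
  its projections are asymptotically singular; then covering each point at one of two suitable scales
  gives null \<open>s\<close>-dimensional measure for some \<open>s < D\<close>.  Hence \<open>H^\<beta>(K) = 0\<close> forces the Hausdorff
  dimension below \<open>\<beta>\<close>.

  The examples consist of sequences over one digit set followed by sequences over another: for two
  single digits \<open>K\<close> is countable and infinite; for \<open>m = (4, 3)\<close>, a full row followed by a column of
  \<open>q\<close> digits, \<open>K\<close> is a horizontal unit segment together with vertical Cantor sets (\<open>q = 2\<close>) or with
  \<open>4^n\<close> vertical segments of length \<open>3^-n\<close> for every \<open>n\<close> (\<open>q = 3\<close>).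
\<close>

section \<open>Hausdorff measures\<close>

text \<open>Passing from one component to another leaves the crossing times free, at a polynomial
  cost. The box dimension does not notice this, but no statement on measures at the critical
  exponent would survive it. Measures are therefore estimated on single components only, where
  gluing with bounded gaps yields word counts between \<open>r ^ n\<close> and
  \<open>K * r ^ n\<close>; the prefixes are paid for by a countable union, hence
  \<sigma>-finiteness without finiteness. The obstacle to positivity is that the uniform measure on
  the words of a component, when projected, need not be comparable to the uniform measure on the
  projected words. If the density is unbounded, gluing produces a word that occurs almost surely
  under one measure and rarely under the other. Repeating this test over consecutive blocks makes
  the error exponentially small. An exponential gain in the number of cubes, unlike mere
  singularity, lowers the exponent by a definite amount, and this is what is required: measure zero
  at \<open>\<beta>\<close> says nothing about the dimension, whereas finitely many exponents
  \<open>s < \<beta>\<close> have a maximum below \<open>\<beta>\<close> that passes to countable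
  unions.\<close>

lemma ennreal_suminf_tail_tendsto_0:
  fixes f :: "nat \<Rightarrow> ennreal"
  assumes "(\<Sum>k. f k) \<noteq> top"
  shows "(\<lambda>n. \<Sum>k. f (k + n)) \<longlonglongrightarrow> 0"
proof -
  have "f k \<noteq> top" for k
    using assms ennreal_suminf_lessD less_top by blast
  define g where "g k = enn2real (f k)" for k
  have f: "f k = ennreal (g k)" "g k \<ge> 0" for k
    using \<open>\<And>k. f k \<noteq> top\<close> by (auto simp: g_def less_top)
  have sg: "summable g"
    using assms f by (intro summable_suminf_not_top) auto
  have eq: "(\<Sum>k. f (k + n)) = ennreal (\<Sum>k. g (k + n))" for n
    unfolding f by (intro suminf_ennreal2) (auto simp: f sg summable_iff_shift)
  have "(\<lambda>n. \<Sum>k. g (k + n)) \<longlonglongrightarrow> 0"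
    using suminf_exist_split2[OF sg] .
  then have "(\<lambda>n. ennreal (\<Sum>k. g (k + n))) \<longlonglongrightarrow> ennreal 0"
    by (rule tendsto_ennrealI)
  then show ?thesis using eq by simp
qed

context Metric_space
begin

lemma ediam_upper: "\<lbrakk>x \<in> U; y \<in> U\<rbrakk> \<Longrightarrow> ennreal (d x y) \<le> ediam U"
  unfolding ediam_def by (meson SUP_upper2 order_refl SUP_upper)

lemma ediam_mono: "U \<subseteq> V \<Longrightarrow> ediam U \<le> ediam V"
  unfolding ediam_def by (intro SUP_mono) (meson SUP_mono SUP_subset_mono order_refl subsetD)

lemma ediam_leI: "(\<And>x y. \<lbrakk>x \<in> U; y \<in> U\<rbrakk> \<Longrightarrow> d x y \<le> c) \<Longrightarrow> ediam U \<le> ennreal c"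
  unfolding ediam_def by (intro SUP_least ennreal_leI) auto

lemma ediam_leD: "\<lbrakk>ediam U \<le> ennreal c; 0 \<le> c; x \<in> U; y \<in> U\<rbrakk> \<Longrightarrow> d x y \<le> c"
  using ediam_upper[of x U y] by (metis ennreal_le_iff order_trans)

lemma diam_power_empty [simp]: "diam_power t {} = 0"
  by (simp add: diam_power_def)

lemma diam_power_mono:
  assumes "U \<subseteq> V" "ediam V < top" "t \<ge> 0"
  shows "diam_power t U \<le> diam_power t V"
proof -
  have "ediam U \<le> ediam V" using assms ediam_mono by blast
  then have "enn2real (ediam U) \<le> enn2real (ediam V)"
    using assms(2) by (intro enn2real_mono) auto
  then show ?thesis
    using assms by (auto simp: diam_power_def intro!: ennreal_leI powr_mono2)
qed

lemma diam_power_le: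
  assumes "ediam U \<le> ennreal r" "0 \<le> t" "0 < r"
  shows "diam_power t U \<le> ennreal (r powr t)"
proof -
  have "enn2real (ediam U) \<le> enn2real (ennreal r)"
    using assms by (intro enn2real_mono) auto
  then show ?thesis
    using assms by (auto simp: diam_power_def intro!: ennreal_leI powr_mono2)
qed

lemma diam_power_exponent_le:
  assumes "ediam U \<le> ennreal r" "0 \<le> t" "t < u" "0 < r"
  shows "diam_power u U \<le> ennreal (r powr (u - t)) * diam_power t U"
proof (cases "U = {}")
  case False
  define e where "e = enn2real (ediam U)"
  have e: "0 \<le> e" "e \<le> r"
    using assms enn2real_mono[OF assms(1)] by (auto simp: e_def)
  show ?thesis
  \<comment> \<open>Since \<open>u > 0\<close>, the left side vanishes here, whichever convention is
    in force for the exponent \<open>t\<close>.\<close>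
  proof (cases "e = 0")
    case True
    then show ?thesis using assms False by (simp add: diam_power_def e_def)
  next
    case ne: False
    have "e powr u = e powr (u - t) * e powr t"
      by (simp add: powr_add [symmetric])
    also have "\<dots> \<le> r powr (u - t) * e powr t"
      using e assms by (intro mult_right_mono powr_mono2) auto
    finally show ?thesis
      using False assms ne e
      by (auto simp: diam_power_def e_def [symmetric] ennreal_mult [symmetric] intro!: ennreal_leI)
  qed
qed auto

lemma hausdorff_premeasure_le:
  assumes "\<And>i. U i \<subseteq> M" "\<And>i. ediam (U i) \<le> ennreal \<delta>" "S \<subseteq> (\<Union>i. U i)"
  shows "hausdorff_premeasure \<delta> t S \<le> (\<Sum>i. diam_power t (U i))"
  unfolding hausdorff_premeasure_def using assms by (intro INF_lower) auto

lemma hausdorff_premeasure_ge: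
  assumes "\<And>U. \<lbrakk>\<And>i::nat. U i \<subseteq> M; \<And>i. ediam (U i) \<le> ennreal \<delta>; S \<subseteq> (\<Union>i. U i)\<rbrakk>
     \<Longrightarrow> c \<le> (\<Sum>i. diam_power t (U i))"
  shows "c \<le> hausdorff_premeasure \<delta> t S"
  unfolding hausdorff_premeasure_def using assms by (intro INF_greatest) auto

lemma hausdorff_premeasure_antimono:
  assumes "\<delta> \<le> \<delta>'"
  shows "hausdorff_premeasure \<delta>' t S \<le> hausdorff_premeasure \<delta> t S"
proof (rule hausdorff_premeasure_ge, rule hausdorff_premeasure_le)
  show "ediam (U i) \<le> ennreal \<delta>'" if "\<And>i. ediam (U i) \<le> ennreal \<delta>" for U :: "nat \<Rightarrow> 'a set" and i
    using that[of i] ennreal_leI[OF assms] by (rule order_trans)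
qed auto

lemma hausdorff_premeasure_mono:
  assumes "S \<subseteq> T"
  shows "hausdorff_premeasure \<delta> t S \<le> hausdorff_premeasure \<delta> t T"
  by (rule hausdorff_premeasure_ge, rule hausdorff_premeasure_le) (use assms in auto)

lemma hausdorff_premeasure_le_measure:
  "0 < \<delta> \<Longrightarrow> hausdorff_premeasure \<delta> t S \<le> hausdorff_measure t S"
  unfolding hausdorff_measure_def by (intro SUP_upper) auto

lemma hausdorff_measure_leI:
  "(\<And>\<delta>. 0 < \<delta> \<Longrightarrow> hausdorff_premeasure \<delta> t S \<le> c) \<Longrightarrow> hausdorff_measure t S \<le> c"
  unfolding hausdorff_measure_def by (intro SUP_least) auto

lemma hausdorff_measure_mono: "S \<subseteq> T \<Longrightarrow> hausdorff_measure t S \<le> hausdorff_measure t T"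
  by (rule hausdorff_measure_leI)
     (meson hausdorff_premeasure_le_measure hausdorff_premeasure_mono order_trans)

lemma hausdorff_measure_empty [simp]: "hausdorff_measure t {} = 0"
proof -
  have "hausdorff_premeasure \<delta> t {} \<le> 0" for \<delta>
    using hausdorff_premeasure_le[of "\<lambda>_. {}" \<delta> "{}" t] by (simp add: ediam_def)
  then have "hausdorff_measure t {} \<le> 0" by (intro hausdorff_measure_leI) auto
  then show ?thesis by simp
qed

lemma hausdorff_premeasure_countably_subadditive:
  "hausdorff_premeasure \<delta> t (\<Union>n. S n) \<le> (\<Sum>n. hausdorff_premeasure \<delta> t (S n))"
proof (rule ennreal_le_epsilon)
  fix e :: real assume fin: "(\<Sum>n. hausdorff_premeasure \<delta> t (S n)) < top" and e: "0 < e"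
  let ?C = "\<lambda>n. {U :: nat \<Rightarrow> 'a set. (\<forall>i. U i \<subseteq> M \<and> ediam (U i) \<le> ennreal \<delta>) \<and> S n \<subseteq> (\<Union>i. U i)}"
  have "\<exists>U. U \<in> ?C n \<and> (\<Sum>i. diam_power t (U i)) \<le> hausdorff_premeasure \<delta> t (S n) + ennreal (e * (1/2) ^ Suc n)" for n
  proof -
    have "hausdorff_premeasure \<delta> t (S n) < top"
      using fin ennreal_suminf_lessD by blast
    then have "hausdorff_premeasure \<delta> t (S n) < hausdorff_premeasure \<delta> t (S n) + ennreal (e * (1/2) ^ Suc n)"
      using e by simp
    then show ?thesis
      unfolding hausdorff_premeasure_def INF_less_iff by (blast intro: less_imp_le)
  qed
  then have "\<exists>U. \<forall>n. U n \<in> ?C n \<and> (\<Sum>i. diam_power t (U n i)) \<le> hausdorff_premeasure \<delta> t (S n) + ennreal (e * (1/2) ^ Suc n)"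
    by (intro choice allI)
  then obtain U where U: "\<And>n. U n \<in> ?C n"
    "\<And>n. (\<Sum>i. diam_power t (U n i)) \<le> hausdorff_premeasure \<delta> t (S n) + ennreal (e * (1/2) ^ Suc n)"
    by blast
  have "hausdorff_premeasure \<delta> t (\<Union>n. S n) \<le> (\<Sum>i. diam_power t (case prod_decode i of (n, j) \<Rightarrow> U n j))"
  proof (rule hausdorff_premeasure_le)
    show "(case prod_decode i of (n, j) \<Rightarrow> U n j) \<subseteq> M" for i
      using U(1) by (auto split: prod.splits)
    show "ediam (case prod_decode i of (n, j) \<Rightarrow> U n j) \<le> ennreal \<delta>" for i
      using U(1) by (auto split: prod.splits)
    show "(\<Union>n. S n) \<subseteq> (\<Union>i. case prod_decode i of (n, j) \<Rightarrow> U n j)"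
    proof
      fix x assume "x \<in> (\<Union>n. S n)"
      then obtain n j where "x \<in> U n j" using U(1) by blast
      then have "x \<in> (case prod_decode (prod_encode (n, j)) of (n, j) \<Rightarrow> U n j)" by simp
      then show "x \<in> (\<Union>i. case prod_decode i of (n, j) \<Rightarrow> U n j)" by (rule UN_I [OF UNIV_I])
    qed
  qed
  also have "\<dots> = (\<Sum>i. (\<lambda>(n, j). diam_power t (U n j)) (prod_decode i))"
    by (simp add: case_prod_unfold)
  also have "\<dots> = (\<Sum>n. \<Sum>j. diam_power t (U n j))"
    by (rule suminf_ennreal_2dimen) auto
  also have "\<dots> \<le> (\<Sum>n. hausdorff_premeasure \<delta> t (S n) + ennreal (e * (1/2) ^ Suc n))"
    by (intro suminf_le U) auto
  also have "\<dots> = (\<Sum>n. hausdorff_premeasure \<delta> t (S n)) + (\<Sum>n. ennreal (e * (1/2) ^ Suc n))"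
    by (intro suminf_add [symmetric]) auto
  also have "(\<Sum>n. ennreal (e * (1/2) ^ Suc n)) = ennreal (\<Sum>n. e * (1/2) ^ Suc n)"
    using e by (intro suminf_ennreal2) (auto simp: summable_geometric intro!: summable_mult)
  also have "(\<Sum>n. e * (1/2) ^ Suc n) = e"
    using power_half_series by (metis mult.right_neutral sums_mult sums_unique)
  finally show "hausdorff_premeasure \<delta> t (\<Union>n. S n) \<le> (\<Sum>n. hausdorff_premeasure \<delta> t (S n)) + ennreal e" .
qed

lemma hausdorff_measure_countably_subadditive:
  "hausdorff_measure t (\<Union>n. S n) \<le> (\<Sum>n. hausdorff_measure t (S n))"
proof (rule hausdorff_measure_leI)
  fix \<delta> :: real assume "0 < \<delta>"
  then have "(\<Sum>n. hausdorff_premeasure \<delta> t (S n)) \<le> (\<Sum>n. hausdorff_measure t (S n))"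
    by (intro suminf_le hausdorff_premeasure_le_measure) auto
  then show "hausdorff_premeasure \<delta> t (\<Union>n. S n) \<le> (\<Sum>n. hausdorff_measure t (S n))"
    by (rule order_trans[OF hausdorff_premeasure_countably_subadditive])
qed

lemma hausdorff_premeasure_Un:
  "hausdorff_premeasure \<delta> t (A \<union> B) \<le> hausdorff_premeasure \<delta> t A + hausdorff_premeasure \<delta> t B"
proof -
  define S where "S n = (if n = 0 then A else if n = 1 then B else {})" for n :: nat
  have "hausdorff_premeasure \<delta> t {} \<le> 0"
    using hausdorff_premeasure_le[of "\<lambda>_. {}" \<delta> "{}" t] by (simp add: ediam_def)
  then have e: "hausdorff_premeasure \<delta> t {} = 0" by simp
  have "A \<union> B = (\<Union>n. S n)" by (auto simp: S_def split: if_splits)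
  then have "hausdorff_premeasure \<delta> t (A \<union> B) \<le> (\<Sum>n. hausdorff_premeasure \<delta> t (S n))"
    using hausdorff_premeasure_countably_subadditive by metis
  also have "\<dots> = (\<Sum>n\<in>{0,1}. hausdorff_premeasure \<delta> t (S n))"
    by (rule suminf_finite) (auto simp: S_def e)
  finally show ?thesis by (simp add: S_def)
qed

lemma hausdorff_measure_Un: "hausdorff_measure t (A \<union> B) \<le> hausdorff_measure t A + hausdorff_measure t B"
proof (rule hausdorff_measure_leI)
  fix \<delta> :: real assume "0 < \<delta>"
  then have "hausdorff_premeasure \<delta> t A + hausdorff_premeasure \<delta> t B \<le> hausdorff_measure t A + hausdorff_measure t B"
    by (intro add_mono hausdorff_premeasure_le_measure)
  then show "hausdorff_premeasure \<delta> t (A \<union> B) \<le> hausdorff_measure t A + hausdorff_measure t B"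
    by (rule order_trans[OF hausdorff_premeasure_Un])
qed

lemma hausdorff_measure_countable_null:
  assumes "countable I" "\<And>i. i \<in> I \<Longrightarrow> hausdorff_measure t (S i) = 0"
  shows "hausdorff_measure t (\<Union>i\<in>I. S i) = 0"
proof (cases "I = {}")
  case False
  then have "(\<Union>i\<in>I. S i) = (\<Union>n. S (from_nat_into I n))"
    using assms(1) by (metis UN_extend_simps(10) range_from_nat_into)
  then have "hausdorff_measure t (\<Union>i\<in>I. S i) \<le> (\<Sum>n. hausdorff_measure t (S (from_nat_into I n)))"
    using hausdorff_measure_countably_subadditive by metis
  also have "\<dots> = 0" using assms False by (simp add: from_nat_into)
  finally show ?thesis by simp
qed auto

text \<open>The property of a metric outer measure from which measurability of closed sets follows:
  a cover by sets of diameter below \<open>e\<close> splits into the sets meeting \<open>A\<close>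
  and those meeting \<open>B\<close>.\<close>

lemma hausdorff_measure_separated:
  assumes "0 < e" "\<And>a b. \<lbrakk>a \<in> A; b \<in> B\<rbrakk> \<Longrightarrow> e \<le> d a b" "0 \<le> t"
  shows "hausdorff_measure t A + hausdorff_measure t B \<le> hausdorff_measure t (A \<union> B)"
proof -
  \<comment> \<open>Independent scales are allowed because the two suprema are taken one after the
    other below.\<close>
  have *: "hausdorff_premeasure \<delta>1 t A + hausdorff_premeasure \<delta>2 t B \<le> hausdorff_measure t (A \<union> B)"
    if "0 < \<delta>1" "0 < \<delta>2" for \<delta>1 \<delta>2
  proof -
    define \<delta> where "\<delta> = min (e/2) (min \<delta>1 \<delta>2)"
    have \<delta>: "0 < \<delta>" "\<delta> < e" "\<delta> \<le> \<delta>1" "\<delta> \<le> \<delta>2" using that assms(1) by (auto simp: \<delta>_def)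
    have "hausdorff_premeasure \<delta> t A + hausdorff_premeasure \<delta> t B \<le> hausdorff_premeasure \<delta> t (A \<union> B)"
    proof (rule hausdorff_premeasure_ge)
      fix U :: "nat \<Rightarrow> 'a set"
      assume U: "\<And>i. U i \<subseteq> M" "\<And>i. ediam (U i) \<le> ennreal \<delta>" "A \<union> B \<subseteq> (\<Union>i. U i)"
      have le: "ediam (U i \<inter> C) \<le> ennreal \<delta>" for i C
        using ediam_mono[of "U i \<inter> C" "U i"] U(2)[of i] by auto
      have "hausdorff_premeasure \<delta> t A \<le> (\<Sum>i. diam_power t (U i \<inter> A))"
        "hausdorff_premeasure \<delta> t B \<le> (\<Sum>i. diam_power t (U i \<inter> B))"
        by (rule hausdorff_premeasure_le; use U le in fastforce)+
      then have "hausdorff_premeasure \<delta> t A + hausdorff_premeasure \<delta> t B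
          \<le> (\<Sum>i. diam_power t (U i \<inter> A)) + (\<Sum>i. diam_power t (U i \<inter> B))"
        by (rule add_mono)
      also have "\<dots> = (\<Sum>i. diam_power t (U i \<inter> A) + diam_power t (U i \<inter> B))"
        by (intro suminf_add) auto
      also have "\<dots> \<le> (\<Sum>i. diam_power t (U i))"
      proof (intro suminf_le)
        fix i
        have "U i \<inter> A = {} \<or> U i \<inter> B = {}"
        proof (rule ccontr)
          assume "\<not> ?thesis"
          then obtain a b where "a \<in> U i" "a \<in> A" "b \<in> U i" "b \<in> B" by blast
          then show False using ediam_leD[OF U(2)] assms(2)[of a b] \<delta> by fastforce
        qed
        moreover have "ediam (U i) < top" using U(2)[of i] by (simp add: order_le_less_trans)
        ultimately show "diam_power t (U i \<inter> A) + diam_power t (U i \<inter> B) \<le> diam_power t (U i)"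
          using assms(3) by (auto intro!: diam_power_mono)
      qed auto
      finally show "hausdorff_premeasure \<delta> t A + hausdorff_premeasure \<delta> t B \<le> (\<Sum>i. diam_power t (U i))" .
    qed
    moreover have "hausdorff_premeasure \<delta>1 t A \<le> hausdorff_premeasure \<delta> t A"
      "hausdorff_premeasure \<delta>2 t B \<le> hausdorff_premeasure \<delta> t B"
      by (intro hausdorff_premeasure_antimono \<delta>)+
    ultimately have "hausdorff_premeasure \<delta>1 t A + hausdorff_premeasure \<delta>2 t B \<le> hausdorff_premeasure \<delta> t (A \<union> B)"
      by (meson add_mono order_trans)
    then show ?thesis
      using hausdorff_premeasure_le_measure[OF \<delta>(1), of t "A \<union> B"] by (rule order_trans)
  qed
  have "hausdorff_measure t A + hausdorff_premeasure \<delta> t B \<le> hausdorff_measure t (A \<union> B)" if "0 < \<delta>" for \<delta>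
  proof -
    have "hausdorff_measure t A + hausdorff_premeasure \<delta> t B
        = (SUP \<delta>1\<in>{0<..}. hausdorff_premeasure \<delta>1 t A + hausdorff_premeasure \<delta> t B)"
      unfolding hausdorff_measure_def by (rule ennreal_SUP_add_left [symmetric]) (auto intro: exI[of _ 1])
    then show ?thesis using that by (auto intro!: SUP_least *)
  qed
  moreover have "hausdorff_measure t A + hausdorff_measure t B
      = (SUP \<delta>\<in>{0<..}. hausdorff_measure t A + hausdorff_premeasure \<delta> t B)"
    unfolding hausdorff_measure_def[of t B] by (rule ennreal_SUP_add_right) (auto intro: exI[of _ 1])
  ultimately show ?thesis by (auto intro!: SUP_least)
qed

text \<open>Caratheodory's criterion. \<open>A n\<close> collects the points of \<open>T\<close> at
  distance at least \<open>1 / (n + 1)\<close> from \<open>F\<close>, so it is separated from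
  \<open>F\<close>; the rest of \<open>T - F\<close> is covered by the rings \<open>R k\<close> with
  \<open>k \<ge> n\<close>. Rings of equal parity are separated from each other, so the sum of all
  ring measures is finite and its tails tend to 0.\<close>

theorem closedin_lambda_system:
  assumes "closedin mtopology F" "0 \<le> t"
  shows "F \<in> lambda_system M (Pow M) (hausdorff_measure t)"
proof -
  let ?H = "hausdorff_measure t"
  have FM: "F \<subseteq> M" using assms(1) closedin_metric by blast
  have main: "?H (F \<inter> T) + ?H (T - F) \<le> ?H T" if TM: "T \<subseteq> M" for T
  proof (cases "?H T = top")
    case False
    define A where "A n = {x \<in> T. \<forall>y\<in>F. 1 / real (Suc n) \<le> d x y}" for n
    define R where "R n = A (Suc n) - A n" for n
    have Amono: "A m \<subseteq> A n" if "m \<le> n" for m n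
    proof -
      have "1 / real (Suc n) \<le> 1 / real (Suc m)" using that by (simp add: field_simps)
      then show ?thesis unfolding A_def by (auto intro: order_trans)
    qed
    \<comment> \<open>A point of \<open>R j\<close> has a point of \<open>F\<close> closer than
      \<open>1 / (j + 1)\<close>, from which \<open>x\<close> keeps its distance.\<close>
    have sep: "1 / real (k + 2) - 1 / real (j + 1) \<le> d x y"
      if x: "x \<in> A (Suc k)" and y: "y \<in> R j" for x y k j
    proof -
      obtain f where f: "f \<in> F" "d y f < 1 / real (Suc j)"
        using y unfolding R_def A_def by (auto simp: not_le simp del: of_nat_Suc)
      have "1 / real (Suc (Suc k)) \<le> d x f" using x f unfolding A_def by blast
      moreover have "d x f \<le> d x y + d y f"
        using x y f FM TM by (intro triangle) (auto simp: A_def R_def)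
      ultimately show ?thesis using f by simp
    qed
    \<comment> \<open>Consecutive rings may touch; taking every second one leaves a positive
      gap.\<close>
    have par: "(\<Sum>k<N. ?H (R (2 * k + c))) \<le> ?H (\<Union>k<N. R (2 * k + c))" for N c
    proof (induction N)
      case (Suc N)
      let ?j = "2 * N + c"
      let ?B = "\<Union>k<N. R (2 * k + c)"
      have "?H ?B + ?H (R ?j) \<le> ?H (?B \<union> R ?j)"
      proof (cases "N = 0")
        case False
        show ?thesis
        proof (rule hausdorff_measure_separated[OF _ _ assms(2)])
          show "0 < 1 / real ?j - 1 / real (?j + 1)" using False by (simp add: frac_less2)
          fix a b assume "a \<in> ?B" "b \<in> R ?j"
          then obtain k where k: "k < N" "a \<in> A (Suc (2 * k + c))" by (auto simp: R_def)
          have "Suc (2 * k + c) \<le> Suc (?j - 2)" using k(1) by auto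
          then have "a \<in> A (Suc (?j - 2))" using k Amono by blast
          moreover have "?j - 2 + 2 = ?j" using False by simp
          ultimately show "1 / real ?j - 1 / real (?j + 1) \<le> d a b"
            using sep[of a "?j - 2" b ?j] \<open>b \<in> R ?j\<close> by simp
        qed
      qed auto
      also have "?B \<union> R ?j = (\<Union>k<Suc N. R (2 * k + c))" by (auto simp: less_Suc_eq)
      finally have "?H ?B + ?H (R ?j) \<le> ?H (\<Union>k<Suc N. R (2 * k + c))" .
      moreover have "(\<Sum>k<Suc N. ?H (R (2 * k + c))) \<le> ?H ?B + ?H (R ?j)"
        using Suc.IH by (simp add: add_right_mono)
      ultimately show ?case by (rule order_trans[rotated])
    qed auto
    have RT: "(\<Union>k<N. R (2 * k + c)) \<subseteq> T" for N c by (auto simp: R_def A_def)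
    have par_sum: "(\<Sum>k. ?H (R (2 * k + c))) \<le> ?H T" for c
      by (intro suminf_le_const) (auto intro: order_trans[OF par hausdorff_measure_mono[OF RT]])
    have "(\<Sum>k<N. ?H (R k)) \<le> ?H T + ?H T" for N
    proof -
      have "(\<Sum>k<N. ?H (R k)) \<le> (\<Sum>k\<in>{..<2 * N}. ?H (R k))" by (intro sum_mono2) auto
      also have "\<dots> = (\<Sum>k<N. ?H (R (2 * k + 0))) + (\<Sum>k<N. ?H (R (2 * k + 1)))"
        by (induction N) (auto simp: algebra_simps)
      also have "\<dots> \<le> (\<Sum>k. ?H (R (2 * k + 0))) + (\<Sum>k. ?H (R (2 * k + 1)))"
        by (intro add_mono sum_le_suminf) auto
      also have "\<dots> \<le> ?H T + ?H T" by (intro add_mono par_sum)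
      finally show ?thesis .
    qed
    then have "(\<Sum>k. ?H (R k)) \<le> ?H T + ?H T" by (intro suminf_le_const) auto
    then have "(\<Sum>k. ?H (R k)) \<noteq> top" using False by (auto simp: top_unique)
    then have tail: "(\<lambda>n. \<Sum>k. ?H (R (k + n))) \<longlonglongrightarrow> 0" by (rule ennreal_suminf_tail_tendsto_0)
    have TF: "T - F \<subseteq> A n \<union> (\<Union>k. R (k + n))" for n
    proof
      fix x assume x: "x \<in> T - F"
      then have "x \<in> M - F" using TM by auto
      moreover have "openin mtopology (M - F)" using assms(1) by (simp add: closedin_def)
      ultimately have "\<exists>r>0. mball x r \<subseteq> M - F" by (simp add: openin_mtopology)
      then obtain r where r: "r > 0" "mball x r \<subseteq> M - F" by blast
      obtain N where N: "1 / real (Suc N) < r" using r(1) nat_approx_posE by blast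
      have "x \<in> A N"
      proof -
        have "1 / real (Suc N) \<le> d x y" if "y \<in> F" for y
        proof (rule ccontr)
          assume "\<not> ?thesis"
          then have "y \<in> mball x r" using N x that FM TM by (auto simp: in_mball)
          then show False using r that by blast
        qed
        then show ?thesis using x by (auto simp: A_def)
      qed
      then have ex: "\<exists>N. x \<in> A N" ..
      define m where "m = (LEAST N. x \<in> A N)"
      have m: "x \<in> A m" using ex LeastI_ex m_def by (metis (mono_tags, lifting))
      show "x \<in> A n \<union> (\<Union>k. R (k + n))"
      proof (cases "m \<le> n")
        case True then show ?thesis using m Amono by blast
      next
        case False
        then have "x \<in> R (m - 1)"
          using m not_less_Least[of "m - 1" "\<lambda>N. x \<in> A N"] unfolding R_def m_def[symmetric] by auto
        then have "x \<in> R ((m - 1 - n) + n)" using False by simp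
        then show ?thesis by blast
      qed
    qed
    have "?H (F \<inter> T) + ?H (T - F) \<le> ?H T + (\<Sum>k. ?H (R (k + n)))" for n
    proof -
      have "?H (T - F) \<le> ?H (A n) + ?H (\<Union>k. R (k + n))"
        by (rule order_trans[OF hausdorff_measure_mono[OF TF] hausdorff_measure_Un])
      also have "\<dots> \<le> ?H (A n) + (\<Sum>k. ?H (R (k + n)))"
        by (intro add_left_mono hausdorff_measure_countably_subadditive)
      finally have 1: "?H (T - F) \<le> \<dots>" .
      have "?H (F \<inter> T) + ?H (A n) \<le> ?H ((F \<inter> T) \<union> A n)"
      proof (rule hausdorff_measure_separated[OF _ _ assms(2)])
        show "0 < 1 / real (Suc n)" by simp
        fix a b assume "a \<in> F \<inter> T" "b \<in> A n"
        then show "1 / real (Suc n) \<le> d a b" unfolding A_def using commute by force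
      qed
      also have "\<dots> \<le> ?H T" by (rule hausdorff_measure_mono) (auto simp: A_def)
      finally have 2: "?H (F \<inter> T) + ?H (A n) \<le> ?H T" .
      have "?H (F \<inter> T) + ?H (T - F) \<le> ?H (F \<inter> T) + (?H (A n) + (\<Sum>k. ?H (R (k + n))))"
        using 1 by (rule add_left_mono)
      also have "\<dots> = (?H (F \<inter> T) + ?H (A n)) + (\<Sum>k. ?H (R (k + n)))" by (simp add: add.assoc)
      also have "\<dots> \<le> ?H T + (\<Sum>k. ?H (R (k + n)))" using 2 by (rule add_right_mono)
      finally show ?thesis .
    qed
    moreover have "(\<lambda>n. ?H T + (\<Sum>k. ?H (R (k + n)))) \<longlonglongrightarrow> ?H T + 0"
      by (intro tendsto_add tail) auto
    ultimately show ?thesis using LIMSEQ_le_const by (metis (mono_tags, lifting) add.right_neutral)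
  qed auto
  show ?thesis
    unfolding lambda_system_def
  proof (intro CollectI conjI ballI)
    show "F \<in> Pow M" using FM by auto
    fix T assume T: "T \<in> Pow M"
    have "?H T \<le> ?H (F \<inter> T) + ?H ((M - F) \<inter> T)"
    proof -
      have "T = (F \<inter> T) \<union> ((M - F) \<inter> T)" using T by auto
      then show ?thesis using hausdorff_measure_Un[of t "F \<inter> T" "(M - F) \<inter> T"] by simp
    qed
    moreover have "(M - F) \<inter> T = T - F" using T by auto
    ultimately show "?H (F \<inter> T) + ?H ((M - F) \<inter> T) = ?H T"
      using main T by (simp add: antisym)
  qed
qed

lemma hausdorff_measure_lipschitz_image:
  assumes "\<And>x y. \<lbrakk>x \<in> S; y \<in> S\<rbrakk> \<Longrightarrow> d (f x) (f y) \<le> d x y" "f ` S \<subseteq> M" "0 \<le> t"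
  shows "hausdorff_measure t (f ` S) \<le> hausdorff_measure t S"
proof (rule hausdorff_measure_leI)
  fix \<delta> :: real assume \<delta>: "0 < \<delta>"
  have "hausdorff_premeasure \<delta> t (f ` S) \<le> hausdorff_premeasure \<delta> t S"
  proof (rule hausdorff_premeasure_ge)
    fix U :: "nat \<Rightarrow> 'a set"
    assume U: "\<And>i. U i \<subseteq> M" "\<And>i. ediam (U i) \<le> ennreal \<delta>" "S \<subseteq> (\<Union>i. U i)"
    have ed: "ediam (f ` (U i \<inter> S)) \<le> ediam (U i)" for i
      unfolding ediam_def[of "f ` _"]
    proof (intro SUP_least)
      fix x y assume "x \<in> f ` (U i \<inter> S)" "y \<in> f ` (U i \<inter> S)"
      then obtain a b where ab: "a \<in> U i" "b \<in> U i" "a \<in> S" "b \<in> S" "x = f a" "y = f b" by blast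
      then have "ennreal (d x y) \<le> ennreal (d a b)" using assms(1) by (simp add: ennreal_leI)
      then show "ennreal (d x y) \<le> ediam (U i)" by (rule order_trans[OF _ ediam_upper[OF ab(1,2)]])
    qed
    have "hausdorff_premeasure \<delta> t (f ` S) \<le> (\<Sum>i. diam_power t (f ` (U i \<inter> S)))"
    proof (rule hausdorff_premeasure_le)
      show "f ` S \<subseteq> (\<Union>i. f ` (U i \<inter> S))" using U(3) by blast
      show "f ` (U i \<inter> S) \<subseteq> M" for i using assms(2) by blast
      show "ediam (f ` (U i \<inter> S)) \<le> ennreal \<delta>" for i by (rule order_trans[OF ed U(2)])
    qed
    also have "\<dots> \<le> (\<Sum>i. diam_power t (U i))"
    proof (intro suminf_le)
      fix i
      have "ediam (U i) < top" using U(2)[of i] by (simp add: order_le_less_trans)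
      then have "enn2real (ediam (f ` (U i \<inter> S))) \<le> enn2real (ediam (U i))"
        by (intro enn2real_mono ed)
      then show "diam_power t (f ` (U i \<inter> S)) \<le> diam_power t (U i)"
        using assms(3) by (auto simp: diam_power_def intro!: ennreal_leI powr_mono2)
    qed auto
    finally show "hausdorff_premeasure \<delta> t (f ` S) \<le> (\<Sum>i. diam_power t (U i))" .
  qed
  then show "hausdorff_premeasure \<delta> t (f ` S) \<le> hausdorff_measure t S"
    by (rule order_trans[OF _ hausdorff_premeasure_le_measure[OF \<delta>]])
qed

lemma hausdorff_premeasure_le_finite_cover:
  assumes "finite F" "\<And>U. U \<in> F \<Longrightarrow> U \<subseteq> M" "\<And>U. U \<in> F \<Longrightarrow> ediam U \<le> ennreal \<delta>" "S \<subseteq> \<Union>F"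
  shows "hausdorff_premeasure \<delta> t S \<le> (\<Sum>U\<in>F. diam_power t U)"
proof -
  obtain f where f: "bij_betw f {..<card F} F"
    using ex_bij_betw_nat_finite[OF assms(1)] by (auto simp: lessThan_atLeast0)
  define U where "U i = (if i < card F then f i else {})" for i
  have fF: "f i \<in> F" if "i < card F" for i using f that by (auto simp: bij_betw_def)
  have "hausdorff_premeasure \<delta> t S \<le> (\<Sum>i. diam_power t (U i))"
  proof (rule hausdorff_premeasure_le)
    show "U i \<subseteq> M" "ediam (U i) \<le> ennreal \<delta>" for i
      using fF assms(2,3) by (auto simp: U_def ediam_def[of "{}"])
    have "F = f ` {..<card F}" using f by (simp add: bij_betw_def)
    then have "\<Union>F = (\<Union>i\<in>{..<card F}. f i)" by (rule arg_cong)
    also have "\<dots> = (\<Union>i\<in>{..<card F}. U i)" by (intro SUP_cong) (auto simp: U_def)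
    finally have "\<Union>F = (\<Union>i\<in>{..<card F}. U i)" .
    also have "\<dots> \<subseteq> (\<Union>i. U i)" by (rule UN_mono) auto
    finally show "S \<subseteq> (\<Union>i. U i)" by (rule order_trans[OF assms(4)])
  qed
  also have "\<dots> = (\<Sum>i<card F. diam_power t (U i))" by (rule suminf_finite) (auto simp: U_def)
  also have "\<dots> = (\<Sum>i<card F. diam_power t (f i))" by (simp add: U_def)
  also have "\<dots> = (\<Sum>U\<in>F. diam_power t U)" by (rule sum.reindex_bij_betw[OF f])
  finally show ?thesis .
qed

section \<open>Change of exponent, Hausdorff dimension and counting measure\<close>

lemma hausdorff_measure_zero_exponent_less:
  assumes "hausdorff_measure t S < top" "0 \<le> t" "t < u"
  shows "hausdorff_measure u S = 0"
proof -
  obtain h where h: "hausdorff_measure t S = ennreal h" "0 \<le> h"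
    using assms(1) by (cases "hausdorff_measure t S") auto
  have *: "hausdorff_premeasure \<delta> u S \<le> ennreal (\<delta> powr (u - t) * h)" if \<delta>: "0 < \<delta>" for \<delta>
  proof -
    have "hausdorff_premeasure \<delta> u S \<le> ennreal (\<delta> powr (u - t)) * hausdorff_premeasure \<delta> t S"
    proof -

      \<comment> \<open>The factor is moved to the left because an infimum over covers is bounded
        from below cover by cover.\<close>
      have "hausdorff_premeasure \<delta> u S / ennreal (\<delta> powr (u - t)) \<le> hausdorff_premeasure \<delta> t S"
      proof (rule hausdorff_premeasure_ge)
        fix U :: "nat \<Rightarrow> 'a set"
        assume U: "\<And>i. U i \<subseteq> M" "\<And>i. ediam (U i) \<le> ennreal \<delta>" "S \<subseteq> (\<Union>i. U i)"
        have "hausdorff_premeasure \<delta> u S \<le> (\<Sum>i. diam_power u (U i))"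
          by (rule hausdorff_premeasure_le) (use U in auto)
        also have "\<dots> \<le> (\<Sum>i. ennreal (\<delta> powr (u - t)) * diam_power t (U i))"
          by (intro suminf_le diam_power_exponent_le U assms \<delta>) auto
        also have "\<dots> = ennreal (\<delta> powr (u - t)) * (\<Sum>i. diam_power t (U i))" by simp
        finally show "hausdorff_premeasure \<delta> u S / ennreal (\<delta> powr (u - t)) \<le> (\<Sum>i. diam_power t (U i))"
          using \<delta> by (intro divide_le_posI_ennreal) auto
      qed
      then have "ennreal (\<delta> powr (u - t)) * (hausdorff_premeasure \<delta> u S / ennreal (\<delta> powr (u - t)))
          \<le> ennreal (\<delta> powr (u - t)) * hausdorff_premeasure \<delta> t S" by (rule mult_left_mono) auto
      moreover have "ennreal (\<delta> powr (u - t)) * (x / ennreal (\<delta> powr (u - t))) = x" for x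
        using \<delta> by (subst ennreal_times_divide, subst mult.commute, subst ennreal_mult_divide_eq) auto
      ultimately show ?thesis by simp
    qed
    also have "\<dots> \<le> ennreal (\<delta> powr (u - t)) * ennreal h"
      using hausdorff_premeasure_le_measure[OF \<delta>, of t S] h by (intro mult_left_mono) auto
    finally show ?thesis using h by (simp add: ennreal_mult)
  qed
  have "hausdorff_measure u S \<le> 0"
  proof (rule hausdorff_measure_leI)
    fix \<delta> :: real assume \<delta>: "0 < \<delta>"
    show "hausdorff_premeasure \<delta> u S \<le> 0"
    proof (rule ennreal_le_epsilon)
      fix e :: real assume e: "0 < e"
      \<comment> \<open>The second entry solves \<open>r powr (u - t) * (h + 1) = e\<close>; the
        summand 1 covers the case \<open>h = 0\<close>.\<close>
      define r where "r = min \<delta> ((e / (h + 1)) powr (1 / (u - t)))"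
      have r: "0 < r" "r \<le> \<delta>" using \<delta> e h by (auto simp: r_def)
      have "r powr (u - t) \<le> ((e / (h + 1)) powr (1 / (u - t))) powr (u - t)"
        using r assms by (intro powr_mono2) (auto simp: r_def)
      also have "\<dots> = e / (h + 1)" using assms e h by (simp add: powr_powr)
      finally have "r powr (u - t) * h \<le> e / (h + 1) * h" using h by (intro mult_right_mono)
      also have "\<dots> \<le> e" using e h by (simp add: field_simps)
      finally have "hausdorff_premeasure r u S \<le> ennreal e"
        by (rule order_trans[OF *[OF r(1)] ennreal_leI])
      then show "hausdorff_premeasure \<delta> u S \<le> 0 + ennreal e"
        using hausdorff_premeasure_antimono[OF r(2), of u S] by simp
    qed
  qed
  then show ?thesis by simp
qed

lemma hausdorff_dim_le: "\<lbrakk>hausdorff_measure t S = 0; 0 \<le> t\<rbrakk> \<Longrightarrow> hausdorff_dim S \<le> ereal t"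
  unfolding hausdorff_dim_def by (intro INF_lower) auto

lemma hausdorff_dim_ge:
  assumes "hausdorff_measure t S > 0"
  shows "ereal t \<le> hausdorff_dim S"
  unfolding hausdorff_dim_def
proof (intro INF_greatest)
  fix u assume "u \<in> {t. 0 \<le> t \<and> hausdorff_measure t S = 0}"
  then show "ereal t \<le> ereal u"
    using hausdorff_measure_zero_exponent_less[of u S t] assms by force
qed

lemma hausdorff_dim_le_finite:
  assumes "\<And>u. t < u \<Longrightarrow> hausdorff_measure u S = 0" "0 \<le> t"
  shows "hausdorff_dim S \<le> ereal t"
proof (rule ereal_le_epsilon2)
  fix e :: real assume "0 < e"
  then show "hausdorff_dim S \<le> ereal t + ereal e"
    using hausdorff_dim_le[of "t + e" S] assms by simp
qed

lemma hausdorff_measure_0_ge_1: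
  assumes "S \<noteq> {}"
  shows "1 \<le> hausdorff_measure 0 S"
proof -
  have "1 \<le> hausdorff_premeasure 1 0 S"
  proof (rule hausdorff_premeasure_ge)
    fix U :: "nat \<Rightarrow> 'a set" assume "S \<subseteq> (\<Union>i. U i)"
    then obtain i where "U i \<noteq> {}" using assms by blast
    then have "1 = (\<Sum>j\<in>{i}. diam_power 0 (U j))" by (simp add: diam_power_def)
    also have "\<dots> \<le> (\<Sum>i. diam_power 0 (U i))" by (intro sum_le_suminf) auto
    finally show "1 \<le> (\<Sum>i. diam_power 0 (U i))" .
  qed
  then show ?thesis using hausdorff_premeasure_le_measure[of 1 0 S] by (simp add: order_trans)
qed

text \<open>Disjoint closed sets need not have positive distance, so additivity comes from
  Caratheodory measurability and not from separation.\<close>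

lemma hausdorff_measure_disjoint_closed:
  assumes "finite F" "\<And>i. i \<in> F \<Longrightarrow> closedin mtopology (V i)" "disjoint_family_on V F" "0 \<le> t"
  shows "(\<Sum>i\<in>F. hausdorff_measure t (V i)) \<le> hausdorff_measure t (\<Union>i\<in>F. V i)"
  using assms(1-3)
proof (induction F)
  case (insert i F)
  let ?T = "\<Union>j\<in>insert i F. V j"
  have "V i \<in> lambda_system M (Pow M) (hausdorff_measure t)"
    using insert.prems assms(4) by (intro closedin_lambda_system) auto
  moreover have "?T \<in> Pow M" using insert.prems closedin_subset topspace_mtopology by fastforce
  ultimately have "hausdorff_measure t (V i \<inter> ?T) + hausdorff_measure t ((M - V i) \<inter> ?T) = hausdorff_measure t ?T"
    unfolding lambda_system_def by blast
  moreover have "V i \<inter> ?T = V i" by blast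
  moreover have "(M - V i) \<inter> ?T = (\<Union>j\<in>F. V j)"
  proof -
    have "V i \<inter> V j = {}" if "j \<in> F" for j
      using insert.prems(2) insert.hyps that unfolding disjoint_family_on_def by fastforce
    then show ?thesis using \<open>?T \<in> Pow M\<close> by blast
  qed
  moreover have "(\<Sum>j\<in>F. hausdorff_measure t (V j)) \<le> hausdorff_measure t (\<Union>j\<in>F. V j)"
    using insert by (auto simp: disjoint_family_on_def)
  ultimately show ?case using insert.hyps by (metis add_left_mono sum.insert)
qed simp

lemma hausdorff_measure_0_infinite:
  assumes "infinite S" "S \<subseteq> M"
  shows "hausdorff_measure 0 S = top"
proof -
  have "of_nat n \<le> hausdorff_measure 0 S" for n
  proof -
    obtain F where F: "F \<subseteq> S" "finite F" "card F = n" using assms infinite_arbitrarily_large by blast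
    have "(of_nat n :: ennreal) = (\<Sum>x\<in>F. 1)" using F(3) by simp
    also have "\<dots> \<le> (\<Sum>x\<in>F. hausdorff_measure 0 {x})" by (intro sum_mono hausdorff_measure_0_ge_1) auto
    also have "\<dots> \<le> hausdorff_measure 0 (\<Union>x\<in>F. {x})"
      using F assms(2)
      by (intro hausdorff_measure_disjoint_closed closedin_t1_singleton t1_space_mtopology)
         (auto simp: disjoint_family_on_def)
    also have "\<dots> \<le> hausdorff_measure 0 S" using F(1) by (intro hausdorff_measure_mono) auto
    finally show ?thesis .
  qed
  then show ?thesis by (metis ennreal_Ex_less_of_nat less_top not_less)
qed

section \<open>Box dimension and optimal covers\<close>

lemma lower_le_upper_box_dim: "lower_box_dim S \<le> upper_box_dim S"
  unfolding lower_box_dim_def upper_box_dim_def by (intro Liminf_le_Limsup) auto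

lemma covering_number_le:
  assumes "finite F" "\<And>U. U \<in> F \<Longrightarrow> U \<subseteq> M" "\<And>U. U \<in> F \<Longrightarrow> ediam U \<le> ennreal \<delta>" "S \<subseteq> \<Union>F"
  shows "covering_number \<delta> S \<le> card F"
  unfolding covering_number_def by (rule Least_le) (use assms in blast)

lemma covering_number_cover:
  assumes "finite F" "\<And>U. U \<in> F \<Longrightarrow> U \<subseteq> M" "\<And>U. U \<in> F \<Longrightarrow> ediam U \<le> ennreal \<delta>" "S \<subseteq> \<Union>F"
  obtains G where "finite G" "card G = covering_number \<delta> S" "\<And>U. U \<in> G \<Longrightarrow> U \<subseteq> M"
    "\<And>U. U \<in> G \<Longrightarrow> ediam U \<le> ennreal \<delta>" "S \<subseteq> \<Union>G"
proof -
  have "\<exists>G. finite G \<and> card G = covering_number \<delta> S \<and> (\<forall>U\<in>G. U \<subseteq> M \<and> ediam U \<le> ennreal \<delta>) \<and> S \<subseteq> \<Union>G"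
    unfolding covering_number_def
    by (rule LeastI_ex) (use assms in blast)
  then show ?thesis using that by blast
qed

end

section \<open>Word counts of shift spaces with bounded gluing gaps\<close>

definition word :: "nat \<Rightarrow> (nat \<Rightarrow> 'a) \<Rightarrow> 'a list" where
  "word n x = map x [0..<n]"

definition words :: "(nat \<Rightarrow> 'a) set \<Rightarrow> nat \<Rightarrow> 'a list set" where
  "words Y n = word n ` Y"

definition word_count :: "(nat \<Rightarrow> 'a) set \<Rightarrow> nat \<Rightarrow> real" where
  "word_count Y n = real (card (words Y n))"

text \<open>The exponential of the topological entropy. The two bounds determine \<open>r\<close>
  whenever such an \<open>r\<close> exists. They are stronger than convergence of the n-th roots:
  errors are bounded by a constant, as needed for measures at the critical exponent.\<close>

definition growth :: "(nat \<Rightarrow> 'a) set \<Rightarrow> real" where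
  "growth Y = (SOME r. 1 \<le> r \<and> (\<exists>K. \<forall>n. r ^ n \<le> word_count Y n \<and> word_count Y n \<le> K * r ^ n))"

lemma length_word [simp]: "length (word n x) = n"
  by (simp add: word_def)

lemma word_nth [simp]: "k < n \<Longrightarrow> word n x ! k = x k"
  by (simp add: word_def)

lemma word_eq_iff: "word n x = word n y \<longleftrightarrow> (\<forall>k<n. x k = y k)"
  by (auto simp: list_eq_iff_nth_eq)

lemma take_word: "m \<le> n \<Longrightarrow> take m (word n x) = word m x"
  by (auto simp: list_eq_iff_nth_eq)

lemma take_drop_word: "m + k \<le> n \<Longrightarrow> take k (drop m (word n x)) = word k (\<lambda>i. x (m + i))"
  by (auto simp: list_eq_iff_nth_eq)

lemma drop_word: "drop m (word n x) = word (n - m) (\<lambda>i. x (m + i))"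
  by (auto simp: list_eq_iff_nth_eq)

lemma map_word: "map f (word n x) = word n (f \<circ> x)"
  by (auto simp: list_eq_iff_nth_eq)

lemma words_length: "w \<in> words Y n \<Longrightarrow> length w = n"
  by (auto simp: words_def)

lemma words_image: "words ((\<lambda>y. f \<circ> y) ` Y) n = map f ` words Y n"
  by (auto simp: words_def map_word image_iff)

text \<open>Used with \<open>g\<close> the gap of a gluing, which is only known to be at most
  \<open>D\<close>: decoding with every possible gap costs the factor \<open>D + 1\<close>.\<close>

lemma card_le_fibres:
  assumes "finite S" "A \<subseteq> (\<Union>g\<le>(D::nat). h g ` S)"
  shows "card A \<le> (D + 1) * card S"
proof -
  have "card A \<le> card (\<Union>g\<le>D. h g ` S)" using assms by (intro card_mono) auto
  also have "\<dots> \<le> (\<Sum>g\<le>D. card (h g ` S))" by (rule card_UN_le) auto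
  also have "\<dots> \<le> (\<Sum>g\<le>D. card S)" using assms by (intro sum_mono card_image_le)
  finally show ?thesis by simp
qed

text \<open>Double counting of the pairs with \<open>u\<close> in \<open>X v\<close>: the element
  \<open>u\<close> together with a gap determines \<open>v\<close>.\<close>

lemma card_mult_le_fibres:
  assumes "finite H" "finite L" "\<And>v. v \<in> L \<Longrightarrow> X v \<subseteq> H" "\<And>v. v \<in> L \<Longrightarrow> a \<le> real (card (X v))"
    "\<And>u. u \<in> H \<Longrightarrow> {v\<in>L. u \<in> X v} \<subseteq> (\<lambda>g. h g u) ` {..D::nat}"
  shows "real (card L) * a \<le> real (D + 1) * real (card H)"
proof -
  have "real (card L) * a = (\<Sum>v\<in>L. a)" by simp
  also have "\<dots> \<le> (\<Sum>v\<in>L. real (card (X v)))" by (intro sum_mono assms)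
  also have "\<dots> = (\<Sum>v\<in>L. \<Sum>u\<in>H. if u \<in> X v then 1 else 0)"
  proof (intro sum.cong refl)
    fix v assume "v \<in> L"
    then have "H \<inter> X v = X v" using assms(3) by blast
    then show "real (card (X v)) = (\<Sum>u\<in>H. if u \<in> X v then 1 else 0)"
      using assms(1) by (simp flip: sum.inter_restrict)
  qed
  also have "\<dots> = (\<Sum>u\<in>H. \<Sum>v\<in>L. if u \<in> X v then 1 else 0)" by (rule sum.swap)
  also have "\<dots> \<le> (\<Sum>u\<in>H. real (D + 1))"
  proof (intro sum_mono)
    fix u assume u: "u \<in> H"
    have "(\<Sum>v\<in>L. if u \<in> X v then 1 else 0) = real (card {v\<in>L. u \<in> X v})"
      using assms(2) by (simp flip: sum.inter_filter)
    also have "card {v\<in>L. u \<in> X v} \<le> card ((\<lambda>g. h g u) ` {..D})"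
      by (intro card_mono assms(5) u) auto
    also have "\<dots> \<le> card {..D}" by (intro card_image_le) auto
    finally show "(\<Sum>v\<in>L. if u \<in> X v then 1 else 0) \<le> real (D + 1)" by simp
  qed
  finally show ?thesis by (simp add: mult.commute)
qed

lemma card_append_le:
  assumes "finite A" "finite B" "\<And>w. w \<in> S \<Longrightarrow> take m w \<in> A \<and> drop m w \<in> B"
  shows "card S \<le> card A * card B"
proof -
  have "card S \<le> card (A \<times> B)"
    using assms
    by (intro card_inj_on_le[of "\<lambda>w. (take m w, drop m w)"])
       (auto simp: inj_on_def, metis append_take_drop_id)
  then show ?thesis by (simp add: card_cartesian_product)
qed

text \<open>Irreducibility in a form free of graphs and of mixing: the gap may depend on
  \<open>x\<close>, \<open>y\<close> and \<open>n\<close>, as it must for periodic components, but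
  it is bounded by \<open>D\<close>. All of \<open>y\<close> is appended, so words of any length can
  be prescribed behind a given prefix.\<close>

locale glue_shift =
  fixes Y :: "(nat \<Rightarrow> 'a) set" and D :: nat
  assumes nonempty: "Y \<noteq> {}"
    and finite_alphabet: "finite (\<Union>y\<in>Y. range y)"
    and shift_closed: "y \<in> Y \<Longrightarrow> shift y \<in> Y"
    and glue: "\<lbrakk>x \<in> Y; y \<in> Y\<rbrakk> \<Longrightarrow> \<exists>g\<le>D. \<exists>z\<in>Y. (\<forall>k<n. z k = x k) \<and> (\<forall>k. z (n + g + k) = y k)"
begin

lemma shift_add_closed: "y \<in> Y \<Longrightarrow> (\<lambda>k. y (m + k)) \<in> Y"
proof (induction m)
  case (Suc m)
  then show ?case using shift_closed[of "\<lambda>k. y (m + k)"] by (simp add: shift_def)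
qed simp

lemma finite_words: "finite (words Y n)"
proof (rule finite_subset)
  show "words Y n \<subseteq> {w. set w \<subseteq> (\<Union>y\<in>Y. range y) \<and> length w = n}"
    by (force simp: words_def word_def)
  show "finite {w. set w \<subseteq> (\<Union>y\<in>Y. range y) \<and> length w = n}"
    using finite_alphabet by (rule finite_lists_length_eq)
qed

lemma take_words: "w \<in> words Y n \<Longrightarrow> m \<le> n \<Longrightarrow> take m w \<in> words Y m"
  by (auto simp: words_def take_word)

lemma drop_words: "w \<in> words Y n \<Longrightarrow> drop m w \<in> words Y (n - m)"
  using shift_add_closed[of _ m] by (auto simp: words_def drop_word intro!: imageI)

lemma take_drop_words: "w \<in> words Y n \<Longrightarrow> m + k \<le> n \<Longrightarrow> take k (drop m w) \<in> words Y k"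
  using take_words[OF drop_words[of w n m], of k] by simp

lemma word_count_ge_1: "1 \<le> word_count Y n"
proof -
  have "words Y n \<noteq> {}" using nonempty by (auto simp: words_def)
  then have "card (words Y n) > 0" using finite_words by (simp add: card_gt_0_iff)
  then show ?thesis by (simp add: word_count_def)
qed

lemma word_count_add_le: "word_count Y (m + n) \<le> word_count Y m * word_count Y n"
proof -
  have "card (words Y (m + n)) \<le> card (words Y m) * card (words Y n)"
    using take_words[of _ "m + n" m] drop_words[of _ "m + n" m]
    by (intro card_append_le[of _ _ _ m] finite_words) auto
  then show ?thesis unfolding word_count_def by (metis of_nat_le_iff of_nat_mult)
qed

lemma word_count_0 [simp]: "word_count Y 0 = 1"
proof -
  have "words Y 0 = {[]}" using nonempty by (auto simp: words_def word_def)
  then show ?thesis by (simp add: word_count_def)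
qed

lemma word_count_mult_le: "word_count Y (k * n) \<le> word_count Y n ^ k"
proof (induction k)
  case (Suc k)
  have "word_count Y (Suc k * n) \<le> word_count Y n * word_count Y (k * n)" using word_count_add_le[of n "k * n"] by simp
  also have "\<dots> \<le> word_count Y n * word_count Y n ^ k"
    using Suc word_count_ge_1[of n] by (intro mult_left_mono) auto
  finally show ?case by simp
qed simp

lemma word_count_mono: "m \<le> n \<Longrightarrow> word_count Y m \<le> word_count Y n"
proof -
  assume mn: "m \<le> n"
  have "words Y m \<subseteq> take m ` words Y n" using mn by (auto simp: words_def take_word image_image)
  then have "card (words Y m) \<le> card (take m ` words Y n)" by (intro card_mono finite_imageI finite_words)
  also have "\<dots> \<le> card (words Y n)" by (intro card_image_le finite_words)
  finally show ?thesis by (simp add: word_count_def)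
qed

definition extensions :: "(nat \<Rightarrow> 'a) \<Rightarrow> nat \<Rightarrow> nat \<Rightarrow> 'a list set" where
  "extensions x m k = {w \<in> words Y (m + k). take m w = word m x}"

lemma finite_extensions [simp]: "finite (extensions x m k)"
  by (simp add: extensions_def finite_words)

text \<open>Every word of length \<open>k\<close> can be placed behind the prefix after some gap;
  extensions are taken \<open>D\<close> letters longer so that they contain the word whatever the
  gap.\<close>

lemma word_count_le_extensions:
  assumes "x \<in> Y"
  shows "word_count Y k \<le> real (D + 1) * real (card (extensions x m (k + D)))"
proof -
  have "words Y k \<subseteq> (\<Union>g\<le>D. (\<lambda>w. take k (drop (m + g) w)) ` extensions x m (k + D))"
  proof
    fix v assume "v \<in> words Y k"
    then obtain y where y: "y \<in> Y" "v = word k y" by (auto simp: words_def)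
    obtain g z where z: "g \<le> D" "z \<in> Y" "\<And>k. k < m \<Longrightarrow> z k = x k" "\<And>k. z (m + g + k) = y k"
      using glue[OF assms y(1), of m] by blast
    have "word (m + (k + D)) z \<in> extensions x m (k + D)"
      using z by (auto simp: extensions_def words_def take_word word_eq_iff)
    moreover have "take k (drop (m + g) (word (m + (k + D)) z)) = v"
      using z by (subst take_drop_word) (auto simp: y word_eq_iff)
    ultimately show "v \<in> (\<Union>g\<le>D. (\<lambda>w. take k (drop (m + g) w)) ` extensions x m (k + D))"
      using z(1) by blast
  qed
  then have "card (words Y k) \<le> (D + 1) * card (extensions x m (k + D))"
    by (intro card_le_fibres[where h = "\<lambda>g w. take k (drop (m + g) w)"]) auto
  then show ?thesis unfolding word_count_def by (metis of_nat_le_iff of_nat_mult)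
qed

text \<open>Almost supermultiplicativity, the counterpart of \<open>word_count_add_le\<close>:
  distinct words of length \<open>m\<close> have disjoint sets of extensions, each of which is
  large.\<close>

lemma word_count_mult_count_le: "word_count Y m * word_count Y k \<le> real (D + 1) * word_count Y (m + k + D)"
proof -
  define rep where "rep v = (SOME x. x \<in> Y \<and> word m x = v)" for v
  have rep: "rep v \<in> Y" "word m (rep v) = v" if "v \<in> words Y m" for v
    using someI_ex[of "\<lambda>x. x \<in> Y \<and> word m x = v"] that by (auto simp: rep_def words_def)
  have "word_count Y m * word_count Y k = (\<Sum>v\<in>words Y m. word_count Y k)" by (simp add: word_count_def)
  also have "\<dots> \<le> (\<Sum>v\<in>words Y m. real (D + 1) * real (card (extensions (rep v) m (k + D))))"
    by (intro sum_mono word_count_le_extensions rep)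
  also have "\<dots> = real (D + 1) * real (\<Sum>v\<in>words Y m. card (extensions (rep v) m (k + D)))"
    by (simp add: sum_distrib_left)
  also have "(\<Sum>v\<in>words Y m. card (extensions (rep v) m (k + D)))
      = card (\<Union>v\<in>words Y m. extensions (rep v) m (k + D))"
    by (intro card_UN_disjoint [symmetric] finite_words ballI finite_extensions) (auto simp: extensions_def rep)
  also have "\<dots> \<le> card (words Y (m + k + D))"
    by (intro card_mono finite_words) (auto simp: extensions_def add.assoc)
  finally show ?thesis by (simp add: word_count_def mult_left_mono)
qed

text \<open>Fekete's argument from both sides. The infimum \<open>r\<close> of the roots satisfies
  the lower bound by definition. Almost supermultiplicativity, its loss \<open>D + 1\<close> being
  absorbed in \<open>b\<close>, bounds \<open>b n ^ k\<close> by the count at length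
  \<open>k * (n + D)\<close>; submultiplicativity bounds that count by a power of the count at
  length \<open>k\<close>. So the root of \<open>b n\<close> of order \<open>n + D\<close> lies
  below every root entering the infimum.\<close>

lemma growth_exists: "\<exists>r\<ge>1. \<exists>K. \<forall>n. r ^ n \<le> word_count Y n \<and> word_count Y n \<le> K * r ^ n"
proof -
  define b where "b n = word_count Y n / real (D + 1)" for n
  have bpos: "b n > 0" for n using word_count_ge_1[of n] by (simp add: b_def)
  have bpow: "b n ^ k \<le> word_count Y (k * (n + D))" for n k
  proof -
    have "b n ^ k \<le> word_count Y (k * (n + D)) / real (D + 1)" if "k > 0"
      using that
    proof (induction k rule: nat_induct_non_zero)
      case 1
      show ?case using word_count_mono[of n "n + D"] by (simp add: b_def divide_right_mono)
    next
      case (Suc k)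
      have "b n ^ Suc k \<le> b n * (word_count Y (k * (n + D)) / real (D + 1))"
        using mult_left_mono[OF Suc.IH, of "b n"] bpos[of n] by simp
      also have "\<dots> = word_count Y n * word_count Y (k * (n + D)) / real (D + 1) / real (D + 1)" by (simp add: b_def)
      also have "\<dots> \<le> (real (D + 1) * word_count Y (n + k * (n + D) + D)) / real (D + 1) / real (D + 1)"
        by (intro divide_right_mono word_count_mult_count_le) auto
      also have "\<dots> = word_count Y (n + k * (n + D) + D) / real (D + 1)" by simp
      also have "n + k * (n + D) + D = Suc k * (n + D)" by simp
      finally show ?case .
    qed
    moreover have "word_count Y (k * (n + D)) / real (D + 1) \<le> word_count Y (k * (n + D))"
      using word_count_ge_1[of "k * (n + D)"] by (simp add: field_simps)
    ultimately show ?thesis using word_count_ge_1[of 0] by (cases "k = 0") auto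
  qed
  define r where "r = (INF k\<in>{1..}. root k (word_count Y k))"
  have bdd: "bdd_below ((\<lambda>k. root k (word_count Y k)) ` {1..})"
    using word_count_ge_1 by (intro bdd_belowI[of _ 0]) (auto intro!: real_root_ge_zero order_trans[OF zero_le_one])
  have r1: "1 \<le> r"
    unfolding r_def using word_count_ge_1 by (intro cINF_greatest) (auto simp: real_root_ge_1_iff)
  have low: "r ^ n \<le> word_count Y n" for n
  proof (cases "n = 0")
    case False
    have "r \<le> root n (word_count Y n)" unfolding r_def using False bdd by (intro cINF_lower) auto
    then have "r ^ n \<le> root n (word_count Y n) ^ n" using r1 by (intro power_mono) auto
    also have "\<dots> = word_count Y n" using False word_count_ge_1[of n] by (intro real_root_pow_pos2) auto
    finally show ?thesis .
  qed simp
  have up: "word_count Y n \<le> (real (D + 1) * r ^ D) * r ^ n" for n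
  proof -
    have "b n \<le> r ^ (n + D)"
    proof (cases "n + D = 0")
      case False
      have "root (n + D) (b n) \<le> r"
        unfolding r_def
      proof (rule cINF_greatest)
        fix k :: nat assume "k \<in> {1..}"
        then have k: "k > 0" by simp
        have "b n ^ k \<le> word_count Y k ^ (n + D)"
          using bpow[of n k] word_count_mult_le[of "n + D" k] by (simp add: mult.commute)
        then have "root k (root (n + D) (b n ^ k)) \<le> root k (root (n + D) (word_count Y k ^ (n + D)))"
          using False k by simp
        moreover have "root (n + D) (word_count Y k ^ (n + D)) = word_count Y k"
          using False word_count_ge_1[of k] by (intro real_root_power_cancel) auto
        moreover have "root k (root (n + D) (b n ^ k)) = root (n + D) (b n)"
        proof -
          have "root k (root (n + D) (b n ^ k)) = root (n + D) (root k (b n ^ k))" by (rule real_root_commute)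
          also have "root k (b n ^ k) = b n" using k bpos[of n] by (intro real_root_power_cancel) auto
          finally show ?thesis .
        qed
        ultimately show "root (n + D) (b n) \<le> root k (word_count Y k)" by simp
      qed auto
      then have "root (n + D) (b n) ^ (n + D) \<le> r ^ (n + D)"
        using bpos[of n] by (intro power_mono) (auto intro: real_root_ge_zero less_imp_le)
      moreover have "root (n + D) (b n) ^ (n + D) = b n"
        using False bpos[of n] by (intro real_root_pow_pos2) auto
      ultimately show ?thesis by simp
    qed (auto simp: b_def)
    then show ?thesis by (simp add: b_def field_simps power_add)
  qed
  show ?thesis using r1 low up by blast
qed

lemma growth_props:
  obtains K where "1 \<le> K" "1 \<le> growth Y" "\<And>n. growth Y ^ n \<le> word_count Y n" "\<And>n. word_count Y n \<le> K * growth Y ^ n"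
proof -
  have *: "1 \<le> growth Y \<and> (\<exists>K. \<forall>n. growth Y ^ n \<le> word_count Y n \<and> word_count Y n \<le> K * growth Y ^ n)"
    unfolding growth_def by (rule someI_ex[OF growth_exists[unfolded bex_simps]])
  then obtain K where K: "\<And>n. growth Y ^ n \<le> word_count Y n" "\<And>n. word_count Y n \<le> K * growth Y ^ n" by blast
  have "1 \<le> K" using K(2)[of 0] by simp
  then show ?thesis using that K * by blast
qed

lemma growth_ge_1: "1 \<le> growth Y"
  using growth_props by blast

text \<open>No prefix is short of continuations, uniformly in \<open>x\<close> and \<open>m\<close>.
  This homogeneity plays the part of the Gibbs property of the measure of maximal entropy.\<close>

lemma extensions_lower:
  assumes "x \<in> Y"
  shows "growth Y ^ k \<le> real (D + 1) * growth Y ^ D * real (card (extensions x m k))"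
proof -
  have K: "1 \<le> growth Y" "\<And>n. growth Y ^ n \<le> word_count Y n" using growth_props by blast+
  show ?thesis
  proof (cases "D \<le> k")
    case True
    have "growth Y ^ k = growth Y ^ D * growth Y ^ (k - D)" using True by (simp flip: power_add)
    also have "\<dots> \<le> growth Y ^ D * (real (D + 1) * real (card (extensions x m (k - D + D))))"
      using K by (intro mult_left_mono order_trans[OF K(2) word_count_le_extensions] assms) auto
    finally show ?thesis using True by (simp add: mult_ac)
  next
    \<comment> \<open>For \<open>k < D\<close> the word of \<open>x\<close> itself is one extension,
      and the factor \<open>growth Y ^ D\<close> compensates for
      \<open>growth Y ^ k\<close>.\<close>
    case False
    have "word (m + k) x \<in> extensions x m k"
      using assms by (auto simp: extensions_def words_def take_word)
    then have "card (extensions x m k) > 0" by (auto simp: card_gt_0_iff)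
    then have "1 * growth Y ^ k \<le> (real (D + 1) * real (card (extensions x m k))) * growth Y ^ D"
    proof (intro mult_mono power_increasing)
      have "1 \<le> (D + 1) * card (extensions x m k)" using \<open>card (extensions x m k) > 0\<close> by simp
      then show "1 \<le> real (D + 1) * real (card (extensions x m k))" by (metis of_nat_1 of_nat_le_iff of_nat_mult)
    qed (use False K(1) in auto)
    then show ?thesis by (simp add: mult_ac)
  qed
qed

lemma card_extensions_le: "real (card (extensions x m k)) \<le> word_count Y k"
proof -
  have "card (extensions x m k) \<le> card (words Y k)"
  proof (rule card_inj_on_le[of "drop m"])
    show "inj_on (drop m) (extensions x m k)"
      by (auto simp: inj_on_def extensions_def) (metis append_take_drop_id)
    show "drop m ` extensions x m k \<subseteq> words Y k"
      using drop_words[of _ "m + k" m] by (auto simp: extensions_def)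
  qed (rule finite_words)
  then show ?thesis by (simp add: word_count_def)
qed

text \<open>Lifts of \<open>x\<close> and \<open>y\<close> are glued and the result is projected, so
  the gap bound is inherited unchanged.\<close>

lemma glue_shift_image: "glue_shift ((\<lambda>y. f \<circ> y) ` Y) D"
proof
  show "(\<lambda>y. f \<circ> y) ` Y \<noteq> {}" using nonempty by simp
  have "(\<Union>y\<in>(\<lambda>y. f \<circ> y) ` Y. range y) = f ` (\<Union>y\<in>Y. range y)" by auto
  then show "finite (\<Union>y\<in>(\<lambda>y. f \<circ> y) ` Y. range y)" using finite_alphabet by simp
next
  fix y assume "y \<in> (\<lambda>y. f \<circ> y) ` Y"
  then obtain z where "z \<in> Y" "y = f \<circ> z" by blast
  then show "shift y \<in> (\<lambda>y. f \<circ> y) ` Y"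
    using shift_closed[of z] by (auto simp: shift_def comp_def intro!: image_eqI)
next
  fix x y n assume "x \<in> (\<lambda>y. f \<circ> y) ` Y" "y \<in> (\<lambda>y. f \<circ> y) ` Y"
  then obtain x' y' where xy: "x' \<in> Y" "x = f \<circ> x'" "y' \<in> Y" "y = f \<circ> y'" by blast
  obtain g z where "g \<le> D" "z \<in> Y" "\<forall>k<n. z k = x' k" "\<forall>k. z (n + g + k) = y' k"
    using glue[OF xy(1,3), of n] by blast
  then show "\<exists>g\<le>D. \<exists>z\<in>(\<lambda>y. f \<circ> y) ` Y. (\<forall>k<n. z k = x k) \<and> (\<forall>k. z (n + g + k) = y k)"
    using xy by (intro exI[of _ g] conjI bexI[of _ "f \<circ> z"]) auto
qed

end

section \<open>Uniform measures on words under a one-block factor map\<close>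

text \<open>Total probability: a conditional probability of at least \<open>p\<close> on every fibre
  of \<open>g\<close> gives a probability of at least \<open>p\<close>.\<close>

lemma fibrewise_card_le:
  fixes p :: real
  assumes "finite A" "\<And>s. s \<in> g ` A \<Longrightarrow> p * card {x\<in>A. g x = s} \<le> card {x\<in>A. g x = s \<and> P x}"
  shows "p * card A \<le> card {x\<in>A. P x}"
proof -
  have dis: "card (\<Union>s\<in>g ` A. {x\<in>A. g x = s \<and> Q x}) = (\<Sum>s\<in>g ` A. card {x\<in>A. g x = s \<and> Q x})" for Q
    using assms(1) by (intro card_UN_disjoint) auto
  have "A = (\<Union>s\<in>g ` A. {x\<in>A. g x = s \<and> True})" "{x\<in>A. P x} = (\<Union>s\<in>g ` A. {x\<in>A. g x = s \<and> P x})" by auto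
  then have *: "card A = (\<Sum>s\<in>g ` A. card {x\<in>A. g x = s})" "card {x\<in>A. P x} = (\<Sum>s\<in>g ` A. card {x\<in>A. g x = s \<and> P x})"
    using dis[of "\<lambda>_. True"] dis[of P] by simp_all
  have "p * card A = (\<Sum>s\<in>g ` A. p * card {x\<in>A. g x = s})" by (subst *) (simp add: sum_distrib_left)
  also have "\<dots> \<le> (\<Sum>s\<in>g ` A. real (card {x\<in>A. g x = s \<and> P x}))" by (intro sum_mono assms(2))
  finally show ?thesis by (simp add: *(2))
qed

lemma sum_sqrt_le:
  fixes h :: "'a \<Rightarrow> real"
  assumes "\<And>v. v \<in> S \<Longrightarrow> 0 \<le> h v"
  shows "(\<Sum>v\<in>S. sqrt (h v)) \<le> sqrt (card S * (\<Sum>v\<in>S. h v))"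
proof -
  have "(\<Sum>v\<in>S. 1 * sqrt (h v))\<^sup>2 \<le> (\<Sum>v\<in>S. 1\<^sup>2) * (\<Sum>v\<in>S. (sqrt (h v))\<^sup>2)"
    by (rule Cauchy_Schwarz_ineq_sum)
  also have "\<dots> = card S * (\<Sum>v\<in>S. h v)" using assms by simp
  finally show ?thesis by (simp add: real_le_rsqrt)
qed

definition lifts :: "('a \<Rightarrow> 'b) \<Rightarrow> (nat \<Rightarrow> 'a) set \<Rightarrow> 'b list \<Rightarrow> 'a list set" where
  "lifts f Y v = {w \<in> words Y (length v). map f w = v}"

abbreviation factor :: "('a \<Rightarrow> 'b) \<Rightarrow> (nat \<Rightarrow> 'a) set \<Rightarrow> (nat \<Rightarrow> 'b) set" where
  "factor f Y \<equiv> (\<lambda>y. f \<circ> y) ` Y"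

context glue_shift
begin

lemma finite_lifts [simp]: "finite (lifts f Y v)"
  by (simp add: lifts_def finite_words)

lemma sum_card_lifts: "(\<Sum>v\<in>words (factor f Y) n. card (lifts f Y v)) = card (words Y n)"
proof -
  have "(\<Sum>v\<in>words (factor f Y) n. card (lifts f Y v)) = card (\<Union>v\<in>words (factor f Y) n. lifts f Y v)"
    by (intro card_UN_disjoint [symmetric]) (auto simp: words_image finite_words lifts_def)
  also have "(\<Union>v\<in>words (factor f Y) n. lifts f Y v) = words Y n"
    by (auto simp: lifts_def words_image dest: words_length)
  finally show ?thesis .
qed

text \<open>The word is cut into \<open>R\<close> windows of length \<open>l\<close>, each with room
  for a gap followed by a lift of \<open>v0\<close>. Given the letters before a window, at least a
  proportion \<open>p\<close> of the continuations shows a lift in it: gluing places every lift, and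
  all prefixes have comparable numbers of continuations. The bound \<open>p \<le> 1\<close> is
  proved along the way because the induction multiplies estimates by \<open>1 - p\<close>.\<close>

lemma avoiding_words_decay:
  fixes K :: real and v0 :: "'b list" and f :: "'a \<Rightarrow> 'b"
  defines "l \<equiv> length v0 + D"
  defines "p \<equiv> card (lifts f Y v0) / (real (D + 1) ^ 2 * growth Y ^ D * K * growth Y ^ l)"
  defines "hit \<equiv> \<lambda>i u. \<exists>g\<le>D. map f (take (length v0) (drop (i * l + g) u)) = v0"
  assumes K: "1 \<le> K" "\<And>n. word_count Y n \<le> K * growth Y ^ n"
  assumes n: "n = R * l"
  shows "i \<le> R \<Longrightarrow> card {u\<in>words Y n. \<forall>j<i. \<not> hit j u} \<le> (1 - p) ^ i * word_count Y n \<and> (0 < i \<longrightarrow> p \<le> 1)"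
proof (induction i)
  case 0
  then show ?case by (simp add: word_count_def)
next
  case (Suc i)
  define E where "E i = {u\<in>words Y n. \<forall>j<i. \<not> hit j u}" for i
  define m where "m = i * l"
  define k where "k = n - m"
  have r1: "1 \<le> growth Y" by (rule growth_ge_1)
  have finE: "finite (E i)" for i by (simp add: E_def finite_words)
  have ml: "m + l \<le> n" using mult_le_mono1[OF Suc.prems, of l] n by (simp add: m_def)
  have key: "p * card (E i) \<le> card {u\<in>E i. hit i u}"
  proof (rule fibrewise_card_le[of _ "take m"])
    fix s assume "s \<in> take m ` E i"
    then obtain x where x: "x \<in> Y" "word n x \<in> E i" "s = word m x"
      using ml by (auto simp: E_def words_def take_word)
    \<comment> \<open>Window \<open>j\<close> with \<open>j < i\<close> ends before position
      \<open>m\<close>, so the prefix \<open>s\<close> alone decides whether it is hit.\<close>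
    have nohit: "\<not> hit j u" if "take m u = s" "j < i" "length u = n" for j u
    proof -
      have "take (length v0) (drop (j * l + g) u) = take (length v0) (drop (j * l + g) (word n x))" if "g \<le> D" for g
      proof -
        have "Suc j * l \<le> m" using \<open>j < i\<close> unfolding m_def by (intro mult_le_mono1) auto
        then have "j * l + g + length v0 \<le> m" using that by (simp add: l_def)
        then have "take (length v0) (drop (j * l + g) u) = take (length v0) (drop (j * l + g) (take m u))" for u :: "'a list"
          by (simp add: drop_take min_def)
        then show ?thesis using \<open>take m u = s\<close> x(3) ml take_word[of m n x] by (metis add_leD1)
      qed
      then show ?thesis using x(2) \<open>j < i\<close> unfolding E_def hit_def by fastforce
    qed
    have fib: "{u \<in> E i. take m u = s} = extensions x m k"
      using nohit ml x(3) by (auto simp: E_def extensions_def k_def dest: words_length)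
    have fibh: "{u \<in> E i. take m u = s \<and> hit i u} = {u\<in>extensions x m k. hit i u}"
      using fib by blast
    \<comment> \<open>A lower bound for the number of continuations that remain once a gap and a
      lift have been placed in the window.\<close>
    define a where "a = growth Y ^ (k - l) / (real (D + 1) * growth Y ^ D)"
    have ex: "\<exists>X. X \<subseteq> {u\<in>extensions x m k. hit i u} \<and> a \<le> card X \<and>
        (\<exists>g\<le>D. \<forall>u\<in>X. take (length v0) (drop (m + g) u) = w)" if w: "w \<in> lifts f Y v0" for w
    proof -
      obtain y where y: "y \<in> Y" "w = word (length v0) y" "map f w = v0"
        using w by (auto simp: lifts_def words_def)
      obtain g z where z: "g \<le> D" "z \<in> Y" "\<And>k. k < m \<Longrightarrow> z k = x k" "\<And>k. z (m + g + k) = y k"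
        using glue[OF x(1) y(1), of m] by blast
      define m' where "m' = m + g + length v0"
      have m': "m' \<le> n" "m \<le> m'" using z(1) ml by (auto simp: m'_def l_def)
      define X where "X = extensions z m' (n - m')"
      have X: "take m u = s" "take (length v0) (drop (m + g) u) = w" "u \<in> words Y n" if "u \<in> X" for u
      proof -
        have u: "take m' u = word m' z" "u \<in> words Y n" using that m' by (auto simp: X_def extensions_def)
        have "take m u = take m (take m' u)" using m' by (simp add: min_def)
        then show "take m u = s" using u z(3) m' x(3) by (simp add: take_word word_eq_iff)
        have "take (length v0) (drop (m + g) u) = take (length v0) (drop (m + g) (take m' u))"
          by (simp add: m'_def drop_take)
        then show "take (length v0) (drop (m + g) u) = w"
          using u z(4) y(2) by (simp add: drop_word m'_def word_eq_iff)
        show "u \<in> words Y n" by (rule u)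
      qed
      have "X \<subseteq> {u\<in>extensions x m k. hit i u}"
        using X y(3) z(1) ml x(3) unfolding hit_def extensions_def k_def m_def[symmetric] by auto
      moreover have "a \<le> card X"
      proof -
        have "growth Y ^ (k - l) \<le> growth Y ^ (n - m')"
          using z(1) r1 by (intro power_increasing) (auto simp: k_def m'_def l_def)
        also have "\<dots> \<le> real (D + 1) * growth Y ^ D * card X"
          unfolding X_def by (rule extensions_lower[OF z(2)])
        finally show ?thesis using r1 by (simp add: a_def pos_divide_le_eq mult_ac)
      qed
      ultimately show ?thesis using z(1) X(2) by blast
    qed
    have "\<forall>w. \<exists>X. w \<in> lifts f Y v0 \<longrightarrow> X \<subseteq> {u\<in>extensions x m k. hit i u} \<and> a \<le> card X \<and>
        (\<exists>g\<le>D. \<forall>u\<in>X. take (length v0) (drop (m + g) u) = w)"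
    proof (intro allI)
      show "\<exists>X. w \<in> lifts f Y v0 \<longrightarrow> X \<subseteq> {u\<in>extensions x m k. hit i u} \<and> a \<le> card X \<and>
        (\<exists>g\<le>D. \<forall>u\<in>X. take (length v0) (drop (m + g) u) = w)" for w
        using ex[of w] by (cases "w \<in> lifts f Y v0") simp_all
    qed
    from choice[OF this] obtain X where X0: "\<forall>w. w \<in> lifts f Y v0 \<longrightarrow> X w \<subseteq> {u\<in>extensions x m k. hit i u} \<and> a \<le> card (X w) \<and>
        (\<exists>g\<le>D. \<forall>u\<in>X w. take (length v0) (drop (m + g) u) = w)" ..
    then have X: "\<And>w. w \<in> lifts f Y v0 \<Longrightarrow> X w \<subseteq> {u\<in>extensions x m k. hit i u}"
      "\<And>w. w \<in> lifts f Y v0 \<Longrightarrow> a \<le> card (X w)"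
      "\<And>w. w \<in> lifts f Y v0 \<Longrightarrow> \<exists>g\<le>D. \<forall>u\<in>X w. take (length v0) (drop (m + g) u) = w"
      by simp_all
    \<comment> \<open>A word \<open>u\<close> belongs to \<open>X w\<close> for at most
      \<open>D + 1\<close> lifts \<open>w\<close>, one for each gap.\<close>
    have many: "real (card (lifts f Y v0)) * a \<le> real (D + 1) * card {u\<in>extensions x m k. hit i u}"
    proof (rule card_mult_le_fibres[where X = X and h = "\<lambda>g u. take (length v0) (drop (m + g) u)"])
      fix u
      show "{v \<in> lifts f Y v0. u \<in> X v} \<subseteq> (\<lambda>g. take (length v0) (drop (m + g) u)) ` {..D}"
      proof
        fix v assume v: "v \<in> {v \<in> lifts f Y v0. u \<in> X v}"
        then obtain g where "g \<le> D" "take (length v0) (drop (m + g) u) = v" using X(3)[of v] by auto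
        then show "v \<in> (\<lambda>g. take (length v0) (drop (m + g) u)) ` {..D}" by auto
      qed
    qed (use X in auto)
    have "real (card (lifts f Y v0)) * a / real (D + 1) \<le> card {u\<in>extensions x m k. hit i u}"
      by (subst pos_divide_le_eq) (use many in \<open>simp_all add: mult.commute\<close>)
    moreover have "p * card (extensions x m k) \<le> card (lifts f Y v0) * a / real (D + 1)"
    proof -
      have pos: "0 \<le> p" using K r1 by (simp add: p_def)
      have "p * card (extensions x m k) \<le> p * (K * growth Y ^ k)"
        by (intro mult_left_mono pos order_trans[OF card_extensions_le K(2)])
      also have "growth Y ^ k = growth Y ^ l * growth Y ^ (k - l)"
        using ml by (simp add: k_def flip: power_add)
      also have "p * (K * (growth Y ^ l * growth Y ^ (k - l))) = card (lifts f Y v0) * a / real (D + 1)"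
      proof -
        have "z / (d\<^sup>2 * a0 * K * b) * (K * (b * e)) = z * (e / (d * a0)) / d"
          if "0 < d" "0 < a0" "0 < b" for z d a0 b e :: real
          using that K by (simp add: field_simps power2_eq_square)
        then show ?thesis using K r1 unfolding p_def a_def by (simp add: power2_eq_square)
      qed
      finally show ?thesis .
    qed
    ultimately show "p * card {u \<in> E i. take m u = s} \<le> card {u \<in> E i. take m u = s \<and> hit i u}"
      unfolding fib fibh by (rule order_trans[rotated])
  qed (rule finE)
  have "E (Suc i) = E i - {u\<in>E i. hit i u}" by (auto simp: E_def less_Suc_eq)
  then have "real (card (E (Suc i))) = real (card (E i)) - card {u\<in>E i. hit i u}"
    using finE by (simp add: card_Diff_subset of_nat_diff card_mono)
  then have step: "card (E (Suc i)) \<le> (1 - p) * card (E i)" using key by (simp add: algebra_simps)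
  \<comment> \<open>For \<open>i = 0\<close> the set \<open>E i\<close> consists of all words and is
    nonempty, so \<open>key\<close> itself forces the bound; later it is inherited.\<close>
  have p1: "p \<le> 1"
  proof (cases "i = 0")
    case True
    then have "real (card (E i)) \<ge> 1" using word_count_ge_1[of n] by (simp add: E_def word_count_def)
    moreover have "real (card {u\<in>E i. hit i u}) \<le> card (E i)" using finE by (simp add: card_mono)
    ultimately have "p * card (E i) \<le> 1 * real (card (E i))" using key by linarith
    then show ?thesis by (rule mult_right_le_imp_le) (use \<open>real (card (E i)) \<ge> 1\<close> in linarith)
  qed (use Suc in auto)
  note step
  also have "(1 - p) * card (E i) \<le> (1 - p) * ((1 - p) ^ i * word_count Y n)"
    using Suc p1 by (intro mult_left_mono) (auto simp: E_def)
  finally show ?case using p1 by (simp add: E_def mult.assoc)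
qed

text \<open>Removing the occurrence leaves a prefix and a suffix that determine the word; each of
  the two counts contributes a factor \<open>K\<close>.\<close>

lemma card_words_at_le:
  fixes K :: real
  assumes K: "1 \<le> K" "\<And>n. word_count Y n \<le> K * growth Y ^ n" and a: "a + length v0 \<le> n"
  shows "card {v\<in>words Y n. take (length v0) (drop a v) = v0} \<le> K\<^sup>2 * growth Y ^ n / growth Y ^ length v0"
proof -
  let ?S = "{v\<in>words Y n. take (length v0) (drop a v) = v0}"
  let ?b = "n - (a + length v0)"
  have "card ?S \<le> card (words Y a \<times> words Y ?b)"
  proof (rule card_inj_on_le[of "\<lambda>v. (take a v, drop (a + length v0) v)"])
    show "inj_on (\<lambda>v. (take a v, drop (a + length v0) v)) ?S"
    proof (rule inj_onI)
      fix v v' assume *: "v \<in> ?S" "v' \<in> ?S" "(take a v, drop (a + length v0) v) = (take a v', drop (a + length v0) v')"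
      have "u = take a u @ take (length v0) (drop a u) @ drop (a + length v0) u" for u :: "'a list"
      proof -
        have "drop a u = take (length v0) (drop a u) @ drop (a + length v0) u"
          by (simp only: append_take_drop_id flip: drop_drop[of "length v0" a u, unfolded add.commute[of "length v0"]])
        then show ?thesis by (metis append_take_drop_id)
      qed
      from this[of v] this[of v'] show "v = v'" using * by simp
    qed
    show "(\<lambda>v. (take a v, drop (a + length v0) v)) ` ?S \<subseteq> words Y a \<times> words Y ?b"
    proof (rule image_subsetI)
      fix v assume "v \<in> ?S"
      then have "v \<in> words Y n" by simp
      then have "take a v \<in> words Y a" "drop (a + length v0) v \<in> words Y ?b"
        using a by (auto intro: take_words drop_words)
      then show "(take a v, drop (a + length v0) v) \<in> words Y a \<times> words Y ?b" by (rule SigmaI)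
    qed
  qed (simp add: finite_words)
  then have "real (card ?S) \<le> word_count Y a * word_count Y ?b"
    unfolding card_cartesian_product word_count_def of_nat_mult[symmetric] of_nat_le_iff .
  also have "\<dots> \<le> (K * growth Y ^ a) * (K * growth Y ^ ?b)"
    using K word_count_ge_1 growth_ge_1 by (intro mult_mono) (auto intro: order_trans[OF zero_le_one])
  also have "\<dots> = K\<^sup>2 * growth Y ^ n / growth Y ^ length v0"
  proof -
    have "growth Y ^ n = growth Y ^ a * growth Y ^ length v0 * growth Y ^ ?b"
      using a by (simp flip: power_add)
    then show ?thesis using growth_ge_1 by (simp add: field_simps power2_eq_square)
  qed
  finally show ?thesis .
qed

text \<open>
  If the lifts of single words are not uniformly distributed, a word \<open>v0\<close> with too many lifts occurs
  in almost every image of a long word of \<open>Y\<close>, but in few words of the factor.  The two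
  uniform measures then live on almost disjoint sets, so that their affinity is small.
\<close>

theorem affinity_lt:
  fixes f :: "'a \<Rightarrow> 'b"
  defines "B \<equiv> factor f Y"
  assumes unb: "\<And>C. \<exists>n. \<exists>v\<in>words B n. C < card (lifts f Y v) * (growth B / growth Y) ^ n"
  shows "\<exists>n. (\<Sum>v\<in>words B n. sqrt (card (lifts f Y v))) < sqrt (growth Y * growth B) ^ n"
proof -
  interpret B: glue_shift B D unfolding B_def by (rule glue_shift_image)
  let ?rA = "growth Y" and ?rB = "growth B"
  obtain KA where KA: "1 \<le> KA" "\<And>n. word_count Y n \<le> KA * ?rA ^ n" by (metis growth_props)
  obtain KB where KB: "1 \<le> KB" "\<And>n. word_count B n \<le> KB * ?rB ^ n" by (metis B.growth_props)
  have rA: "1 \<le> ?rA" and rB: "1 \<le> ?rB" using growth_ge_1 B.growth_ge_1 by auto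
  \<comment> \<open>\<open>C1\<close> collects the constants of \<open>p\<close>, so that
    \<open>p = C1 * T / growth B ^ n0\<close>; \<open>C2\<close> collects those of the bound for the
    words containing \<open>v0\<close>.\<close>
  define C1 where "C1 = 1 / (real (D + 1) ^ 2 * ?rA ^ D * KA * ?rA ^ D)"
  define C2 where "C2 = real (D + 1) * KB\<^sup>2 * KA"
  \<comment> \<open>Thus \<open>exp (- q) = 1 / (16 * KA * KB)\<close>: after the square root, 16
    makes each of the two parts of the sum at most a quarter of the target.\<close>
  define q where "q = ln (16 * KA * KB)"
  have C1: "0 < C1" using KA rA by (simp add: C1_def)
  have C2: "0 < C2" using KA KB by (simp add: C2_def)
  have KAB: "16 \<le> 16 * KA * KB" using mult_mono[OF KA(1) KB(1)] KA by simp
  have q: "0 < q" unfolding q_def using KAB by (intro ln_gt_zero) linarith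
  obtain n0 v0 where v0: "v0 \<in> words B n0"
    and T: "16 * (q + 1) * C2 / C1 < card (lifts f Y v0) * (?rB / ?rA) ^ n0"
    using unb by blast
  define T where "T = card (lifts f Y v0) * (?rB / ?rA) ^ n0"
  have T0: "0 < T" using T C1 C2 q by (simp add: T_def) (smt (verit) divide_pos_pos mult_pos_pos)
  have ln0: "length v0 = n0" using v0 by (rule words_length)
  define l where "l = length v0 + D"
  define p where "p = card (lifts f Y v0) / (real (D + 1) ^ 2 * ?rA ^ D * KA * ?rA ^ l)"
  have p_eq: "p = C1 * T / ?rB ^ n0"
    using rA rB by (simp add: p_def C1_def T_def l_def ln0 power_add power_divide field_simps)
  have p0: "0 < p" unfolding p_eq using C1 T0 rB by simp
  \<comment> \<open>Just enough windows for the avoiding words of \<open>Y\<close> to have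
    proportion at most \<open>exp (- q)\<close>. The proportion of words of the factor that contain
    \<open>v0\<close> grows with \<open>R\<close>, hence like \<open>1 / p\<close>, and stays small
    because \<open>p\<close> contains the large factor \<open>T\<close>.\<close>
  define R where "R = nat \<lceil>q / p\<rceil>"
  have "0 < q / p" using q p0 by simp
  then have R: "q / p \<le> R" "R \<le> q / p + 1" unfolding R_def by linarith+
  have R0: "0 < R" using R(1) \<open>0 < q / p\<close> by (cases R) auto
  define n where "n = R * l"
  define hit where "hit i u = (\<exists>g\<le>D. take (length v0) (drop (i * l + g) u) = v0)" for i and u :: "'b list"
  define H where "H = {v\<in>words B n. \<exists>i<R. hit i v}"
  have avoid: "card {u\<in>words Y n. \<forall>j<R. \<not> hit j (map f u)} \<le> (1 - p) ^ R * word_count Y n" and p1: "p \<le> 1"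
    using avoiding_words_decay[OF KA n_def[unfolded l_def], where f = f and i = R] R0
    by (simp_all add: hit_def p_def l_def drop_map take_map)
  have finB: "finite (words B n)" by (rule B.finite_words)
  have H1: "card H \<le> R * real (D + 1) * (KB\<^sup>2 * ?rB ^ n / ?rB ^ n0)"
  proof -
    have "H \<subseteq> (\<Union>(i, g)\<in>{..<R} \<times> {..D}. {v\<in>words B n. take (length v0) (drop (i * l + g) v) = v0})"
      by (auto simp: H_def hit_def)
    then have "card H \<le> card (\<Union>(i, g)\<in>{..<R} \<times> {..D}. {v\<in>words B n. take (length v0) (drop (i * l + g) v) = v0})"
      by (intro card_mono) (auto simp: finB)
    also have "\<dots> \<le> (\<Sum>x\<in>{..<R} \<times> {..D}. card (case x of (i, g) \<Rightarrow> {v\<in>words B n. take (length v0) (drop (i * l + g) v) = v0}))"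
      by (rule card_UN_le) auto
    finally have "real (card H) \<le> (\<Sum>x\<in>{..<R} \<times> {..D}. real (card (case x of (i, g) \<Rightarrow> {v\<in>words B n. take (length v0) (drop (i * l + g) v) = v0})))"
      by (metis (no_types, lifting) of_nat_le_iff of_nat_sum sum.cong)
    also have "\<dots> \<le> (\<Sum>x\<in>{..<R} \<times> {..D}. KB\<^sup>2 * ?rB ^ n / ?rB ^ n0)"
    proof (intro sum_mono)
      fix x assume "x \<in> {..<R} \<times> {..D}"
      then obtain i g where x: "x = (i, g)" "i < R" "g \<le> D" by auto
      have "Suc i * l \<le> n" unfolding n_def using x by (intro mult_le_mono1) auto
      then have "i * l + g + length v0 \<le> n" using x by (simp add: l_def)
      from B.card_words_at_le[OF KB this]
      show "real (card (case x of (i, g) \<Rightarrow> {v\<in>words B n. take (length v0) (drop (i * l + g) v) = v0}))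
          \<le> KB\<^sup>2 * ?rB ^ n / ?rB ^ n0" by (simp add: x ln0)
    qed
    also have "\<dots> = R * real (D + 1) * (KB\<^sup>2 * ?rB ^ n / ?rB ^ n0)"
      by (simp add: card_cartesian_product algebra_simps)
    finally show ?thesis .
  qed
  let ?Z = "\<lambda>v. real (card (lifts f Y v))"
  let ?G = "sqrt (?rA * ?rB) ^ n"
  have G: "?G = sqrt (?rA ^ n * ?rB ^ n)" by (metis power_mult_distrib real_sqrt_power)
  have G0: "0 < ?G" using rA rB by simp
  have quarter: "sqrt x \<le> ?G / 4" if "x \<le> (?rA ^ n * ?rB ^ n) / 16" for x
  proof -
    have "sqrt x \<le> sqrt ((?rA ^ n * ?rB ^ n) / 16)" using that by simp
    also have "\<dots> = ?G / 4" by (simp add: G real_sqrt_divide)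
    finally show ?thesis .
  qed
  \<comment> \<open>On \<open>H\<close> the count of the factor is small, off \<open>H\<close> the
    count of the lifts is small; Cauchy-Schwarz turns either into a small part of the
    affinity.\<close>
  have "(\<Sum>v\<in>H. sqrt (?Z v)) \<le> sqrt (card H * (\<Sum>v\<in>H. ?Z v))" by (rule sum_sqrt_le[of H ?Z]) simp
  also have "\<dots> \<le> ?G / 4"
  proof (rule quarter)
    have "(\<Sum>v\<in>H. ?Z v) \<le> (\<Sum>v\<in>words B n. ?Z v)" using finB by (intro sum_mono2) (auto simp: H_def)
    also have "\<dots> = word_count Y n"
      using sum_card_lifts[of f n] by (simp add: word_count_def B_def flip: of_nat_sum)
    also have "\<dots> \<le> KA * ?rA ^ n" by (rule KA)
    finally have 1: "(\<Sum>v\<in>H. ?Z v) \<le> KA * ?rA ^ n" .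
    have "card H * (\<Sum>v\<in>H. ?Z v) \<le> (R * real (D + 1) * (KB\<^sup>2 * ?rB ^ n / ?rB ^ n0)) * (KA * ?rA ^ n)"
      using KB rB by (intro mult_mono H1 1) (auto intro!: sum_nonneg)
    also have "\<dots> = (C2 * R / ?rB ^ n0) * (?rA ^ n * ?rB ^ n)" by (simp add: C2_def)
    also have "\<dots> \<le> (1 / 16) * (?rA ^ n * ?rB ^ n)"
    proof (intro mult_right_mono)
      have "R \<le> q / p + 1 / p" using R(2) p0 p1 by (simp add: field_simps)
      then have "C2 * R / ?rB ^ n0 \<le> C2 * ((q + 1) / p) / ?rB ^ n0"
        using C2 rB by (intro divide_right_mono mult_left_mono) (auto simp: add_divide_distrib)
      also have "\<dots> = (q + 1) * C2 / C1 / T" using rB by (simp add: p_eq)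
      also have "\<dots> \<le> 1 / 16"
      proof -
        define c where "c = (q + 1) * C2 / C1"
        have "16 * (q + 1) * C2 / C1 = 16 * c" by (simp add: c_def)
        then have "16 * c < T" using T[folded T_def] by linarith
        then show ?thesis unfolding c_def[symmetric] using T0 by (simp add: pos_divide_le_eq)
      qed
      finally show "C2 * R / ?rB ^ n0 \<le> 1 / 16" .
    qed (use rA rB in auto)
    finally show "card H * (\<Sum>v\<in>H. ?Z v) \<le> (?rA ^ n * ?rB ^ n) / 16" by simp
  qed
  finally have part1: "(\<Sum>v\<in>H. sqrt (?Z v)) \<le> ?G / 4" .
  let ?N = "words B n - H"
  have "(\<Sum>v\<in>?N. sqrt (?Z v)) \<le> sqrt (card ?N * (\<Sum>v\<in>?N. ?Z v))" by (rule sum_sqrt_le[of ?N ?Z]) simp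
  also have "\<dots> \<le> ?G / 4"
  proof (rule quarter)
    have "(\<Sum>v\<in>?N. card (lifts f Y v)) = card (\<Union>v\<in>?N. lifts f Y v)"
      using finB by (intro card_UN_disjoint [symmetric]) (auto simp: lifts_def finite_words)
    also have "\<dots> \<le> card {u\<in>words Y n. \<forall>j<R. \<not> hit j (map f u)}"
      by (intro card_mono) (auto simp: finite_words lifts_def H_def dest: words_length)
    finally have "(\<Sum>v\<in>?N. ?Z v) \<le> card {u\<in>words Y n. \<forall>j<R. \<not> hit j (map f u)}"
      by (metis (no_types, lifting) of_nat_le_iff of_nat_sum sum.cong)
    also have "\<dots> \<le> (1 - p) ^ R * word_count Y n" by (rule avoid)
    also have "\<dots> \<le> exp (- q) * (KA * ?rA ^ n)"
    proof (intro mult_mono KA)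
      have "(1 - p) ^ R \<le> exp (- p) ^ R" using p1 exp_ge_add_one_self[of "- p"] by (intro power_mono) auto
      also have "\<dots> = exp (- (p * R))" by (simp add: exp_of_nat_mult[symmetric] mult.commute)
      also have "\<dots> \<le> exp (- q)" using R(1) p0 by (simp add: field_simps)
      finally show "(1 - p) ^ R \<le> exp (- q)" .
    qed (use word_count_ge_1[of n] in auto)
    finally have 1: "(\<Sum>v\<in>?N. ?Z v) \<le> exp (- q) * (KA * ?rA ^ n)" .
    have "card ?N \<le> card (words B n)" using finB by (intro card_mono) auto
    then have "card ?N \<le> KB * ?rB ^ n" using KB(2)[of n] by (simp add: word_count_def)
    then have "card ?N * (\<Sum>v\<in>?N. ?Z v) \<le> (KB * ?rB ^ n) * (exp (- q) * (KA * ?rA ^ n))"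
      using KB rB by (intro mult_mono 1) (auto intro!: sum_nonneg)
    also have "\<dots> = (KA * KB * exp (- q)) * (?rA ^ n * ?rB ^ n)" by simp
    also have "exp (- q) = 1 / (16 * KA * KB)" using KAB by (simp add: q_def exp_minus inverse_eq_divide)
    also have "KA * KB * (1 / (16 * KA * KB)) = 1 / 16" using KA KB by simp
    finally show "card ?N * (\<Sum>v\<in>?N. ?Z v) \<le> (?rA ^ n * ?rB ^ n) / 16" by simp
  qed
  finally have part2: "(\<Sum>v\<in>?N. sqrt (?Z v)) \<le> ?G / 4" .
  have "(\<Sum>v\<in>words B n. sqrt (?Z v)) = (\<Sum>v\<in>?N. sqrt (?Z v)) + (\<Sum>v\<in>H. sqrt (?Z v))"
    using finB by (intro sum.subset_diff) (auto simp: H_def)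
  then have "(\<Sum>v\<in>words B n. sqrt (?Z v)) < ?G" using part1 part2 G0 by linarith
  then show ?thesis by blast
qed

end

section \<open>Label words of paths in a finite graph\<close>

definition splice :: "(nat \<Rightarrow> 'v) \<Rightarrow> nat \<Rightarrow> (nat \<Rightarrow> 'v) \<Rightarrow> nat \<Rightarrow> 'v" where
  "splice p n q k = (if k < n then p k else q (k - n))"

lemma splice_less [simp]: "k < n \<Longrightarrow> splice p n q k = p k"
  by (simp add: splice_def)

lemma splice_add [simp]: "splice p n q (n + k) = q k"
  by (simp add: splice_def)

locale finite_graph =
  fixes E :: "('v \<times> 'v) set"
  assumes finite_E: "finite E"
begin

definition infinite_path :: "(nat \<Rightarrow> 'v) \<Rightarrow> bool" where
  "infinite_path p \<longleftrightarrow> (\<forall>k. (p k, p (Suc k)) \<in> E)"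

definition paths :: "'v \<Rightarrow> (nat \<Rightarrow> 'v) set" where
  "paths v = {p. infinite_path p \<and> p 0 = v}"

definition component :: "'v \<Rightarrow> 'v set" where
  "component v = {u. (v, u) \<in> E\<^sup>* \<and> (u, v) \<in> E\<^sup>*}"

text \<open>Every vertex belongs to its own \<open>component\<close>. One on no cycle forms a
  singleton component without infinite paths, so \<open>rate\<close> is meaningful for cyclic
  vertices only.\<close>

definition cyclic :: "'v \<Rightarrow> bool" where
  "cyclic v \<longleftrightarrow> (v, v) \<in> E\<^sup>+"

definition component_paths :: "'v \<Rightarrow> (nat \<Rightarrow> 'v) set" where
  "component_paths v = {p. infinite_path p \<and> range p \<subseteq> component v}"

definition component_shift :: "('v \<Rightarrow> 'a) \<Rightarrow> 'v \<Rightarrow> (nat \<Rightarrow> 'a) set" where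
  "component_shift h v = (\<lambda>p. h \<circ> p) ` component_paths v"

abbreviation rate :: "('v \<Rightarrow> 'a) \<Rightarrow> 'v \<Rightarrow> real" where
  "rate h v \<equiv> growth (component_shift h v)"

lemma infinite_path_shift: "infinite_path p \<Longrightarrow> infinite_path (\<lambda>k. p (n + k))"
  by (simp add: infinite_path_def)

lemma infinite_path_splice:
  assumes "\<And>k. k < n \<Longrightarrow> (p k, p (Suc k)) \<in> E" "p n = q 0" "infinite_path q"
  shows "infinite_path (splice p n q)"
  unfolding infinite_path_def
proof
  fix k
  consider "Suc k < n" | "Suc k = n" | "n \<le> k" by linarith
  then show "(splice p n q k, splice p n q (Suc k)) \<in> E"
    using assms assms(1)[of k] by cases (auto simp: splice_def infinite_path_def Suc_diff_le)
qed

lemma infinite_path_reach: "infinite_path p \<Longrightarrow> (p i, p (i + k)) \<in> E\<^sup>*"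
  by (induction k) (auto simp: infinite_path_def intro: rtrancl_into_rtrancl)

lemma infinite_path_Field: "infinite_path p \<Longrightarrow> p k \<in> Field E"
  unfolding infinite_path_def Field_def by blast

lemma paths_reach: "p \<in> paths v \<Longrightarrow> (v, p n) \<in> E\<^sup>*"
  using infinite_path_reach[of p 0 n] by (auto simp: paths_def)

lemma finite_Field: "finite (Field E)"
  using finite_E by (rule finite_Field)

lemma cyclic_Field: "cyclic v \<Longrightarrow> v \<in> Field E"
  unfolding cyclic_def by (auto dest: tranclD intro: FieldI1)

lemma finite_cyclic: "finite {w. cyclic w \<and> P w}"
  by (rule finite_subset[OF _ finite_Field]) (auto intro: cyclic_Field)

lemma short_walk:
  assumes "(u, w) \<in> E\<^sup>*"
  obtains f g where "g \<le> card E" "f 0 = u" "f g = w" "\<And>i. i < g \<Longrightarrow> (f i, f (Suc i)) \<in> E"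
proof -
  from assms obtain g where "g \<le> card E" "(u, w) \<in> E ^^ g"
    unfolding rtrancl_finite_eq_relpow[OF finite_E] by blast
  then show ?thesis using that unfolding relpow_fun_conv by blast
qed

lemma walk_reach:
  assumes "\<And>i. i < g \<Longrightarrow> (f i, f (Suc i)) \<in> E" "i \<le> j" "j \<le> g"
  shows "(f i, f j) \<in> E\<^sup>*"
  using assms(2,3)
proof (induction j)
  case (Suc j)
  then show ?case using assms(1)[of j] by (cases "i = Suc j") (auto intro: rtrancl_into_rtrancl)
qed auto

lemma component_refl [simp]: "v \<in> component v"
  by (simp add: component_def)

lemma component_between:
  "\<lbrakk>u \<in> component v; w \<in> component v; (u, x) \<in> E\<^sup>*; (x, w) \<in> E\<^sup>*\<rbrakk> \<Longrightarrow> x \<in> component v"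
  unfolding component_def by (auto intro: rtrancl_trans)

lemma component_path_exists:
  assumes "cyclic v" "u \<in> component v"
  obtains p where "p \<in> component_paths v" "p 0 = u"
proof -
  have step: "\<exists>y. y \<in> component v \<and> (x, y) \<in> E" if "x \<in> component v" for x
  proof -
    have "(x, x) \<in> E\<^sup>+"
      using assms(1) that unfolding cyclic_def component_def
      by (metis (no_types, lifting) mem_Collect_eq rtrancl_trancl_trancl trancl_rtrancl_trancl)
    then obtain y where "(x, y) \<in> E" "(y, x) \<in> E\<^sup>*" by (meson tranclD)
    then show ?thesis using that component_between[of x v x y] by blast
  qed
  have "\<exists>p. \<forall>n. (p n \<in> component v \<and> (n = 0 \<longrightarrow> p n = u)) \<and> (p n, p (Suc n)) \<in> E"
    by (rule dependent_nat_choice[of "\<lambda>n x. x \<in> component v \<and> (n = 0 \<longrightarrow> x = u)" "\<lambda>n x y. (x, y) \<in> E"])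
       (use assms step in auto)
  then obtain p where "\<And>n. p n \<in> component v" "p 0 = u" "\<And>n. (p n, p (Suc n)) \<in> E" by blast
  then show ?thesis using that[of p] by (auto simp: component_paths_def infinite_path_def)
qed

text \<open>A walk from \<open>p n\<close> to \<open>q 0\<close> can be chosen with at most
  \<open>card E\<close> edges, and since it runs between two vertices of the component it stays
  inside.\<close>

lemma component_paths_glue:
  assumes "p \<in> component_paths v" "q \<in> component_paths v"
  shows "\<exists>g\<le>card E. \<exists>r\<in>component_paths v. (\<forall>k<n. r k = p k) \<and> (\<forall>k. r (n + g + k) = q k)"
proof -
  have pq: "p n \<in> component v" "q 0 \<in> component v" using assms by (auto simp: component_paths_def)
  then have "(p n, q 0) \<in> E\<^sup>*" unfolding component_def by (auto intro: rtrancl_trans)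
  then obtain f g where f: "g \<le> card E" "f 0 = p n" "f g = q 0" "\<And>i. i < g \<Longrightarrow> (f i, f (Suc i)) \<in> E"
    by (rule short_walk) blast
  have fc: "f i \<in> component v" if "i \<le> g" for i
    using walk_reach[where f = f and g = g and i = 0 and j = i] walk_reach[where f = f and g = g and i = i and j = g] that f
    by (intro component_between[OF pq]) auto
  let ?r = "splice p n (splice f g q)"
  have "infinite_path (splice f g q)"
    using f assms by (intro infinite_path_splice) (auto simp: component_paths_def)
  moreover have "p n = splice f g q 0" using f by (cases "g = 0") (auto simp: splice_def)
  ultimately have "infinite_path ?r"
    using assms by (intro infinite_path_splice[of n p "splice f g q"]) (auto simp: component_paths_def infinite_path_def)
  moreover have "range ?r \<subseteq> component v"
    using assms fc by (auto simp: splice_def component_paths_def)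
  ultimately have "?r \<in> component_paths v" by (simp add: component_paths_def)
  moreover have "?r (n + g + k) = q k" for k by (simp add: add.assoc)
  ultimately show ?thesis using f(1) by (intro exI[of _ g] conjI bexI[of _ ?r]) auto
qed

lemma glue_shift_component:
  assumes "cyclic v"
  shows "glue_shift (component_shift h v) (card E)"
proof
  show "component_shift h v \<noteq> {}"
    using component_path_exists[OF assms component_refl] by (auto simp: component_shift_def)
  have "(\<Union>y\<in>component_shift h v. range y) \<subseteq> h ` Field E"
    using infinite_path_Field by (auto simp: component_shift_def component_paths_def)
  then show "finite (\<Union>y\<in>component_shift h v. range y)"
    using finite_Field finite_subset by blast
next
  fix y assume "y \<in> component_shift h v"
  then obtain p where p: "p \<in> component_paths v" "y = h \<circ> p" by (auto simp: component_shift_def)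
  then have "(\<lambda>k. p (1 + k)) \<in> component_paths v"
    using infinite_path_shift[of p 1] by (auto simp: component_paths_def)
  then show "shift y \<in> component_shift h v"
    by (auto simp: component_shift_def p shift_def comp_def intro!: image_eqI)
next
  fix x y n assume "x \<in> component_shift h v" "y \<in> component_shift h v"
  then obtain p q where p: "p \<in> component_paths v" "x = h \<circ> p" and q: "q \<in> component_paths v" "y = h \<circ> q"
    by (auto simp: component_shift_def)
  obtain g r where "g \<le> card E" "r \<in> component_paths v" "\<forall>k<n. r k = p k" "\<forall>k. r (n + g + k) = q k"
    using component_paths_glue[OF p(1) q(1), of n] by blast
  then show "\<exists>g\<le>card E. \<exists>z\<in>component_shift h v. (\<forall>k<n. z k = x k) \<and> (\<forall>k. z (n + g + k) = y k)"
    using p q by (intro exI[of _ g] conjI bexI[of _ "h \<circ> r"]) (auto simp: component_shift_def)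
qed

lemma rate_ge_1: "cyclic v \<Longrightarrow> 1 \<le> rate h v"
  using glue_shift.growth_ge_1[OF glue_shift_component] .

lemma factor_component_shift: "factor f (component_shift h v) = component_shift (f \<circ> h) v"
  by (auto simp: component_shift_def image_iff comp_assoc)

lemma cyclic_reachable:
  assumes "p \<in> paths v"
  obtains w where "cyclic w" "(v, w) \<in> E\<^sup>*"
proof -
  have p: "infinite_path p" using assms by (simp add: paths_def)
  have "\<not> inj p"
    using finite_Field finite_subset[of "range p" "Field E"] infinite_path_Field[OF p] finite_imageD[of p UNIV]
    by auto
  then obtain i j where ij: "i < j" "p i = p j" by (metis injI linorder_neqE_nat)
  have "(p i, p (Suc i)) \<in> E" using p by (simp add: infinite_path_def)
  moreover have "(p (Suc i), p j) \<in> E\<^sup>*" using infinite_path_reach[OF p, of "Suc i" "j - Suc i"] ij by simp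
  ultimately have "cyclic (p i)" unfolding cyclic_def using ij by (metis rtrancl_into_trancl2)
  then show ?thesis using that paths_reach[OF assms] by blast
qed

text \<open>The vertex at time \<open>n\<close> contributes no letter: the next block is read from
  it. Only walks that extend to infinite paths are counted.\<close>

definition walk_words :: "('v \<Rightarrow> 'a) \<Rightarrow> 'v \<Rightarrow> nat \<Rightarrow> 'v \<Rightarrow> 'a list set" where
  "walk_words h v n u = {word n (h \<circ> p) |p. p \<in> paths v \<and> p n = u}"

lemma finite_path_words: "finite {word n (h \<circ> p) |p. infinite_path p \<and> Q p}"
proof (rule finite_subset)
  show "{word n (h \<circ> p) |p. infinite_path p \<and> Q p} \<subseteq> {w. set w \<subseteq> h ` Field E \<and> length w = n}"
    by (auto simp: word_def infinite_path_Field)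
  show "finite {w. set w \<subseteq> h ` Field E \<and> length w = n}"
    using finite_Field by (intro finite_lists_length_eq) auto
qed

lemma finite_walk_words [simp]: "finite (walk_words h v n u)"
  by (rule finite_subset[OF _ finite_path_words[where Q = "\<lambda>p. p \<in> paths v \<and> p n = u"]])
     (auto simp: walk_words_def paths_def)

text \<open>Replacing the tail from the last vertex on by a path inside the component shows that
  such a word is a word of the component shift. If \<open>v\<close> is on no cycle, the path leaves
  after one step and there is at most one word.\<close>

lemma path_in_component_words:
  fixes K \<rho> :: real
  assumes K: "1 \<le> K" "\<And>w n. cyclic w \<Longrightarrow> word_count (component_shift h w) n \<le> K * rate h w ^ n"
    and \<rho>: "1 \<le> \<rho>" "cyclic v \<Longrightarrow> rate h v \<le> \<rho>"
  shows "card {word k (h \<circ> p) |p. infinite_path p \<and> p 0 = v \<and> (\<forall>i<k. p i \<in> component v)} \<le> K * \<rho> ^ k"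
proof (cases "cyclic v")
  let ?L = "{word k (h \<circ> p) |p. infinite_path p \<and> p 0 = v \<and> (\<forall>i<k. p i \<in> component v)}"
  case True
  interpret glue_shift "component_shift h v" "card E" by (rule glue_shift_component[OF True])
  have "?L \<subseteq> words (component_shift h v) k"
  proof clarify
    fix p assume p: "infinite_path p" "v = p 0" "\<forall>i<k. p i \<in> component (p 0)"
    show "word k (h \<circ> p) \<in> words (component_shift h (p 0)) k"
    proof (cases "k = 0")
      case True
      obtain r where r: "r \<in> component_paths (p 0)"
        using component_path_exists[OF \<open>cyclic v\<close> component_refl] p(2) by blast
      show ?thesis using r True
        by (auto simp: words_def component_shift_def word_def)
    next
      case False
      then have "p (k - 1) \<in> component v" using p by simp
      then obtain q where q: "q \<in> component_paths v" "q 0 = p (k - 1)"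
        using component_path_exists[OF True] by metis
      let ?r = "splice p (k - 1) q"
      have "infinite_path ?r"
        using p q by (intro infinite_path_splice) (auto simp: infinite_path_def component_paths_def)
      moreover have "range ?r \<subseteq> component v" using p q by (auto simp: splice_def component_paths_def)
      moreover have "word k (h \<circ> p) = word k (h \<circ> ?r)"
        unfolding word_eq_iff
      proof (intro allI impI)
        fix i assume "i < k"
        then have "i < k - 1 \<or> i = k - 1" by linarith
        then show "(h \<circ> p) i = (h \<circ> ?r) i" using q by (auto simp: splice_def)
      qed
      ultimately show ?thesis using p(2)
        by (auto simp: words_def component_shift_def component_paths_def intro!: image_eqI)
    qed
  qed
  then have "card ?L \<le> card (words (component_shift h v) k)" by (intro card_mono finite_words)
  also have "\<dots> \<le> K * rate h v ^ k" using K(2)[OF True, of k] by (simp add: word_count_def)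
  also have "\<dots> \<le> K * \<rho> ^ k"
    using K(1) \<rho>(2)[OF True] growth_ge_1 by (intro mult_left_mono power_mono) auto
  finally show ?thesis by simp
next
  let ?L = "{word k (h \<circ> p) |p. infinite_path p \<and> p 0 = v \<and> (\<forall>i<k. p i \<in> component v)}"
  case False
  have "?L \<subseteq> {word k (\<lambda>_. h v)}"
  proof clarify
    fix p assume p: "infinite_path p" "v = p 0" "\<forall>i<k. p i \<in> component (p 0)"
    have "k \<le> 1"
    proof (rule ccontr)
      assume "\<not> k \<le> 1"
      then have "p 1 \<in> component v" using p by simp
      then have "(p 1, v) \<in> E\<^sup>*" by (simp add: component_def)
      moreover have "(v, p 1) \<in> E" using p by (simp add: infinite_path_def)
      ultimately show False using False unfolding cyclic_def by (metis rtrancl_into_trancl2)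
    qed
    then show "word k (h \<circ> p) = word k (\<lambda>_. h (p 0))" by (cases k) (auto simp: word_eq_iff)
  qed
  then have "card ?L \<le> card {word k (\<lambda>_. h v)}" by (intro card_mono) auto
  then have "real (card ?L) \<le> 1" by simp
  also have "1 \<le> K * \<rho> ^ k" using mult_mono[of 1 K 1 "\<rho> ^ k"] K \<rho> by simp
  finally show ?thesis .
qed

text \<open>Induction on the number of vertices reachable from \<open>v\<close>. A path is cut where
  it first leaves the component of \<open>v\<close>; the remainder starts at a vertex that cannot
  return to \<open>v\<close> and so reaches fewer vertices. The choice of the exit time costs a
  factor linear in \<open>n\<close> for each component passed. Only components between
  \<open>v\<close> and \<open>u\<close> enter \<open>\<rho>\<close>, which is what links consecutive
  blocks to chains of components.\<close>

lemma card_walk_words_le: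
  "\<exists>c\<ge>1. \<forall>v u n \<rho>. 1 \<le> \<rho> \<longrightarrow>
     (\<forall>w. cyclic w \<and> (v, w) \<in> E\<^sup>* \<and> (w, u) \<in> E\<^sup>* \<longrightarrow> rate h w \<le> \<rho>) \<longrightarrow>
     card (walk_words h v n u) \<le> (c * real (n + 1)) ^ card (Field E) * \<rho> ^ n"
proof -
  have "\<forall>w. \<exists>K\<ge>1. cyclic w \<longrightarrow> (\<forall>n. word_count (component_shift h w) n \<le> K * rate h w ^ n)"
  proof
    fix w
    show "\<exists>K\<ge>1. cyclic w \<longrightarrow> (\<forall>n. word_count (component_shift h w) n \<le> K * rate h w ^ n)"
    proof (cases "cyclic w")
      case True
      then show ?thesis using glue_shift.growth_props[OF glue_shift_component[OF True]] by metis
    qed auto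
  qed
  then obtain Kf where Kf: "\<And>w. Kf w \<ge> (1::real)"
    "\<And>w n. cyclic w \<Longrightarrow> word_count (component_shift h w) n \<le> Kf w * rate h w ^ n" by metis
  \<comment> \<open>One constant for all components; the summand 1 gives \<open>1 \<le> K\<close>
    even for an empty graph.\<close>
  define K where "K = (\<Sum>w\<in>Field E. Kf w) + 1"
  have K: "1 \<le> K" "Kf w \<le> K" if "w \<in> Field E" for w
  proof -
    have "Kf w \<le> (\<Sum>w\<in>Field E. Kf w)"
      using that finite_Field Kf(1) by (intro member_le_sum) (auto intro: order_trans[OF zero_le_one])
    then show "Kf w \<le> K" by (simp add: K_def)
    then show "1 \<le> K" using Kf(1) order_trans by blast
  qed
  have K1: "1 \<le> K" using Kf(1) by (auto simp: K_def intro!: sum_nonneg intro: order_trans[OF zero_le_one])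
  have K2: "word_count (component_shift h w) n \<le> K * rate h w ^ n" if "cyclic w" for w n
  proof -
    have "Kf w * rate h w ^ n \<le> K * rate h w ^ n"
      using K(2)[OF cyclic_Field[OF that]] rate_ge_1[OF that, of h] by (intro mult_right_mono) auto
    then show ?thesis using Kf(2)[OF that, of n] by simp
  qed
  define N where "N = card (Field E)"
  define c where "c = K * (1 + real N)"
  have c1: "1 \<le> c" using mult_mono[of 1 K 1 "1 + real N"] K1 by (simp add: c_def)
  have ind: "card (walk_words h v n u) \<le> (c * real (n + 1)) ^ card (E\<^sup>* `` {v}) * \<rho> ^ n"
    if "v \<in> Field E" "1 \<le> \<rho>" "\<And>w. cyclic w \<Longrightarrow> (v, w) \<in> E\<^sup>* \<Longrightarrow> (w, u) \<in> E\<^sup>* \<Longrightarrow> rate h w \<le> \<rho>" for v n \<rho> u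
    using that
  proof (induction "card (E\<^sup>* `` {v})" arbitrary: v n rule: less_induct)
    case less
    have reachF: "E\<^sup>* `` {x} \<subseteq> Field E" if "x \<in> Field E" for x
      using that by (auto elim: rtranclE intro: FieldI2)
    have finr: "finite (E\<^sup>* `` {x})" if "x \<in> Field E" for x
      using reachF[OF that] finite_Field finite_subset by blast
    show ?case
    proof (cases "walk_words h v n u = {}")
      case True
      then show ?thesis using c1 less.prems by simp
    next
      case False
      then have vu: "(v, u) \<in> E\<^sup>*" by (auto simp: walk_words_def paths_reach)
      define L where "L k = {word k (h \<circ> p) |p. infinite_path p \<and> p 0 = v \<and> (\<forall>i<k. p i \<in> component v)}" for k
      have L: "card (L k) \<le> K * \<rho> ^ k" for k
        unfolding L_def using less.prems(2) less.prems(3)[of v] vu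
        by (intro path_in_component_words[where h = h and K = K and \<rho> = \<rho> and v = v and k = k, OF K1 K2]) auto
      have finL: "finite (L k)" for k unfolding L_def by (rule finite_path_words)
      define R where "R = E\<^sup>* `` {v} - component v"
      have Rb: "b \<in> Field E" "card (E\<^sup>* `` {b}) < card (E\<^sup>* `` {v})" "(v, b) \<in> E\<^sup>*" if "b \<in> R" for b
      proof -
        show b: "(v, b) \<in> E\<^sup>*" using that by (simp add: R_def)
        then show "b \<in> Field E" using reachF[OF less.prems(1)] by blast
        have "(b, v) \<notin> E\<^sup>*" using that b by (auto simp: R_def component_def)
        then have "E\<^sup>* `` {b} \<subset> E\<^sup>* `` {v}" using b by (auto intro: rtrancl_trans)
        then show "card (E\<^sup>* `` {b}) < card (E\<^sup>* `` {v})"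
          using finr[OF less.prems(1)] psubset_card_mono by blast
      qed
      have RN: "finite R" "card R \<le> N"
        using reachF[OF less.prems(1)] finite_Field unfolding R_def N_def
        by (auto intro!: card_mono intro: finite_subset)
      define r where "r = card (E\<^sup>* `` {v})"
      have r0: "0 < r" unfolding r_def using finr[OF less.prems(1)] by (auto simp: card_gt_0_iff)
      define cn where "cn = c * real (n + 1)"
      have cn1: "1 \<le> cn" using mult_mono[of 1 c 1 "real (n + 1)"] c1 by (simp add: cn_def)
      have \<rho>0: "0 < \<rho>" using less.prems by simp
      have IH: "card (walk_words h b (n - k) u) \<le> cn ^ (r - 1) * \<rho> ^ (n - k)" if "b \<in> R" for b k
      proof -
        have "card (walk_words h b (n - k) u) \<le> (c * real (n - k + 1)) ^ card (E\<^sup>* `` {b}) * \<rho> ^ (n - k)"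
          using Rb[OF that] less.prems by (intro less.hyps) (auto intro: rtrancl_trans)
        also have "\<dots> \<le> cn ^ card (E\<^sup>* `` {b}) * \<rho> ^ (n - k)"
          using c1 \<rho>0 by (intro mult_right_mono power_mono) (auto simp: cn_def)
        also have "\<dots> \<le> cn ^ (r - 1) * \<rho> ^ (n - k)"
          using Rb(2)[OF that] cn1 \<rho>0 by (intro mult_right_mono power_increasing) (auto simp: r_def)
        finally show ?thesis .
      qed
      let ?S = "\<lambda>k b. (\<lambda>(x, y). x @ y) ` (L k \<times> walk_words h b (n - k) u)"
      have sub: "walk_words h v n u \<subseteq> L n \<union> (\<Union>k<n. \<Union>b\<in>R. ?S k b)"
      proof
        fix x assume "x \<in> walk_words h v n u"
        then obtain p where p: "infinite_path p" "p 0 = v" "p n = u" "x = word n (h \<circ> p)"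
          by (auto simp: walk_words_def paths_def)
        show "x \<in> L n \<union> (\<Union>k<n. \<Union>b\<in>R. ?S k b)"
        proof (cases "\<forall>i<n. p i \<in> component v")
          case True
          then show ?thesis using p by (auto simp: L_def)
        next
          case False
          define k where "k = (LEAST i. i < n \<and> p i \<notin> component v)"
          have k: "k < n" "p k \<notin> component v"
            using LeastI_ex[of "\<lambda>i. i < n \<and> p i \<notin> component v"] False by (auto simp: k_def)
          have lk: "p i \<in> component v" if "i < k" for i
            using not_less_Least[of i "\<lambda>i. i < n \<and> p i \<notin> component v"] that k unfolding k_def[symmetric] by auto
          have "word k (h \<circ> p) \<in> L k" using p lk by (auto simp: L_def)
          moreover have "p k \<in> R" using k infinite_path_reach[OF p(1), of 0 k] p by (simp add: R_def)
          moreover have "word (n - k) (h \<circ> (\<lambda>i. p (k + i))) \<in> walk_words h (p k) (n - k) u"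
            using infinite_path_shift[OF p(1), of k] p k unfolding walk_words_def paths_def
            by (intro CollectI exI[of _ "\<lambda>i. p (k + i)"]) auto
          moreover have "x = word k (h \<circ> p) @ word (n - k) (h \<circ> (\<lambda>i. p (k + i)))"
            using k p(4) by (auto simp: list_eq_iff_nth_eq nth_append)
          ultimately show ?thesis using k(1) by (intro UnI2 UN_I[of k] UN_I[of "p k"]) auto
        qed
      qed
      have S: "card (?S k b) \<le> K * \<rho> ^ n * cn ^ (r - 1)" if "k < n" "b \<in> R" for k b
      proof -
        have "card (?S k b) \<le> card (L k) * card (walk_words h b (n - k) u)"
          using finL by (metis card_cartesian_product card_image_le finite_SigmaI finite_walk_words)
        then have "real (card (?S k b)) \<le> real (card (L k)) * card (walk_words h b (n - k) u)"
          by (metis of_nat_le_iff of_nat_mult)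
        also have "\<dots> \<le> (K * \<rho> ^ k) * (cn ^ (r - 1) * \<rho> ^ (n - k))"
          using K1 \<rho>0 by (intro mult_mono L IH that) auto
        also have "\<dots> = K * \<rho> ^ n * cn ^ (r - 1)"
          using that(1) by (simp flip: power_add[of \<rho> k "n - k"] add: mult_ac)
        finally show ?thesis .
      qed
      have "card (walk_words h v n u) \<le> card (L n \<union> (\<Union>k<n. \<Union>b\<in>R. ?S k b))"
        using finL RN by (intro card_mono[OF _ sub]) auto
      also have "\<dots> \<le> card (L n) + card (\<Union>k<n. \<Union>b\<in>R. ?S k b)" by (rule card_Un_le)
      also have "card (\<Union>k<n. \<Union>b\<in>R. ?S k b) \<le> (\<Sum>k<n. \<Sum>b\<in>R. card (?S k b))"
        using RN by (intro order_trans[OF card_UN_le] sum_mono card_UN_le) auto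
      finally have "real (card (walk_words h v n u)) \<le> real (card (L n)) + (\<Sum>k<n. \<Sum>b\<in>R. real (card (?S k b)))"
        by (simp flip: of_nat_sum of_nat_add)
      also have "\<dots> \<le> K * \<rho> ^ n + (\<Sum>k<n. \<Sum>b\<in>R. K * \<rho> ^ n * cn ^ (r - 1))"
        by (intro add_mono L sum_mono S) auto
      also have "\<dots> = K * \<rho> ^ n * (1 + real n * card R * cn ^ (r - 1))" by (simp add: algebra_simps)
      also have "\<dots> \<le> K * \<rho> ^ n * (cn ^ (r - 1) + real n * N * cn ^ (r - 1))"
        using K1 \<rho>0 cn1 RN by (intro mult_left_mono add_mono mult_right_mono one_le_power) auto
      also have "\<dots> = K * (1 + real n * N) * cn ^ (r - 1) * \<rho> ^ n" by (simp add: algebra_simps)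
      also have "\<dots> \<le> cn * cn ^ (r - 1) * \<rho> ^ n"
      proof (intro mult_right_mono)
        have "K * (1 + real n * N) \<le> K * ((1 + real N) * real (n + 1))"
          using K1 by (intro mult_left_mono) (auto simp: algebra_simps)
        then show "K * (1 + real n * N) \<le> cn" by (simp add: cn_def c_def mult.assoc)
      qed (use cn1 \<rho>0 in auto)
      also have "cn * cn ^ (r - 1) = cn ^ r" using r0 by (simp flip: power_Suc)
      finally show ?thesis by (simp add: cn_def r_def)
    qed
  qed
  show ?thesis
  proof (intro exI[of _ c] conjI c1 allI impI)
    fix v u n \<rho>
    assume \<rho>: "1 \<le> (\<rho>::real)" "\<forall>w. cyclic w \<and> (v, w) \<in> E\<^sup>* \<and> (w, u) \<in> E\<^sup>* \<longrightarrow> rate h w \<le> \<rho>"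
    show "card (walk_words h v n u) \<le> (c * real (n + 1)) ^ card (Field E) * \<rho> ^ n"
    proof (cases "v \<in> Field E")
      case True
      have "E\<^sup>* `` {v} \<subseteq> Field E" using True by (auto elim: rtranclE intro: FieldI2)
      then have "card (E\<^sup>* `` {v}) \<le> card (Field E)" by (intro card_mono finite_Field)
      moreover have "1 \<le> c * real (n + 1)" using mult_mono[of 1 c 1 "real (n + 1)"] c1 by simp
      ultimately have "(c * real (n + 1)) ^ card (E\<^sup>* `` {v}) * \<rho> ^ n \<le> (c * real (n + 1)) ^ card (Field E) * \<rho> ^ n"
        using \<rho> by (intro mult_right_mono power_increasing) auto
      moreover have "card (walk_words h v n u) \<le> (c * real (n + 1)) ^ card (E\<^sup>* `` {v}) * \<rho> ^ n"
        using True \<rho> by (intro ind) auto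
      ultimately show ?thesis by linarith
    next
      case False
      then have "walk_words h v n u = {}"
        using infinite_path_Field[of _ 0] by (auto simp: walk_words_def paths_def)
      then show ?thesis using c1 \<rho> by simp
    qed
  qed
qed

end

section \<open>Block codes\<close>

text \<open>
  With \<open>h i\<close> the projection to the coordinates \<open>\<ge> i\<close>, the block codes of digit sequences index
  the approximate cubes of a self-affine set.
\<close>

fun blocks :: "(nat \<Rightarrow> 'v \<Rightarrow> 'b) \<Rightarrow> (nat \<Rightarrow> nat) \<Rightarrow> nat \<Rightarrow> nat \<Rightarrow> (nat \<Rightarrow> 'v) \<Rightarrow> 'b list list" where
  "blocks h n j 0 p = []"
| "blocks h n j (Suc m) p = word (n j) (h j \<circ> p) # blocks h n (Suc j) m (\<lambda>k. p (n j + k))"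

lemma blocks_eq_iff:
  "blocks h n j m p = blocks h n j m q \<longleftrightarrow>
    (\<forall>i<m. \<forall>k<n (j + i). h (j + i) (p ((\<Sum>i'<i. n (j + i')) + k)) = h (j + i) (q ((\<Sum>i'<i. n (j + i')) + k)))"
proof (induction m arbitrary: j p q)
  case (Suc m)
  have "blocks h n j (Suc m) p = blocks h n j (Suc m) q \<longleftrightarrow>
     (\<forall>k<n j. h j (p k) = h j (q k)) \<and>
     (\<forall>i<m. \<forall>k<n (Suc j + i). h (Suc j + i) (p (n j + ((\<Sum>i'<i. n (Suc j + i')) + k)))
        = h (Suc j + i) (q (n j + ((\<Sum>i'<i. n (Suc j + i')) + k))))"
    by (simp add: word_eq_iff Suc.IH)
  also have "\<dots> \<longleftrightarrow> (\<forall>i<Suc m. \<forall>k<n (j + i). h (j + i) (p ((\<Sum>i'<i. n (j + i')) + k)) = h (j + i) (q ((\<Sum>i'<i. n (j + i')) + k)))"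
    unfolding All_less_Suc2 sum.lessThan_Suc_shift by (simp add: add.assoc)
  finally show ?case .
qed simp

context finite_graph
begin

text \<open>Recursive form of the maximum over chains of components, each represented by a cyclic
  vertex \<open>w\<close>. Reachability being reflexive, successive blocks may use the same
  component. The \<open>Max\<close> runs over a nonempty set if \<open>paths v\<close> is
  nonempty.\<close>

fun chain :: "(nat \<Rightarrow> 'v \<Rightarrow> 'b) \<Rightarrow> (nat \<Rightarrow> real) \<Rightarrow> nat \<Rightarrow> nat \<Rightarrow> 'v \<Rightarrow> real" where
  "chain h \<alpha> j 0 v = 0"
| "chain h \<alpha> j (Suc m) v =
     Max ((\<lambda>w. \<alpha> j * ln (rate (h j) w) + chain h \<alpha> (Suc j) m w) ` {w. cyclic w \<and> (v, w) \<in> E\<^sup>*})"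

lemma chain_ge:
  assumes "cyclic w" "(v, w) \<in> E\<^sup>*"
  shows "\<alpha> j * ln (rate (h j) w) + chain h \<alpha> (Suc j) m w \<le> chain h \<alpha> j (Suc m) v"
  using assms finite_cyclic by (auto intro!: Max_ge imageI)

lemma chain_attained:
  assumes "paths v \<noteq> {}"
  obtains w where "cyclic w" "(v, w) \<in> E\<^sup>*"
    "chain h \<alpha> j (Suc m) v = \<alpha> j * ln (rate (h j) w) + chain h \<alpha> (Suc j) m w"
proof -
  let ?f = "\<lambda>w. \<alpha> j * ln (rate (h j) w) + chain h \<alpha> (Suc j) m w"
  obtain p where "p \<in> paths v" using assms by blast
  then obtain w where "cyclic w" "(v, w) \<in> E\<^sup>*" by (rule cyclic_reachable)
  then have "Max (?f ` {w. cyclic w \<and> (v, w) \<in> E\<^sup>*}) \<in> ?f ` {w. cyclic w \<and> (v, w) \<in> E\<^sup>*}"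
    using finite_cyclic by (intro Max_in) auto
  then show ?thesis using that by auto
qed

lemma paths_shift_nonempty: "p \<in> paths v \<Longrightarrow> (\<lambda>k. p (n + k)) \<in> paths (p n)"
  using infinite_path_shift by (auto simp: paths_def)

lemma chain_mono:
  assumes "(v, w) \<in> E\<^sup>*" "paths w \<noteq> {}"
  shows "chain h \<alpha> j m w \<le> chain h \<alpha> j m v"
proof (cases m)
  case (Suc m')
  obtain u where u: "cyclic u" "(w, u) \<in> E\<^sup>*" "chain h \<alpha> j (Suc m') w = \<alpha> j * ln (rate (h j) u) + chain h \<alpha> (Suc j) m' u"
    by (rule chain_attained[OF assms(2)])
  moreover have "(v, u) \<in> E\<^sup>*" using assms(1) u(2) by (rule rtrancl_trans)
  ultimately show ?thesis using chain_ge[OF u(1), of v] Suc by metis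
qed simp

lemma cyclic_paths:
  assumes "cyclic w"
  shows "paths w \<noteq> {}"
proof -
  obtain p where "p \<in> component_paths w" "p 0 = w" using component_path_exists[OF assms component_refl] by blast
  then show ?thesis by (auto simp: paths_def component_paths_def)
qed

text \<open>The component chosen for the second block can serve the first one as well, where its
  term is nonnegative.\<close>

lemma chain_drop:
  assumes "paths v \<noteq> {}" "0 \<le> \<alpha> j"
  shows "chain h \<alpha> (Suc j) m v \<le> chain h \<alpha> j (Suc m) v"
proof -
  have "\<exists>w. cyclic w \<and> (v, w) \<in> E\<^sup>* \<and> chain h \<alpha> (Suc j) m v \<le> chain h \<alpha> (Suc j) m w"
  proof (cases m)
    case 0
    then show ?thesis using assms(1) cyclic_reachable by (metis chain.simps(1) ex_in_conv order_refl)
  next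
    case (Suc m')
    obtain u where u: "cyclic u" "(v, u) \<in> E\<^sup>*"
      "chain h \<alpha> (Suc j) (Suc m') v = \<alpha> (Suc j) * ln (rate (h (Suc j)) u) + chain h \<alpha> (Suc (Suc j)) m' u"
      by (rule chain_attained[OF assms(1)])
    then show ?thesis using chain_ge[OF u(1) rtrancl_refl, of \<alpha> "Suc j" h m'] Suc by metis
  qed
  then obtain w where w: "cyclic w" "(v, w) \<in> E\<^sup>*" "chain h \<alpha> (Suc j) m v \<le> chain h \<alpha> (Suc j) m w" by blast
  have "0 \<le> \<alpha> j * ln (rate (h j) w)" using assms(2) rate_ge_1[OF w(1)] by (intro mult_nonneg_nonneg ln_ge_zero) auto
  then show ?thesis using w(3) chain_ge[OF w(1,2), of \<alpha> j h m] by linarith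
qed

lemma finite_blocks: "finite (blocks h n j m ` paths v)"
proof (induction m arbitrary: j v)
  case (Suc m)
  have "blocks h n j (Suc m) ` paths v \<subseteq>
      (\<lambda>(x, y). x # y) ` ({word (n j) (h j \<circ> p) |p. infinite_path p \<and> True} \<times> (\<Union>u\<in>Field E. blocks h n (Suc j) m ` paths u))"
  proof clarify
    fix p assume p: "p \<in> paths v"
    then have "blocks h n (Suc j) m (\<lambda>k. p (n j + k)) \<in> (\<Union>u\<in>Field E. blocks h n (Suc j) m ` paths u)"
      using paths_shift_nonempty[OF p, of "n j"] infinite_path_Field[of p "n j"] by (auto simp: paths_def)
    then show "blocks h n j (Suc m) p \<in> (\<lambda>(x, y). x # y) `
        ({word (n j) (h j \<circ> p) |p. infinite_path p \<and> True} \<times> (\<Union>u\<in>Field E. blocks h n (Suc j) m ` paths u))"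
      using p by (intro image_eqI[of _ _ "(word (n j) (h j \<circ> p), blocks h n (Suc j) m (\<lambda>k. p (n j + k)))"])
        (auto simp: paths_def)
  qed
  moreover have "finite (\<Union>u\<in>Field E. blocks h n (Suc j) m ` paths u)"
    using Suc.IH finite_Field by blast
  then have "finite ((\<lambda>(x, y). x # y) ` ({word (n j) (h j \<circ> p) |p. infinite_path p \<and> True} \<times> (\<Union>u\<in>Field E. blocks h n (Suc j) m ` paths u)))"
    by (intro finite_imageI[OF finite_cartesian_product[OF finite_path_words]])
  ultimately show ?case by (rule finite_subset)
next
  case 0
  show ?case by (rule finite_subset[of _ "{[]}"]) auto
qed

text \<open>Codes are split by the vertex \<open>u\<close> reached at the end of the first block.
  The fastest component between \<open>v\<close> and \<open>u\<close> governs that block and, since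
  it reaches \<open>u\<close>, can be put in front of every chain from \<open>u\<close>.\<close>

lemma card_blocks_upper:
  assumes "\<And>i. 0 \<le> \<alpha> i"
  shows "\<exists>C M. 0 < C \<and> (\<forall>t n v. 0 \<le> t \<longrightarrow> (\<forall>i. real (n i) \<le> \<alpha> i * t + 1) \<longrightarrow>
     card (blocks h n j m ` paths v) \<le> C * (t + 1) ^ M * exp (t * chain h \<alpha> j m v))"
proof (induction m arbitrary: j)
  case 0
  have "card (blocks h n j 0 ` paths v) \<le> 1" for n v
    using card_mono[of "{[]}" "blocks h n j 0 ` paths v"] by auto
  then show ?case by (intro exI[of _ 1] exI[of _ 0]) auto
next
  case (Suc m)
  obtain C M where C: "0 < C" and IH: "\<And>t n v. \<lbrakk>0 \<le> t; \<And>i. real (n i) \<le> \<alpha> i * t + 1\<rbrakk> \<Longrightarrow>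
     card (blocks h n (Suc j) m ` paths v) \<le> C * (t + 1) ^ M * exp (t * chain h \<alpha> (Suc j) m v)"
    using Suc.IH[of "Suc j"] by blast
  obtain c where c: "1 \<le> c" and W: "\<And>v u n \<rho>. \<lbrakk>1 \<le> \<rho>; \<And>w. \<lbrakk>cyclic w; (v, w) \<in> E\<^sup>*; (w, u) \<in> E\<^sup>*\<rbrakk> \<Longrightarrow> rate (h j) w \<le> \<rho>\<rbrakk>
     \<Longrightarrow> card (walk_words (h j) v n u) \<le> (c * real (n + 1)) ^ card (Field E) * \<rho> ^ n"
    using card_walk_words_le[of "h j"] by metis
  define N where "N = card (Field E)"
  \<comment> \<open>A bound for all rates; it absorbs the rounding of the block length, which may
    exceed \<open>\<alpha> j * t\<close> by 1.\<close>
  define G where "G = Max (insert 1 (rate (h j) ` {w. cyclic w \<and> True}))"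
  have finG: "finite (insert 1 (rate (h j) ` {w. cyclic w \<and> True}))" using finite_cyclic[of "\<lambda>_. True"] by simp
  have G1: "1 \<le> G" unfolding G_def using finG by (intro Max_ge) auto
  have G: "rate (h j) w \<le> G" if "cyclic w" for w unfolding G_def using finG that by (intro Max_ge) auto
  define A where "A = c * (\<alpha> j + 2)"
  have A: "0 < A" using c assms[of j] by (simp add: A_def)
  define C' where "C' = (real N + 1) * (A ^ N * G * C)"
  show ?case
  proof (rule exI[of _ C'], rule exI[of _ "N + M"], intro conjI allI impI)
    show "0 < C'" using A C G1 by (simp add: C'_def)
    fix t and n :: "nat \<Rightarrow> nat" and v
    assume t: "0 \<le> (t::real)" and n: "\<forall>i. real (n i) \<le> \<alpha> i * t + 1"
    let ?B = "\<lambda>u. (\<lambda>(x, y). x # y) ` (walk_words (h j) v (n j) u \<times> blocks h n (Suc j) m ` paths u)"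
    let ?bd = "A ^ N * G * C * (t + 1) ^ (N + M) * exp (t * chain h \<alpha> j (Suc m) v)"
    have fin: "finite (?B u)" for u by (intro finite_imageI[of "_ \<times> _"] finite_cartesian_product finite_walk_words finite_blocks)
    have bd0: "0 \<le> ?bd" using A G1 C t by simp
    have sub: "blocks h n j (Suc m) ` paths v \<subseteq> (\<Union>u\<in>Field E. ?B u)"
    proof clarify
      fix p assume p: "p \<in> paths v"
      have "word (n j) (h j \<circ> p) \<in> walk_words (h j) v (n j) (p (n j))" using p by (auto simp: walk_words_def)
      moreover have "blocks h n (Suc j) m (\<lambda>k. p (n j + k)) \<in> blocks h n (Suc j) m ` paths (p (n j))"
        using paths_shift_nonempty[OF p] by blast
      ultimately have "blocks h n j (Suc m) p \<in> ?B (p (n j))" by auto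
      moreover have "p (n j) \<in> Field E" using p infinite_path_Field by (auto simp: paths_def)
      ultimately show "blocks h n j (Suc m) p \<in> (\<Union>u\<in>Field E. ?B u)" by blast
    qed
    have each: "card (?B u) \<le> ?bd" for u
    proof (cases "walk_words (h j) v (n j) u = {} \<or> paths u = {}")
      case True
      then show ?thesis using bd0 by auto
    next
      case False
      then have vu: "(v, u) \<in> E\<^sup>*" and pu: "paths u \<noteq> {}" by (auto simp: walk_words_def paths_reach)
      have poly: "(c * real (n j + 1)) ^ N \<le> A ^ N * (t + 1) ^ N"
      proof -
        have "c * real (n j + 1) \<le> c * (\<alpha> j * t + 2)"
          using c n[rule_format, of j] by (intro mult_left_mono) auto
        also have "\<dots> \<le> c * ((\<alpha> j + 2) * (t + 1))"
          using c assms[of j] t by (intro mult_left_mono) (auto simp: algebra_simps)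
        finally have "c * real (n j + 1) \<le> A * (t + 1)" by (simp add: A_def mult.assoc)
        then show ?thesis using c by (simp flip: power_mult_distrib add: power_mono)
      qed
      have "\<exists>\<rho>. 1 \<le> \<rho> \<and> \<rho> \<le> G \<and> (\<forall>w. cyclic w \<longrightarrow> (v, w) \<in> E\<^sup>* \<longrightarrow> (w, u) \<in> E\<^sup>* \<longrightarrow> rate (h j) w \<le> \<rho>) \<and>
          \<alpha> j * ln \<rho> + chain h \<alpha> (Suc j) m u \<le> chain h \<alpha> j (Suc m) v"
      proof (cases "\<exists>w. cyclic w \<and> (v, w) \<in> E\<^sup>* \<and> (w, u) \<in> E\<^sup>*")
        case True
        let ?S = "{w. cyclic w \<and> ((v, w) \<in> E\<^sup>* \<and> (w, u) \<in> E\<^sup>*)}"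
        have S: "finite ?S" "?S \<noteq> {}" using True by (auto intro: finite_cyclic)
        then have "Max (rate (h j) ` ?S) \<in> rate (h j) ` ?S" by (intro Max_in) auto
        then obtain w where w: "w \<in> ?S" "rate (h j) w = Max (rate (h j) ` ?S)" by (metis (no_types, lifting) imageE)
        have "rate (h j) x \<le> rate (h j) w" if "x \<in> ?S" for x
          unfolding w(2) using S that by (intro Max_ge) auto
        moreover have "\<alpha> j * ln (rate (h j) w) + chain h \<alpha> (Suc j) m u \<le> chain h \<alpha> j (Suc m) v"
          using chain_ge[of w v \<alpha> j h m] chain_mono[OF _ pu, of w h \<alpha> "Suc j" m] w(1) by simp
        ultimately show ?thesis using w(1) rate_ge_1[of w "h j"] G[of w]
          by (intro exI[of _ "rate (h j) w"]) auto
      next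
        \<comment> \<open>No cycle lies between \<open>v\<close> and \<open>u\<close>, so the first
          block admits only polynomially many words: \<open>\<rho> = 1\<close> works and the first
          term of the chain is dropped.\<close>
        case False
        have "chain h \<alpha> (Suc j) m u \<le> chain h \<alpha> j (Suc m) u" using pu assms by (intro chain_drop)
        also have "\<dots> \<le> chain h \<alpha> j (Suc m) v" using vu pu by (rule chain_mono)
        finally show ?thesis using False G1 by (intro exI[of _ 1]) auto
      qed
      then obtain \<rho> where \<rho>: "1 \<le> \<rho>" "\<rho> \<le> G" "\<And>w. \<lbrakk>cyclic w; (v, w) \<in> E\<^sup>*; (w, u) \<in> E\<^sup>*\<rbrakk> \<Longrightarrow> rate (h j) w \<le> \<rho>"
        "\<alpha> j * ln \<rho> + chain h \<alpha> (Suc j) m u \<le> chain h \<alpha> j (Suc m) v" by blast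
      have pw: "\<rho> ^ n j \<le> G * exp (t * (\<alpha> j * ln \<rho>))"
      proof -
        have "\<rho> ^ n j = exp (real (n j) * ln \<rho>)" using \<rho>(1) by (simp add: exp_of_nat_mult)
        also have "\<dots> \<le> exp ((\<alpha> j * t + 1) * ln \<rho>)"
          using n[rule_format, of j] \<rho>(1) by (simp add: mult_right_mono)
        also have "\<dots> = \<rho> * exp (t * (\<alpha> j * ln \<rho>))" using \<rho>(1) by (simp add: ring_distribs exp_add mult_ac)
        finally show ?thesis using \<rho>(2) by (meson exp_ge_zero mult_right_mono order_trans)
      qed
      have "card (?B u) \<le> card (walk_words (h j) v (n j) u) * card (blocks h n (Suc j) m ` paths u)"
        using finite_blocks by (metis card_cartesian_product card_image_le finite_SigmaI finite_walk_words)
      then have "real (card (?B u)) \<le> real (card (walk_words (h j) v (n j) u)) * card (blocks h n (Suc j) m ` paths u)"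
        by (metis of_nat_le_iff of_nat_mult)
      also have "\<dots> \<le> ((A ^ N * (t + 1) ^ N) * (G * exp (t * (\<alpha> j * ln \<rho>)))) *
          (C * (t + 1) ^ M * exp (t * chain h \<alpha> (Suc j) m u))"
      proof (intro mult_mono IH t n[rule_format])
        have "card (walk_words (h j) v (n j) u) \<le> (c * real (n j + 1)) ^ N * \<rho> ^ n j"
          unfolding N_def using \<rho> by (intro W) auto
        also have "\<dots> \<le> (A ^ N * (t + 1) ^ N) * (G * exp (t * (\<alpha> j * ln \<rho>)))"
          using \<rho>(1) A t by (intro mult_mono poly pw) auto
        finally show "card (walk_words (h j) v (n j) u) \<le> (A ^ N * (t + 1) ^ N) * (G * exp (t * (\<alpha> j * ln \<rho>)))" .
      qed (use A t G1 in auto)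
      also have "\<dots> = A ^ N * G * C * (t + 1) ^ (N + M) * exp (t * (\<alpha> j * ln \<rho> + chain h \<alpha> (Suc j) m u))"
        by (simp add: power_add ring_distribs exp_add mult_ac)
      also have "\<dots> \<le> ?bd"
        using \<rho>(4) A t G1 C by (intro mult_left_mono) (auto intro!: mult_left_mono)
      finally show ?thesis .
    qed
    have "card (blocks h n j (Suc m) ` paths v) \<le> card (\<Union>u\<in>Field E. ?B u)"
      using fin finite_Field by (intro card_mono[OF _ sub]) auto
    also have "\<dots> \<le> (\<Sum>u\<in>Field E. card (?B u))" using finite_Field by (rule card_UN_le)
    finally have "real (card (blocks h n j (Suc m) ` paths v)) \<le> (\<Sum>u\<in>Field E. real (card (?B u)))"
      by (simp flip: of_nat_sum)
    also have "\<dots> \<le> (\<Sum>u\<in>Field E. ?bd)" by (intro sum_mono each)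
    also have "\<dots> \<le> (real N + 1) * ?bd" using bd0 by (simp add: N_def algebra_simps)
    finally show "card (blocks h n j (Suc m) ` paths v) \<le> C' * (t + 1) ^ (N + M) * exp (t * chain h \<alpha> j (Suc m) v)"
      by (simp add: C'_def mult_ac)
  qed
qed

text \<open>A path reaches the component of \<open>w\<close> within \<open>card E\<close> steps and
  stays there. Its vertex at time \<open>n\<close> is only asked to reach \<open>w\<close>, since
  for small \<open>n\<close> it may still be on the way.\<close>

lemma card_words_through_ge:
  fixes h :: "'v \<Rightarrow> 'a" and n :: nat
  assumes w: "cyclic w" and vw: "(v, w) \<in> E\<^sup>*"
  defines "S \<equiv> {word n (h \<circ> p) |p. p \<in> paths v \<and> (p n, w) \<in> E\<^sup>*}"
  shows "rate h w ^ n \<le> (real (card E) + 1) * rate h w ^ card E * card S"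
proof -
  interpret glue_shift "component_shift h w" "card E" by (rule glue_shift_component[OF w])
  let ?D = "card E"
  have r: "1 \<le> rate h w" using rate_ge_1[OF w] .
  have finS: "finite S" unfolding S_def
    by (rule finite_subset[OF _ finite_path_words[where Q = "\<lambda>p. p \<in> paths v \<and> (p n, w) \<in> E\<^sup>*"]]) (auto simp: paths_def)
  \<comment> \<open>For \<open>n \<le> card E\<close> the truncated subtraction gives 0 and only the
    empty word is involved.\<close>
  have "words (component_shift h w) (n - ?D) \<subseteq> (\<Union>g\<le>?D. (\<lambda>x. take (n - ?D) (drop g x)) ` S)"
  proof
    fix x assume "x \<in> words (component_shift h w) (n - ?D)"
    then obtain q where q: "q \<in> component_paths w" "x = word (n - ?D) (h \<circ> q)"
      by (auto simp: words_def component_shift_def)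
    then have qw: "(q i, w) \<in> E\<^sup>*" "(w, q i) \<in> E\<^sup>*" for i by (auto simp: component_paths_def component_def)
    obtain f g where f: "g \<le> ?D" "f 0 = v" "f g = q 0" "\<And>i. i < g \<Longrightarrow> (f i, f (Suc i)) \<in> E"
      using short_walk[OF rtrancl_trans[OF vw qw(2)]] by metis
    let ?p = "splice f g q"
    have "infinite_path ?p" using f q by (intro infinite_path_splice) (auto simp: component_paths_def)
    moreover have "?p 0 = v" using f by (cases "g = 0") (auto simp: splice_def)
    moreover have "(?p n, w) \<in> E\<^sup>*"
    proof (cases "n < g")
      case True
      then have "(f n, q 0) \<in> E\<^sup>*" using walk_reach[where f = f and i = n and j = g and g = g] f by simp
      then show ?thesis using True qw(1)[of 0] by (simp add: rtrancl_trans)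
    qed (simp add: splice_def qw)
    ultimately have "word n (h \<circ> ?p) \<in> S" by (auto simp: S_def paths_def)
    moreover have "take (n - ?D) (drop g (word n (h \<circ> ?p))) = x"
    proof (cases "n \<le> ?D")
      case False
      then have "g + (n - ?D) \<le> n" using f(1) by simp
      then show ?thesis by (subst take_drop_word) (auto simp: q(2) word_eq_iff)
    qed (simp add: q(2) word_def)
    ultimately show "x \<in> (\<Union>g\<le>?D. (\<lambda>x. take (n - ?D) (drop g x)) ` S)" using f(1) by blast
  qed
  then have cw0: "card (words (component_shift h w) (n - ?D)) \<le> (?D + 1) * card S"
    using finS by (intro card_le_fibres[where h = "\<lambda>g x. take (n - ?D) (drop g x)"])
  have cw: "word_count (component_shift h w) (n - ?D) \<le> (real ?D + 1) * card S"
  proof -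
    have "real (card (words (component_shift h w) (n - ?D))) \<le> real ((?D + 1) * card S)" by (rule of_nat_mono[OF cw0])
    then show ?thesis by (simp add: word_count_def algebra_simps)
  qed
  have "rate h w ^ n \<le> rate h w ^ (?D + (n - ?D))" using r by (intro power_increasing) auto
  also have "\<dots> = rate h w ^ ?D * rate h w ^ (n - ?D)" by (rule power_add)
  also have "rate h w ^ (n - ?D) \<le> (real ?D + 1) * card S"
  proof -
    have "rate h w ^ (n - ?D) \<le> word_count (component_shift h w) (n - ?D)" using growth_props by blast
    then show ?thesis using cw by linarith
  qed
  finally show ?thesis using r by (simp add: mult_ac mult_left_mono)
qed

text \<open>An optimal chain is followed. For every first block \<open>s\<close> a path is fixed
  whose end still reaches \<open>w\<close>, so by \<open>chain_mono\<close> the rest of the chain is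
  available from that end. The blocks \<open>s\<close> are the heads of the codes, so the counts for
  different \<open>s\<close> add up.\<close>

lemma card_blocks_lower:
  assumes "\<And>i. 0 \<le> \<alpha> i"
  shows "\<exists>c>0. \<forall>t n v. 0 \<le> t \<longrightarrow> (\<forall>i. \<alpha> i * t \<le> real (n i) + 1) \<longrightarrow> paths v \<noteq> {} \<longrightarrow>
     c * exp (t * chain h \<alpha> j m v) \<le> card (blocks h n j m ` paths v)"
proof (induction m arbitrary: j)
  case 0
  show ?case
  proof (intro exI[of _ 1] conjI allI impI)
    fix t :: real and n v assume "paths v \<noteq> {}"
    then have "blocks h n j 0 ` paths v = {[]}" by auto
    then show "1 * exp (t * chain h \<alpha> j 0 v) \<le> card (blocks h n j 0 ` paths v)" by simp
  qed simp
next
  case (Suc m)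
  obtain c where c: "0 < c" and IH: "\<And>t n v. \<lbrakk>0 \<le> t; \<And>i. \<alpha> i * t \<le> real (n i) + 1; paths v \<noteq> {}\<rbrakk> \<Longrightarrow>
     c * exp (t * chain h \<alpha> (Suc j) m v) \<le> card (blocks h n (Suc j) m ` paths v)"
    using Suc.IH[of "Suc j"] by blast
  let ?D = "card E"
  define G where "G = Max (insert 1 (rate (h j) ` {w. cyclic w \<and> True}))"
  have finG: "finite (insert 1 (rate (h j) ` {w. cyclic w \<and> True}))" using finite_cyclic[of "\<lambda>_. True"] by simp
  have G1: "1 \<le> G" unfolding G_def using finG by (intro Max_ge) auto
  have G: "rate (h j) w \<le> G" if "cyclic w" for w unfolding G_def using finG that by (intro Max_ge) auto
  \<comment> \<open>The factors pay for the rounding of the block length, for the unknown gap and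
    for the steps spent on reaching the component.\<close>
  define b where "b = G * ((real ?D + 1) * G ^ ?D)"
  have b: "0 < b" using G1 by (simp add: b_def)
  show ?case
  proof (rule exI[of _ "c / b"], intro conjI allI impI)
    show "0 < c / b" using b c by simp
    fix t and n :: "nat \<Rightarrow> nat" and v
    assume t: "0 \<le> (t::real)" and n: "\<forall>i. \<alpha> i * t \<le> real (n i) + 1" and v: "paths v \<noteq> {}"
    obtain w where w: "cyclic w" "(v, w) \<in> E\<^sup>*"
      "chain h \<alpha> j (Suc m) v = \<alpha> j * ln (rate (h j) w) + chain h \<alpha> (Suc j) m w"
      by (rule chain_attained[OF v])
    let ?r = "rate (h j) w"
    have r: "1 \<le> ?r" "?r \<le> G" using rate_ge_1 G w by auto
    define S where "S = {word (n j) (h j \<circ> p) |p. p \<in> paths v \<and> (p (n j), w) \<in> E\<^sup>*}"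
    have finS: "finite S" unfolding S_def
      by (rule finite_subset[OF _ finite_path_words[where Q = "\<lambda>p. p \<in> paths v \<and> (p (n j), w) \<in> E\<^sup>*"]]) (auto simp: paths_def)
    have cS: "exp (t * (\<alpha> j * ln ?r)) \<le> b * card S"
    proof -
      have "exp (t * (\<alpha> j * ln ?r)) = exp ((\<alpha> j * t) * ln ?r)" by (simp add: mult_ac)
      also have "\<dots> \<le> exp ((real (n j) + 1) * ln ?r)"
        using n[rule_format, of j] r(1) by (simp add: mult_right_mono)
      also have "\<dots> = ?r * ?r ^ n j" using r(1) by (simp add: ring_distribs exp_add exp_of_nat_mult)
      also have "\<dots> \<le> ?r * ((real ?D + 1) * ?r ^ ?D * card S)"
        unfolding S_def using r(1) by (intro mult_left_mono card_words_through_ge w) auto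
      also have "\<dots> \<le> G * ((real ?D + 1) * G ^ ?D * card S)"
        using r by (intro mult_mono power_mono) auto
      finally show ?thesis by (simp add: b_def mult_ac)
    qed
    have "\<forall>s. \<exists>p. s \<in> S \<longrightarrow> p \<in> paths v \<and> (p (n j), w) \<in> E\<^sup>* \<and> s = word (n j) (h j \<circ> p)" by (auto simp: S_def)
    then obtain P where P: "\<And>s. s \<in> S \<Longrightarrow> P s \<in> paths v" "\<And>s. s \<in> S \<Longrightarrow> (P s (n j), w) \<in> E\<^sup>*"
      "\<And>s. s \<in> S \<Longrightarrow> s = word (n j) (h j \<circ> P s)" by metis
    let ?B = "\<lambda>s. (\<lambda>y. s # y) ` blocks h n (Suc j) m ` paths (P s (n j))"
    have sub: "(\<Union>s\<in>S. ?B s) \<subseteq> blocks h n j (Suc m) ` paths v"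
    proof clarify
      fix s q assume s: "s \<in> S" and q: "q \<in> paths (P s (n j))"
      let ?p = "splice (P s) (n j) q"
      have "infinite_path ?p"
        using P(1)[OF s] q by (intro infinite_path_splice) (auto simp: paths_def infinite_path_def)
      moreover have "?p 0 = v" using P(1)[OF s] q by (cases "n j = 0") (auto simp: splice_def paths_def)
      moreover have "word (n j) (h j \<circ> ?p) = s" by (subst P(3)[OF s]) (simp add: word_eq_iff)
      ultimately show "s # blocks h n (Suc j) m q \<in> blocks h n j (Suc m) ` paths v"
        by (intro image_eqI[of _ _ ?p]) (auto simp: paths_def)
    qed
    have "c / b * exp (t * chain h \<alpha> j (Suc m) v) = exp (t * (\<alpha> j * ln ?r)) / b * (c * exp (t * chain h \<alpha> (Suc j) m w))"
      unfolding w(3) by (simp add: ring_distribs exp_add)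
    also have "\<dots> \<le> real (card S) * (c * exp (t * chain h \<alpha> (Suc j) m w))"
      using cS b c by (intro mult_right_mono) (auto simp: pos_divide_le_eq mult.commute)
    also have "\<dots> = (\<Sum>s\<in>S. c * exp (t * chain h \<alpha> (Suc j) m w))" by simp
    also have "\<dots> \<le> (\<Sum>s\<in>S. real (card (?B s)))"
    proof (intro sum_mono)
      fix s assume s: "s \<in> S"
      have "chain h \<alpha> (Suc j) m w \<le> chain h \<alpha> (Suc j) m (P s (n j))"
        by (rule chain_mono[OF P(2)[OF s] cyclic_paths[OF w(1)]])
      then have "c * exp (t * chain h \<alpha> (Suc j) m w) \<le> c * exp (t * chain h \<alpha> (Suc j) m (P s (n j)))"
        using c t by (intro mult_left_mono) (auto intro: mult_left_mono)
      also have "\<dots> \<le> card (blocks h n (Suc j) m ` paths (P s (n j)))"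
        using paths_shift_nonempty[OF P(1)[OF s]] n by (intro IH t) auto
      also have "\<dots> = card (?B s)" by (intro arg_cong[of _ _ real] card_image [symmetric]) (auto simp: inj_on_def)
      finally show "c * exp (t * chain h \<alpha> (Suc j) m w) \<le> card (?B s)" .
    qed
    also have "\<dots> = real (card (\<Union>s\<in>S. ?B s))"
      unfolding of_nat_sum[symmetric]
      by (intro arg_cong[of _ _ real] card_UN_disjoint [symmetric] finS ballI finite_imageI finite_blocks) auto
    also have "\<dots> \<le> card (blocks h n j (Suc m) ` paths v)"
      using sub finite_blocks by (intro of_nat_mono card_mono)
    finally show "c / b * exp (t * chain h \<alpha> j (Suc m) v) \<le> card (blocks h n j (Suc m) ` paths v)" .
  qed
qed

text \<open>The constant chain that uses \<open>w\<close> for every block is one of the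
  competitors.\<close>

lemma sum_component_le_chain:
  assumes "cyclic w"
  shows "(\<Sum>i<m. \<alpha> (j + i) * ln (rate (h (j + i)) w)) \<le> chain h \<alpha> j m w"
proof (induction m arbitrary: j)
  case (Suc m)
  have "(\<Sum>i<Suc m. \<alpha> (j + i) * ln (rate (h (j + i)) w))
      = \<alpha> j * ln (rate (h j) w) + (\<Sum>i<m. \<alpha> (Suc j + i) * ln (rate (h (Suc j + i)) w))"
    by (subst sum.lessThan_Suc_shift) simp
  also have "\<dots> \<le> \<alpha> j * ln (rate (h j) w) + chain h \<alpha> (Suc j) m w" using Suc.IH[of "Suc j"] by simp
  also have "\<dots> \<le> chain h \<alpha> j (Suc m) w" by (rule chain_ge[OF assms rtrancl_refl])
  finally show ?case .
qed simp

end

section \<open>Base expansions and approximate cubes\<close>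

definition expansion :: "int \<Rightarrow> (nat \<Rightarrow> int) \<Rightarrow> real" where
  "expansion b x = (\<Sum>k. of_int (x k) / of_int b ^ Suc k)"

fun prefix_value :: "int \<Rightarrow> (nat \<Rightarrow> int) \<Rightarrow> nat \<Rightarrow> int" where
  "prefix_value b x 0 = 0"
| "prefix_value b x (Suc n) = b * prefix_value b x n + x n"

lemma expansion_summable:
  assumes "2 \<le> b" "\<And>k. x k \<in> {0..b - 1}"
  shows "summable (\<lambda>k. of_int (x k) / of_int b ^ Suc k :: real)"
proof (rule summable_comparison_test[OF exI[of _ 0]], intro allI impI)
  have "summable (\<lambda>k. (1 / real_of_int b) ^ k)" using assms(1) by (intro summable_geometric) auto
  then show "summable (\<lambda>k. (1 / real_of_int b) ^ k)" .
  fix k :: nat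
  have "real_of_int (x k) \<le> real_of_int b" "0 \<le> real_of_int (x k)" using assms(2)[of k] by auto
  then have "real_of_int (x k) / real_of_int b ^ Suc k \<le> real_of_int b / real_of_int b ^ Suc k"
    using assms(1) by (intro divide_right_mono) auto
  also have "\<dots> = (1 / real_of_int b) ^ k" using assms(1) by (simp add: power_divide)
  finally show "norm (real_of_int (x k) / real_of_int b ^ Suc k) \<le> (1 / real_of_int b) ^ k"
    using assms(1) \<open>0 \<le> real_of_int (x k)\<close> by simp
qed

lemma expansion_ge_0: "\<lbrakk>2 \<le> b; \<And>k. x k \<in> {0..b - 1}\<rbrakk> \<Longrightarrow> 0 \<le> expansion b x"
  unfolding expansion_def by (intro suminf_nonneg expansion_summable) auto

lemma expansion_le_1:
  assumes "2 \<le> b" "\<And>k. x k \<in> {0..b - 1}"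
  shows "expansion b x \<le> 1"
proof -
  let ?q = "1 / real_of_int b"
  have g: "(\<lambda>k. (of_int b - 1) * ?q * ?q ^ k) sums ((of_int b - 1) * ?q * (1 / (1 - ?q)))"
    using assms(1) by (intro sums_mult geometric_sums) auto
  have "expansion b x \<le> (\<Sum>k. (of_int b - 1) * ?q * ?q ^ k)"
    unfolding expansion_def
  proof (intro suminf_le expansion_summable assms)
    fix k
    have "real_of_int (x k) \<le> of_int b - 1" using assms(2)[of k] by auto
    then have "real_of_int (x k) / of_int b ^ Suc k \<le> (of_int b - 1) / of_int b ^ Suc k"
      using assms(1) by (intro divide_right_mono) auto
    then show "real_of_int (x k) / of_int b ^ Suc k \<le> (of_int b - 1) * ?q * ?q ^ k"
      by (simp add: power_divide)
  qed (use g in \<open>auto simp: sums_iff\<close>)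
  also have "\<dots> = (of_int b - 1) * ?q * (1 / (1 - ?q))" using g by (simp add: sums_iff)
  also have "\<dots> = 1" using assms(1) by (simp add: field_simps)
  finally show ?thesis .
qed

lemma expansion_split:
  assumes "2 \<le> b" "\<And>k. x k \<in> {0..b - 1}"
  shows "expansion b x = (of_int (prefix_value b x n) + expansion b (\<lambda>k. x (n + k))) / of_int b ^ n"
proof (induction n)
  case (Suc n)
  let ?y = "\<lambda>k. x (n + k)"
  have y: "?y k \<in> {0..b - 1}" for k using assms(2) by blast
  have "expansion b ?y = of_int (x n) / of_int b + (\<Sum>k. of_int (x (n + Suc k)) / of_int b ^ Suc (Suc k))"
    unfolding expansion_def
    using suminf_split_head[OF expansion_summable[of b ?y, OF assms(1) y]] by simp
  also have "(\<Sum>k. real_of_int (x (n + Suc k)) / of_int b ^ Suc (Suc k))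
      = (\<Sum>k. of_int (x (Suc n + k)) / of_int b ^ Suc k) / of_int b"
    using expansion_summable[OF assms(1), of "\<lambda>k. x (Suc n + k)"] assms(2)
    by (subst suminf_divide [symmetric]) (auto simp: mult_ac)
  finally have "expansion b ?y = (of_int (x n) + expansion b (\<lambda>k. x (Suc n + k))) / of_int b"
    by (simp add: expansion_def add_divide_distrib)
  then show ?case using Suc assms(1) by (simp add: field_simps)
qed simp

lemma prefix_value_cong: "(\<And>k. k < n \<Longrightarrow> x k = y k) \<Longrightarrow> prefix_value b x n = prefix_value b y n"
  by (induction n) auto

lemma prefix_value_inj:
  assumes "2 \<le> b" "\<And>k. x k \<in> {0..b - 1}" "\<And>k. y k \<in> {0..b - 1}" "prefix_value b x n = prefix_value b y n" "k < n"
  shows "x k = y k"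
  using assms(4,5)
proof (induction n)
  case (Suc n)
  have r: "0 \<le> x n" "x n < b" "0 \<le> y n" "y n < b" using assms(2,3)[of n] by auto
  have *: "b * prefix_value b x n + x n = b * prefix_value b y n + y n" using Suc.prems by simp
  have "(b * prefix_value b x n + x n) mod b = x n" "(b * prefix_value b y n + y n) mod b = y n"
    using r by (simp_all add: mod_add_eq[symmetric])
  then have "x n = y n" using * by simp
  moreover have "prefix_value b x n = prefix_value b y n" using * calculation assms(1) by simp
  ultimately show ?case using Suc by (cases "k = n") auto
qed simp

text \<open>Close points may have different digits because of carries, but after scaling by
  \<open>b ^ n\<close> they differ by at most 1, and so do their fractional tails. The resulting
  five possible integers are the origin of the constant \<open>5 ^ d\<close>.\<close>

lemma prefix_value_close:
  assumes "2 \<le> b" "\<And>k. x k \<in> {0..b - 1}" "\<And>k. y k \<in> {0..b - 1}"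
    and "\<bar>expansion b x - expansion b y\<bar> \<le> 1 / of_int b ^ n"
  shows "prefix_value b y n \<in> {prefix_value b x n - 2..prefix_value b x n + 2}"
proof -
  let ?u = "expansion b (\<lambda>k. x (n + k))" and ?v = "expansion b (\<lambda>k. y (n + k))"
  have uv: "0 \<le> ?u" "?u \<le> 1" "0 \<le> ?v" "?v \<le> 1"
    using assms by (auto intro!: expansion_ge_0 expansion_le_1)
  have "expansion b x - expansion b y = (of_int (prefix_value b x n) + ?u - (of_int (prefix_value b y n) + ?v)) / of_int b ^ n"
    using expansion_split[of b x n, OF assms(1,2)] expansion_split[of b y n, OF assms(1,3)] by (simp add: diff_divide_distrib)
  then have "\<bar>of_int (prefix_value b x n) + ?u - (of_int (prefix_value b y n) + ?v)\<bar> / of_int b ^ n \<le> 1 / of_int b ^ n"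
    using assms(1,4) by (simp add: abs_divide)
  then have "\<bar>of_int (prefix_value b x n) + ?u - (of_int (prefix_value b y n) + ?v)\<bar> \<le> 1"
    using assms(1) by (simp add: divide_le_cancel)
  then have "\<bar>real_of_int (prefix_value b x n - prefix_value b y n)\<bar> \<le> 2" using uv by linarith
  then show ?thesis by auto
qed

lemma expansion_close:
  assumes "2 \<le> b" "\<And>k. x k \<in> {0..b - 1}" "\<And>k. y k \<in> {0..b - 1}" "\<And>k. k < n \<Longrightarrow> x k = y k"
  shows "\<bar>expansion b x - expansion b y\<bar> \<le> 1 / of_int b ^ n"
proof -
  let ?u = "expansion b (\<lambda>k. x (n + k))" and ?v = "expansion b (\<lambda>k. y (n + k))"
  have uv: "0 \<le> ?u" "?u \<le> 1" "0 \<le> ?v" "?v \<le> 1"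
    using assms by (auto intro!: expansion_ge_0 expansion_le_1)
  have "expansion b x - expansion b y = (?u - ?v) / of_int b ^ n"
    using expansion_split[of b x n, OF assms(1,2)] expansion_split[of b y n, OF assms(1,3)] prefix_value_cong[of n x y b, OF assms(4)]
    by (simp add: diff_divide_distrib [symmetric])
  then show ?thesis using uv assms(1) by (simp add: abs_divide divide_right_mono)
qed

text \<open>Among infinitely many indices that agree on the first \<open>k\<close> places,
  infinitely many agree on the next one as well.\<close>

lemma koenig_limit:
  fixes f :: "nat \<Rightarrow> nat \<Rightarrow> 'v"
  assumes "finite V" "\<And>n k. f n k \<in> V"
  obtains p where "\<And>k. infinite {n. \<forall>i<k. f n i = p i}"
proof -
  have "\<exists>g. \<forall>k. infinite {n. \<forall>i<k. f n i = g k i} \<and> (\<forall>i<k. g (Suc k) i = g k i)"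
  proof (rule dependent_nat_choice)
    show "\<exists>g. infinite {n. \<forall>i<0. f n i = g i}" by simp
    fix g and k :: nat assume inf: "infinite {n. \<forall>i<k. f n i = g i}"
    have "{n. \<forall>i<k. f n i = g i} = (\<Union>v\<in>V. {n. (\<forall>i<k. f n i = g i) \<and> f n k = v})" using assms(2) by auto
    then obtain v where "infinite {n. (\<forall>i<k. f n i = g i) \<and> f n k = v}" using inf assms(1) by auto
    moreover have "{n. (\<forall>i<k. f n i = g i) \<and> f n k = v} = {n. \<forall>i<Suc k. f n i = (g(k := v)) i}"
      by (auto simp: less_Suc_eq)
    ultimately show "\<exists>g'. infinite {n. \<forall>i<Suc k. f n i = g' i} \<and> (\<forall>i<k. g' i = g i)"
      by (intro exI[of _ "g(k := v)"]) auto
  qed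
  then obtain g where g: "\<And>k. infinite {n. \<forall>i<k. f n i = g k i}" "\<And>k i. i < k \<Longrightarrow> g (Suc k) i = g k i" by blast
  have stable: "g (Suc i) i = g (Suc i + j) i" for i j
    by (induction j) (auto simp: g(2))
  have "g k i = g (Suc i) i" if "i < k" for i k
    using stable[of i "k - Suc i"] that by simp
  then have "infinite {n. \<forall>i<k. f n i = g (Suc i) i}" for k
  proof -
    have "{n. \<forall>i<k. f n i = g (Suc i) i} = {n. \<forall>i<k. f n i = g k i}"
    proof (intro Collect_cong)
      have eq: "g k i = g (Suc i) i" if "i < k" for i by (rule \<open>\<And>k i. i < k \<Longrightarrow> g k i = g (Suc i) i\<close>[OF that])
      show "(\<forall>i<k. f n i = g (Suc i) i) = (\<forall>i<k. f n i = g k i)" for n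
        using eq by metis
    qed
    then show ?thesis using g(1)[of k] by simp
  qed
  then show ?thesis by (rule that)
qed

text \<open>Sequential compactness for the topology of prefixes, expressed by cluster points so that
  the counting arguments can use it without a topology on the alphabet.\<close>

definition prefix_compact :: "(nat \<Rightarrow> 'a) set \<Rightarrow> bool" where
  "prefix_compact Y \<longleftrightarrow> (\<forall>f :: nat \<Rightarrow> nat \<Rightarrow> 'a. (\<forall>n. f n \<in> Y) \<longrightarrow> (\<exists>y\<in>Y. \<forall>k. infinite {n. \<forall>i<k. f n i = y i}))"

text \<open>The sets \<open>V i\<close> are open in \<open>Y\<close>, membership being decided by
  \<open>L i\<close> letters. Points missing more and more of them would have a cluster point, which
  lies in some \<open>V i\<close> together with late members of the sequence.\<close>

lemma prefix_compact_finite_cover: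
  assumes "prefix_compact Y" "Y \<subseteq> (\<Union>i. V i)"
    and "\<And>i y z. \<lbrakk>y \<in> V i; z \<in> Y; \<forall>k<L i. z k = y k\<rbrakk> \<Longrightarrow> z \<in> V i"
  obtains n :: nat where "Y \<subseteq> (\<Union>i<n. V i)"
proof (rule ccontr)
  assume "\<not> thesis"
  then have "\<forall>n. \<exists>y. y \<in> Y \<and> y \<notin> (\<Union>i<n. V i)" using that by blast
  then obtain f where f: "\<And>n. f n \<in> Y" "\<And>n. f n \<notin> (\<Union>i<n. V i)" by metis
  then obtain y where y: "y \<in> Y" "\<And>k. infinite {n. \<forall>i<k. f n i = y i}"
    using assms(1) unfolding prefix_compact_def by blast
  obtain i where i: "y \<in> V i" using y(1) assms(2) by blast
  obtain n where "n > i" "\<forall>k<L i. f n k = y k"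
    using y(2)[of "L i"] unfolding infinite_nat_iff_unbounded by blast
  then show False using assms(3)[OF i f(1)] f(2)[of n] by auto
qed

section \<open>Approximate cubes at scale \<open>exp (- t)\<close> and their codes\<close>

locale sponge =
  fixes d :: nat and m :: "nat \<Rightarrow> int"
  assumes admissible: "admissible_diagonal d m"
begin

abbreviation "D \<equiv> digits d m"
abbreviation "R \<equiv> coding_map d m"

definition lg :: "nat \<Rightarrow> real" where "lg r = ln (of_int (m r))"

definition level :: "nat \<Rightarrow> real \<Rightarrow> nat" where "level r t = nat \<lfloor>t / lg r\<rfloor>"

definition \<alpha> :: "nat \<Rightarrow> real" where
  "\<alpha> j = (if j < d then 1 / lg j - (if j = 0 then 0 else 1 / lg (j - 1)) else 0)"

text \<open>Integer counterpart of \<open>\<alpha> j * t\<close>. For \<open>t \<ge> 0\<close> the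
  levels increase with the coordinate, so the truncated subtraction is a genuine difference.\<close>

definition seg :: "real \<Rightarrow> nat \<Rightarrow> nat" where
  "seg t j = (if j < d then level j t - (if j = 0 then 0 else level (j - 1) t) else 0)"

definition pr :: "nat \<Rightarrow> (nat \<Rightarrow> int) \<Rightarrow> nat \<Rightarrow> int" where "pr j a = restrict a {j..<d}"

definition code :: "real \<Rightarrow> (nat \<Rightarrow> nat \<Rightarrow> int) \<Rightarrow> (nat \<Rightarrow> int) list list" where
  "code t x = blocks pr (seg t) 0 d x"

definition digit_seqs :: "(nat \<Rightarrow> nat \<Rightarrow> int) set" where "digit_seqs = {x. \<forall>k. x k \<in> D}"

lemma m_ge_2: "r < d \<Longrightarrow> 2 \<le> m r"
  using admissible by (simp add: admissible_diagonal_def)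

lemma m_mono: "\<lbrakk>r \<le> s; s < d\<rbrakk> \<Longrightarrow> m s \<le> m r"
  using admissible by (auto simp: admissible_diagonal_def monotone_on_def)

lemma d_pos: "0 < d"
  using admissible by (auto simp: admissible_diagonal_def)

lemma lg_pos: "r < d \<Longrightarrow> 0 < lg r"
  using m_ge_2[of r] by (simp add: lg_def)

lemma lg_mono: "\<lbrakk>r \<le> s; s < d\<rbrakk> \<Longrightarrow> lg s \<le> lg r"
  using m_mono[of r s] m_ge_2[of s] by (simp add: lg_def)

lemma level_mono: "\<lbrakk>r \<le> s; s < d; 0 \<le> t\<rbrakk> \<Longrightarrow> level r t \<le> level s t"
  unfolding level_def using lg_mono[of r s] lg_pos[of s] by (intro nat_mono floor_mono divide_left_mono) auto

lemma level_le: "\<lbrakk>r < d; 0 \<le> t\<rbrakk> \<Longrightarrow> real (level r t) \<le> t / lg r"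
  unfolding level_def using lg_pos[of r] by simp

lemma level_gt: "r < d \<Longrightarrow> 0 \<le> t \<Longrightarrow> t / lg r < real (level r t) + 1"
  unfolding level_def using lg_pos[of r] floor_correct[of "t / lg r"] by (simp add: of_nat_nat)

lemma \<alpha>_nonneg: "0 \<le> \<alpha> j"
  using lg_mono[of "j - 1" j] lg_pos[of j] by (auto simp: \<alpha>_def frac_le less_imp_le)

lemma seg_bounds:
  assumes "0 \<le> t"
  shows "real (seg t j) \<le> \<alpha> j * t + 1" "\<alpha> j * t \<le> real (seg t j) + 1"
proof -
  have "real (seg t j) \<le> \<alpha> j * t + 1 \<and> \<alpha> j * t \<le> real (seg t j) + 1"
  proof (cases "0 < j \<and> j < d")
    case True
    then have "real (seg t j) = real (level j t) - real (level (j - 1) t)"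
      using level_mono[of "j - 1" j t] assms by (simp add: seg_def)
    moreover have "\<alpha> j * t = t / lg j - t / lg (j - 1)" using True by (simp add: \<alpha>_def algebra_simps)
    ultimately show ?thesis
      using level_le[OF conjunct2[OF True] assms] level_gt[OF conjunct2[OF True] assms]
        level_le[OF _ assms, of "j - 1"] level_gt[OF _ assms, of "j - 1"] True by linarith
  next
    case False
    then show ?thesis
      using level_le[of j t] level_gt[of j t] assms by (auto simp: seg_def \<alpha>_def)
  qed
  then show "real (seg t j) \<le> \<alpha> j * t + 1" "\<alpha> j * t \<le> real (seg t j) + 1" by auto
qed

lemma sum_seg:
  assumes "i < d" "0 \<le> t"
  shows "(\<Sum>j<Suc i. seg t j) = level i t"
  using assms(1)
proof (induction i)
  case (Suc i)
  then have "(\<Sum>j<Suc (Suc i). seg t j) = level i t + (level (Suc i) t - level i t)" by (simp add: seg_def)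
  then show ?case using level_mono[of i "Suc i" t] Suc.prems assms(2) by simp
qed (simp add: seg_def)

lemma digitsD: "\<lbrakk>a \<in> D; r < d\<rbrakk> \<Longrightarrow> a r \<in> {0..m r - 1}"
  unfolding digits_def by blast

lemma digit_seqsD: "\<lbrakk>x \<in> digit_seqs; r < d\<rbrakk> \<Longrightarrow> x k r \<in> {0..m r - 1}"
  by (simp add: digit_seqs_def digitsD del: atLeastAtMost_iff)

text \<open>Block \<open>i\<close> occupies the positions between the levels of \<open>i - 1\<close>
  and \<open>i\<close> and is read in all coordinates from \<open>i\<close> on; hence coordinate
  \<open>r\<close> is read exactly at the positions below its own level.\<close>

lemma code_eq_iff:
  assumes "0 \<le> t"
  shows "code t x = code t y \<longleftrightarrow> (\<forall>r<d. \<forall>k<level r t. x k r = y k r)"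
proof -
  have pr: "pr i a = pr i b \<longleftrightarrow> (\<forall>r\<in>{i..<d}. a r = b r)" for i a b
    unfolding pr_def by (auto simp: restrict_def fun_eq_iff)
  let ?a = "\<lambda>i. if i = 0 then 0 else level (i - 1) t"
  have off: "(\<Sum>i'<i. seg t (0 + i')) = ?a i" if "i < d" for i
    using sum_seg[of "i - 1" t] that assms by (cases i) auto
  have "code t x = code t y \<longleftrightarrow> (\<forall>i<d. \<forall>k<seg t i. \<forall>r\<in>{i..<d}. x (?a i + k) r = y (?a i + k) r)"
    unfolding code_def blocks_eq_iff pr using off by simp
  also have "\<dots> \<longleftrightarrow> (\<forall>r<d. \<forall>k<level r t. x k r = y k r)"
  proof (intro iffI allI impI ballI)
    fix r k assume *: "\<forall>i<d. \<forall>k<seg t i. \<forall>r\<in>{i..<d}. x (?a i + k) r = y (?a i + k) r" "r < d" "k < level r t"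
    \<comment> \<open>The block that contains position \<open>k\<close>.\<close>
    define i where "i = (LEAST i. k < level i t)"
    have i: "k < level i t" "i \<le> r"
      using LeastI[of "\<lambda>i. k < level i t" r] Least_le[of "\<lambda>i. k < level i t" r] *(3) by (auto simp: i_def)
    have "?a i \<le> k" using not_less_Least[of "i - 1" "\<lambda>i. k < level i t"] unfolding i_def[symmetric] by auto
    moreover have "k - ?a i < seg t i" using i *(2) calculation by (auto simp: seg_def)
    ultimately show "x k r = y k r" using *(1)[rule_format, of i "k - ?a i" r] i *(2) by auto
  next
    fix i k r assume *: "\<forall>r<d. \<forall>k<level r t. x k r = y k r" "i < d" "k < seg t i" "r \<in> {i..<d}"
    have "?a i + k < level i t" using * by (auto simp: seg_def split: if_splits)
    also have "level i t \<le> level r t" using * assms by (intro level_mono) auto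
    finally show "x (?a i + k) r = y (?a i + k) r" using * by auto
  qed
  finally show ?thesis .
qed

lemma R_eq: "r < d \<Longrightarrow> R x r = expansion (m r) (\<lambda>k. x k r)"
  by (simp add: coding_map_def expansion_def)

lemma R_in_Rd: "R x \<in> Rd d"
  by (simp add: coding_map_def Rd_def)

lemma Rd_dist_le_sum: "Rd_dist d x y \<le> (\<Sum>i<d. \<bar>x i - y i\<bar>)"
  unfolding Rd_dist_def by (rule order_trans[OF L2_set_le_sum_abs]) auto

lemma Rd_dist_ge_coord: "i < d \<Longrightarrow> \<bar>x i - y i\<bar> \<le> Rd_dist d x y"
  unfolding Rd_dist_def using member_le_L2_set[of "{..<d}" i "\<lambda>i. \<bar>x i - y i\<bar>"]
  by (simp add: L2_set_def)

text \<open>An approximate cube has width at most \<open>m r * exp (- t)\<close> in direction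
  \<open>r\<close>, the factor \<open>m r\<close> coming from rounding the level; the sum bounds its
  diameter.\<close>

definition c0 :: real where "c0 = (\<Sum>r<d. of_int (m r))"

lemma c0_ge_1: "1 \<le> c0"
proof -
  have "(1::real) \<le> of_int (m 0)" using m_ge_2[OF d_pos] by simp
  also have "\<dots> \<le> c0" unfolding c0_def
    using m_ge_2 d_pos by (intro member_le_sum) (force intro: order_trans[of 0 2])+
  finally show ?thesis .
qed

lemma power_level:
  assumes "r < d" "0 \<le> t"
  shows "exp (- t) \<le> 1 / of_int (m r) ^ level r t" "1 / of_int (m r) ^ level r t \<le> of_int (m r) * exp (- t)"
proof -
  have m: "0 < real_of_int (m r)" using m_ge_2[OF assms(1)] by simp
  have e: "of_int (m r) ^ n = exp (n * lg r)" for n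
    using m by (simp add: lg_def exp_of_nat_mult)
  have "level r t * lg r \<le> t" using level_le[OF assms] lg_pos[OF assms(1)] by (simp add: pos_le_divide_eq)
  then show "exp (- t) \<le> 1 / of_int (m r) ^ level r t" by (simp add: e exp_minus inverse_eq_divide frac_le)
  have "t < (level r t + 1) * lg r"
    using level_gt[OF assms] lg_pos[OF assms(1)] by (simp add: pos_divide_less_eq add.commute)
  then have "exp t \<le> of_int (m r) ^ level r t * of_int (m r)"
  proof -
    have "exp t \<le> exp (real (Suc (level r t)) * lg r)"
    proof -
      have "real (Suc (level r t)) = level r t + 1" by simp
      then show ?thesis using \<open>t < (level r t + 1) * lg r\<close> by (simp only: exp_le_cancel_iff)
    qed
    then show ?thesis unfolding e[symmetric] by (simp add: mult.commute)
  qed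
  then show "1 / of_int (m r) ^ level r t \<le> of_int (m r) * exp (- t)"
    using m by (simp add: exp_minus field_simps)
qed

lemma dist_le_same_code:
  assumes "x \<in> digit_seqs" "y \<in> digit_seqs" "0 \<le> t" "code t x = code t y"
  shows "Rd_dist d (R x) (R y) \<le> c0 * exp (- t)"
proof -
  have "Rd_dist d (R x) (R y) \<le> (\<Sum>r<d. \<bar>R x r - R y r\<bar>)" by (rule Rd_dist_le_sum)
  also have "\<dots> \<le> (\<Sum>r<d. of_int (m r) * exp (- t))"
  proof (intro sum_mono)
    fix r assume "r \<in> {..<d}"
    then have r: "r < d" by simp
    have "\<bar>R x r - R y r\<bar> \<le> 1 / of_int (m r) ^ level r t"
      unfolding R_eq[OF r]
      using assms r digit_seqsD m_ge_2 by (intro expansion_close) (auto simp: code_eq_iff)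
    then show "\<bar>R x r - R y r\<bar> \<le> of_int (m r) * exp (- t)"
      using power_level(2)[OF r assms(3)] by linarith
  qed
  finally show ?thesis by (simp add: c0_def sum_distrib_right)
qed

text \<open>Codes are determined by \<open>d\<close> integer prefix values, each within 2 of that of
  \<open>x\<close>. Consequently a set of diameter at most \<open>exp (- t)\<close> meets at most
  \<open>5 ^ d\<close> approximate cubes.\<close>

lemma codes_near:
  assumes "x \<in> digit_seqs" "0 \<le> t" "Y \<subseteq> digit_seqs" "\<And>y. y \<in> Y \<Longrightarrow> Rd_dist d (R x) (R y) \<le> exp (- t)"
  shows "finite (code t ` Y)" "card (code t ` Y) \<le> 5 ^ d"
proof -
  define I where "I y = (\<lambda>r\<in>{..<d}. prefix_value (m r) (\<lambda>k. y k r) (level r t))" for y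
  define B where "B = (\<Pi>\<^sub>E r\<in>{..<d}. {I x r - 2..I x r + 2})"
  have B: "finite B" "card B = 5 ^ d" by (auto simp: B_def card_PiE intro: finite_PiE)
  have IB: "I ` Y \<subseteq> B"
  proof
    fix z assume "z \<in> I ` Y"
    then obtain y where y: "y \<in> Y" "z = I y" by blast
    have "prefix_value (m r) (\<lambda>k. y k r) (level r t) \<in>
        {prefix_value (m r) (\<lambda>k. x k r) (level r t) - 2..prefix_value (m r) (\<lambda>k. x k r) (level r t) + 2}" if "r < d" for r
    proof (rule prefix_value_close)
      show "\<bar>expansion (m r) (\<lambda>k. x k r) - expansion (m r) (\<lambda>k. y k r)\<bar> \<le> 1 / of_int (m r) ^ level r t"
        using assms(4)[OF y(1)] Rd_dist_ge_coord[OF that, of "R x" "R y"] power_level(1)[OF that assms(2)]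
        by (simp add: R_eq[OF that])
    qed (use y assms m_ge_2 that digit_seqsD in \<open>auto simp del: atLeastAtMost_iff\<close>)
    then show "z \<in> B" by (auto simp: y(2) B_def I_def)
  qed
  have inj: "code t y = code t z" if "I y = I z" "y \<in> Y" "z \<in> Y" for y z
    unfolding code_eq_iff[OF assms(2)]
  proof (intro allI impI)
    fix r k assume r: "r < d" "k < level r t"
    have "prefix_value (m r) (\<lambda>k. y k r) (level r t) = prefix_value (m r) (\<lambda>k. z k r) (level r t)"
      using fun_cong[OF that(1), of r] r by (simp add: I_def)
    then show "y k r = z k r"
      using r that(2,3) assms(3) m_ge_2 digit_seqsD
      by (intro prefix_value_inj[of "m r" "\<lambda>k. y k r" "\<lambda>k. z k r" "level r t" k]) (auto simp del: atLeastAtMost_iff)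
  qed
  define g where "g z = code t (SOME y. y \<in> Y \<and> I y = z)" for z
  have "code t y = g (I y)" if y: "y \<in> Y" for y
  proof -
    let ?y' = "SOME y'. y' \<in> Y \<and> I y' = I y"
    have "?y' \<in> Y \<and> I ?y' = I y" by (rule someI[of _ y]) (use y in simp)
    then show ?thesis unfolding g_def using y by (intro inj) auto
  qed
  then have sub: "code t ` Y \<subseteq> g ` I ` Y" by blast
  have fin: "finite (I ` Y)" using IB B finite_subset by blast
  then show "finite (code t ` Y)" using sub finite_subset by blast
  have "card (code t ` Y) \<le> card (I ` Y)" using sub fin by (meson card_image_le card_mono finite_imageI order_trans)
  also have "\<dots> \<le> 5 ^ d" using card_mono[OF B(1) IB] B(2) by simp
  finally show "card (code t ` Y) \<le> 5 ^ d" .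
qed

definition cubes :: "real \<Rightarrow> (nat \<Rightarrow> nat \<Rightarrow> int) set \<Rightarrow> (nat \<Rightarrow> real) set set" where
  "cubes t Y = (\<lambda>c. R ` {y\<in>Y. code t y = c}) ` code t ` Y"

lemma cubes_props:
  assumes "Y \<subseteq> digit_seqs" "0 \<le> t"
  shows "\<And>U. U \<in> cubes t Y \<Longrightarrow> U \<subseteq> Rd d" "\<And>U. U \<in> cubes t Y \<Longrightarrow> Rd.ediam d U \<le> ennreal (c0 * exp (- t))"
    "R ` Y \<subseteq> \<Union>(cubes t Y)"
proof -
  show "U \<subseteq> Rd d" if "U \<in> cubes t Y" for U using that R_in_Rd by (auto simp: cubes_def)
  show "Rd.ediam d U \<le> ennreal (c0 * exp (- t))" if "U \<in> cubes t Y" for U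
    using that assms by (intro Rd.ediam_leI) (auto simp: cubes_def intro!: dist_le_same_code)
  show "R ` Y \<subseteq> \<Union>(cubes t Y)" by (auto simp: cubes_def)
qed

lemma hausdorff_premeasure_upper:
  assumes "Y \<subseteq> digit_seqs" "0 \<le> t" "finite (code t ` Y)" "0 \<le> s" "c0 * exp (- t) \<le> \<delta>"
  shows "Rd.hausdorff_premeasure d \<delta> s (R ` Y) \<le> ennreal (card (code t ` Y) * (c0 powr s * exp (- (s * t))))"
proof -
  let ?r = "c0 * exp (- t)"
  have fin: "finite (cubes t Y)" "card (cubes t Y) \<le> card (code t ` Y)"
    using assms(3) by (auto simp: cubes_def intro: card_image_le)
  have "Rd.hausdorff_premeasure d \<delta> s (R ` Y) \<le> (\<Sum>U\<in>cubes t Y. Rd.diam_power d s U)"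
    using fin cubes_props[OF assms(1,2)] order_trans[OF _ ennreal_leI[OF assms(5)]]
    by (intro Rd.hausdorff_premeasure_le_finite_cover) auto
  also have "\<dots> \<le> (\<Sum>U\<in>cubes t Y. ennreal (?r powr s))"
    using cubes_props[OF assms(1,2)] c0_ge_1 assms(4) by (intro sum_mono Rd.diam_power_le) auto
  also have "\<dots> = ennreal (card (cubes t Y) * ?r powr s)" by (simp add: ennreal_mult ennreal_of_nat_eq_real_of_nat)
  also have "\<dots> \<le> ennreal (card (code t ` Y) * ?r powr s)"
    using fin by (intro ennreal_leI mult_right_mono) auto
  also have "?r powr s = c0 powr s * exp (- (s * t))"
    using c0_ge_1 by (subst powr_mult) (auto simp: powr_def)
  finally show ?thesis .
qed

lemma hausdorff_measure_finite:
  assumes "Y \<subseteq> digit_seqs" "0 \<le> s" "\<And>t. 0 \<le> t \<Longrightarrow> finite (code t ` Y)"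
    "\<And>t. 0 \<le> t \<Longrightarrow> card (code t ` Y) \<le> K * exp (s * t)"
  shows "Rd.hausdorff_measure d s (R ` Y) < top"
proof -
  have "Rd.hausdorff_measure d s (R ` Y) \<le> ennreal (K * c0 powr s)"
  proof (rule Rd.hausdorff_measure_leI)
    fix \<delta> :: real assume \<delta>: "0 < \<delta>"
    define t where "t = max 0 (ln (c0 / \<delta>))"
    have "exp (- t) \<le> exp (- ln (c0 / \<delta>))" by (simp add: t_def)
    also have "\<dots> = \<delta> / c0" using \<delta> c0_ge_1 by (simp add: exp_minus)
    finally have t: "0 \<le> t" "c0 * exp (- t) \<le> \<delta>" using c0_ge_1 by (auto simp: t_def field_simps)
    have "card (code t ` Y) * (c0 powr s * exp (- (s * t))) \<le> (K * exp (s * t)) * (c0 powr s * exp (- (s * t)))"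
      using assms(4)[OF t(1)] by (intro mult_right_mono) auto
    also have "\<dots> = K * c0 powr s" by (simp add: exp_minus field_simps)
    finally have le: "card (code t ` Y) * (c0 powr s * exp (- (s * t))) \<le> K * c0 powr s" .
    show "Rd.hausdorff_premeasure d \<delta> s (R ` Y) \<le> ennreal (K * c0 powr s)"
      using hausdorff_premeasure_upper[OF assms(1) t(1) assms(3)[OF t(1)] assms(2) t(2)] ennreal_leI[OF le]
      by (rule order_trans)
  qed
  then show ?thesis by (simp add: order_le_less_trans)
qed

end

section \<open>Dimension estimates from counting approximate cubes\<close>

lemma word_count_pos: "\<lbrakk>finite (words Y n); Y \<noteq> {}\<rbrakk> \<Longrightarrow> 0 < card (words Y n)"
  by (auto simp: words_def card_gt_0_iff)

context sponge
begin

text \<open>Normalised counts of words of one large length \<open>T\<close> take the place of a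
  measure. Compactness reduces a countable cover to finitely many sets, after which a single
  \<open>T\<close> resolves all their codes and the covered words can be counted by
  \<open>mass\<close>.\<close>

theorem mass_distribution:
  assumes Y: "Y \<subseteq> digit_seqs" "Y \<noteq> {}" "prefix_compact Y" "\<And>n. finite (words Y n)"
    and s: "0 < s" and A: "0 < A"
    and mass: "\<And>t c T. \<lbrakk>0 \<le> t; level (d - 1) t \<le> T\<rbrakk> \<Longrightarrow>
      card {word T y |y. y \<in> Y \<and> code t y = c} \<le> A * exp (- (s * t)) * card (words Y T)"
  shows "0 < Rd.hausdorff_measure d s (R ` Y)"
proof -
  define B where "B = 5 ^ d * A"
  have B: "0 < B" using A by (simp add: B_def)
  have "ennreal (1 / B) \<le> Rd.hausdorff_premeasure d 1 s (R ` Y)"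
  proof (rule Rd.hausdorff_premeasure_ge)
    fix U :: "nat \<Rightarrow> (nat \<Rightarrow> real) set"
    assume U: "\<And>i. U i \<subseteq> Rd d" "\<And>i. Rd.ediam d (U i) \<le> ennreal 1" "R ` Y \<subseteq> (\<Union>i. U i)"
    show "ennreal (1 / B) \<le> (\<Sum>i. Rd.diam_power d s (U i))"
    proof (rule ennreal_le_epsilon)
      fix e :: real assume e: "0 < e"
      define r where "r i = enn2real (Rd.ediam d (U i))" for i
      have fin: "Rd.ediam d (U i) < top" for i using U(2)[of i] by (simp add: order_le_less_trans)
      have r: "0 \<le> r i" "r i \<le> 1" "Rd.ediam d (U i) = ennreal (r i)" for i
        using enn2real_mono[OF U(2)[of i]] fin[of i] by (auto simp: r_def)
      have dp: "Rd.diam_power d s (U i) = ennreal (r i powr s)" for i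
        using s by (auto simp: Rd.diam_power_def r_def Rd.ediam_def bot_ennreal)
      \<comment> \<open>A set of diameter 0 has no scale of its own; it is given one so fine that
        the error fits into \<open>e * (1/2) ^ Suc i\<close>.\<close>
      have "\<exists>t\<ge>0. r i \<le> exp (- t) \<and> exp (- (s * t)) \<le> r i powr s + e * (1/2) ^ Suc i" for i
      proof (cases "r i = 0")
        case False
        then have "0 < r i" using r(1)[of i] by simp
        then show ?thesis using r(2)[of i] e
          by (intro exI[of _ "- ln (r i)"]) (auto simp: powr_def)
      next
        case True
        define t where "t = max 0 (- ln (e * (1/2) ^ Suc i) / s)"
        have "- ln (e * (1/2) ^ Suc i) / s \<le> t" by (simp add: t_def)
        then have "- ln (e * (1/2) ^ Suc i) \<le> t * s" using s by (simp only: pos_divide_le_eq)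
        then have "- (s * t) \<le> ln (e * (1/2) ^ Suc i)" by (simp add: mult.commute)
        then have "exp (- (s * t)) \<le> exp (ln (e * (1/2) ^ Suc i))" by (simp only: exp_le_cancel_iff)
        also have "\<dots> = e * (1/2) ^ Suc i" using e by (intro exp_ln) simp
        finally show ?thesis using True by (intro exI[of _ t]) (auto simp: t_def)
      qed
      then obtain t where t: "\<And>i. 0 \<le> t i" "\<And>i. r i \<le> exp (- t i)"
        "\<And>i. exp (- (s * t i)) \<le> r i powr s + e * (1/2) ^ Suc i" by metis
      define C where "C i = code (t i) ` {y\<in>Y. R y \<in> U i}" for i
      have C: "finite (C i)" "card (C i) \<le> 5 ^ d" for i
      proof -
        have "finite (C i) \<and> card (C i) \<le> 5 ^ d"
        proof (cases "{y\<in>Y. R y \<in> U i} = {}")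
          case False
          then obtain x where x: "x \<in> Y" "R x \<in> U i" by blast
          have "Rd_dist d (R x) (R y) \<le> exp (- t i)" if "y \<in> {y\<in>Y. R y \<in> U i}" for y
          proof -
            have "Rd_dist d (R x) (R y) \<le> r i"
              using that x r(1,3)[of i] by (intro Rd.ediam_leD[of d "U i"]) auto
            then show ?thesis using t(2)[of i] by linarith
          qed
          then show ?thesis unfolding C_def using x Y(1) t(1)
            by (intro conjI codes_near[of x]) auto
        next
          case True
          show ?thesis unfolding C_def True by simp
        qed
        then show "finite (C i)" "card (C i) \<le> 5 ^ d" by auto
      qed
      \<comment> \<open>Enlargement of the points over \<open>U i\<close> to all points sharing a
        code with them, a set decided by finitely many letters.\<close>
      define V where "V i = {y\<in>Y. code (t i) y \<in> C i}" for i
      define L where "L i = level (d - 1) (t i)" for i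
      have "Y \<subseteq> (\<Union>i. V i)"
      proof
        fix y assume y: "y \<in> Y"
        then obtain i where "R y \<in> U i" using U(3) by blast
        then have "y \<in> V i" using y by (auto simp: V_def C_def)
        then show "y \<in> (\<Union>i. V i)" by blast
      qed
      moreover have "z \<in> V i" if "y \<in> V i" "z \<in> Y" "\<forall>k<L i. z k = y k" for i y z
      proof -
        have "code (t i) z = code (t i) y"
          unfolding code_eq_iff[OF t(1)]
        proof (intro allI impI)
          fix q k assume "q < d" "k < level q (t i)"
          moreover have "level q (t i) \<le> L i"
            unfolding L_def using \<open>q < d\<close> t(1) by (intro level_mono) auto
          ultimately show "z k q = y k q" using that(3) by simp
        qed
        then show ?thesis using that by (simp add: V_def)
      qed
      ultimately obtain n where n: "Y \<subseteq> (\<Union>i<n. V i)"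
        by (rule prefix_compact_finite_cover[OF Y(3)]) blast
      \<comment> \<open>The sum is a convenient length not below any of the finitely many
        \<open>L i\<close>.\<close>
      define T where "T = (\<Sum>i<n. L i)"
      have T: "L i \<le> T" if "i < n" for i unfolding T_def using that by (intro member_le_sum) auto
      define W where "W i c = {word T y |y. y \<in> Y \<and> code (t i) y = c}" for i c
      have finW: "finite (W i c)" for i c
        by (rule finite_subset[OF _ Y(4)[of T]]) (auto simp: W_def words_def)
      have sub: "words Y T \<subseteq> (\<Union>i<n. \<Union>c\<in>C i. W i c)"
      proof
        fix w assume "w \<in> words Y T"
        then obtain y where y: "y \<in> Y" "w = word T y" by (auto simp: words_def)
        then obtain i where "i < n" "y \<in> V i" using n by blast
        then show "w \<in> (\<Union>i<n. \<Union>c\<in>C i. W i c)"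
          using y by (intro UN_I[of i] UN_I[of "code (t i) y"]) (auto simp: V_def W_def)
      qed
      have "card (words Y T) \<le> card (\<Union>i<n. \<Union>c\<in>C i. W i c)"
        using C finW by (intro card_mono[OF _ sub]) auto
      also have "\<dots> \<le> (\<Sum>i<n. \<Sum>c\<in>C i. card (W i c))"
        using C by (intro order_trans[OF card_UN_le] sum_mono card_UN_le) auto
      finally have "real (card (words Y T)) \<le> (\<Sum>i<n. \<Sum>c\<in>C i. real (card (W i c)))"
        by (simp flip: of_nat_sum)
      also have "\<dots> \<le> (\<Sum>i<n. \<Sum>c\<in>C i. A * exp (- (s * t i)) * card (words Y T))"
        unfolding W_def using T by (intro sum_mono mass t(1)) (auto simp: L_def)
      also have "\<dots> \<le> (\<Sum>i<n. 5 ^ d * (A * exp (- (s * t i)) * card (words Y T)))"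
      proof (intro sum_mono)
        fix i
        have "real (card (C i)) \<le> 5 ^ d" using of_nat_mono[OF C(2)[of i], where ?'a = real] by simp
        then show "(\<Sum>c\<in>C i. A * exp (- (s * t i)) * card (words Y T)) \<le> 5 ^ d * (A * exp (- (s * t i)) * card (words Y T))"
          using A by (simp add: mult_right_mono)
      qed
      also have "\<dots> = (B * (\<Sum>i<n. exp (- (s * t i)))) * card (words Y T)"
        by (simp add: B_def sum_distrib_left sum_distrib_right mult_ac)
      finally have "1 * real (card (words Y T)) \<le> (B * (\<Sum>i<n. exp (- (s * t i)))) * card (words Y T)" by simp
      then have "1 \<le> B * (\<Sum>i<n. exp (- (s * t i)))"
        by (rule mult_right_le_imp_le) (use word_count_pos[OF Y(4,2), of T] in simp)
      then have "1 / B \<le> (\<Sum>i<n. exp (- (s * t i)))" using B by (simp add: field_simps)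
      also have "\<dots> \<le> (\<Sum>i<n. r i powr s + e * (1/2) ^ Suc i)" by (intro sum_mono t)
      also have "\<dots> = (\<Sum>i<n. r i powr s) + e * (\<Sum>i<n. (1/2) ^ Suc i)"
        by (simp add: sum.distrib sum_distrib_left)
      also have "(\<Sum>i<n. (1/2::real) ^ Suc i) \<le> 1"
      proof -
        have "(\<Sum>i<n. (1/2::real) ^ Suc i) = 1 - (1/2) ^ n" by (induction n) (auto simp: field_simps)
        then show ?thesis by simp
      qed
      finally have "1 / B \<le> (\<Sum>i<n. r i powr s) + e" using e by (simp add: mult_left_mono)
      then have "ennreal (1 / B) \<le> ennreal ((\<Sum>i<n. r i powr s) + e)" by (rule ennreal_leI)
      also have "\<dots> = (\<Sum>i<n. Rd.diam_power d s (U i)) + ennreal e"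
        using e by (simp add: dp sum_nonneg ennreal_plus)
      also have "\<dots> \<le> (\<Sum>i. Rd.diam_power d s (U i)) + ennreal e"
        by (intro add_right_mono sum_le_suminf) auto
      finally show "ennreal (1 / B) \<le> (\<Sum>i. Rd.diam_power d s (U i)) + ennreal e" .
    qed
  qed
  then have "ennreal (1 / B) \<le> Rd.hausdorff_measure d s (R ` Y)"
    using Rd.hausdorff_premeasure_le_measure[of 1 d s "R ` Y"] by simp
  moreover have "0 < ennreal (1 / B)" using B by simp
  ultimately show ?thesis by (rule order_less_le_trans[rotated])
qed

text \<open>Both directions lose constants only: a covering set meets at most \<open>5 ^ d\<close>
  cubes, and passing from \<open>t\<close> to \<open>t + ln c0\<close> brings the diameter of the
  cubes down to \<open>exp (- t)\<close>.\<close>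

lemma covering_number_bounds:
  assumes Y: "Y \<subseteq> digit_seqs" "\<And>t. 0 \<le> t \<Longrightarrow> finite (code t ` Y)" and t: "0 \<le> t"
  shows "card (code t ` Y) \<le> 5 ^ d * Rd.covering_number d (exp (- t)) (R ` Y)"
    "Rd.covering_number d (exp (- t)) (R ` Y) \<le> card (code (t + ln c0) ` Y)"
proof -
  let ?t = "t + ln c0"
  have t': "0 \<le> ?t" using t c0_ge_1 by simp
  have c: "c0 * exp (- ?t) = exp (- t)" using c0_ge_1 by (simp add: exp_diff exp_minus field_simps exp_add)
  have fin: "finite (cubes ?t Y)" using Y(2)[OF t'] by (simp add: cubes_def)
  note cu = cubes_props[OF Y(1) t', unfolded c]
  have "Rd.covering_number d (exp (- t)) (R ` Y) \<le> card (cubes ?t Y)"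
    using fin cu by (intro Rd.covering_number_le) auto
  also have "\<dots> \<le> card (code ?t ` Y)" unfolding cubes_def using Y(2)[OF t'] by (rule card_image_le)
  finally show "Rd.covering_number d (exp (- t)) (R ` Y) \<le> card (code ?t ` Y)" .
  obtain G where G: "finite G" "card G = Rd.covering_number d (exp (- t)) (R ` Y)" "\<And>U. U \<in> G \<Longrightarrow> U \<subseteq> Rd d"
    "\<And>U. U \<in> G \<Longrightarrow> Rd.ediam d U \<le> ennreal (exp (- t))" "R ` Y \<subseteq> \<Union>G"
    using Rd.covering_number_cover[of "cubes ?t Y" d "exp (- t)" "R ` Y"] fin cu by metis
  have near: "finite (code t ` {y\<in>Y. R y \<in> U}) \<and> card (code t ` {y\<in>Y. R y \<in> U}) \<le> 5 ^ d" if "U \<in> G" for U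
  proof (cases "{y\<in>Y. R y \<in> U} = {}")
    case False
    then obtain x where x: "x \<in> Y" "R x \<in> U" by blast
    then show ?thesis using Y(1) t Rd.ediam_leD[OF G(4)[OF that]]
      by (intro conjI codes_near[of x]) auto
  next
    case True
    show ?thesis unfolding True by simp
  qed
  have "code t ` Y \<subseteq> (\<Union>U\<in>G. code t ` {y\<in>Y. R y \<in> U})" using G(5) by fastforce
  then have "card (code t ` Y) \<le> card (\<Union>U\<in>G. code t ` {y\<in>Y. R y \<in> U})"
    using G(1) near by (intro card_mono) auto
  also have "\<dots> \<le> (\<Sum>U\<in>G. card (code t ` {y\<in>Y. R y \<in> U}))" using G(1) by (rule card_UN_le)
  also have "\<dots> \<le> (\<Sum>U\<in>G. 5 ^ d)" using near by (intro sum_mono) auto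
  finally show "card (code t ` Y) \<le> 5 ^ d * Rd.covering_number d (exp (- t)) (R ` Y)"
    using G(2) by (simp add: mult.commute)
qed

lemma tendsto_neg_ln_at_right_0:
  fixes f :: "real \<Rightarrow> real"
  assumes "(f \<longlongrightarrow> \<beta>) at_top"
  shows "((\<lambda>\<delta>. ereal (f (- ln \<delta>))) \<longlongrightarrow> ereal \<beta>) (at_right 0)"
proof (rule tendsto_ereal)
  have "filterlim (\<lambda>\<delta>. - ln \<delta> :: real) at_top (at_right 0)"
    using ln_at_0 by (simp add: filterlim_uminus_at_top)
  then show "((\<lambda>\<delta>. f (- ln \<delta>)) \<longlongrightarrow> \<beta>) (at_right 0)" by (rule filterlim_compose[OF assms])
qed

lemma tendsto_const_div_at_top: "((\<lambda>t. x / t) \<longlongrightarrow> (0::real)) at_top"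
  by (intro tendsto_divide_0[OF tendsto_const] filterlim_at_top_imp_at_infinity filterlim_ident)

theorem lower_box_dim_ge:
  assumes Y: "Y \<subseteq> digit_seqs" "\<And>t. 0 \<le> t \<Longrightarrow> finite (code t ` Y)"
    and c: "0 < c" "\<And>t. 0 \<le> t \<Longrightarrow> c * exp (t * \<beta>) \<le> card (code t ` Y)"
  shows "ereal \<beta> \<le> Rd.lower_box_dim d (R ` Y)"
proof -
  define cov where "cov \<delta> = real (Rd.covering_number d \<delta> (R ` Y))" for \<delta>
  define c' where "c' = ln (c / 5 ^ d)"
  have low: "c' + t * \<beta> \<le> ln (cov (exp (- t)))" if "0 \<le> t" for t
  proof -
    have "c * exp (t * \<beta>) \<le> 5 ^ d * cov (exp (- t))"
      using c(2)[OF that] of_nat_mono[OF covering_number_bounds(1)[OF Y that], where ?'a = real]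
      by (simp add: cov_def)
    then have *: "c / 5 ^ d * exp (t * \<beta>) \<le> cov (exp (- t))" by (simp add: field_simps)
    moreover have "0 < c / 5 ^ d * exp (t * \<beta>)" using c(1) by simp
    ultimately have "ln (c / 5 ^ d * exp (t * \<beta>)) \<le> ln (cov (exp (- t)))"
      using c(1) by (intro ln_mono) auto
    then show ?thesis using c(1) by (subst (asm) ln_mult) (auto simp: c'_def)
  qed
  have "((\<lambda>t. c' / t + \<beta>) \<longlongrightarrow> 0 + \<beta>) at_top" by (intro tendsto_add tendsto_const_div_at_top tendsto_const)
  then have "((\<lambda>\<delta>. ereal (c' / - ln \<delta> + \<beta>)) \<longlongrightarrow> ereal (0 + \<beta>)) (at_right 0)" by (rule tendsto_neg_ln_at_right_0)
  then have "ereal \<beta> = Liminf (at_right 0) (\<lambda>\<delta>. ereal (c' / - ln \<delta> + \<beta>))"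
    by (intro lim_imp_Liminf[symmetric]) auto
  also have "\<dots> \<le> Liminf (at_right 0) (\<lambda>\<delta>. ereal (ln (cov \<delta>) / - ln \<delta>))"
  proof (rule Liminf_mono)
    have "\<forall>\<^sub>F \<delta> in at_right (0::real). 0 < \<delta> \<and> \<delta> < 1"
      using eventually_at_right_less[of 0] eventually_at_right_field[of "\<lambda>\<delta>. \<delta> < 1" "0::real"]
      by (intro eventually_conj) (auto intro: exI[of _ 1])
    then show "\<forall>\<^sub>F \<delta> in at_right 0. ereal (c' / - ln \<delta> + \<beta>) \<le> ereal (ln (cov \<delta>) / - ln \<delta>)"
    proof eventually_elim
      case (elim \<delta>)
      define t where "t = - ln \<delta>"
      have t: "0 < t" "\<delta> = exp (- t)" using elim by (auto simp: t_def)
      have "(c' + t * \<beta>) / t \<le> ln (cov (exp (- t))) / t" using low[of t] t by (intro divide_right_mono) auto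
      then show ?case using t by (simp add: add_divide_distrib)
    qed
  qed
  finally show ?thesis by (simp add: Rd.lower_box_dim_def cov_def)
qed

theorem upper_box_dim_le:
  assumes Y: "Y \<subseteq> digit_seqs" "\<And>t. 0 \<le> t \<Longrightarrow> finite (code t ` Y)" "Y \<noteq> {}"
    and C: "0 < C" "\<And>t. 0 \<le> t \<Longrightarrow> card (code t ` Y) \<le> C * (t + 1) ^ M * exp (t * \<beta>)"
  shows "Rd.upper_box_dim d (R ` Y) \<le> ereal \<beta>"
proof -
  define cov where "cov \<delta> = real (Rd.covering_number d \<delta> (R ` Y))" for \<delta>
  define b where "b = ln c0"
  have b: "0 \<le> b" using c0_ge_1 by (simp add: b_def)
  define C' where "C' = ln (C * 2 ^ M * exp (b * \<beta>))"
  \<comment> \<open>The lower bound on \<open>t\<close> gives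
    \<open>t + b + 1 \<le> 2 * t\<close>.\<close>
  have up: "ln (cov (exp (- t))) \<le> C' + M * ln t + t * \<beta>" if "b + 1 \<le> t" for t
  proof -
    have t: "0 \<le> t" "0 < t" "0 \<le> t + b" using that b by auto
    have "0 < card (code t ` Y)" using Y(2)[OF t(1)] Y(3) by (simp add: card_gt_0_iff)
    then have pos: "0 < cov (exp (- t))"
      using covering_number_bounds(1)[OF Y(1,2) t(1)] by (cases "cov (exp (- t)) = 0") (auto simp: cov_def)
    have "cov (exp (- t)) \<le> C * (t + b + 1) ^ M * exp ((t + b) * \<beta>)"
      using C(2)[OF t(3)] of_nat_mono[OF covering_number_bounds(2)[OF Y(1,2) t(1)], where ?'a = real]
      by (simp add: cov_def b_def)
    also have "\<dots> \<le> C * (2 * t) ^ M * exp ((t + b) * \<beta>)"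
      using C(1) that t b by (intro mult_right_mono mult_left_mono power_mono) auto
    also have "\<dots> = (C * 2 ^ M * exp (b * \<beta>)) * t ^ M * exp (t * \<beta>)"
      by (simp add: power_mult_distrib ring_distribs exp_add mult_ac)
    finally have "ln (cov (exp (- t))) \<le> ln ((C * 2 ^ M * exp (b * \<beta>)) * t ^ M * exp (t * \<beta>))"
      using pos by (intro ln_mono) auto
    also have "\<dots> = C' + M * ln t + t * \<beta>"
      using C(1) t by (simp add: C'_def ln_mult ln_realpow)
    finally show ?thesis .
  qed
  \<comment> \<open>The polynomial factor enters only through \<open>M * (ln t / t)\<close>, which
    tends to 0.\<close>
  have "((\<lambda>t. C' / t + M * (ln t / t) + \<beta>) \<longlongrightarrow> 0 + real M * 0 + \<beta>) at_top"
    by (intro tendsto_add tendsto_mult tendsto_const_div_at_top tendsto_const ln_x_over_x_tendsto_0)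
  then have "((\<lambda>\<delta>. ereal (C' / - ln \<delta> + M * (ln (- ln \<delta>) / - ln \<delta>) + \<beta>)) \<longlongrightarrow> ereal (0 + real M * 0 + \<beta>)) (at_right 0)"
    by (rule tendsto_neg_ln_at_right_0)
  then have "ereal \<beta> = Limsup (at_right 0) (\<lambda>\<delta>. ereal (C' / - ln \<delta> + M * (ln (- ln \<delta>) / - ln \<delta>) + \<beta>))"
    by (intro lim_imp_Limsup[symmetric]) auto
  moreover have "Limsup (at_right 0) (\<lambda>\<delta>. ereal (ln (cov \<delta>) / - ln \<delta>)) \<le> \<dots>"
  proof (rule Limsup_mono)
    have "\<forall>\<^sub>F \<delta> in at_right (0::real). 0 < \<delta> \<and> \<delta> \<le> exp (- (b + 1))"
      using eventually_at_right_less[of 0] eventually_at_right_field[of "\<lambda>\<delta>. \<delta> \<le> exp (- (b + 1))" "0::real"]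
      by (intro eventually_conj) (auto intro: exI[of _ "exp (- (b + 1))"])
    then show "\<forall>\<^sub>F \<delta> in at_right 0. ereal (ln (cov \<delta>) / - ln \<delta>) \<le> ereal (C' / - ln \<delta> + M * (ln (- ln \<delta>) / - ln \<delta>) + \<beta>)"
    proof eventually_elim
      case (elim \<delta>)
      define t where "t = - ln \<delta>"
      have "ln \<delta> \<le> - (b + 1)" using elim ln_mono[of \<delta> "exp (- (b + 1))"] by simp
      then have t: "b + 1 \<le> t" "\<delta> = exp (- t)" using elim by (auto simp: t_def)
      have "ln (cov (exp (- t))) / t \<le> (C' + M * ln t + t * \<beta>) / t" using up[of t] t b by (intro divide_right_mono) auto
      then show ?case using t b by (simp add: add_divide_distrib)
    qed
  qed
  ultimately show ?thesis by (simp add: Rd.upper_box_dim_def cov_def)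
qed

end

section \<open>Images of irreducible subshifts\<close>

lemma card_image_le_of_kernel:
  assumes "finite (g ` S)" "\<And>x y. \<lbrakk>x \<in> S; y \<in> S; g x = g y\<rbrakk> \<Longrightarrow> f x = f y"
  shows "finite (f ` S)" "card (f ` S) \<le> card (g ` S)"
proof -
  define k where "k z = f (SOME x. x \<in> S \<and> g x = z)" for z
  have "f x = k (g x)" if x: "x \<in> S" for x
  proof -
    let ?y = "SOME y. y \<in> S \<and> g y = g x"
    have "?y \<in> S \<and> g ?y = g x" by (rule someI[of _ x]) (use x in simp)
    then show ?thesis unfolding k_def using x by (intro assms(2)) auto
  qed
  then have eq: "f ` S = k ` g ` S" by (auto simp: image_image)
  show "finite (f ` S)" "card (f ` S) \<le> card (g ` S)"
    unfolding eq using assms(1) by (auto intro: card_image_le)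
qed

text \<open>The entry of \<open>blocks h n 0 m\<close> with index \<open>i\<close>, addressed
  without recursion, so that the blocks can be counted independently.\<close>

definition segment :: "(nat \<Rightarrow> 'v \<Rightarrow> 'b) \<Rightarrow> (nat \<Rightarrow> nat) \<Rightarrow> nat \<Rightarrow> (nat \<Rightarrow> 'v) \<Rightarrow> 'b list" where
  "segment h n i y = word (n i) (\<lambda>k. h i (y ((\<Sum>i'<i. n i') + k)))"

lemma card_blocks_le_prod:
  assumes "\<And>i. i < m \<Longrightarrow> finite (segment h n i ` S)"
  shows "finite (blocks h n 0 m ` S)" "card (blocks h n 0 m ` S) \<le> (\<Prod>i<m. card (segment h n i ` S))"
proof -
  let ?F = "\<lambda>y. \<lambda>i\<in>{..<m}. segment h n i y"
  have sub: "?F ` S \<subseteq> (\<Pi>\<^sub>E i\<in>{..<m}. segment h n i ` S)"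
    by (intro image_subsetI) (simp add: restrict_PiE_iff)
  have fin: "finite (\<Pi>\<^sub>E i\<in>{..<m}. segment h n i ` S)" using assms by (intro finite_PiE) auto
  then have finF: "finite (?F ` S)" using sub finite_subset by blast
  have ker: "blocks h n 0 m x = blocks h n 0 m y" if eq: "?F x = ?F y" for x y
  proof -
    have "segment h n i x = segment h n i y" if "i < m" for i using fun_cong[OF eq, of i] that by simp
    then show ?thesis by (simp add: blocks_eq_iff segment_def word_eq_iff)
  qed
  show "finite (blocks h n 0 m ` S)" by (rule card_image_le_of_kernel(1)[OF finF ker])
  have "card (blocks h n 0 m ` S) \<le> card (?F ` S)" by (rule card_image_le_of_kernel(2)[OF finF ker])
  also have "\<dots> \<le> card (\<Pi>\<^sub>E i\<in>{..<m}. segment h n i ` S)" by (rule card_mono[OF fin sub])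
  also have "\<dots> = (\<Prod>i<m. card (segment h n i ` S))" by (simp add: card_PiE)
  finally show "card (blocks h n 0 m ` S) \<le> (\<Prod>i<m. card (segment h n i ` S))" .
qed

lemma sqrt_prod_lessThan: "sqrt (\<Prod>i<q. f i) = (\<Prod>i<(q::nat). sqrt (f i))"
  by (induction q) (auto simp: real_sqrt_mult)

definition block_prod :: "('a list \<Rightarrow> real) \<Rightarrow> nat \<Rightarrow> nat \<Rightarrow> 'a list \<Rightarrow> real" where
  "block_prod g N q w = (\<Prod>i<q. g (take N (drop (i * N) w)))"

lemma block_prod_Suc: "block_prod g N (Suc q) w = g (take N w) * block_prod g N q (drop N w)"
  unfolding block_prod_def by (subst prod.lessThan_Suc_shift) (simp add: add.commute)

context glue_shift
begin

text \<open>A word is determined by its blocks and the remainder, so the sum is at most the one over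
  independent choices of blocks: submultiplicativity with weights.\<close>

lemma sum_block_prod_le:
  assumes "\<And>u. 0 \<le> g u"
  shows "(\<Sum>w\<in>words Y (q * N + r). block_prod g N q w) \<le> (\<Sum>u\<in>words Y N. g u) ^ q * word_count Y r"
proof (induction q)
  case 0
  then show ?case by (simp add: block_prod_def word_count_def)
next
  case (Suc q)
  let ?n = "Suc q * N + r" and ?n' = "q * N + r"
  have nonneg: "0 \<le> block_prod g N q w" for w unfolding block_prod_def by (intro prod_nonneg) (use assms in auto)
  let ?f = "\<lambda>w. (take N w, drop N w)"
  have inj: "inj_on ?f (words Y ?n)" by (auto simp: inj_on_def) (metis append_take_drop_id)
  have sub: "?f ` words Y ?n \<subseteq> words Y N \<times> words Y ?n'"
  proof (rule image_subsetI)
    fix w assume "w \<in> words Y ?n"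
    then have "take N w \<in> words Y N" "drop N w \<in> words Y ?n'"
      using take_words[of w ?n N] drop_words[of w ?n N] by (simp_all add: add.assoc)
    then show "?f w \<in> words Y N \<times> words Y ?n'" by simp
  qed
  have "(\<Sum>w\<in>words Y ?n. block_prod g N (Suc q) w) = (\<Sum>x\<in>?f ` words Y ?n. g (fst x) * block_prod g N q (snd x))"
    by (subst sum.reindex[OF inj]) (simp add: block_prod_Suc)
  also have "\<dots> \<le> (\<Sum>x\<in>words Y N \<times> words Y ?n'. g (fst x) * block_prod g N q (snd x))"
    using sub assms nonneg by (intro sum_mono2) (auto simp: finite_words)
  also have "\<dots> = (\<Sum>u\<in>words Y N. g u) * (\<Sum>w\<in>words Y ?n'. block_prod g N q w)"
    by (simp add: sum_product sum.cartesian_product case_prod_unfold)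
  also have "\<dots> \<le> (\<Sum>u\<in>words Y N. g u) * ((\<Sum>u\<in>words Y N. g u) ^ q * word_count Y r)"
    using Suc.IH assms by (intro mult_left_mono sum_nonneg) auto
  finally show ?case by (simp add: mult_ac)
qed

lemma card_lifts_pos: "v \<in> words (factor f Y) n \<Longrightarrow> 1 \<le> card (lifts f Y v)"
proof -
  assume "v \<in> words (factor f Y) n"
  then obtain u where "u \<in> words Y n" "v = map f u" by (auto simp: words_image)
  then have "u \<in> lifts f Y v" by (auto simp: lifts_def dest: words_length)
  then show ?thesis by (auto simp: Suc_le_eq card_gt_0_iff)
qed

text \<open>
  A word is put into \<open>G\<close> when the product of the normalised numbers of lifts of its blocks is at
  least 1: both bounds are then Chernoff estimates with exponent one half.
\<close>

lemma factor_words_split: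
  fixes f :: "'a \<Rightarrow> 'b"
  defines "B \<equiv> factor f Y"
  assumes unb: "\<And>C. \<exists>n. \<exists>v\<in>words B n. C < card (lifts f Y v) * (growth B / growth Y) ^ n"
  shows "\<exists>\<eta>>0. \<exists>K. 1 \<le> K \<and> (\<forall>n. \<exists>G. card (words B n \<inter> G) \<le> K * exp (- \<eta> * n) * growth B ^ n \<and>
     card {u\<in>words Y n. map f u \<notin> G} \<le> K * exp (- \<eta> * n) * growth Y ^ n)"
proof -
  interpret B: glue_shift B D unfolding B_def by (rule glue_shift_image)
  let ?rA = "growth Y" and ?rB = "growth B"
  let ?Z = "\<lambda>v. real (card (lifts f Y v))"
  obtain KA where KA: "1 \<le> KA" "\<And>n. word_count Y n \<le> KA * ?rA ^ n" by (metis growth_props)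
  obtain KB where KB: "1 \<le> KB" "\<And>n. word_count B n \<le> KB * ?rB ^ n" by (metis B.growth_props)
  have rA: "1 \<le> ?rA" and rB: "1 \<le> ?rB" using growth_ge_1 B.growth_ge_1 by auto
  obtain N where N: "(\<Sum>v\<in>words B N. sqrt (?Z v)) < sqrt (?rA * ?rB) ^ N"
    using affinity_lt[of f] unb unfolding B_def by blast
  define Q where "Q = (\<Sum>v\<in>words B N. sqrt (?Z v))"
  have Z1: "1 \<le> ?Z v" if "v \<in> words B n" for v n using card_lifts_pos[of v f n] that by (simp add: B_def)
  have Q1: "1 \<le> Q"
  proof -
    have "1 \<le> word_count B N" by (rule B.word_count_ge_1)
    also have "\<dots> = (\<Sum>v\<in>words B N. 1)" by (simp add: word_count_def)
    also have "\<dots> \<le> Q" unfolding Q_def using Z1 by (intro sum_mono) auto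
    finally show ?thesis .
  qed
  have N0: "0 < N" using N Q1 by (cases N) (auto simp: Q_def)
  \<comment> \<open>The affinity of the two uniform measures on blocks of length \<open>N\<close>,
    normalised by the growth rates. Being below 1, it gains a fixed factor in every block.\<close>
  define \<theta> where "\<theta> = Q / sqrt (?rA * ?rB) ^ N"
  have G0: "0 < sqrt (?rA * ?rB) ^ N" using rA rB by simp
  have \<theta>: "0 < \<theta>" "\<theta> < 1" using N Q1 G0 by (auto simp: \<theta>_def Q_def)
  have sq: "sqrt (?rA * ?rB) = sqrt ?rA * sqrt ?rB" by (rule real_sqrt_mult)
  have \<theta>Q: "\<theta> * (sqrt ?rA * sqrt ?rB) ^ N = Q" using G0 unfolding sq[symmetric]
    by (metis \<theta>_def less_irrefl nonzero_divide_eq_eq)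
  \<comment> \<open>The normalisation that turns the number of lifts of a block into the likelihood
    ratio of the two measures, up to constants.\<close>
  define w where "w = (?rB / ?rA) ^ N"
  have w: "0 < w" using rA rB by (simp add: w_def)
  have sw: "sqrt w = (sqrt ?rB / sqrt ?rA) ^ N" by (simp add: w_def real_sqrt_power real_sqrt_divide)
  have rr: "sqrt ?rB * sqrt ?rB = ?rB" "sqrt ?rA * sqrt ?rA = ?rA" using rA rB by auto
  have QB: "Q * sqrt w = \<theta> * ?rB ^ N"
  proof -
    have "Q * sqrt w = \<theta> * (sqrt ?rA * sqrt ?rB * (sqrt ?rB / sqrt ?rA)) ^ N"
      by (simp only: \<theta>Q[symmetric] sw power_mult_distrib[of "sqrt ?rA * sqrt ?rB" "sqrt ?rB / sqrt ?rA"] mult.assoc[of \<theta>])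
    also have "sqrt ?rA * sqrt ?rB * (sqrt ?rB / sqrt ?rA) = ?rB" using rA rr by simp
    finally show ?thesis .
  qed
  have QA: "Q / sqrt w = \<theta> * ?rA ^ N"
  proof -
    have "Q / sqrt w = \<theta> * (sqrt ?rA * sqrt ?rB / (sqrt ?rB / sqrt ?rA)) ^ N"
      by (simp only: \<theta>Q[symmetric] sw power_divide[of "sqrt ?rA * sqrt ?rB" "sqrt ?rB / sqrt ?rA"] times_divide_eq_right)
    also have "sqrt ?rA * sqrt ?rB / (sqrt ?rB / sqrt ?rA) = ?rA" using rB rr by simp
    finally show ?thesis .
  qed
  define \<eta> where "\<eta> = - ln \<theta> / N"
  have \<eta>: "0 < \<eta>" using \<theta> N0 by (simp add: \<eta>_def divide_neg_pos)
  define K where "K = KA * KB / \<theta>"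
  have KAB: "KA \<le> KA * KB" "KB \<le> KA * KB" using KA(1) KB(1) mult_mono[of KA KA 1 KB] mult_mono[of 1 KA KB KB] by auto
  have K: "1 \<le> K" "KA / \<theta> \<le> K" "KB / \<theta> \<le> K"
  proof -
    show "KA / \<theta> \<le> K" "KB / \<theta> \<le> K" unfolding K_def using KAB \<theta> by (auto intro!: divide_right_mono)
    have "1 \<le> KA / \<theta>" using KA(1) \<theta> by (simp add: field_simps)
    then show "1 \<le> K" using \<open>KA / \<theta> \<le> K\<close> by linarith
  qed
  \<comment> \<open>The incomplete last block costs at most one factor
    \<open>\<theta>\<close>.\<close>
  have \<theta>n: "\<theta> ^ (n div N) \<le> exp (- \<eta> * n) / \<theta>" for n
  proof -
    have "real n / N \<le> real (n div N) + 1"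
    proof -
      have "n < N * (n div N + 1)" using N0 dividend_less_times_div[of N n] by simp
      then have "real n \<le> real (N * (n div N + 1))" by (simp only: of_nat_le_iff less_imp_le)
      then show ?thesis using N0 by (simp add: field_simps)
    qed
    then have "ln \<theta> * (real (n div N) + 1) \<le> ln \<theta> * (real n / N)" using \<theta> by (intro mult_left_mono_neg) auto
    then have "exp (ln \<theta> * (real (n div N) + 1)) \<le> exp (- \<eta> * n)" by (simp add: \<eta>_def)
    moreover have "exp (ln \<theta> * (real (n div N) + 1)) = \<theta> ^ (n div N) * \<theta>"
      using \<theta> by (simp add: ring_distribs exp_add exp_of_nat2_mult)
    ultimately have "\<theta> ^ (n div N) * \<theta> \<le> exp (- \<eta> * n)" by linarith
    then show ?thesis using \<theta> by (simp only: pos_le_divide_eq)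
  qed
  show ?thesis
  proof (rule exI[of _ \<eta>], rule conjI[OF \<eta>], rule exI[of _ K], rule conjI[OF K(1)], rule allI)
    fix n
    define q where "q = n div N"
    define r where "r = n mod N"
    have n: "n = q * N + r" by (simp add: q_def r_def)
    define \<pi> where "\<pi> = block_prod (\<lambda>u. ?Z u * w) N q"
    define G where "G = {v. 1 \<le> \<pi> v}"
    have \<pi>0: "0 \<le> \<pi> v" for v unfolding \<pi>_def block_prod_def using w by (intro prod_nonneg) auto
    \<comment> \<open>On \<open>G\<close> the constant 1 is at most \<open>sqrt (\<pi> v)\<close>,
      off \<open>G\<close> it is at most the reciprocal; both functions are products over
      blocks.\<close>
    have "real (card (words B n \<inter> G)) = (\<Sum>v\<in>words B n \<inter> G. 1)" by simp
    also have "\<dots> \<le> (\<Sum>v\<in>words B n \<inter> G. sqrt (\<pi> v))" by (intro sum_mono) (auto simp: G_def)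
    also have "\<dots> \<le> (\<Sum>v\<in>words B n. sqrt (\<pi> v))"
      using \<pi>0 by (intro sum_mono2) (auto simp: B.finite_words)
    also have "\<dots> = (\<Sum>v\<in>words B n. block_prod (\<lambda>u. sqrt (?Z u * w)) N q v)"
      by (simp add: \<pi>_def block_prod_def sqrt_prod_lessThan)
    also have "\<dots> \<le> (\<Sum>u\<in>words B N. sqrt (?Z u * w)) ^ q * word_count B r"
      unfolding n using w by (intro B.sum_block_prod_le) auto
    also have "(\<Sum>u\<in>words B N. sqrt (?Z u * w)) = \<theta> * ?rB ^ N"
      by (simp add: real_sqrt_mult QB[symmetric] Q_def sum_distrib_right)
    also have "(\<theta> * ?rB ^ N) ^ q * word_count B r \<le> (\<theta> * ?rB ^ N) ^ q * (KB * ?rB ^ r)"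
      using \<theta> rB by (intro mult_left_mono KB) auto
    also have "\<dots> = KB * \<theta> ^ (n div N) * ?rB ^ n"
      by (simp add: n[symmetric] q_def[symmetric] power_mult_distrib power_mult[symmetric] mult.commute[of N q])
        (simp add: n power_add)
    also have "\<dots> \<le> KB * (exp (- \<eta> * n) / \<theta>) * ?rB ^ n"
      using KB rB by (intro mult_right_mono mult_left_mono \<theta>n) auto
    also have "\<dots> = (KB / \<theta>) * exp (- \<eta> * n) * ?rB ^ n" by simp
    also have "\<dots> \<le> K * exp (- \<eta> * n) * ?rB ^ n" using rB by (intro mult_right_mono K) auto
    finally have 1: "card (words B n \<inter> G) \<le> K * exp (- \<eta> * n) * ?rB ^ n" .
    have blk: "take N (drop (i * N) (map f u)) \<in> words B N" if "u \<in> words Y n" "i < q" for u i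
    proof -
      have "Suc i * N \<le> q * N" using that(2) by (intro mult_le_mono1) auto
      then have "i * N + N \<le> n" by (simp add: n)
      then have "take N (drop (i * N) u) \<in> words Y N" using that(1) take_drop_words by blast
      then show ?thesis by (auto simp: B_def words_image drop_map take_map)
    qed
    let ?H = "{u\<in>words Y n. map f u \<notin> G}"
    have "real (card ?H) = (\<Sum>u\<in>?H. 1)" by simp
    also have "\<dots> \<le> (\<Sum>u\<in>?H. 1 / sqrt (\<pi> (map f u)))"
    proof (intro sum_mono)
      fix u assume u: "u \<in> ?H"
      have "0 < \<pi> (map f u)" unfolding \<pi>_def block_prod_def
      proof (intro prod_pos)
        fix i assume "i \<in> {..<q}"
        then have "1 \<le> ?Z (take N (drop (i * N) (map f u)))" using Z1[OF blk[of u i]] u by simp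
        then have "0 < ?Z (take N (drop (i * N) (map f u)))" by linarith
        then show "0 < ?Z (take N (drop (i * N) (map f u))) * w" using w by (intro mult_pos_pos)
      qed
      moreover have "\<pi> (map f u) < 1" using u by (simp add: G_def)
      ultimately show "1 \<le> 1 / sqrt (\<pi> (map f u))" by simp
    qed
    also have "\<dots> \<le> (\<Sum>u\<in>words Y n. 1 / sqrt (\<pi> (map f u)))"
      using \<pi>0 by (intro sum_mono2) (auto simp: finite_words)
    also have "\<dots> = (\<Sum>u\<in>words Y n. block_prod (\<lambda>x. 1 / sqrt (?Z (map f x) * w)) N q u)"
      by (simp add: \<pi>_def block_prod_def sqrt_prod_lessThan prod_dividef drop_map take_map)
    also have "\<dots> \<le> (\<Sum>x\<in>words Y N. 1 / sqrt (?Z (map f x) * w)) ^ q * word_count Y r"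
      unfolding n using w by (intro sum_block_prod_le) auto
    \<comment> \<open>Grouping by the image: \<open>v\<close> has as many preimages as lifts, which
      turns the reciprocal square roots into the same affinity \<open>Q\<close>.\<close>
    also have "(\<Sum>x\<in>words Y N. 1 / sqrt (?Z (map f x) * w)) = Q / sqrt w"
    proof -
      have "(\<Sum>x\<in>words Y N. 1 / sqrt (?Z (map f x) * w)) = (\<Sum>v\<in>map f ` words Y N. \<Sum>x\<in>{x\<in>words Y N. map f x = v}. 1 / sqrt (?Z (map f x) * w))"
        by (rule sum.image_gen) (rule finite_words)
      also have "\<dots> = (\<Sum>v\<in>words B N. sqrt (?Z v) / sqrt w)"
        unfolding B_def words_image
      proof (intro sum.cong refl)
        fix v assume "v \<in> map f ` words Y N"
        then have "length v = N" by (auto dest: words_length)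
        then have "{x\<in>words Y N. map f x = v} = lifts f Y v" by (simp add: lifts_def)
        then have "(\<Sum>x\<in>{x\<in>words Y N. map f x = v}. 1 / sqrt (?Z (map f x) * w)) = ?Z v * (1 / sqrt (?Z v * w))"
          by (simp add: lifts_def)
        also have "\<dots> = sqrt (?Z v) / sqrt w"
          by (simp add: real_sqrt_mult real_div_sqrt flip: divide_divide_eq_left)
        finally show "(\<Sum>x\<in>{x\<in>words Y N. map f x = v}. 1 / sqrt (?Z (map f x) * w)) = sqrt (?Z v) / sqrt w" .
      qed
      finally show ?thesis by (simp add: Q_def sum_divide_distrib)
    qed
    also have "(Q / sqrt w) ^ q * word_count Y r \<le> (\<theta> * ?rA ^ N) ^ q * (KA * ?rA ^ r)"
      unfolding QA using \<theta> rA by (intro mult_left_mono KA) auto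
    also have "\<dots> = KA * \<theta> ^ (n div N) * ?rA ^ n"
      by (simp add: n[symmetric] q_def[symmetric] power_mult_distrib power_mult[symmetric] mult.commute[of N q])
        (simp add: n power_add)
    also have "\<dots> \<le> KA * (exp (- \<eta> * n) / \<theta>) * ?rA ^ n"
      using KA rA by (intro mult_right_mono mult_left_mono \<theta>n) auto
    also have "\<dots> = (KA / \<theta>) * exp (- \<eta> * n) * ?rA ^ n" by simp
    also have "\<dots> \<le> K * exp (- \<eta> * n) * ?rA ^ n" using rA by (intro mult_right_mono K) auto
    finally have 2: "card ?H \<le> K * exp (- \<eta> * n) * ?rA ^ n" .
    show "\<exists>G. card (words B n \<inter> G) \<le> K * exp (- \<eta> * n) * ?rB ^ n \<and> card {u\<in>words Y n. map f u \<notin> G} \<le> K * exp (- \<eta> * n) * ?rA ^ n"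
      using 1 2 by blast
  qed
qed

text \<open>The letters of the first block form a lift of the first entry of \<open>c\<close>, and
  the sequence behind it has the remaining entries as its code. Letters beyond the last block are
  free.\<close>

lemma card_words_with_blocks_le:
  fixes b :: "nat \<Rightarrow> real"
  assumes "\<And>i v. \<lbrakk>j \<le> i; i < j + m; v \<in> words (factor (h i) Y) (n i)\<rbrakk> \<Longrightarrow> card (lifts (h i) Y v) \<le> b i"
    and "\<And>i. 0 \<le> b i" "(\<Sum>i<m. n (j + i)) \<le> T"
  shows "card {word T y |y. y \<in> Y \<and> blocks h n j m y = c} \<le> (\<Prod>i<m. b (j + i)) * word_count Y (T - (\<Sum>i<m. n (j + i)))"
  using assms(1,3)
proof (induction m arbitrary: j T c)
  case 0
  have "card {word T y |y. y \<in> Y \<and> blocks h n j 0 y = c} \<le> card (words Y T)"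
    by (intro card_mono finite_words) (auto simp: words_def)
  then show ?case by (simp add: word_count_def)
next
  case (Suc m)
  let ?S = "{word T y |y. y \<in> Y \<and> blocks h n j (Suc m) y = c}"
  have sumS: "(\<Sum>i<Suc m. n (j + i)) = n j + (\<Sum>i<m. n (Suc j + i))" by (subst sum.lessThan_Suc_shift) simp
  have nT: "n j \<le> T" "(\<Sum>i<m. n (Suc j + i)) \<le> T - n j" using Suc.prems(2) unfolding sumS by auto
  have rhs0: "0 \<le> (\<Prod>i<Suc m. b (j + i)) * word_count Y (T - (\<Sum>i<Suc m. n (j + i)))"
    using assms(2) by (intro mult_nonneg_nonneg prod_nonneg) (auto simp: word_count_def)
  show ?case
  proof (cases "?S = {}")
    case True
    show ?thesis using rhs0 by (simp only: True card.empty of_nat_0)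
  next
    case False
    then obtain y0 where y0: "y0 \<in> Y" "blocks h n j (Suc m) y0 = c" by blast
    define v where "v = word (n j) (h j \<circ> y0)"
    define c' where "c' = blocks h n (Suc j) m (\<lambda>k. y0 (n j + k))"
    let ?S' = "{word (T - n j) y |y. y \<in> Y \<and> blocks h n (Suc j) m y = c'}"
    have v: "v \<in> words (factor (h j) Y) (n j)" using y0 by (auto simp: v_def words_def)
    have finS': "finite ?S'" by (rule finite_subset[OF _ finite_words[of "T - n j"]]) (auto simp: words_def)
    have "card ?S \<le> card (lifts (h j) Y v) * card ?S'"
    proof (rule card_append_le[of _ _ _ "n j"])
      fix x assume "x \<in> ?S"
      then obtain y where y: "y \<in> Y" "x = word T y" "word (n j) (h j \<circ> y) = v"
        "blocks h n (Suc j) m (\<lambda>k. y (n j + k)) = c'"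
        using y0(2) by (auto simp: v_def c'_def)
      have "take (n j) x \<in> lifts (h j) Y v"
        using y nT by (auto simp: lifts_def take_word v_def words_def map_word)
      moreover have "drop (n j) x \<in> ?S'"
        using y shift_add_closed[OF y(1), of "n j"] by (auto simp: drop_word)
      ultimately show "take (n j) x \<in> lifts (h j) Y v \<and> drop (n j) x \<in> ?S'" ..
    qed (use finS' in auto)
    then have "real (card ?S) \<le> real (card (lifts (h j) Y v)) * card ?S'"
      unfolding of_nat_mult[symmetric] of_nat_le_iff .
    also have "\<dots> \<le> b j * ((\<Prod>i<m. b (Suc j + i)) * word_count Y (T - n j - (\<Sum>i<m. n (Suc j + i))))"
    proof (intro mult_mono)
      show "card (lifts (h j) Y v) \<le> b j" by (rule Suc.prems(1)[OF _ _ v]) auto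
      show "card ?S' \<le> (\<Prod>i<m. b (Suc j + i)) * word_count Y (T - n j - (\<Sum>i<m. n (Suc j + i)))"
        using nT Suc.prems(1) by (intro Suc.IH) auto
    qed (use assms(2) in auto)
    also have "\<dots> = (\<Prod>i<Suc m. b (j + i)) * word_count Y (T - (\<Sum>i<Suc m. n (j + i)))"
      unfolding sumS by (subst prod.lessThan_Suc_shift) simp
    finally show ?thesis .
  qed
qed

end

section \<open>A single component and its image at the critical exponent\<close>

locale sponge_shift = sponge d m + glue_shift Y gap
  for d m and Y :: "(nat \<Rightarrow> nat \<Rightarrow> int) set" and gap +
  assumes digit_seqs: "Y \<subseteq> digit_seqs" and compact: "prefix_compact Y"
begin

abbreviation B :: "nat \<Rightarrow> (nat \<Rightarrow> nat \<Rightarrow> int) set" where "B j \<equiv> factor (pr j) Y"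

text \<open>The value of the chain that stays in one component for all blocks, expressed without a
  graph.\<close>

definition dimY :: real where "dimY = (\<Sum>j<d. \<alpha> j * ln (growth (B j)))"

lemma glue_B: "glue_shift (B j) gap"
  by (rule glue_shift_image)

lemma pr_0:
  assumes "y \<in> Y"
  shows "pr 0 \<circ> y = y"
proof
  fix k
  have "y \<in> digit_seqs" using assms digit_seqs by blast
  then have "y k \<in> D" by (simp add: digit_seqs_def)
  then have "y k \<in> extensional {..<d}" unfolding digits_def by (rule PiE_iff[THEN iffD1, THEN conjunct2])
  then show "(pr 0 \<circ> y) k = y k" by (simp add: pr_def extensional_restrict lessThan_atLeast0[symmetric])
qed

lemma B0: "B 0 = Y"
  using pr_0 by simp

lemma uniform_K:
  "\<exists>K\<ge>1. \<forall>j n. j < d \<longrightarrow> word_count (B j) n \<le> K * growth (B j) ^ n"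
proof -
  have "\<forall>j. \<exists>K\<ge>1. \<forall>n. word_count (B j) n \<le> K * growth (B j) ^ n"
    using glue_shift.growth_props[OF glue_B] by metis
  then obtain Kf where Kf: "\<And>j. Kf j \<ge> (1::real)" "\<And>j n. word_count (B j) n \<le> Kf j * growth (B j) ^ n" by metis
  define K where "K = (\<Sum>j<d. Kf j) + 1"
  have "Kf j \<le> K" if "j < d" for j
  proof -
    have "Kf j \<le> (\<Sum>j<d. Kf j)" using that Kf(1) by (intro member_le_sum) (auto intro: order_trans[OF zero_le_one])
    then show ?thesis by (simp add: K_def)
  qed
  moreover have "1 \<le> growth (B j)" for j using glue_shift.growth_ge_1[OF glue_B] .
  ultimately have "word_count (B j) n \<le> K * growth (B j) ^ n" if "j < d" for j n
    using Kf(2)[of j n] that by (meson mult_right_mono order_trans zero_le_one zero_le_power)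
  moreover have "1 \<le> K" using Kf(1) by (auto simp: K_def intro!: sum_nonneg intro: order_trans[OF zero_le_one])
  ultimately show ?thesis by blast
qed

lemma growth_B_ge_1: "1 \<le> growth (B j)"
  using glue_shift.growth_ge_1[OF glue_B] .

lemma growth_power_seg:
  assumes "0 \<le> t"
  shows "growth (B j) ^ seg t j \<le> growth (B j) * exp (t * (\<alpha> j * ln (growth (B j))))"
    "1 / growth (B j) ^ seg t j \<le> growth (B j) * exp (- (t * (\<alpha> j * ln (growth (B j)))))"
proof -
  let ?r = "growth (B j)"
  have r: "1 \<le> ?r" by (rule growth_B_ge_1)
  have e: "?r ^ seg t j = exp (real (seg t j) * ln ?r)" using r by (simp add: exp_of_nat_mult)
  have "real (seg t j) * ln ?r \<le> (\<alpha> j * t + 1) * ln ?r"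
    using seg_bounds[OF assms, of j] r by (intro mult_right_mono) auto
  then have "exp (real (seg t j) * ln ?r) \<le> exp ((\<alpha> j * t + 1) * ln ?r)" by simp
  also have "\<dots> = ?r * exp (t * (\<alpha> j * ln ?r))" using r by (simp add: ring_distribs exp_add mult_ac)
  finally show "?r ^ seg t j \<le> ?r * exp (t * (\<alpha> j * ln ?r))" by (simp add: e)
  have "(\<alpha> j * t - 1) * ln ?r \<le> real (seg t j) * ln ?r"
    using seg_bounds[OF assms, of j] r by (intro mult_right_mono) auto
  then have "exp (- (real (seg t j) * ln ?r)) \<le> exp (- ((\<alpha> j * t - 1) * ln ?r))" by simp
  also have "\<dots> = ?r * exp (- (t * (\<alpha> j * ln ?r)))"
    using r by (simp add: ring_distribs exp_add exp_diff exp_minus field_simps)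
  finally show "1 / ?r ^ seg t j \<le> ?r * exp (- (t * (\<alpha> j * ln ?r)))"
    by (simp add: e exp_minus inverse_eq_divide)
qed

lemma segment_in_words:
  assumes "y \<in> Y"
  shows "segment pr (seg t) i y \<in> words (B i) (seg t i)"
  unfolding segment_def words_image words_def
  using shift_add_closed[OF assms, of "\<Sum>i'<i. seg t i'"]
  by (auto simp: map_word comp_def image_iff intro!: bexI[of _ "\<lambda>k. y ((\<Sum>i'<i. seg t i') + k)"])

lemma dimY_exp: "exp (t * dimY) = (\<Prod>i<d. exp (t * (\<alpha> i * ln (growth (B i)))))"
  by (simp add: dimY_def sum_distrib_left exp_sum)

text \<open>Blocks are counted independently, so if the segments at one place \<open>j\<close> are
  rarer by a factor \<open>\<epsilon>\<close>, so are the codes. Taking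
  \<open>\<epsilon> = 1\<close> gives the plain count.\<close>

lemma code_count_improved:
  assumes K: "1 \<le> K" "\<And>j n. j < d \<Longrightarrow> word_count (B j) n \<le> K * growth (B j) ^ n"
    and S: "S \<subseteq> Y" and t: "0 \<le> t" and j: "j < d"
    and \<epsilon>: "0 \<le> \<epsilon>" "card (segment pr (seg t) j ` S) \<le> \<epsilon> * (K * growth (B j) ^ seg t j)"
  shows "finite (code t ` S)" "card (code t ` S) \<le> \<epsilon> * (\<Prod>i<d. K * growth (B i)) * exp (t * dimY)"
proof -
  have sub: "segment pr (seg t) i ` S \<subseteq> words (B i) (seg t i)" for i
    using S segment_in_words by blast
  have finw: "finite (words (B i) n)" for i n using glue_shift.finite_words[OF glue_B] .
  have fin: "finite (segment pr (seg t) i ` S)" for i using sub finw finite_subset by blast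
  show "finite (code t ` S)"
    unfolding code_def by (rule card_blocks_le_prod(1)) (use fin in auto)
  have c: "card (segment pr (seg t) i ` S) \<le> K * growth (B i) ^ seg t i" if "i < d" for i
  proof -
    have "card (segment pr (seg t) i ` S) \<le> card (words (B i) (seg t i))" by (intro card_mono sub finw)
    then show ?thesis using K(2)[OF that, of "seg t i"] by (simp add: word_count_def)
  qed
  let ?e = "\<lambda>i. if i = j then \<epsilon> else 1"
  have "card (code t ` S) \<le> (\<Prod>i<d. card (segment pr (seg t) i ` S))"
    unfolding code_def by (rule card_blocks_le_prod(2)) (use fin in auto)
  then have "real (card (code t ` S)) \<le> (\<Prod>i<d. real (card (segment pr (seg t) i ` S)))"
    by (simp flip: of_nat_prod)
  also have "\<dots> \<le> (\<Prod>i<d. ?e i * ((K * growth (B i)) * exp (t * (\<alpha> i * ln (growth (B i))))))"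
  proof (intro prod_mono conjI)
    fix i assume i: "i \<in> {..<d}"
    have 1: "K * growth (B i) ^ seg t i \<le> (K * growth (B i)) * exp (t * (\<alpha> i * ln (growth (B i))))"
      using growth_power_seg(1)[OF t, of i] K(1) by (simp add: mult.assoc mult_left_mono)
    have 2: "card (segment pr (seg t) i ` S) \<le> ?e i * (K * growth (B i) ^ seg t i)"
      using \<epsilon> c i by auto
    have 3: "0 \<le> ?e i" using \<epsilon>(1) by simp
    show "card (segment pr (seg t) i ` S) \<le> ?e i * ((K * growth (B i)) * exp (t * (\<alpha> i * ln (growth (B i)))))"
      by (rule order_trans[OF 2 mult_left_mono[OF 1 3]])
  qed auto
  also have "\<dots> = (\<Prod>i<d. ?e i) * ((\<Prod>i<d. K * growth (B i)) * exp (t * dimY))"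
    by (simp add: prod.distrib dimY_exp)
  also have "(\<Prod>i<d. ?e i) = \<epsilon>"
    using j by (subst prod.delta) auto
  finally show "card (code t ` S) \<le> \<epsilon> * (\<Prod>i<d. K * growth (B i)) * exp (t * dimY)"
    by (simp only: mult.assoc)
qed

lemma dimY_nonneg: "0 \<le> dimY"
  unfolding dimY_def using \<alpha>_nonneg growth_B_ge_1 by (intro sum_nonneg mult_nonneg_nonneg ln_ge_zero) auto

lemma code_count:
  "\<exists>C. \<forall>t\<ge>0. finite (code t ` Y) \<and> card (code t ` Y) \<le> C * exp (t * dimY)"
proof -
  obtain K :: real where K: "1 \<le> K" "\<And>j n. j < d \<Longrightarrow> word_count (B j) n \<le> K * growth (B j) ^ n" using uniform_K by blast
  have c: "card (segment pr (seg t) 0 ` Y) \<le> 1 * (K * growth (B 0) ^ seg t 0)" for t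
  proof -
    have "card (segment pr (seg t) 0 ` Y) \<le> card (words (B 0) (seg t 0))"
      using segment_in_words by (intro card_mono glue_shift.finite_words[OF glue_B]) blast
    then show ?thesis using K(2)[OF d_pos, of "seg t 0"] by (simp add: word_count_def)
  qed
  show ?thesis
    using code_count_improved[OF K subset_refl _ d_pos zero_le_one c] by auto
qed

lemma hausdorff_measure_dimY_finite: "Rd.hausdorff_measure d dimY (R ` Y) < top"
  using code_count hausdorff_measure_finite[OF digit_seqs dimY_nonneg] by (metis mult.commute)

text \<open>The uniform measure on the words of \<open>Y\<close>, projected to coordinates from
  \<open>j\<close> on, has bounded density against the uniform measure on the projected words. Only
  coordinates with nonzero \<open>\<alpha> j\<close> matter, since otherwise the block is
  empty.\<close>

definition uniform :: bool where
  "uniform \<longleftrightarrow> (\<forall>j<d. 0 < \<alpha> j \<longrightarrow>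
     (\<exists>C. \<forall>n. \<forall>v\<in>words (B j) n. card (lifts (pr j) Y v) * (growth (B j) / growth Y) ^ n \<le> C))"

lemma seg_zero: "\<lbrakk>\<alpha> j = 0; j < d\<rbrakk> \<Longrightarrow> seg t j = 0"
  using lg_pos[of "j - 1"] lg_pos[of j] by (auto simp: \<alpha>_def seg_def level_def split: if_splits)

text \<open>With bounded densities, the proportion of long words having a given code is at most a
  constant times the product of the \<open>1 / growth (B j) ^ seg t j\<close>, which is of order
  \<open>exp (- (dimY * t))\<close>. This is the hypothesis of mass distribution.\<close>

lemma hausdorff_measure_dimY_pos:
  assumes uniform
  shows "0 < Rd.hausdorff_measure d dimY (R ` Y)"
\<comment> \<open>Mass distribution is stated for positive exponents; at exponent 0 a nonempty set
  has measure at least 1.\<close>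
proof (cases "dimY = 0")
  case True
  then have "1 \<le> Rd.hausdorff_measure d dimY (R ` Y)" using nonempty Rd.hausdorff_measure_0_ge_1 by simp
  then show ?thesis by (meson ennreal_zero_less_one order_less_le_trans)
next
  case False
  then have dim: "0 < dimY" using dimY_nonneg by simp
  have rY: "1 \<le> growth Y" by (rule growth_ge_1)
  have "\<forall>j. \<exists>C\<ge>0. \<forall>t v. j < d \<longrightarrow> v \<in> words (B j) (seg t j) \<longrightarrow>
      real (card (lifts (pr j) Y v)) \<le> C * (growth Y / growth (B j)) ^ seg t j"
  proof
    fix j
    show "\<exists>C\<ge>0. \<forall>t v. j < d \<longrightarrow> v \<in> words (B j) (seg t j) \<longrightarrow>
      real (card (lifts (pr j) Y v)) \<le> C * (growth Y / growth (B j)) ^ seg t j"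
    proof (cases "j < d \<and> \<alpha> j \<noteq> 0")
      case True
      then obtain C where C: "\<And>n v. v \<in> words (B j) n \<Longrightarrow> card (lifts (pr j) Y v) * (growth (B j) / growth Y) ^ n \<le> C"
        using assms \<alpha>_nonneg[of j] unfolding uniform_def by force
      have "real (card (lifts (pr j) Y v)) \<le> max C 0 * (growth Y / growth (B j)) ^ n" if "v \<in> words (B j) n" for v n
      proof -
        have p: "0 < (growth (B j) / growth Y) ^ n" using rY growth_B_ge_1[of j] by simp
        have "card (lifts (pr j) Y v) * (growth (B j) / growth Y) ^ n \<le> max C 0" using C[OF that] by simp
        then have "real (card (lifts (pr j) Y v)) \<le> max C 0 / (growth (B j) / growth Y) ^ n"
          using p by (simp only: pos_le_divide_eq)
        then show ?thesis by (simp add: power_divide)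
      qed
      then show ?thesis by (intro exI[of _ "max C 0"]) auto
    next
      case False
      have "real (card (lifts (pr j) Y v)) \<le> 1 * (growth Y / growth (B j)) ^ seg t j"
        if "j < d" "v \<in> words (B j) (seg t j)" for v t
      proof -
        have s: "seg t j = 0" using False that seg_zero by blast
        then have "v = []" using that words_length by force
        then have "card (lifts (pr j) Y v) \<le> card {[] :: (nat \<Rightarrow> int) list}"
          by (intro card_mono) (auto simp: lifts_def)
        then show ?thesis using s by simp
      qed
      then show ?thesis by (intro exI[of _ 1]) auto
    qed
  qed
  then obtain C where C: "\<And>j. 0 \<le> C j" "\<And>j t v. j < d \<Longrightarrow> v \<in> words (B j) (seg t j) \<Longrightarrow>
      real (card (lifts (pr j) Y v)) \<le> C j * (growth Y / growth (B j)) ^ seg t j" by metis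
  obtain K where K: "1 \<le> K" "\<And>n. word_count Y n \<le> K * growth Y ^ n" using growth_props by metis
  \<comment> \<open>The summand 1 keeps \<open>A\<close> positive if some \<open>C j\<close>
    vanishes.\<close>
  define A where "A = (\<Prod>j<d. C j * growth (B j)) * K + 1"
  have A: "0 < A" using C(1) K(1) growth_B_ge_1
    by (auto simp: A_def intro!: add_nonneg_pos mult_nonneg_nonneg prod_nonneg intro: order_trans[OF zero_le_one])
  show ?thesis
  proof (rule mass_distribution[OF digit_seqs nonempty compact finite_words dim A])
    fix t c and T :: nat assume t: "0 \<le> (t::real)" and T: "level (d - 1) t \<le> T"
    let ?n = "\<Sum>i<d. seg t i"
    have n: "?n = level (d - 1) t" using sum_seg[of "d - 1" t] t d_pos by simp
    have "card {word T y |y. y \<in> Y \<and> code t y = c}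
        \<le> (\<Prod>i<d. C (0 + i) * (growth Y / growth (B (0 + i))) ^ seg t (0 + i)) * word_count Y (T - (\<Sum>i<d. seg t (0 + i)))"
      unfolding code_def
    proof (rule card_words_with_blocks_le[where b = "\<lambda>i. C i * (growth Y / growth (B i)) ^ seg t i" and h = pr and n = "seg t" and j = 0 and m = d])
      show "0 \<le> C i * (growth Y / growth (B i)) ^ seg t i" for i
        using C(1)[of i] rY growth_B_ge_1[of i] by simp
      show "card (lifts (pr i) Y v) \<le> C i * (growth Y / growth (B i)) ^ seg t i"
        if "i < 0 + d" "v \<in> words (B i) (seg t i)" for i v
        by (rule C(2)) (use that in \<open>simp_all only: add_0\<close>)
      show "(\<Sum>i<d. seg t (0 + i)) \<le> T" using T n by simp
    qed
    also have "\<dots> = (\<Prod>i<d. C i * (growth Y / growth (B i)) ^ seg t i) * word_count Y (T - ?n)" by simp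
    also have "\<dots> \<le> (\<Prod>i<d. C i * (growth Y / growth (B i)) ^ seg t i) * (K * growth Y ^ (T - ?n))"
    proof (intro mult_left_mono K(2) prod_nonneg)
      show "0 \<le> C i * (growth Y / growth (B i)) ^ seg t i" for i
        using C(1)[of i] rY growth_B_ge_1[of i] by simp
    qed
    \<comment> \<open>The powers of \<open>growth Y\<close> from the lifts and from the free letters
      combine to \<open>growth Y ^ T\<close>, which is at most the number of all words of length
      \<open>T\<close>.\<close>
    also have "(\<Prod>i<d. C i * (growth Y / growth (B i)) ^ seg t i) = (\<Prod>i<d. C i * (1 / growth (B i) ^ seg t i)) * growth Y ^ ?n"
      by (simp add: power_divide power_sum prod.distrib[symmetric])
    also have "(\<Prod>i<d. C i * (1 / growth (B i) ^ seg t i)) * growth Y ^ ?n * (K * growth Y ^ (T - ?n))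
        = (\<Prod>i<d. C i * (1 / growth (B i) ^ seg t i)) * K * growth Y ^ T"
      using T n by (simp add: mult_ac flip: power_add)
    also have "\<dots> \<le> (\<Prod>i<d. (C i * growth (B i)) * exp (- (t * (\<alpha> i * ln (growth (B i)))))) * K * growth Y ^ T"
    proof (intro mult_right_mono prod_mono conjI)
      fix i assume "i \<in> {..<d}"
      show "C i * (1 / growth (B i) ^ seg t i) \<le> (C i * growth (B i)) * exp (- (t * (\<alpha> i * ln (growth (B i)))))"
        using growth_power_seg(2)[OF t, of i] C(1)[of i] by (simp only: mult.assoc mult_left_mono)
      show "0 \<le> C i * (1 / growth (B i) ^ seg t i)" using C(1)[of i] growth_B_ge_1[of i] by simp
    qed (use K rY in auto)
    also have "(\<Prod>i<d. (C i * growth (B i)) * exp (- (t * (\<alpha> i * ln (growth (B i))))))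
        = (\<Prod>i<d. C i * growth (B i)) * exp (- (dimY * t))"
      by (simp add: prod.distrib exp_sum[symmetric] dimY_def sum_distrib_left sum_negf mult_ac)
    also have "(\<Prod>i<d. C i * growth (B i)) * exp (- (dimY * t)) * K * growth Y ^ T = (A - 1) * exp (- (dimY * t)) * growth Y ^ T"
      by (simp add: A_def)
    also have "\<dots> \<le> A * exp (- (dimY * t)) * growth Y ^ T" using rY by (intro mult_right_mono) auto
    also have "\<dots> \<le> A * exp (- (dimY * t)) * card (words Y T)"
      using A growth_props unfolding word_count_def[symmetric] by (intro mult_left_mono) (blast, simp)
    finally show "card {word T y |y. y \<in> Y \<and> code t y = c} \<le> A * exp (- (dimY * t)) * card (words Y T)" .
  qed
qed

text \<open>
  For a nonuniform coordinate \<open>j\<close> the cover uses two scales \<open>t\<close> and \<open>t' > t\<close> with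
  \<open>level 0 t' = level j t\<close>.  Points whose segment \<open>j\<close> at scale \<open>t\<close> has many lifts are few when
  counted at scale \<open>t\<close>, where this segment is read through the projection; the remaining points are
  few when counted at scale \<open>t'\<close>, where it is read completely.
\<close>

lemma hausdorff_measure_zero_below_dimY:
  assumes "\<not> uniform"
  shows "\<exists>s. 0 \<le> s \<and> s < dimY \<and> Rd.hausdorff_measure d s (R ` Y) = 0"
proof -
  obtain j where j: "j < d" "0 < \<alpha> j"
    and unb: "\<And>C. \<exists>n. \<exists>v\<in>words (B j) n. C < card (lifts (pr j) Y v) * (growth (B j) / growth Y) ^ n"
    using assms unfolding uniform_def by (meson not_le)
  have rY: "1 \<le> growth Y" by (rule growth_ge_1)
  obtain K :: real where K: "1 \<le> K" "\<And>j n. j < d \<Longrightarrow> word_count (B j) n \<le> K * growth (B j) ^ n" using uniform_K by blast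
  have KY: "word_count Y n \<le> K * growth Y ^ n" for n using K(2)[OF d_pos] by (simp add: B0)
  have lifts_le: "card (lifts (pr j) Y v) \<le> K * growth Y ^ n" if "v \<in> words (B j) n" for v n
  proof -
    have "card (lifts (pr j) Y v) \<le> card (words Y n)"
      using words_length[OF that] by (intro card_mono finite_words) (auto simp: lifts_def)
    then show ?thesis using KY[of n] by (simp add: word_count_def)
  qed
  \<comment> \<open>\<open>pr 0\<close> is the identity on digit sequences, so a word has at most
    one lift and the ratio cannot exceed 1.\<close>
  have j0: "0 < j"
  proof (rule ccontr)
    assume "\<not> 0 < j"
    then have [simp]: "j = 0" by simp
    obtain n v where v: "v \<in> words (B 0) n" "1 < card (lifts (pr 0) Y v) * (growth (B 0) / growth Y) ^ n"
      using unb[of 1] by auto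
    have "lifts (pr 0) Y v \<subseteq> {v}"
    proof
      fix u assume u: "u \<in> lifts (pr 0) Y v"
      then obtain y where y: "y \<in> Y" "u = word (length v) y" by (auto simp: lifts_def words_def)
      have "map (pr 0) u = u" using pr_0[OF y(1)] y(2) by (simp add: map_word)
      then show "u \<in> {v}" using u by (simp add: lifts_def)
    qed
    then have "card (lifts (pr 0) Y v) \<le> card {v}" by (intro card_mono) auto
    then show False using v(2) rY by (simp add: B0)
  qed
  have \<alpha>0: "0 < \<alpha> 0" using d_pos lg_pos[OF d_pos] by (simp add: \<alpha>_def)
  \<comment> \<open>For \<open>dimY = 0\<close> both growth rates would be 1, and then the number of
    lifts would be bounded by \<open>K\<close>.\<close>
  have dim: "0 < dimY"
  proof (rule ccontr)
    assume "\<not> 0 < dimY"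
    then have "dimY = 0" using dimY_nonneg by simp
    then have "\<forall>i\<in>{..<d}. \<alpha> i * ln (growth (B i)) = 0"
      unfolding dimY_def using \<alpha>_nonneg growth_B_ge_1 by (subst (asm) sum_nonneg_eq_0_iff) auto
    then have "growth (B 0) = 1" "growth (B j) = 1"
    proof -
      have "growth (B i) = 1" if "i < d" "0 < \<alpha> i" for i
      proof -
        have "\<alpha> i * ln (growth (B i)) = 0" using \<open>\<forall>i\<in>{..<d}. \<alpha> i * ln (growth (B i)) = 0\<close> that(1) by blast
        then show ?thesis using that(2) growth_B_ge_1[of i] by simp
      qed
      then show "growth (B 0) = 1" "growth (B j) = 1" using \<alpha>0 j d_pos by blast+
    qed
    then show False using unb[of K] lifts_le by (force simp: B0)
  qed
  obtain \<eta> K2 where \<eta>: "0 < \<eta>" and K2: "1 \<le> K2"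
    and split: "\<And>n. \<exists>G. card (words (B j) n \<inter> G) \<le> K2 * exp (- \<eta> * n) * growth (B j) ^ n \<and>
     card {u\<in>words Y n. map (pr j) u \<notin> G} \<le> K2 * exp (- \<eta> * n) * growth Y ^ n"
    using factor_words_split[of "pr j"] unb by blast
  define \<rho> where "\<rho> = lg 0 / lg j"
  have \<rho>: "1 \<le> \<rho>" using lg_mono[of 0 j] lg_pos[OF j(1)] j by (simp add: \<rho>_def)
  \<comment> \<open>Half of the gain \<open>\<eta> * \<alpha> j\<close> per unit of
    \<open>t\<close>. The other half pays for lowering the exponent to \<open>s\<close>, at either
    scale, since \<open>t'\<close> is at most \<open>\<rho> * t\<close>.\<close>
  define \<xi> where "\<xi> = \<eta> * \<alpha> j / 2"
  have \<xi>: "0 < \<xi>" using \<eta> j by (simp add: \<xi>_def)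
  define s where "s = dimY - min dimY (\<xi> / \<rho>)"
  have s: "0 \<le> s" "s < dimY" "(dimY - s) * \<rho> \<le> \<xi>"
    using dim \<xi> \<rho> by (auto simp: s_def min_def field_simps)
  define PK where "PK = (\<Prod>i<d. K * growth (B i))"
  have PK: "0 \<le> PK" unfolding PK_def
  proof (intro prod_nonneg)
    show "0 \<le> K * growth (B i)" for i using K(1) growth_B_ge_1[of i] by simp
  qed
  define C where "C = K2 * exp \<eta> * PK * c0 powr s"
  have C: "0 \<le> C" using K2 PK by (simp add: C_def)
  have bound: "Rd.hausdorff_premeasure d \<delta> s (R ` Y) \<le> ennreal (2 * C * exp (- (\<xi> * t)))"
    if t: "0 \<le> t" and t\<delta>: "c0 * exp (- (t - lg 0)) \<le> \<delta>" for t \<delta>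
  proof -
    define n where "n = seg t j"
    define a where "a = level (j - 1) t"
    define b where "b = level j t"
    have ab: "b = a + n" using level_mono[of "j - 1" j t] j t j0 by (simp add: a_def b_def n_def seg_def)
    define t' where "t' = b * lg 0"
    have t'0: "0 \<le> t'" using lg_pos[OF d_pos] by (simp add: t'_def)
    have t'1: "t' \<le> \<rho> * t"
      using level_le[OF j(1) t] lg_pos[OF d_pos] mult_right_mono[of "real b" "t / lg j" "lg 0"]
      by (simp add: t'_def \<rho>_def b_def mult_ac)
    \<comment> \<open>Rounding may put \<open>t'\<close> slightly below \<open>t\<close>, which is
      why the hypothesis on \<open>\<delta>\<close> leaves the room \<open>lg 0\<close>.\<close>
    have t'2: "t - lg 0 \<le> t'"
    proof -
      have "t / lg 0 \<le> t / lg j" using lg_mono[of 0 j] lg_pos[OF j(1)] j t by (intro divide_left_mono) auto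
      then have "t / lg 0 \<le> real b + 1" using level_gt[OF j(1) t] by (simp add: b_def)
      then show ?thesis using lg_pos[OF d_pos] by (simp add: t'_def pos_divide_le_eq ring_distribs)
    qed
    have lev': "level 0 t' = b" using lg_pos[OF d_pos] by (simp add: level_def t'_def)
    obtain G where G: "card (words (B j) n \<inter> G) \<le> K2 * exp (- \<eta> * n) * growth (B j) ^ n"
      "card {u\<in>words Y n. map (pr j) u \<notin> G} \<le> K2 * exp (- \<eta> * n) * growth Y ^ n"
      using split[of n] by blast
    define \<epsilon> where "\<epsilon> = K2 * exp (- \<eta> * n)"
    have \<epsilon>0: "0 \<le> \<epsilon>" using K2 by (simp add: \<epsilon>_def)
    have \<epsilon>1: "\<epsilon> \<le> K2 * exp \<eta> * exp (- (2 * \<xi> * t))"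
    proof -
      have "\<alpha> j * t - 1 \<le> real n" using seg_bounds[OF t, of j] by (simp add: n_def)
      then have "\<eta> * (\<alpha> j * t - 1) \<le> \<eta> * n" using \<eta> by (intro mult_left_mono) auto
      then have "- \<eta> * n \<le> \<eta> + - (2 * \<xi> * t)" by (simp add: \<xi>_def algebra_simps)
      then have "exp (- \<eta> * n) \<le> exp (\<eta> + - (2 * \<xi> * t))" by (simp only: exp_le_cancel_iff)
      also have "\<dots> = exp \<eta> * exp (- (2 * \<xi> * t))" by (rule exp_add)
      finally show ?thesis using K2 by (simp add: \<epsilon>_def mult.assoc)
    qed
    let ?seg = "segment pr (seg t) j"
    have seg_eq: "?seg y = map (pr j) (word n (\<lambda>k. y (a + k)))" for y
    proof -
      have "(\<Sum>i'<j. seg t i') = a" using sum_seg[of "j - 1" t] j t j0 by (simp add: a_def)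
      then show ?thesis by (simp add: segment_def map_word n_def comp_def)
    qed
    define Y1 where "Y1 = {y\<in>Y. ?seg y \<in> G}"
    define Y2 where "Y2 = {y\<in>Y. ?seg y \<notin> G}"
    have Y12: "Y1 \<subseteq> Y" "Y2 \<subseteq> Y" "R ` Y = R ` Y1 \<union> R ` Y2" by (auto simp: Y1_def Y2_def)
    have finw: "finite (words (B i) n)" for i n using glue_shift.finite_words[OF glue_B] .
    have s1: "card (?seg ` Y1) \<le> \<epsilon> * (K * growth (B j) ^ seg t j)"
    proof -
      have "card (?seg ` Y1) \<le> card (words (B j) n \<inter> G)"
        using segment_in_words finw by (intro card_mono) (auto simp: Y1_def n_def)
      then have "card (?seg ` Y1) \<le> \<epsilon> * (1 * growth (B j) ^ n)" using G(1) by (simp add: \<epsilon>_def)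
      also have "\<dots> \<le> \<epsilon> * (K * growth (B j) ^ n)"
        using \<epsilon>0 K growth_B_ge_1[of j] by (intro mult_left_mono mult_right_mono) auto
      finally show ?thesis by (simp add: n_def)
    qed
    \<comment> \<open>At scale \<open>t'\<close> the first block is a complete word of length
      \<open>b = a + n\<close>. On \<open>Y2\<close> its last \<open>n\<close> letters lie in the
      small set of words whose projection avoids \<open>G\<close>, while its first \<open>a\<close>
      letters are arbitrary.\<close>
    have s2: "card (segment pr (seg t') 0 ` Y2) \<le> \<epsilon> * (K * growth (B 0) ^ seg t' 0)"
    proof -
      have seg0: "seg t' 0 = b" using d_pos by (simp add: seg_def lev')
      let ?S = "{w\<in>words Y b. map (pr j) (drop a w) \<notin> G}"
      have "segment pr (seg t') 0 y = map (pr 0) (word b y)" for y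
        by (simp add: segment_def map_word seg0 comp_def)
      moreover have "word b y \<in> ?S" if "y \<in> Y2" for y
        using that seg_eq[of y] by (auto simp: Y2_def words_def drop_word ab)
      ultimately have "segment pr (seg t') 0 ` Y2 \<subseteq> map (pr 0) ` ?S" by auto
      moreover have finS: "finite ?S" using finite_words[of b] by simp
      ultimately have "card (segment pr (seg t') 0 ` Y2) \<le> card (map (pr 0) ` ?S)" by (intro card_mono finite_imageI)
      also have "\<dots> \<le> card ?S" using finS by (rule card_image_le)
      also have "card ?S \<le> card (words Y a) * card {u\<in>words Y n. map (pr j) u \<notin> G}"
      proof (rule card_append_le[of _ _ _ a])
        fix w assume "w \<in> ?S"
        then show "take a w \<in> words Y a \<and> drop a w \<in> {u\<in>words Y n. map (pr j) u \<notin> G}"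
          using take_words[of w b a] drop_words[of w b a] ab by simp
      qed (simp_all add: finite_words)
      finally have "real (card (segment pr (seg t') 0 ` Y2)) \<le> word_count Y a * card {u\<in>words Y n. map (pr j) u \<notin> G}"
        unfolding word_count_def of_nat_mult[symmetric] of_nat_le_iff .
      also have "\<dots> \<le> (K * growth Y ^ a) * (\<epsilon> * growth Y ^ n)"
        using KY G(2) K(1) rY by (intro mult_mono) (auto simp: \<epsilon>_def)
      also have "\<dots> = \<epsilon> * (K * growth (B 0) ^ seg t' 0)" by (simp add: B0 seg0 ab power_add mult_ac)
      finally show ?thesis .
    qed
    note c1 = code_count_improved[OF K Y12(1) t j(1) \<epsilon>0 s1, folded PK_def]
    note c2 = code_count_improved[OF K Y12(2) t'0 d_pos \<epsilon>0 s2, folded PK_def]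
    have est: "Rd.hausdorff_premeasure d \<delta> s (R ` S) \<le> ennreal (C * exp (- (\<xi> * t)))"
      if S: "S \<subseteq> Y" and u: "0 \<le> u" "t - lg 0 \<le> u" "u \<le> \<rho> * t"
        and fin: "finite (code u ` S)" and cS: "card (code u ` S) \<le> \<epsilon> * PK * exp (u * dimY)" for S u
    proof -
      have "c0 * exp (- u) \<le> c0 * exp (- (t - lg 0))" using u c0_ge_1 by (intro mult_left_mono) auto
      then have "c0 * exp (- u) \<le> \<delta>" using t\<delta> by linarith
      then have 1: "Rd.hausdorff_premeasure d \<delta> s (R ` S) \<le> ennreal (card (code u ` S) * (c0 powr s * exp (- (s * u))))"
        using S digit_seqs u fin s by (intro hausdorff_premeasure_upper) auto
      have "card (code u ` S) * (c0 powr s * exp (- (s * u))) \<le> (\<epsilon> * PK * exp (u * dimY)) * (c0 powr s * exp (- (s * u)))"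
        by (intro mult_right_mono cS) auto
      also have "\<dots> = \<epsilon> * (PK * c0 powr s * exp ((dimY - s) * u))"
        by (simp add: ring_distribs exp_diff exp_minus field_simps)
      also have "\<dots> \<le> (K2 * exp \<eta> * exp (- (2 * \<xi> * t))) * (PK * c0 powr s * exp (\<xi> * t))"
      proof (intro mult_mono \<epsilon>1)
        have "(dimY - s) * u \<le> (dimY - s) * (\<rho> * t)" using s u by (intro mult_left_mono) auto
        also have "\<dots> \<le> \<xi> * t" using s(3) t by (simp add: mult.assoc[symmetric] mult_right_mono)
        finally show "exp ((dimY - s) * u) \<le> exp (\<xi> * t)" by simp
      qed (use PK K2 \<epsilon>0 in auto)
      also have "\<dots> = C * (exp (- (2 * \<xi> * t)) * exp (\<xi> * t))" by (simp add: C_def mult_ac)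
      also have "exp (- (2 * \<xi> * t)) * exp (\<xi> * t) = exp (- (\<xi> * t))" by (simp flip: exp_add)
      finally show ?thesis using 1 ennreal_leI order_trans by blast
    qed
    have "Rd.hausdorff_premeasure d \<delta> s (R ` Y) \<le> Rd.hausdorff_premeasure d \<delta> s (R ` Y1) + Rd.hausdorff_premeasure d \<delta> s (R ` Y2)"
      unfolding Y12(3) by (rule Rd.hausdorff_premeasure_Un)
    also have "\<dots> \<le> ennreal (C * exp (- (\<xi> * t))) + ennreal (C * exp (- (\<xi> * t)))"
    proof (intro add_mono)
      show "Rd.hausdorff_premeasure d \<delta> s (R ` Y1) \<le> ennreal (C * exp (- (\<xi> * t)))"
        using Y12 t \<rho> lg_pos[OF d_pos] mult_right_mono[OF \<rho> t] c1 by (intro est[where u = t]) auto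
      show "Rd.hausdorff_premeasure d \<delta> s (R ` Y2) \<le> ennreal (C * exp (- (\<xi> * t)))"
        using Y12 t'0 t'1 t'2 c2 by (intro est[where u = t']) auto
    qed
    also have "\<dots> = ennreal (2 * C * exp (- (\<xi> * t)))" using C by (simp flip: ennreal_plus)
    finally show ?thesis .
  qed
  have "Rd.hausdorff_measure d s (R ` Y) \<le> 0"
  proof (rule Rd.hausdorff_measure_leI)
    fix \<delta> :: real assume \<delta>: "0 < \<delta>"
    show "Rd.hausdorff_premeasure d \<delta> s (R ` Y) \<le> 0"
    proof (rule ennreal_le_epsilon)
      fix e :: real assume e: "0 < e"
      define t where "t = max 0 (max (lg 0 + ln (c0 / \<delta>)) (ln ((2 * C + 1) / e) / \<xi>))"
      have t: "0 \<le> t" "lg 0 + ln (c0 / \<delta>) \<le> t" "ln ((2 * C + 1) / e) / \<xi> \<le> t" by (auto simp: t_def)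
      have "exp (- (t - lg 0)) \<le> exp (- ln (c0 / \<delta>))" using t(2) by simp
      also have "\<dots> = \<delta> / c0" using \<delta> c0_ge_1 by (simp add: exp_minus)
      finally have 1: "c0 * exp (- (t - lg 0)) \<le> \<delta>" using c0_ge_1 by (simp add: field_simps)
      have "ln ((2 * C + 1) / e) \<le> t * \<xi>" using t(3) \<xi> by (simp only: pos_divide_le_eq)
      then have "exp (ln ((2 * C + 1) / e)) \<le> exp (t * \<xi>)" by (simp only: exp_le_cancel_iff)
      then have "(2 * C + 1) / e \<le> exp (\<xi> * t)" using C e by (simp add: mult.commute)
      then have "2 * C + 1 \<le> e * exp (\<xi> * t)" using e by (simp add: pos_divide_le_eq mult.commute)
      then have "2 * C * exp (- (\<xi> * t)) \<le> e" by (simp add: exp_minus field_simps)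
      then show "Rd.hausdorff_premeasure d \<delta> s (R ` Y) \<le> 0 + ennreal e"
        using bound[OF t(1) 1] ennreal_leI order_trans by fastforce
    qed
  qed
  then show ?thesis using s by auto
qed

theorem hausdorff_measure_dimY_dichotomy:
  "0 < Rd.hausdorff_measure d dimY (R ` Y) \<or> (\<exists>s. 0 \<le> s \<and> s < dimY \<and> Rd.hausdorff_measure d s (R ` Y) = 0)"
  using hausdorff_measure_dimY_pos hausdorff_measure_zero_below_dimY by blast

end

section \<open>Self-affine sofic sets\<close>

lemma blocks_comp: "blocks h n j m (l \<circ> p) = blocks (\<lambda>i. h i \<circ> l) n j m p"
proof (induction m arbitrary: j p)
  case (Suc m)
  have "(\<lambda>k. (l \<circ> p) (n j + k)) = l \<circ> (\<lambda>k. p (n j + k))" by auto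
  then show ?case using Suc.IH[of "Suc j" "\<lambda>k. p (n j + k)"] by (simp add: comp_def)
qed simp

lemma prefix_compact_splice:
  fixes Y :: "(nat \<Rightarrow> 'a) set"
  assumes "prefix_compact Y"
  shows "prefix_compact (splice p n ` Y)"
  unfolding prefix_compact_def
proof (intro allI impI)
  fix f :: "nat \<Rightarrow> nat \<Rightarrow> 'a" assume "\<forall>i. f i \<in> splice p n ` Y"
  then have "\<forall>i. \<exists>y. y \<in> Y \<and> f i = splice p n y" by blast
  from choice[OF this] obtain g where g: "\<And>i. g i \<in> Y" "\<And>i. f i = splice p n (g i)" by blast
  have "\<exists>y\<in>Y. \<forall>k. infinite {i. \<forall>j<k. g i j = y j}"
    using assms g(1) unfolding prefix_compact_def by simp
  then obtain y where y: "y \<in> Y" "\<And>k. infinite {i. \<forall>j<k. g i j = y j}" by blast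
  have "infinite {i. \<forall>j<k. f i j = splice p n y j}" for k
  proof (rule infinite_super[OF _ y(2)[of k]])
    show "{i. \<forall>j<k. g i j = y j} \<subseteq> {i. \<forall>j<k. f i j = splice p n y j}"
      by (auto simp: g(2) splice_def)
  qed
  then show "\<exists>z\<in>splice p n ` Y. \<forall>k. infinite {i. \<forall>j<k. f i j = z j}" using y(1) by blast
qed

context sponge
begin

text \<open>The preimages of a convergent sequence have a cluster point, and sequences with a long
  common prefix have close images; so the limit is the image of the cluster point.\<close>

lemma closedin_R_image:
  assumes "Y \<subseteq> digit_seqs" "prefix_compact Y"
  shows "closedin (Rd.mtopology d) (R ` Y)"
  unfolding Rd.metric_closedin_iff_sequentially_closed
proof (intro conjI allI impI)
  show "R ` Y \<subseteq> Rd d" using R_in_Rd by blast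
  fix \<sigma> l assume \<sigma>: "range \<sigma> \<subseteq> R ` Y \<and> limitin (Rd.mtopology d) \<sigma> l sequentially"
  then have "\<forall>i. \<exists>y. y \<in> Y \<and> \<sigma> i = R y" by blast
  then obtain f where f: "\<And>i. f i \<in> Y" "\<And>i. \<sigma> i = R (f i)" by metis
  then obtain y where y: "y \<in> Y" "\<And>k. infinite {i. \<forall>j<k. f i j = y j}"
    using assms(2) unfolding prefix_compact_def by blast
  have l: "l \<in> Rd d" and lim: "\<And>e. 0 < e \<Longrightarrow> \<forall>\<^sub>F i in sequentially. Rd_dist d (\<sigma> i) l < e"
    using \<sigma> by (auto simp: Rd.limitin_metric elim: eventually_mono)
  have "Rd_dist d (R y) l \<le> 2 * e" if e: "0 < e" for e
  proof -
    define t where "t = max 0 (ln (c0 / e))"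
    have t: "0 \<le> t" by (simp add: t_def)
    have "exp (- t) \<le> exp (- ln (c0 / e))" by (simp add: t_def)
    also have "\<dots> = e / c0" using e c0_ge_1 by (simp add: exp_minus)
    finally have te: "c0 * exp (- t) \<le> e" using c0_ge_1 by (simp add: field_simps)
    obtain N where N: "\<And>i. N \<le> i \<Longrightarrow> Rd_dist d (\<sigma> i) l < e"
      using lim[OF e] by (auto simp: eventually_sequentially)
    obtain i where i: "N \<le> i" "\<forall>j<level (d - 1) t. f i j = y j"
      using y(2)[of "level (d - 1) t"] unfolding infinite_nat_iff_unbounded_le by blast
    have "code t (f i) = code t y"
      unfolding code_eq_iff[OF t]
    proof (intro allI impI)
      fix q k assume "q < d" "k < level q t"
      moreover have "level q t \<le> level (d - 1) t" using \<open>q < d\<close> t by (intro level_mono) auto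
      ultimately show "f i k q = y k q" using i(2) by simp
    qed
    then have "Rd_dist d (R y) (R (f i)) \<le> e"
      using dist_le_same_code[of y "f i" t] y(1) f(1) assms(1) t te by force
    moreover have "Rd_dist d (R y) l \<le> Rd_dist d (R y) (R (f i)) + Rd_dist d (R (f i)) l"
      by (intro Rd.triangle R_in_Rd l)
    ultimately show ?thesis using N[OF i(1)] f(2)[of i] by simp
  qed
  \<comment> \<open>A positive distance would be at most half of itself.\<close>
  from this[of "Rd_dist d (R y) l / 4"] have "Rd_dist d (R y) l = 0"
    using Rd.nonneg[of d "R y" l] by (cases "Rd_dist d (R y) l = 0") auto
  then have "R y = l" using R_in_Rd l by simp
  then show "l \<in> R ` Y" using y(1) by blast
qed

lemma splice_digit_seqs: "\<lbrakk>\<And>k. k < n \<Longrightarrow> p k \<in> D; Y \<subseteq> digit_seqs\<rbrakk> \<Longrightarrow> splice p n ` Y \<subseteq> digit_seqs"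
  by (auto simp: digit_seqs_def splice_def)

text \<open>Prepending a fixed word acts on the images as a diagonal affine map with factors
  \<open>1 / m r ^ n\<close>, which does not increase distances.\<close>

lemma hausdorff_measure_splice_le:
  assumes "\<And>k. k < n \<Longrightarrow> p k \<in> D" "Y \<subseteq> digit_seqs" "0 \<le> s"
  shows "Rd.hausdorff_measure d s (R ` splice p n ` Y) \<le> Rd.hausdorff_measure d s (R ` Y)"
proof -
  define \<tau> where "\<tau> z = (\<lambda>r\<in>{..<d}. (of_int (prefix_value (m r) (\<lambda>k. p k r) n) + z r) / of_int (m r) ^ n)" for z :: "nat \<Rightarrow> real"
  have eq: "R (splice p n y) = \<tau> (R y)" if y: "y \<in> Y" for y
  proof
    fix r
    have sp: "splice p n y \<in> digit_seqs" using splice_digit_seqs[of n p Y] assms(1,2) y by blast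
    show "R (splice p n y) r = \<tau> (R y) r"
    proof (cases "r < d")
      case True
      have "expansion (m r) (\<lambda>k. splice p n y k r)
          = (of_int (prefix_value (m r) (\<lambda>k. splice p n y k r) n) + expansion (m r) (\<lambda>k. splice p n y (n + k) r)) / of_int (m r) ^ n"
        using digit_seqsD[OF sp True] m_ge_2[OF True] by (intro expansion_split) auto
      also have "prefix_value (m r) (\<lambda>k. splice p n y k r) n = prefix_value (m r) (\<lambda>k. p k r) n"
        by (intro prefix_value_cong) simp
      finally show ?thesis using True by (simp add: \<tau>_def R_eq)
    qed (simp add: \<tau>_def coding_map_def)
  qed
  have "R ` splice p n ` Y = \<tau> ` R ` Y" using eq by (auto simp: image_image)
  moreover have "Rd.hausdorff_measure d s (\<tau> ` R ` Y) \<le> Rd.hausdorff_measure d s (R ` Y)"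
  proof (rule Rd.hausdorff_measure_lipschitz_image[OF _ _ assms(3)])
    show "\<tau> ` R ` Y \<subseteq> Rd d" by (rule image_subsetI) (simp add: \<tau>_def Rd_def)
    fix x y
    have "\<bar>\<tau> x r - \<tau> y r\<bar> \<le> \<bar>x r - y r\<bar>" if r: "r < d" for r
    proof -
      have M: "1 \<le> real_of_int (m r) ^ n" using m_ge_2[OF r] by (intro one_le_power) simp
      have "\<tau> x r - \<tau> y r = (x r - y r) / real_of_int (m r) ^ n"
        using r by (simp add: \<tau>_def diff_divide_distrib add_divide_distrib)
      then have "\<bar>\<tau> x r - \<tau> y r\<bar> = \<bar>x r - y r\<bar> / real_of_int (m r) ^ n" using M by (simp add: abs_divide)
      also have "\<dots> \<le> \<bar>x r - y r\<bar> / 1" using M by (intro divide_left_mono) auto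
      finally show ?thesis by simp
    qed
    then show "Rd_dist d (\<tau> x) (\<tau> y) \<le> Rd_dist d x y"
      unfolding Rd_dist_def L2_set_def
      by (intro real_sqrt_le_mono sum_mono) (simp add: abs_le_square_iff)
  qed
  ultimately show ?thesis by simp
qed

end

section \<open>The sofic set presented by a graph, decomposed by eventual components\<close>

locale sofic_sponge = sponge d m + finite_graph E
  for d m and E :: "(nat \<times> nat) set" +
  fixes l :: "nat \<Rightarrow> nat \<Rightarrow> int" and X :: "(nat \<Rightarrow> nat \<Rightarrow> int) set"
  assumes l_digits: "v \<in> Field E \<Longrightarrow> l v \<in> D"
    and X_def: "X = (\<lambda>p. l \<circ> p) ` {p. infinite_path p}"
    and X_nonempty: "X \<noteq> {}"
begin

abbreviation "h \<equiv> \<lambda>j. pr j \<circ> l"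
abbreviation "Y w \<equiv> component_shift l w"

lemma X_digit_seqs: "X \<subseteq> digit_seqs"
  using l_digits infinite_path_Field by (auto simp: X_def digit_seqs_def)

lemma Y_subset: "Y w \<subseteq> X"
  by (auto simp: component_shift_def component_paths_def X_def)

text \<open>Membership in \<open>P\<close> is decided by single edges and single vertices, so it
  passes to limits of prefixes.\<close>

lemma path_set_compact:
  assumes "\<And>p. p \<in> P \<longleftrightarrow> infinite_path p \<and> range p \<subseteq> S"
  shows "prefix_compact ((\<lambda>p. l \<circ> p) ` P)"
  unfolding prefix_compact_def
proof (intro allI impI)
  fix f :: "nat \<Rightarrow> nat \<Rightarrow> nat \<Rightarrow> int" assume "\<forall>n. f n \<in> (\<lambda>p. l \<circ> p) ` P"
  then have "\<forall>n. \<exists>p. p \<in> P \<and> f n = l \<circ> p" by blast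
  from choice[OF this] obtain g where g: "\<And>n. g n \<in> P" "\<And>n. f n = l \<circ> g n" by blast
  have gE: "g n k \<in> Field E" for n k using g(1)[of n] infinite_path_Field assms by blast
  have "\<exists>p. \<forall>k. infinite {n. \<forall>i<k. g n i = p i}"
    by (rule koenig_limit[where f = g, OF finite_Field gE]) blast
  then obtain p where p: "\<And>k. infinite {n. \<forall>i<k. g n i = p i}" by blast
  have near: "\<exists>n. \<forall>i<k. g n i = p i" for k using p[of k] by (metis (mono_tags, lifting) Collect_empty_eq finite.emptyI)
  have "(p k, p (Suc k)) \<in> E" for k
  proof -
    obtain n where "\<forall>i<Suc (Suc k). g n i = p i" using near by blast
    then have "g n k = p k" "g n (Suc k) = p (Suc k)" by auto
    moreover have "(g n k, g n (Suc k)) \<in> E" using g(1)[of n] assms by (simp add: infinite_path_def)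
    ultimately show ?thesis by simp
  qed
  moreover have "p k \<in> S" for k
  proof -
    obtain n where "\<forall>i<Suc k. g n i = p i" using near by blast
    then have "g n k = p k" by auto
    then show ?thesis using g(1)[of n] assms by (metis rangeI subsetD)
  qed
  ultimately have "p \<in> P" using assms by (auto simp: infinite_path_def)
  moreover have "infinite {n. \<forall>i<k. f n i = (l \<circ> p) i}" for k
    by (rule infinite_super[OF _ p[of k]]) (auto simp: g(2))
  ultimately show "\<exists>y\<in>(\<lambda>p. l \<circ> p) ` P. \<forall>k. infinite {n. \<forall>i<k. f n i = y i}" by blast
qed

lemma X_compact: "prefix_compact X"
  unfolding X_def by (rule path_set_compact[where S = UNIV]) simp

lemma Y_compact: "prefix_compact (Y w)"
  unfolding component_shift_def by (rule path_set_compact[where S = "component w"]) (simp add: component_paths_def)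

lemma finite_words_X: "finite (words X n)"
proof -
  have "words X n = {word n (l \<circ> p) |p. infinite_path p \<and> True}" by (auto simp: words_def X_def)
  then show ?thesis using finite_path_words[of n l "\<lambda>_. True"] by simp
qed

lemma sponge_shift_Y: "cyclic w \<Longrightarrow> sponge_shift d m (Y w) (card E)"
  using glue_shift_component[of w l] Y_compact X_digit_seqs Y_subset sponge_axioms
  unfolding sponge_shift_def sponge_shift_axioms_def by blast

text \<open>Starting vertices without an infinite path contribute no point, and there
  \<open>chain\<close> may be a maximum over the empty set.\<close>

definition \<beta> :: real where "\<beta> = Max (chain h \<alpha> 0 d ` {v \<in> Field E. paths v \<noteq> {}})"

lemma starts: "finite {v \<in> Field E. paths v \<noteq> {}}" "{v \<in> Field E. paths v \<noteq> {}} \<noteq> {}"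
proof -
  obtain p where "infinite_path p" using X_nonempty by (auto simp: X_def)
  then have "p \<in> paths (p 0)" "p 0 \<in> Field E" using infinite_path_Field by (auto simp: paths_def)
  then show "{v \<in> Field E. paths v \<noteq> {}} \<noteq> {}" by blast
qed (simp add: finite_Field)

lemma code_X: "code t ` X = (\<Union>v\<in>Field E. blocks h (seg t) 0 d ` paths v)"
proof -
  have "{p. infinite_path p} = (\<Union>v\<in>Field E. paths v)" using infinite_path_Field by (auto simp: paths_def)
  then have "X = (\<Union>v\<in>Field E. (\<lambda>p. l \<circ> p) ` paths v)" unfolding X_def by auto
  then have "code t ` X = (\<Union>v\<in>Field E. (\<lambda>p. code t (l \<circ> p)) ` paths v)" by (simp add: image_UN image_image)
  then show ?thesis by (simp add: code_def blocks_comp)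
qed

lemma finite_code_X: "finite (code t ` X)"
  unfolding code_X using finite_Field finite_blocks by blast

text \<open>There are finitely many starting vertices, so the best one decides the exponent and
  their number only changes the constant.\<close>

theorem box_dim: "Rd.lower_box_dim d (R ` X) = ereal \<beta>" "Rd.upper_box_dim d (R ` X) = ereal \<beta>"
proof -
  obtain C M where C: "0 < C" and up: "\<forall>t n v. 0 \<le> t \<longrightarrow> (\<forall>i. real (n i) \<le> \<alpha> i * t + 1) \<longrightarrow>
     card (blocks h n 0 d ` paths v) \<le> C * (t + 1) ^ M * exp (t * chain h \<alpha> 0 d v)"
    using card_blocks_upper[of \<alpha> h 0 d, OF \<alpha>_nonneg] by (elim exE conjE)
  obtain c where c: "0 < c" and low: "\<forall>t n v. 0 \<le> t \<longrightarrow> (\<forall>i. \<alpha> i * t \<le> real (n i) + 1) \<longrightarrow> paths v \<noteq> {} \<longrightarrow>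
     c * exp (t * chain h \<alpha> 0 d v) \<le> card (blocks h n 0 d ` paths v)"
    using card_blocks_lower[of \<alpha> h 0 d, OF \<alpha>_nonneg] by (elim exE conjE)
  have upper: "card (code t ` X) \<le> (card (Field E) * C + 1) * (t + 1) ^ M * exp (t * \<beta>)" if t: "0 \<le> t" for t
  proof -
    have "card (code t ` X) \<le> (\<Sum>v\<in>Field E. card (blocks h (seg t) 0 d ` paths v))"
      unfolding code_X by (rule card_UN_le[OF finite_Field])
    then have "real (card (code t ` X)) \<le> (\<Sum>v\<in>Field E. real (card (blocks h (seg t) 0 d ` paths v)))"
      by (simp flip: of_nat_sum)
    also have "\<dots> \<le> (\<Sum>v\<in>Field E. C * (t + 1) ^ M * exp (t * \<beta>))"
    proof (intro sum_mono)
      fix v assume v: "v \<in> Field E"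
      show "card (blocks h (seg t) 0 d ` paths v) \<le> C * (t + 1) ^ M * exp (t * \<beta>)"
      proof (cases "paths v = {}")
        case False
        have "chain h \<alpha> 0 d v \<le> \<beta>" unfolding \<beta>_def using starts(1) v False by (intro Max_ge) auto
        then have "C * (t + 1) ^ M * exp (t * chain h \<alpha> 0 d v) \<le> C * (t + 1) ^ M * exp (t * \<beta>)"
          using C t by (intro mult_left_mono) (auto intro: mult_left_mono)
        moreover have "card (blocks h (seg t) 0 d ` paths v) \<le> C * (t + 1) ^ M * exp (t * chain h \<alpha> 0 d v)"
          using seg_bounds[OF t] t by (intro up[rule_format]) auto
        ultimately show ?thesis by linarith
      qed (use C t in simp)
    qed
    also have "\<dots> = (card (Field E) * C) * (t + 1) ^ M * exp (t * \<beta>)" by simp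
    also have "\<dots> \<le> (card (Field E) * C + 1) * (t + 1) ^ M * exp (t * \<beta>)" using t by (intro mult_right_mono) auto
    finally show ?thesis .
  qed
  have "\<beta> \<in> chain h \<alpha> 0 d ` {v \<in> Field E. paths v \<noteq> {}}"
    unfolding \<beta>_def using starts by (intro Max_in) auto
  then obtain v where v: "v \<in> Field E" "paths v \<noteq> {}" "\<beta> = chain h \<alpha> 0 d v" by blast
  have lower: "c * exp (t * \<beta>) \<le> card (code t ` X)" if t: "0 \<le> t" for t
  proof -
    have "c * exp (t * \<beta>) \<le> card (blocks h (seg t) 0 d ` paths v)"
      unfolding v(3) using v t seg_bounds[OF t] by (intro low[rule_format]) auto
    also have "\<dots> \<le> card (code t ` X)"
      using v(1) finite_code_X[of t] unfolding code_X by (intro of_nat_mono card_mono) auto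
    finally show ?thesis .
  qed
  have C': "0 < card (Field E) * C + 1" using C by (intro add_nonneg_pos) auto
  have "ereal \<beta> \<le> Rd.lower_box_dim d (R ` X)"
    by (rule lower_box_dim_ge[OF X_digit_seqs finite_code_X c lower])
  moreover have "Rd.upper_box_dim d (R ` X) \<le> ereal \<beta>"
    by (rule upper_box_dim_le[OF X_digit_seqs finite_code_X X_nonempty C' upper])
  moreover note Rd.lower_le_upper_box_dim[of d "R ` X"]
  ultimately show "Rd.lower_box_dim d (R ` X) = ereal \<beta>" "Rd.upper_box_dim d (R ` X) = ereal \<beta>" by auto
qed

lemma component_dim_le:
  assumes "cyclic w"
  shows "sponge_shift.dimY d m (Y w) \<le> \<beta>"
proof -
  interpret Y: sponge_shift d m "Y w" "card E" by (rule sponge_shift_Y[OF assms])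
  have "sponge_shift.dimY d m (Y w) = (\<Sum>i<d. \<alpha> (0 + i) * ln (rate (h (0 + i)) w))"
    unfolding Y.dimY_def by (simp add: factor_component_shift)
  also have "\<dots> \<le> chain h \<alpha> 0 d w" by (rule sum_component_le_chain[OF assms])
  also have "\<dots> \<le> \<beta>"
    unfolding \<beta>_def using starts(1) cyclic_paths[OF assms] cyclic_Field[OF assms] by (intro Max_ge) auto
  finally show ?thesis .
qed

text \<open>Some vertex \<open>w\<close> is visited infinitely often; from its first visit on, every
  vertex lies between two visits and hence in the component of \<open>w\<close>.\<close>

lemma eventually_component:
  assumes "infinite_path p"
  obtains n w where "cyclic w" "(\<lambda>k. p (n + k)) \<in> component_paths w"
proof -
  have "\<exists>w\<in>Field E. infinite {k. p k = w}"
  proof (rule ccontr)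
    assume "\<not> ?thesis"
    then have "finite (\<Union>w\<in>Field E. {k. p k = w})" using finite_Field by blast
    moreover have "(\<Union>w\<in>Field E. {k. p k = w}) = UNIV" using infinite_path_Field[OF assms] by auto
    ultimately show False by simp
  qed
  then obtain w where w: "infinite {k. p k = w}" by blast
  then obtain n where n: "p n = w" by (metis (mono_tags, lifting) Collect_empty_eq finite.emptyI)
  have "p (n + k) \<in> component w" for k
  proof -
    obtain k' where k': "n + k \<le> k'" "p k' = w" using w unfolding infinite_nat_iff_unbounded_le by blast
    have "(w, p (n + k)) \<in> E\<^sup>*" using infinite_path_reach[OF assms, of n k] n by simp
    moreover have "(p (n + k), w) \<in> E\<^sup>*" using infinite_path_reach[OF assms, of "n + k" "k' - (n + k)"] k' by simp
    ultimately show ?thesis by (simp add: component_def)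
  qed
  moreover have "infinite_path (\<lambda>k. p (n + k))" by (rule infinite_path_shift[OF assms])
  moreover have "cyclic w"
  proof -
    have "(w, p (n + 1)) \<in> E" using assms n by (auto simp: infinite_path_def)
    moreover have "(p (n + 1), w) \<in> E\<^sup>*" using calculation \<open>\<And>k. p (n + k) \<in> component w\<close>[of 1] by (simp add: component_def)
    ultimately show ?thesis unfolding cyclic_def by (metis rtrancl_into_trancl2)
  qed
  ultimately show ?thesis using that[of w n] by (auto simp: component_paths_def)
qed

text \<open>Prefixes and components are combined freely, so a piece may contain sequences outside
  \<open>X\<close>. In return countability and compactness are immediate.\<close>

definition piece_index :: "((nat \<Rightarrow> int) list \<times> nat) set" where
  "piece_index = (\<Union>n. words X n) \<times> {w. cyclic w}"

definition piece :: "(nat \<Rightarrow> int) list \<times> nat \<Rightarrow> (nat \<Rightarrow> nat \<Rightarrow> int) set" where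
  "piece i = splice ((!) (fst i)) (length (fst i)) ` Y (snd i)"

lemma countable_piece_index: "countable piece_index"
  unfolding piece_index_def using finite_words_X finite_cyclic[of "\<lambda>_. True"]
  by (intro countable_SIGMA countable_UN) (auto intro: countable_finite)

lemma piece_props:
  assumes "i \<in> piece_index"
  shows "piece i \<subseteq> digit_seqs" "prefix_compact (piece i)" "cyclic (snd i)"
    "\<And>s. 0 \<le> s \<Longrightarrow> Rd.hausdorff_measure d s (R ` piece i) \<le> Rd.hausdorff_measure d s (R ` Y (snd i))"
proof -
  obtain x n where x: "x \<in> X" "fst i = word n x" using assms by (auto simp: piece_index_def words_def)
  have D: "fst i ! k \<in> D" if "k < length (fst i)" for k
    using that x X_digit_seqs by (auto simp: digit_seqs_def)
  have Y: "Y (snd i) \<subseteq> digit_seqs" using Y_subset X_digit_seqs by blast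
  show "piece i \<subseteq> digit_seqs" unfolding piece_def by (rule splice_digit_seqs[OF D Y])
  show "prefix_compact (piece i)" unfolding piece_def by (rule prefix_compact_splice[OF Y_compact])
  show "cyclic (snd i)" using assms by (auto simp: piece_index_def)
  show "\<And>s. 0 \<le> s \<Longrightarrow> Rd.hausdorff_measure d s (R ` piece i) \<le> Rd.hausdorff_measure d s (R ` Y (snd i))"
    unfolding piece_def by (rule hausdorff_measure_splice_le[OF D Y])
qed

lemma X_pieces: "X \<subseteq> (\<Union>i\<in>piece_index. piece i)"
proof
  fix x assume "x \<in> X"
  then obtain p where p: "infinite_path p" "x = l \<circ> p" by (auto simp: X_def)
  obtain n w where w: "cyclic w" "(\<lambda>k. p (n + k)) \<in> component_paths w" by (rule eventually_component[OF p(1)])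
  let ?y = "l \<circ> (\<lambda>k. p (n + k))"
  have "?y \<in> Y w" using w(2) by (auto simp: component_shift_def)
  moreover have "x = splice ((!) (word n x)) (length (word n x)) ?y"
    using p(2) by (auto simp: splice_def fun_eq_iff)
  ultimately have "x \<in> piece (word n x, w)" unfolding piece_def by simp
  moreover have "(word n x, w) \<in> piece_index" using \<open>x \<in> X\<close> w(1) by (auto simp: piece_index_def words_def)
  ultimately show "x \<in> (\<Union>i\<in>piece_index. piece i)" by blast
qed

lemma hausdorff_sigma_finite:
  assumes "0 \<le> s" "\<And>w. cyclic w \<Longrightarrow> Rd.hausdorff_measure d s (R ` Y w) < top"
  shows "Rd.hausdorff_sigma_finite_on d s (R ` X)"
proof -
  have ne: "piece_index \<noteq> {}" using X_pieces X_nonempty by blast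
  \<comment> \<open>Intersecting with the closed image of \<open>X\<close> discards the foreign
    points of a piece and keeps the set measurable.\<close>
  define A where "A n = R ` X \<inter> R ` piece (from_nat_into piece_index n)" for n
  have ix: "from_nat_into piece_index n \<in> piece_index" for n by (rule from_nat_into[OF ne])
  have "A n \<in> lambda_system (Rd d) (Pow (Rd d)) (Rd.hausdorff_measure d s)" for n
    unfolding A_def
    using closedin_R_image X_digit_seqs X_compact piece_props(1,2)[OF ix]
    by (intro Rd.closedin_lambda_system closedin_Int assms(1)) auto
  moreover have "Rd.hausdorff_measure d s (A n) < \<infinity>" for n
  proof -
    have "Rd.hausdorff_measure d s (A n) \<le> Rd.hausdorff_measure d s (R ` piece (from_nat_into piece_index n))"
      by (rule Rd.hausdorff_measure_mono) (auto simp: A_def)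
    also have "\<dots> \<le> Rd.hausdorff_measure d s (R ` Y (snd (from_nat_into piece_index n)))"
      by (rule piece_props(4)[OF ix assms(1)])
    also have "\<dots> < top" by (intro assms(2) piece_props(3) ix)
    finally show ?thesis by simp
  qed
  moreover have "R ` X = (\<Union>n. A n)"
  proof
    show "R ` X \<subseteq> (\<Union>n. A n)"
    proof (rule image_subsetI)
      fix x assume x: "x \<in> X"
      then obtain i where i: "i \<in> piece_index" "x \<in> piece i" using X_pieces by blast
      then obtain n where "from_nat_into piece_index n = i"
        using from_nat_into_surj[OF countable_piece_index] by metis
      then have "R x \<in> A n" using x i by (auto simp: A_def)
      then show "R x \<in> (\<Union>n. A n)" by blast
    qed
  qed (auto simp: A_def)
  ultimately show ?thesis unfolding Rd.hausdorff_sigma_finite_on_def by blast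
qed

lemma hausdorff_measure_null:
  assumes "0 \<le> s" "\<And>w. cyclic w \<Longrightarrow> Rd.hausdorff_measure d s (R ` Y w) = 0"
  shows "Rd.hausdorff_measure d s (R ` X) = 0"
proof -
  have "Rd.hausdorff_measure d s (\<Union>i\<in>piece_index. R ` piece i) = 0"
    using piece_props(3,4) assms by (intro Rd.hausdorff_measure_countable_null countable_piece_index) (metis le_zero_eq)
  moreover have "R ` X \<subseteq> (\<Union>i\<in>piece_index. R ` piece i)" using X_pieces by blast
  ultimately show ?thesis using Rd.hausdorff_measure_mono by (metis le_zero_eq)
qed

lemma component_measure_finite:
  assumes "cyclic w" "sponge_shift.dimY d m (Y w) \<le> s"
  shows "Rd.hausdorff_measure d s (R ` Y w) < top"
    "sponge_shift.dimY d m (Y w) < s \<Longrightarrow> Rd.hausdorff_measure d s (R ` Y w) = 0"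
proof -
  interpret Y: sponge_shift d m "Y w" "card E" by (rule sponge_shift_Y[OF assms(1)])
  show 1: "sponge_shift.dimY d m (Y w) < s \<Longrightarrow> Rd.hausdorff_measure d s (R ` Y w) = 0"
    using Rd.hausdorff_measure_zero_exponent_less[OF Y.hausdorff_measure_dimY_finite Y.dimY_nonneg] .
  show "Rd.hausdorff_measure d s (R ` Y w) < top"
    using 1 Y.hausdorff_measure_dimY_finite assms(2) by (cases "Y.dimY = s") auto
qed

lemma \<beta>_nonneg: "0 \<le> \<beta>"
proof -
  obtain v where "paths v \<noteq> {}" using starts(2) by blast
  then obtain w where "cyclic w" using cyclic_reachable by blast
  then show ?thesis
    using component_dim_le[of w] sponge_shift.dimY_nonneg[OF sponge_shift_Y[of w]] by linarith
qed

text \<open>If the measure at \<open>\<beta>\<close> vanished, every component would be null at some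
  exponent below \<open>\<beta>\<close>: those with smaller \<open>dimY\<close> by changing the
  exponent, the others by the dichotomy. The largest of these finitely many exponents would then
  bound the dimension.\<close>

theorem full_dimension:
  assumes "Rd.hausdorff_dim d (R ` X) = ereal \<beta>"
  shows "0 < Rd.hausdorff_measure d \<beta> (R ` X)" "Rd.hausdorff_sigma_finite_on d \<beta> (R ` X)"
proof -
  show "Rd.hausdorff_sigma_finite_on d \<beta> (R ` X)"
    using component_measure_finite(1) component_dim_le by (intro hausdorff_sigma_finite \<beta>_nonneg) auto
  show "0 < Rd.hausdorff_measure d \<beta> (R ` X)"
  proof (rule ccontr)
    assume "\<not> ?thesis"
    then have null: "Rd.hausdorff_measure d \<beta> (R ` X) = 0" by simp
    have ex: "\<exists>s. 0 \<le> s \<and> s < \<beta> \<and> Rd.hausdorff_measure d s (R ` Y w) = 0" if w: "cyclic w" for w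
    proof -
      interpret Y: sponge_shift d m "Y w" "card E" by (rule sponge_shift_Y[OF w])
      show ?thesis
      proof (cases "Y.dimY = \<beta>")
        case True
        have "Rd.hausdorff_measure d \<beta> (R ` Y w) \<le> Rd.hausdorff_measure d \<beta> (R ` X)"
          using Y_subset by (intro Rd.hausdorff_measure_mono image_mono)
        then show ?thesis using Y.hausdorff_measure_dimY_dichotomy null True by auto
      next
        case False
        then have "Y.dimY < \<beta>" using component_dim_le[OF w] by simp
        then show ?thesis using component_measure_finite(2)[OF w, of "(Y.dimY + \<beta>) / 2"] Y.dimY_nonneg
          by (intro exI[of _ "(Y.dimY + \<beta>) / 2"]) auto
      qed
    qed
    then obtain s where s: "\<And>w. cyclic w \<Longrightarrow> 0 \<le> s w \<and> s w < \<beta> \<and> Rd.hausdorff_measure d (s w) (R ` Y w) = 0"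
      by metis
    let ?C = "{w. cyclic w \<and> True}"
    have C: "finite ?C" by (rule finite_cyclic)
    have C0: "?C \<noteq> {}"
    proof -
      obtain v where "paths v \<noteq> {}" using starts(2) by blast
      then show ?thesis using cyclic_reachable by blast
    qed
    define s0 where "s0 = Max (s ` ?C)"
    have "s0 \<in> s ` ?C" unfolding s0_def using C C0 by (intro Max_in) auto
    then have s0: "0 \<le> s0" "s0 < \<beta>" using s by auto
    have "Rd.hausdorff_measure d s0 (R ` Y w) = 0" if w: "cyclic w" for w
    proof -
      have "s w \<le> s0" unfolding s0_def using C w by (intro Max_ge) auto
      then show ?thesis
        using s[OF w] Rd.hausdorff_measure_zero_exponent_less[of d "s w" "R ` Y w" s0] by (cases "s w = s0") auto
    qed
    then have "Rd.hausdorff_measure d s0 (R ` X) = 0" using s0 by (intro hausdorff_measure_null) auto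
    then have "Rd.hausdorff_dim d (R ` X) \<le> ereal s0" using s0 by (intro Rd.hausdorff_dim_le)
    then show False using assms s0 by simp
  qed
qed

end

section \<open>Two successive full shifts\<close>

text \<open>The digits are read off from consecutive floors of \<open>b ^ n * y\<close>, so that
  these floors are the prefix values.\<close>

lemma expansion_onto:
  assumes "2 \<le> b" "0 \<le> y" "y < 1"
  obtains x where "\<And>k. x k \<in> {0..b - 1}" "expansion b x = y"
proof -
  let ?b = "real_of_int b"
  define fl where "fl n = \<lfloor>?b ^ n * y\<rfloor>" for n
  define x where "x n = fl (Suc n) - b * fl n" for n
  have x: "x k \<in> {0..b - 1}" for k
  proof -
    let ?z = "?b ^ k * y"
    have f: "of_int \<lfloor>?z\<rfloor> \<le> ?z" "?z < of_int \<lfloor>?z\<rfloor> + 1" by linarith+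
    have "?b * of_int \<lfloor>?z\<rfloor> \<le> ?b * ?z" "?b * ?z < ?b * (of_int \<lfloor>?z\<rfloor> + 1)"
      using f assms(1) by (auto intro: mult_left_mono mult_strict_left_mono)
    then have "of_int (b * \<lfloor>?z\<rfloor>) \<le> ?b * ?z" "?b * ?z < of_int (b * \<lfloor>?z\<rfloor> + b)"
      by (simp_all add: ring_distribs)
    then have "b * \<lfloor>?z\<rfloor> \<le> \<lfloor>?b * ?z\<rfloor>" "\<lfloor>?b * ?z\<rfloor> < b * \<lfloor>?z\<rfloor> + b"
      by (simp_all only: le_floor_iff floor_less_iff)
    then show ?thesis by (simp add: x_def fl_def mult.assoc)
  qed
  have pv: "prefix_value b x n = fl n" for n
    using assms by (induction n) (auto simp: x_def fl_def floor_eq_iff)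
  have close: "\<bar>expansion b x - y\<bar> \<le> 1 / ?b ^ n" for n
  proof -
    let ?e = "expansion b (\<lambda>k. x (n + k))"
    have e: "0 \<le> ?e" "?e \<le> 1" using assms(1) x by (auto intro!: expansion_ge_0 expansion_le_1)
    have p: "0 < ?b ^ n" using assms(1) by simp
    have "expansion b x = (of_int (fl n) + ?e) / ?b ^ n"
      using expansion_split[of b x n, OF assms(1) x] by (simp add: pv)
    then have "expansion b x - y = (of_int (fl n) + ?e - ?b ^ n * y) / ?b ^ n"
      using assms(1) by (simp add: diff_divide_distrib)
    moreover have "\<bar>of_int (fl n) + ?e - ?b ^ n * y\<bar> \<le> 1"
      using e floor_correct[of "?b ^ n * y"] unfolding fl_def by linarith
    ultimately show ?thesis using p by (simp add: abs_divide divide_right_mono)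
  qed
  have "(\<lambda>n. 1 / ?b ^ n) \<longlonglongrightarrow> 0"
  proof -
    have "(\<lambda>n. (1 / ?b) ^ n) \<longlonglongrightarrow> 0" using assms(1) by (intro LIMSEQ_power_zero) simp
    then show ?thesis by (simp add: power_divide)
  qed
  then have "\<bar>expansion b x - y\<bar> \<le> 0" using close by (intro LIMSEQ_le_const) auto
  then have "expansion b x = y" by simp
  then show ?thesis by (rule that[OF x])
qed

text \<open>A set of diameter \<open>r\<close> projects into the interval of radius \<open>r\<close>
  around the coordinate of one of its points. Lebesgue measure of the projection then bounds the sum
  of the diameters, the factor 2 being the price of the centred intervals.\<close>

lemma hausdorff_measure_ge_projection:
  assumes "i < d" "0 \<le> c" "{0..<c} \<subseteq> (\<lambda>x. x i) ` S" "S \<subseteq> Rd d"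
  shows "ennreal (c / 2) \<le> Rd.hausdorff_measure d 1 S"
proof -
  have "ennreal (c / 2) \<le> Rd.hausdorff_premeasure d 1 1 S"
  proof (rule Rd.hausdorff_premeasure_ge)
    fix U :: "nat \<Rightarrow> (nat \<Rightarrow> real) set"
    assume U: "\<And>j. U j \<subseteq> Rd d" "\<And>j. Rd.ediam d (U j) \<le> ennreal 1" "S \<subseteq> (\<Union>j. U j)"
    define r where "r j = enn2real (Rd.ediam d (U j))" for j
    have fin: "Rd.ediam d (U j) < top" for j using U(2)[of j] by (simp add: order_le_less_trans)
    have r: "0 \<le> r j" "Rd.ediam d (U j) = ennreal (r j)" for j using fin[of j] by (auto simp: r_def)
    have dp: "Rd.diam_power d 1 (U j) = ennreal (r j)" for j
      using r(1)[of j] by (auto simp: Rd.diam_power_def r_def Rd.ediam_def bot_ennreal)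
    \<comment> \<open>For an empty \<open>U j\<close> the centre is arbitrary and the radius is 0,
      so the interval is a null set.\<close>
    define z where "z j = (SOME x. x \<in> U j) i" for j
    define I where "I j = {z j - r j..z j + r j}" for j
    have sub: "{0..<c} \<subseteq> (\<Union>j. I j)"
    proof
      fix y assume "y \<in> {0..<c}"
      then obtain x where x: "x \<in> S" "y = x i" using assms(3) by blast
      then obtain j where j: "x \<in> U j" using U(3) by blast
      then have "(SOME x. x \<in> U j) \<in> U j" by (rule someI[of "\<lambda>x. x \<in> U j"])
      then have "Rd_dist d x (SOME x. x \<in> U j) \<le> r j" using j r[of j] by (intro Rd.ediam_leD[of d "U j"]) auto
      moreover have "\<bar>x i - z j\<bar> \<le> Rd_dist d x (SOME x. x \<in> U j)"
        unfolding z_def Rd_dist_def using assms(1) member_le_L2_set[of "{..<d}" i "\<lambda>k. \<bar>x k - (SOME x. x \<in> U j) k\<bar>"]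
        by (simp add: L2_set_def)
      ultimately have "y \<in> I j" by (auto simp: I_def x(2))
      then show "y \<in> (\<Union>j. I j)" by blast
    qed
    have "ennreal c = emeasure lborel {0..<c}" using assms(2) by simp
    also have "\<dots> \<le> emeasure lborel (\<Union>j. I j)" by (intro emeasure_mono sub) (auto simp: I_def)
    also have "\<dots> \<le> (\<Sum>j. emeasure lborel (I j))" by (intro emeasure_subadditive_countably) (auto simp: I_def)
    also have "\<dots> = (\<Sum>j. ennreal 2 * ennreal (r j))"
      using r(1) by (simp add: I_def ennreal_mult[symmetric] del: ennreal_numeral)
    finally have "ennreal (1 / 2) * ennreal c \<le> ennreal (1 / 2) * (ennreal 2 * (\<Sum>j. ennreal (r j)))"
      by (intro mult_left_mono) auto
    also have "\<dots> = ennreal (1 / 2) * ennreal 2 * (\<Sum>j. ennreal (r j))" by (simp only: mult.assoc)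
    also have "ennreal (1 / 2) * ennreal 2 = 1" by (subst ennreal_mult[symmetric]) auto
    finally show "ennreal (c / 2) \<le> (\<Sum>j. Rd.diam_power d 1 (U j))"
      using assms(2) by (simp add: dp ennreal_mult[symmetric] del: ennreal_half)
  qed
  then show ?thesis using Rd.hausdorff_premeasure_le_measure[of 1 d 1 S] by simp
qed

definition full_shift :: "'a set \<Rightarrow> (nat \<Rightarrow> 'a) set" where
  "full_shift A = {x. \<forall>k. x k \<in> A}"

text \<open>Stated through pairs of positions, the set is visibly closed. A change-over index would
  hide this and be ambiguous, since the alphabets may share letters, as \<open>row\<close> and
  \<open>column q\<close> do for positive \<open>q\<close>.\<close>

definition two_step_shift :: "'a set \<Rightarrow> 'a set \<Rightarrow> (nat \<Rightarrow> 'a) set" where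
  "two_step_shift A B = {x. (\<forall>k. x k \<in> A \<union> B) \<and> (\<forall>i j. i < j \<longrightarrow> x i \<in> A \<or> x j \<in> B)}"

lemma two_step_shift_eq:
  "two_step_shift A B = full_shift A \<union> (\<Union>u\<in>lists A. splice ((!) u) (length u) ` full_shift B)"
proof (intro subset_antisym subsetI)
  fix x assume x: "x \<in> two_step_shift A B"
  show "x \<in> full_shift A \<union> (\<Union>u\<in>lists A. splice ((!) u) (length u) ` full_shift B)"
  proof (cases "\<forall>k. x k \<in> A")
    case False
    define n where "n = (LEAST k. x k \<notin> A)"
    have n: "x n \<notin> A" unfolding n_def by (rule LeastI_ex) (use False in blast)
    have less: "x k \<in> A" if "k < n" for k using not_less_Least[of k "\<lambda>k. x k \<notin> A"] that unfolding n_def by blast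
    have ge: "x (n + k) \<in> B" for k
    proof (cases "k = 0")
      case False
      then have "n < n + k" by simp
      then show ?thesis using x n unfolding two_step_shift_def by blast
    qed (use x n in \<open>auto simp: two_step_shift_def\<close>)
    have "word n x \<in> lists A" using less by (auto simp: word_def)
    moreover have "x = splice ((!) (word n x)) (length (word n x)) (\<lambda>k. x (n + k))"
      by (auto simp: splice_def fun_eq_iff)
    moreover have "(\<lambda>k. x (n + k)) \<in> full_shift B" using ge by (simp add: full_shift_def)
    ultimately show ?thesis by blast
  qed (simp add: full_shift_def)
next
  fix x assume "x \<in> full_shift A \<union> (\<Union>u\<in>lists A. splice ((!) u) (length u) ` full_shift B)"
  then consider "x \<in> full_shift A" | u y where "u \<in> lists A" "y \<in> full_shift B" "x = splice ((!) u) (length u) y" by blast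
  then show "x \<in> two_step_shift A B"
  proof cases
    case 2
    then have "u ! k \<in> A" if "k < length u" for k using that nth_mem by blast
    then show ?thesis using 2 by (auto simp: two_step_shift_def splice_def full_shift_def)
  qed (auto simp: two_step_shift_def full_shift_def)
qed

lemma closedin_coordinate:
  assumes "C \<subseteq> A"
  shows "closedin (product_topology (\<lambda>_. discrete_topology A) UNIV) {x \<in> UNIV \<rightarrow>\<^sub>E A. x k \<in> C}"
proof -
  have "closedin (product_topology (\<lambda>_. discrete_topology A) UNIV)
      {x \<in> topspace (product_topology (\<lambda>_. discrete_topology A) UNIV). x k \<in> C}"
    by (rule closedin_continuous_map_preimage[where Y = "discrete_topology A"])
       (use assms in \<open>auto intro: continuous_map_product_projection\<close>)
  then show ?thesis by simp
qed

text \<open>The vertices are disjoint copies of \<open>A\<close> and \<open>B\<close>, with all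
  edges except those from the second copy to the first. A shared letter thus has two
  vertices.\<close>

lemma sofic_two_step_shift:
  assumes "finite A" "finite B" "A \<noteq> {}" "A \<subseteq> S" "B \<subseteq> S"
  shows "sofic_subshift S (two_step_shift A B)"
  unfolding sofic_subshift_def
proof (intro conjI)
  let ?X = "two_step_shift A B"
  let ?T = "product_topology (\<lambda>_. discrete_topology S) (UNIV :: nat set)"
  show "subshift S ?X"
    unfolding subshift_def
  proof (intro conjI)
    obtain a where "a \<in> A" using assms(3) by blast
    then have "(\<lambda>_. a) \<in> ?X" by (simp add: two_step_shift_def)
    then show "?X \<noteq> {}" by blast
    show "shift ` ?X \<subseteq> ?X"
    proof (rule image_subsetI)
      fix x assume "x \<in> ?X"
      then have x: "\<And>k. x k \<in> A \<union> B" "\<And>i j. i < j \<Longrightarrow> x i \<in> A \<or> x j \<in> B" by (auto simp: two_step_shift_def)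
      then show "shift x \<in> ?X" using x(2)[of "Suc _" "Suc _"] by (auto simp: two_step_shift_def shift_def)
    qed
    let ?c = "\<lambda>k C. {x \<in> UNIV \<rightarrow>\<^sub>E S. x k \<in> C}"
    have "?X = (\<Inter>k. ?c k (A \<union> B)) \<inter> (\<Inter>(i, j)\<in>{(i, j). i < j}. ?c i A \<union> ?c j B)"
    proof (intro subset_antisym subsetI)
      fix x assume x: "x \<in> ?X"
      then have "x \<in> UNIV \<rightarrow>\<^sub>E S" using assms(4,5) by (auto simp: two_step_shift_def)
      then show "x \<in> (\<Inter>k. ?c k (A \<union> B)) \<inter> (\<Inter>(i, j)\<in>{(i, j). i < j}. ?c i A \<union> ?c j B)"
        using x by (auto simp: two_step_shift_def)
    qed (auto simp: two_step_shift_def)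
    moreover have "closedin ?T (\<Inter>k. ?c k (A \<union> B))"
    proof (rule closedin_Inter)
      show "closedin ?T C" if "C \<in> range (\<lambda>k. ?c k (A \<union> B))" for C
      proof -
        obtain k where "C = ?c k (A \<union> B)" using \<open>C \<in> _\<close> by blast
        then show ?thesis using closedin_coordinate[of "A \<union> B" S k] assms(4,5) by simp
      qed
    qed auto
    moreover have "closedin ?T (\<Inter>(i, j)\<in>{(i, j). i < j}. ?c i A \<union> ?c j B)"
    proof (rule closedin_Inter)
      have "(0::nat, 1) \<in> {(i, j). i < j}" by simp
      then show "(\<lambda>(i, j). ?c i A \<union> ?c j B) ` {(i::nat, j). i < j} \<noteq> {}" by blast
      show "closedin ?T C" if "C \<in> (\<lambda>(i, j). ?c i A \<union> ?c j B) ` {(i, j). i < j}" for C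
      proof -
        obtain i j where "C = ?c i A \<union> ?c j B" using \<open>C \<in> _\<close> by auto
        then show ?thesis
          using closedin_Un[OF closedin_coordinate[of A S i] closedin_coordinate[of B S j]] assms(4,5) by simp
      qed
    qed
    ultimately show "closedin ?T ?X" by (simp add: closedin_Int)
  qed
  obtain f g where f: "bij_betw f {..<card A} A" and g: "bij_betw g {..<card B} B"
    using ex_bij_betw_nat_finite[OF assms(1)] ex_bij_betw_nat_finite[OF assms(2)] by (auto simp: lessThan_atLeast0)
  define n where "n = card A"
  define V where "V = {..<n + card B}"
  define E where "E = {(u, v). u \<in> V \<and> v \<in> V \<and> (n \<le> u \<longrightarrow> n \<le> v)}"
  define l where "l v = (if v < n then f v else g (v - n))" for v
  define f' where "f' = the_inv_into {..<n} f"
  define g' where "g' = the_inv_into {..<card B} g"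
  have f': "f' a < n" "f (f' a) = a" if "a \<in> A" for a
    using that f the_inv_into_into[of f "{..<n}" a "{..<n}"] f_the_inv_into_f[of f "{..<n}" a]
    by (auto simp: f'_def n_def bij_betw_def)
  have g': "g' b < card B" "g (g' b) = b" if "b \<in> B" for b
    using that g the_inv_into_into[of g "{..<card B}" b "{..<card B}"] f_the_inv_into_f[of g "{..<card B}" b]
    by (auto simp: g'_def bij_betw_def)
  have lA: "l v \<in> A" if "v < n" for v using that f by (auto simp: l_def n_def bij_betw_def)
  have lB: "l v \<in> B" if "v \<in> V" "\<not> v < n" for v using that g by (auto simp: l_def V_def bij_betw_def)
  show "\<exists>(V :: nat set) E l. finite V \<and> E \<subseteq> V \<times> V \<and> l \<in> V \<rightarrow> S \<and> ?X = {\<lambda>k. l (v k) |v. \<forall>k. v k \<in> V \<and> (v k, v (Suc k)) \<in> E}"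
  proof (rule exI[of _ V], rule exI[of _ E], rule exI[of _ l], intro conjI)
    show "finite V" "E \<subseteq> V \<times> V" by (auto simp: V_def E_def)
    show "l \<in> V \<rightarrow> S" using lA lB assms(4,5) by blast
    show "?X = {\<lambda>k. l (v k) |v. \<forall>k. v k \<in> V \<and> (v k, v (Suc k)) \<in> E}"
    proof (intro subset_antisym subsetI)
      fix x assume x: "x \<in> ?X"
      \<comment> \<open>The path stays in the copy of \<open>A\<close> as long as all letters so far
        lie in \<open>A\<close>.\<close>
      define v where "v k = (if \<forall>i\<le>k. x i \<in> A then f' (x k) else n + g' (x k))" for k
      have xAB: "x k \<in> A \<union> B" "i < k \<Longrightarrow> x i \<in> A \<or> x k \<in> B" for i k
        using x unfolding two_step_shift_def by blast+
      have B: "x k \<in> B" if *: "\<not> (\<forall>i\<le>k. x i \<in> A)" for k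
      proof -
        obtain i where "i \<le> k" "x i \<notin> A" using * by blast
        then show ?thesis using xAB(1)[of k] xAB(2)[of i k] by (cases "i = k") auto
      qed
      have "v k \<in> V" for k using f'[of "x k"] g'[of "x k"] B[of k] by (auto simp: v_def V_def)
      moreover have "n \<le> v k \<longrightarrow> n \<le> v (Suc k)" for k
        using f'[of "x k"] by (auto simp: v_def le_Suc_eq)
      moreover have "l (v k) = x k" for k using f'[of "x k"] g'[of "x k"] B[of k] by (auto simp: v_def l_def)
      ultimately show "x \<in> {\<lambda>k. l (v k) |v. \<forall>k. v k \<in> V \<and> (v k, v (Suc k)) \<in> E}"
        by (intro CollectI exI[of _ v]) (auto simp: E_def)
    next
      fix x assume "x \<in> {\<lambda>k. l (v k) |v. \<forall>k. v k \<in> V \<and> (v k, v (Suc k)) \<in> E}"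
      then obtain v where v: "x = (\<lambda>k. l (v k))" "\<And>k. v k \<in> V" "\<And>k. (v k, v (Suc k)) \<in> E" by blast
      have up: "n \<le> v (i + k)" if "n \<le> v i" for i k
        using that by (induction k) (use v(3) in \<open>auto simp: E_def\<close>)
      have "x i \<in> A \<or> x j \<in> B" if "i < j" for i j
      proof (cases "v i < n")
        case False
        then have "n \<le> v j" using up[of i "j - i"] that by simp
        then show ?thesis using lB[OF v(2)[of j]] v(1) by simp
      qed (use lA v(1) in simp)
      moreover have "x k \<in> A \<union> B" for k using lA[of "v k"] lB[OF v(2)[of k]] v(1) by (cases "v k < n") auto
      ultimately show "x \<in> ?X" by (simp add: two_step_shift_def)
    qed
  qed
qed

lemma prefix_compact_full_shift:
  assumes "finite A"
  shows "prefix_compact (full_shift A)"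
  unfolding prefix_compact_def
proof (intro allI impI)
  fix f :: "nat \<Rightarrow> nat \<Rightarrow> 'a" assume "\<forall>n. f n \<in> full_shift A"
  then have f: "f n k \<in> A" for n k by (simp add: full_shift_def)
  have "\<exists>p. \<forall>k. infinite {n. \<forall>i<k. f n i = p i}"
    by (rule koenig_limit[where f = f, OF assms f]) blast
  then obtain p where p: "\<And>k. infinite {n. \<forall>i<k. f n i = p i}" by blast
  have "p k \<in> A" for k
  proof -
    obtain n where "\<forall>i<Suc k. f n i = p i"
      using p[of "Suc k"] by (metis (mono_tags, lifting) Collect_empty_eq finite.emptyI)
    then have "f n k = p k" by auto
    then show ?thesis using f by metis
  qed
  then show "\<exists>y\<in>full_shift A. \<forall>k. infinite {n. \<forall>i<k. f n i = y i}" using p by (auto simp: full_shift_def)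
qed

context sponge
begin

lemma finite_code:
  assumes "Y \<subseteq> digit_seqs" "0 \<le> t"
  shows "finite (code t ` Y)"
proof (rule card_image_le_of_kernel(1)[where g = "\<lambda>x. \<lambda>k\<in>{..<level (d - 1) t}. x k"])
  let ?L = "level (d - 1) t"
  have "finite D" unfolding digits_def by (intro finite_PiE) auto
  then have "finite ({..<?L} \<rightarrow>\<^sub>E D)" by (intro finite_PiE) auto
  moreover have "(\<lambda>x. \<lambda>k\<in>{..<?L}. x k) ` Y \<subseteq> {..<?L} \<rightarrow>\<^sub>E D"
    using assms(1) by (intro image_subsetI) (auto simp: restrict_PiE_iff digit_seqs_def)
  ultimately show "finite ((\<lambda>x. \<lambda>k\<in>{..<?L}. x k) ` Y)" by (rule finite_subset[rotated])
  fix x y :: "nat \<Rightarrow> nat \<Rightarrow> int" assume eq: "(\<lambda>k\<in>{..<?L}. x k) = (\<lambda>k\<in>{..<?L}. y k)"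
  show "code t x = code t y"
    unfolding code_eq_iff[OF assms(2)]
  proof (intro allI impI)
    fix r k assume "r < d" "k < level r t"
    moreover have "level r t \<le> ?L" using \<open>r < d\<close> assms(2) by (intro level_mono) auto
    ultimately show "x k r = y k r" using fun_cong[OF eq, of k] by simp
  qed
qed

text \<open>Only the digits of coordinate \<open>c\<close> vary, and the code sees the first
  \<open>level c t\<close> of them.\<close>

lemma code_count_one_coordinate:
  assumes c: "c < d" and t: "0 \<le> t" and q: "0 < q"
    and Y: "\<And>y k. y \<in> Y \<Longrightarrow> y k c \<in> {0..<int q}" "\<And>y k r. \<lbrakk>y \<in> Y; r < d; r \<noteq> c\<rbrakk> \<Longrightarrow> y k r = 0"
  shows "finite (code t ` Y)" "card (code t ` Y) \<le> exp (ln q / lg c * t)"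
proof -
  let ?L = "level c t"
  let ?g = "\<lambda>x. \<lambda>k\<in>{..<?L}. x k c"
  let ?P = "{..<?L} \<rightarrow>\<^sub>E {0..<int q}"
  have fin: "finite ?P" by (intro finite_PiE) auto
  have sub: "?g ` Y \<subseteq> ?P" using Y(1) by (intro image_subsetI) (simp add: restrict_PiE_iff)
  have ker: "code t x = code t y" if "x \<in> Y" "y \<in> Y" "?g x = ?g y" for x y
    unfolding code_eq_iff[OF t]
  proof (intro allI impI)
    fix r k assume rk: "r < d" "k < level r t"
    show "x k r = y k r"
    proof (cases "r = c")
      case True
      then show ?thesis using fun_cong[OF that(3), of k] rk by simp
    qed (use Y(2)[OF that(1) rk(1)] Y(2)[OF that(2) rk(1)] in simp)
  qed
  have fing: "finite (?g ` Y)" using sub fin by (rule finite_subset)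
  show "finite (code t ` Y)" by (rule card_image_le_of_kernel(1)[OF fing ker])
  have "card (code t ` Y) \<le> card (?g ` Y)" by (rule card_image_le_of_kernel(2)[OF fing ker])
  also have "\<dots> \<le> card ?P" by (rule card_mono[OF fin sub])
  also have "\<dots> = q ^ ?L" by (simp add: card_PiE)
  finally have "real (card (code t ` Y)) \<le> real q ^ ?L" by (metis of_nat_le_iff of_nat_power)
  also have "\<dots> = exp (real ?L * ln q)" using q by (simp add: exp_of_nat_mult)
  also have "\<dots> \<le> exp (t / lg c * ln q)"
    using level_le[OF c t] q by (subst exp_le_cancel_iff) (intro mult_right_mono, auto)
  finally show "card (code t ` Y) \<le> exp (ln q / lg c * t)" by (simp add: mult_ac)
qed

end

lemma prefix_value_zero: "(\<And>k. k < n \<Longrightarrow> x k = 0) \<Longrightarrow> prefix_value b x n = 0"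
  by (induction n) auto

section \<open>The examples over the diagonal matrix with entries 4 and 3\<close>

definition example_m :: "nat \<Rightarrow> int" where
  "example_m r = (if r = 0 then 4 else 3)"

lemma admissible_example: "admissible_diagonal 2 example_m"
proof -
  have "\<exists>r<2. \<exists>s<2. example_m r \<noteq> example_m s"
    by (rule exI[of _ 0], rule conjI, simp, rule exI[of _ 1]) (simp add: example_m_def)
  then show ?thesis by (auto simp: admissible_diagonal_def example_m_def monotone_on_def)
qed

interpretation ex: sponge 2 example_m
  by unfold_locales (rule admissible_example)

lemma lg_example [simp]: "ex.lg 0 = ln 4" "ex.lg (Suc 0) = ln 3"
  by (simp_all add: ex.lg_def example_m_def)

lemma m_example [simp]: "example_m 0 = 4" "example_m (Suc 0) = 3"
  by (simp_all add: example_m_def)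

definition digit :: "int \<Rightarrow> int \<Rightarrow> nat \<Rightarrow> int" where
  "digit a b = (\<lambda>r\<in>{..<2}. if r = 0 then a else b)"

lemma digit_simps [simp]: "digit a b 0 = a" "digit a b (Suc 0) = b"
  by (simp_all add: digit_def)

lemma digit_in: "\<lbrakk>0 \<le> a; a \<le> 3; 0 \<le> b; b \<le> 2\<rbrakk> \<Longrightarrow> digit a b \<in> digits 2 example_m"
  by (auto simp: digit_def digits_def example_m_def restrict_PiE_iff)

definition row :: "(nat \<Rightarrow> int) set" where "row = (\<lambda>a. digit a 0) ` {0..3}"

definition column :: "nat \<Rightarrow> (nat \<Rightarrow> int) set" where "column q = digit 0 ` {0..<int q}"

lemma row_digits: "row \<subseteq> digits 2 example_m"
  using digit_in by (auto simp: row_def)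

lemma column_digits: "q \<le> 3 \<Longrightarrow> column q \<subseteq> digits 2 example_m"
  using digit_in by (auto simp: column_def)

lemma finite_row_column: "finite row" "finite (column q)" "row \<noteq> {}"
  by (auto simp: row_def column_def)

lemma full_shift_example: "A \<subseteq> digits 2 example_m \<Longrightarrow> full_shift A \<subseteq> ex.digit_seqs"
  by (auto simp: full_shift_def ex.digit_seqs_def)

lemma two_step_shift_example:
  "\<lbrakk>A \<subseteq> digits 2 example_m; B \<subseteq> digits 2 example_m\<rbrakk> \<Longrightarrow> two_step_shift A B \<subseteq> ex.digit_seqs"
  by (auto simp: two_step_shift_def ex.digit_seqs_def)

lemma less_2: "r < 2 \<longleftrightarrow> r = 0 \<or> r = Suc 0"
  by auto

lemma row_measure_finite: "Rd.hausdorff_measure 2 1 (ex.R ` full_shift row) < top"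
proof (rule ex.hausdorff_measure_finite[where K = 1])
  have Y: "y k 0 \<in> {0..<int 4}" "\<lbrakk>r < 2; r \<noteq> 0\<rbrakk> \<Longrightarrow> y k r = 0" if "y \<in> full_shift row" for y k r
  proof -
    have "y k \<in> row" using \<open>y \<in> _\<close> by (simp add: full_shift_def)
    then obtain a where "a \<in> {0..3}" "y k = digit a 0" unfolding row_def by blast
    then show "y k 0 \<in> {0..<int 4}" "\<lbrakk>r < 2; r \<noteq> 0\<rbrakk> \<Longrightarrow> y k r = 0" by (auto simp: less_2)
  qed
  fix t :: real assume t: "0 \<le> t"
  show "finite (ex.code t ` full_shift row)"
    by (rule ex.code_count_one_coordinate(1)[of 0 t 4]) (simp, rule t, simp, erule Y(1), erule (2) Y(2))
  have "card (ex.code t ` full_shift row) \<le> exp (ln (real 4) / ex.lg 0 * t)"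
    by (rule ex.code_count_one_coordinate(2)[of 0 t 4]) (simp, rule t, simp, erule Y(1), erule (2) Y(2))
  then show "card (ex.code t ` full_shift row) \<le> 1 * exp (1 * t)" by simp
qed (use full_shift_example[OF row_digits] in auto)

lemma column_measure_finite:
  assumes "0 < q" "q \<le> 3"
  shows "Rd.hausdorff_measure 2 (ln q / ln 3) (ex.R ` full_shift (column q)) < top"
proof (rule ex.hausdorff_measure_finite[where K = 1])
  have Y: "y k 1 \<in> {0..<int q}" "\<lbrakk>r < 2; r \<noteq> 1\<rbrakk> \<Longrightarrow> y k r = 0" if "y \<in> full_shift (column q)" for y k r
  proof -
    have "y k \<in> column q" using \<open>y \<in> _\<close> by (simp add: full_shift_def)
    then obtain a where "a \<in> {0..<int q}" "y k = digit 0 a" unfolding column_def by blast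
    then show "y k 1 \<in> {0..<int q}" "\<lbrakk>r < 2; r \<noteq> 1\<rbrakk> \<Longrightarrow> y k r = 0" by (auto simp: less_2)
  qed
  fix t :: real assume t: "0 \<le> t"
  show "finite (ex.code t ` full_shift (column q))"
    by (rule ex.code_count_one_coordinate(1)[of 1 t q]) (simp, rule t, rule assms(1), erule Y(1), erule (2) Y(2))
  have "card (ex.code t ` full_shift (column q)) \<le> exp (ln q / ex.lg 1 * t)"
    by (rule ex.code_count_one_coordinate(2)[of 1 t q]) (simp, rule t, rule assms(1), erule Y(1), erule (2) Y(2))
  then show "card (ex.code t ` full_shift (column q)) \<le> 1 * exp (ln q / ln 3 * t)" by simp
qed (use full_shift_example[OF column_digits[OF assms(2)]] assms in auto)

lemma row_measure_pos: "0 < Rd.hausdorff_measure 2 1 (ex.R ` full_shift row)"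
proof -
  have "ennreal (1 / 2) \<le> Rd.hausdorff_measure 2 1 (ex.R ` full_shift row)"
  proof (rule hausdorff_measure_ge_projection[of 0])
    show "{0..<1} \<subseteq> (\<lambda>x. x 0) ` ex.R ` full_shift row"
    proof
      fix y :: real assume "y \<in> {0..<1}"
      then obtain x where x: "\<And>k. x k \<in> {0..4 - 1}" "expansion 4 x = y"
        using expansion_onto[of 4 y] by auto
      define z where "z k = digit (x k) 0" for k
      have "z \<in> full_shift row" using x(1) by (auto simp: z_def full_shift_def row_def)
      moreover have "ex.R z 0 = y" using x(2) by (simp add: ex.R_eq z_def)
      ultimately show "y \<in> (\<lambda>x. x 0) ` ex.R ` full_shift row" by (metis imageI)
    qed
  qed (auto simp: ex.R_in_Rd)
  moreover have "0 < ennreal (1 / 2)" by (rule ennreal_less_zero_iff[THEN iffD2]) simp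
  ultimately show ?thesis by (rule order_less_le_trans[rotated])
qed

text \<open>Coordinate 0 is resolved to \<open>L0\<close> digits only, so nothing is lost there by
  switching to the column afterwards. Row words of length \<open>L0\<close> followed by column
  digits up to \<open>L1\<close> have distinct codes: a chain through two components that beats each
  of them alone.\<close>

lemma box_dim_example_gt_1:
  assumes "2 \<le> q" "q \<le> 3"
  shows "1 < Rd.lower_box_dim 2 (ex.R ` two_step_shift row (column q))"
proof -
  let ?X = "two_step_shift row (column q)"
  define b where "b = 1 + ln q * ex.\<alpha> 1"
  have X: "?X \<subseteq> ex.digit_seqs" using two_step_shift_example row_digits column_digits assms by blast
  have lnq: "0 < ln (real q)" using assms by simp
  have "1 / ln 4 < 1 / ln (3::real)" by (intro divide_strict_left_mono) auto
  then have "0 < ex.\<alpha> 1" by (simp add: ex.\<alpha>_def)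
  then have "1 < b" using lnq by (simp add: b_def)
  moreover have "ereal b \<le> Rd.lower_box_dim 2 (ex.R ` ?X)"
  proof (rule ex.lower_box_dim_ge[OF X ex.finite_code[OF X]])
    show "0 < 1 / (4 * real q)" using assms by simp
    fix t :: real assume t: "0 \<le> t"
    define L0 where "L0 = ex.level 0 t"
    define L1 where "L1 = ex.level 1 t"
    have L: "L0 \<le> L1" unfolding L0_def L1_def using t by (intro ex.level_mono) auto
    let ?U = "{..<L0} \<rightarrow>\<^sub>E {0..3::int}" and ?V = "{L0..<L1} \<rightarrow>\<^sub>E {0..<int q}"
    \<comment> \<open>The closing digit \<open>digit 0 0\<close> belongs to the column, so the
      sequence remains admissible after \<open>L1\<close>.\<close>
    define x where "x = (\<lambda>(u, v) k. if k < L0 then digit (u k) 0 else if k < L1 then digit 0 (v k) else digit 0 0)"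
    have xX: "x uv \<in> ?X" if mem: "uv \<in> ?U \<times> ?V" for uv
    proof -
      obtain u v where uv: "uv = (u, v)" "u \<in> ?U" "v \<in> ?V" using mem by blast
      have "digit (u k) 0 \<in> row" if "k < L0" for k using uv(2) that by (auto simp: row_def)
      moreover have "digit 0 (v k) \<in> column q" if "\<not> k < L0" "k < L1" for k
        using PiE_mem[OF uv(3), of k] that by (auto simp: column_def)
      moreover have "digit 0 0 \<in> column q" using assms by (auto simp: column_def)
      ultimately show ?thesis by (auto simp: two_step_shift_def uv(1) x_def)
    qed
    have inj: "inj_on (\<lambda>uv. ex.code t (x uv)) (?U \<times> ?V)"
    proof (rule inj_onI)
      fix uv uv' assume *: "uv \<in> ?U \<times> ?V" "uv' \<in> ?U \<times> ?V" "ex.code t (x uv) = ex.code t (x uv')"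
      obtain u v u' v' where uv: "uv = (u, v)" "uv' = (u', v')" "u \<in> ?U" "v \<in> ?V" "u' \<in> ?U" "v' \<in> ?V" using * by blast
      have c: "x uv k 0 = x uv' k 0" if "k < L0" for k
        using *(3) that unfolding ex.code_eq_iff[OF t] L0_def by simp
      have c': "x uv k 1 = x uv' k 1" if "k < L1" for k
        using *(3) that unfolding ex.code_eq_iff[OF t] L1_def by simp
      have "u k = u' k" if "k \<in> {..<L0}" for k using c[of k] that by (simp add: uv x_def)
      then have "u = u'" using uv by (intro PiE_ext) auto
      moreover have "v k = v' k" if "k \<in> {L0..<L1}" for k using c'[of k] that by (simp add: uv x_def)
      then have "v = v'" using uv by (intro PiE_ext) auto
      ultimately show "uv = uv'" using uv by simp
    qed
    have "4 ^ L0 * q ^ (L1 - L0) = card (?U \<times> ?V)" by (simp add: card_cartesian_product card_PiE)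
    also have "\<dots> = card ((\<lambda>uv. ex.code t (x uv)) ` (?U \<times> ?V))" by (rule card_image[OF inj, symmetric])
    also have "\<dots> \<le> card (ex.code t ` ?X)" using xX by (intro card_mono ex.finite_code[OF X t]) auto
    finally have h1: "real (4 ^ L0 * q ^ (L1 - L0)) \<le> card (ex.code t ` ?X)" by (rule of_nat_mono)
    have h2: "exp t / 4 \<le> 4 ^ L0"
    proof -
      have "t / ln 4 - 1 \<le> L0" using ex.level_gt[of 0 t] t by (simp add: L0_def)
      then have "(t / ln 4 - 1) * ln 4 \<le> L0 * ln (4::real)" by (intro mult_right_mono) auto
      then have "exp ((t / ln 4 - 1) * ln 4) \<le> exp (L0 * ln (4::real))" by (simp only: exp_le_cancel_iff)
      moreover have "exp ((t / ln 4 - 1) * ln 4) = exp t / (4::real)" by (simp add: left_diff_distrib exp_diff)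
      ultimately show ?thesis by (simp add: exp_of_nat_mult)
    qed
    have h3: "exp (t * (ln q * ex.\<alpha> 1)) / q \<le> real q ^ (L1 - L0)"
    proof -
      have "ex.\<alpha> 1 * t - 1 \<le> real (L1 - L0)" using ex.seg_bounds(2)[OF t, of 1] by (simp add: ex.seg_def L0_def L1_def)
      then have "(ex.\<alpha> 1 * t - 1) * ln q \<le> real (L1 - L0) * ln q" using lnq by (intro mult_right_mono) auto
      then have "exp ((ex.\<alpha> 1 * t - 1) * ln q) \<le> exp (real (L1 - L0) * ln q)" by (simp only: exp_le_cancel_iff)
      moreover have "(ex.\<alpha> 1 * t - 1) * ln q = t * (ln q * ex.\<alpha> 1) - ln q" by (simp add: algebra_simps)
      then have "exp ((ex.\<alpha> 1 * t - 1) * ln q) = exp (t * (ln q * ex.\<alpha> 1)) / q"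
        using assms by (simp only: exp_diff) simp
      ultimately show ?thesis using assms by (simp add: exp_of_nat_mult)
    qed
    have "exp t / 4 * (exp (t * (ln q * ex.\<alpha> 1)) / q) \<le> 4 ^ L0 * real q ^ (L1 - L0)"
      by (rule mult_mono[OF h2 h3]) auto
    also have "\<dots> \<le> card (ex.code t ` ?X)" using h1 by simp
    finally show "1 / (4 * real q) * exp (t * b) \<le> card (ex.code t ` ?X)"
      by (simp add: b_def ring_distribs exp_add)
  qed
  ultimately show ?thesis by (metis ereal_less(3) less_ereal.simps(1) one_ereal_def order_less_le_trans)
qed

lemma R_two_step_shift:
  "ex.R ` two_step_shift A B = ex.R ` full_shift A \<union> (\<Union>u\<in>lists A. ex.R ` splice ((!) u) (length u) ` full_shift B)"
  unfolding two_step_shift_eq by (simp add: image_Un image_UN)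

lemma splice_measure_le:
  assumes "u \<in> lists row" "q \<le> 3" "0 \<le> s"
  shows "Rd.hausdorff_measure 2 s (ex.R ` splice ((!) u) (length u) ` full_shift (column q))
    \<le> Rd.hausdorff_measure 2 s (ex.R ` full_shift (column q))"
proof (rule ex.hausdorff_measure_splice_le)
  show "u ! k \<in> digits 2 example_m" if "k < length u" for k
    using assms(1) row_digits nth_mem[OF that] by blast
qed (use full_shift_example column_digits assms in auto)

text \<open>The row alone has positive length, and the countably many column pieces have dimension
  at most 1.\<close>

lemma dim_example:
  assumes "0 < q" "q \<le> 3"
  shows "Rd.hausdorff_dim 2 (ex.R ` two_step_shift row (column q)) = 1"
proof (rule antisym)
  let ?K = "ex.R ` two_step_shift row (column q)"
  have "Rd.hausdorff_measure 2 u ?K = 0" if u: "1 < u" for u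
  proof -
    have "Rd.hausdorff_measure 2 u (ex.R ` full_shift row) = 0"
      using Rd.hausdorff_measure_zero_exponent_less[OF row_measure_finite] u by simp
    moreover have "Rd.hausdorff_measure 2 u (\<Union>v\<in>lists row. ex.R ` splice ((!) v) (length v) ` full_shift (column q)) = 0"
    proof (rule Rd.hausdorff_measure_countable_null)
      show "countable (lists row)" using finite_row_column(1) by (intro countable_lists countable_finite)
      have "ln q / ln 3 \<le> 1" and 0: "0 \<le> ln q / ln (3::real)" using assms by simp_all
      then have "ln q / ln 3 < u" using u by linarith
      then have "Rd.hausdorff_measure 2 u (ex.R ` full_shift (column q)) = 0"
        by (rule Rd.hausdorff_measure_zero_exponent_less[OF column_measure_finite[OF assms] 0])
      then show "Rd.hausdorff_measure 2 u (ex.R ` splice ((!) v) (length v) ` full_shift (column q)) = 0" if "v \<in> lists row" for v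
        using splice_measure_le[OF that assms(2), of u] u by simp
    qed
    ultimately show ?thesis
      unfolding R_two_step_shift
      using Rd.hausdorff_measure_Un[of 2 u "ex.R ` full_shift row"
          "\<Union>v\<in>lists row. ex.R ` splice ((!) v) (length v) ` full_shift (column q)"]
      by simp
  qed
  then show "Rd.hausdorff_dim 2 ?K \<le> 1"
    using Rd.hausdorff_dim_le_finite[of 1 2 ?K] by (simp add: one_ereal_def)
  have "0 < Rd.hausdorff_measure 2 1 ?K"
    using row_measure_pos Rd.hausdorff_measure_mono[of "ex.R ` full_shift row" ?K 2 1]
    by (auto simp: R_two_step_shift)
  then show "1 \<le> Rd.hausdorff_dim 2 ?K" using Rd.hausdorff_dim_ge[of 2 1 ?K] by (simp add: one_ereal_def)
qed

lemma measure_pos_example: "0 < Rd.hausdorff_measure 2 1 (ex.R ` two_step_shift row B)"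
proof -
  have "Rd.hausdorff_measure 2 1 (ex.R ` full_shift row) \<le> Rd.hausdorff_measure 2 1 (ex.R ` two_step_shift row B)"
    by (rule Rd.hausdorff_measure_mono) (auto simp: R_two_step_shift)
  then show ?thesis using row_measure_pos by (rule order_less_le_trans[rotated])
qed

text \<open>The vertical pieces have dimension at most \<open>ln 2 / ln 3\<close>, below 1, so only
  the horizontal segment counts.\<close>

lemma measure_example_2_finite: "Rd.hausdorff_measure 2 1 (ex.R ` two_step_shift row (column 2)) < top"
proof -
  let ?P = "\<Union>v\<in>lists row. ex.R ` splice ((!) v) (length v) ` full_shift (column 2)"
  have "Rd.hausdorff_measure 2 1 ?P = 0"
  proof (rule Rd.hausdorff_measure_countable_null)
    show "countable (lists row)" using finite_row_column(1) by (intro countable_lists countable_finite)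
    have "ln 2 / ln 3 < (1::real)" "0 \<le> ln 2 / ln (3::real)" by simp_all
    then have "Rd.hausdorff_measure 2 1 (ex.R ` full_shift (column 2)) = 0"
      using Rd.hausdorff_measure_zero_exponent_less[OF column_measure_finite[of 2], of 1] by simp
    then show "Rd.hausdorff_measure 2 1 (ex.R ` splice ((!) v) (length v) ` full_shift (column 2)) = 0" if "v \<in> lists row" for v
      using splice_measure_le[OF that, of 2 1] by simp
  qed
  then show ?thesis
    unfolding R_two_step_shift using Rd.hausdorff_measure_Un[of 2 1 "ex.R ` full_shift row" ?P] row_measure_finite
    by (simp add: order_le_less_trans)
qed

lemma sigma_finite_example:
  assumes "0 < q" "q \<le> 3"
  shows "Rd.hausdorff_sigma_finite_on 2 1 (ex.R ` two_step_shift row (column q))"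
proof -
  let ?P = "\<lambda>u. splice ((!) u) (length u) ` full_shift (column q)"
  define A where "A n = ex.R ` (if n = 0 then full_shift row else ?P (from_nat_into (lists row) (n - 1)))" for n
  have ne: "lists row \<noteq> {}" by auto
  have "countable (lists row)" using finite_row_column(1) by (intro countable_lists countable_finite)
  note lst = from_nat_into[OF ne] and surj = from_nat_into_surj[OF this]
  have P: "?P u \<subseteq> ex.digit_seqs" "prefix_compact (?P u)" if "u \<in> lists row" for u
  proof -
    have "u ! k \<in> digits 2 example_m" if "k < length u" for k
      using \<open>u \<in> lists row\<close> row_digits nth_mem[OF that] by blast
    then show "?P u \<subseteq> ex.digit_seqs"
      using full_shift_example[OF column_digits[OF assms(2)]] by (intro ex.splice_digit_seqs) auto
    show "prefix_compact (?P u)" by (intro prefix_compact_splice prefix_compact_full_shift finite_row_column)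
  qed
  have col: "Rd.hausdorff_measure 2 1 (ex.R ` full_shift (column q)) < top"
  proof (cases "q = 3")
    case True
    then show ?thesis using column_measure_finite[of 3] by simp
  next
    case False
    then have 1: "ln q / ln 3 < (1::real)" and 0: "0 \<le> ln q / ln (3::real)" using assms by simp_all
    show ?thesis
      using Rd.hausdorff_measure_zero_exponent_less[OF column_measure_finite[OF assms] 0 1] by simp
  qed
  show ?thesis
    unfolding Rd.hausdorff_sigma_finite_on_def
  proof (intro exI[of _ A] conjI allI)
    fix n
    show "A n \<in> lambda_system (Rd 2) (Pow (Rd 2)) (Rd.hausdorff_measure 2 1)"
      unfolding A_def
      using P[OF lst] full_shift_example[OF row_digits] prefix_compact_full_shift[OF finite_row_column(1)]
      by (intro Rd.closedin_lambda_system ex.closedin_R_image) auto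
    show "Rd.hausdorff_measure 2 1 (A n) < \<infinity>"
      using row_measure_finite order_le_less_trans[OF splice_measure_le[OF lst assms(2)] col]
      by (auto simp: A_def)
  next
    show "ex.R ` two_step_shift row (column q) = (\<Union>n. A n)"
    proof (intro subset_antisym subsetI)
      fix z assume "z \<in> ex.R ` two_step_shift row (column q)"
      then consider "z \<in> ex.R ` full_shift row" | u where "u \<in> lists row" "z \<in> ex.R ` ?P u"
        unfolding R_two_step_shift by blast
      then show "z \<in> (\<Union>n. A n)"
      proof cases
        case 1
        then have "z \<in> A 0" by (simp add: A_def)
        then show ?thesis by blast
      next
        case 2
        obtain n where "from_nat_into (lists row) n = u" using surj[OF 2(1)] by blast
        then have "z \<in> A (Suc n)" using 2(2) by (simp add: A_def)
        then show ?thesis by blast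
      qed
    next
      fix z assume "z \<in> (\<Union>n. A n)"
      then obtain n where "z \<in> A n" by blast
      then show "z \<in> ex.R ` two_step_shift row (column q)"
      proof (cases "n = 0")
        case True
        then show ?thesis using \<open>z \<in> A n\<close> by (simp add: A_def R_two_step_shift)
      next
        case False
        then have "z \<in> ex.R ` ?P (from_nat_into (lists row) (n - 1))" using \<open>z \<in> A n\<close> by (simp add: A_def)
        then show ?thesis unfolding R_two_step_shift using lst[of "n - 1"] by blast
      qed
    qed
  qed
qed

lemma expansion_zero: "expansion b (\<lambda>_. 0) = 0"
  by (simp add: expansion_def)

lemma expansion_append:
  assumes "2 \<le> b" "\<And>k. x k \<in> {0..b - 1}" "\<And>k. k < n \<Longrightarrow> x k = 0"
  shows "expansion b x = expansion b (\<lambda>k. x (n + k)) / of_int b ^ n"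
  using expansion_split[of b x n, OF assms(1,2)] prefix_value_zero[of n x b, OF assms(3)] by simp

text \<open>The \<open>4 ^ n\<close> row words of length \<open>n\<close> start vertical segments of
  length \<open>1 / 3 ^ n\<close> at distinct abscissas, and \<open>(4 / 3) ^ n\<close> is
  unbounded. The factor 1/2 is inherited from
  \<open>hausdorff_measure_ge_projection\<close>.\<close>

lemma measure_example_3_infinite:
  "Rd.hausdorff_measure 2 1 (ex.R ` two_step_shift row (column 3)) = top"
proof -
  let ?K = "ex.R ` two_step_shift row (column 3)"
  define P where "P u = splice ((!) u) (length u) ` full_shift (column 3)" for u :: "(nat \<Rightarrow> int) list"
  have row_nth: "u ! k \<in> row" if "u \<in> lists row" "k < length u" for u k
    using that nth_mem[OF that(2)] by blast
  have digs: "P u \<subseteq> ex.digit_seqs" if u: "u \<in> lists row" for u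
    unfolding P_def using row_nth[OF u] row_digits full_shift_example[OF column_digits[of 3]]
    by (intro ex.splice_digit_seqs) auto
  have low: "ennreal ((1 / 3 ^ n) / 2) \<le> Rd.hausdorff_measure 2 1 (ex.R ` P u)"
    if u: "u \<in> lists row" "length u = n" for u n
  proof (rule hausdorff_measure_ge_projection[of 1])
    show "{0..<1 / 3 ^ n} \<subseteq> (\<lambda>x. x 1) ` ex.R ` P u"
    proof
      fix y :: real assume "y \<in> {0..<1 / 3 ^ n}"
      then have "0 \<le> y * 3 ^ n" "y * 3 ^ n < 1" by (auto simp: field_simps)
      then obtain x where x: "\<And>k. x k \<in> {0..3 - 1}" "expansion 3 x = y * 3 ^ n"
        using expansion_onto[of 3 "y * 3 ^ n"] by auto
      define z where "z = splice ((!) u) n (\<lambda>k. digit 0 (x k))"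
      have "x k \<in> {0..<int 3}" for k using x(1)[of k] by auto
      then have "(\<lambda>k. digit 0 (x k)) \<in> full_shift (column 3)" by (simp add: full_shift_def column_def del: of_nat_numeral)
      then have zP: "z \<in> P u" unfolding z_def P_def using u(2) by blast
      have "ex.R z 1 = expansion 3 (\<lambda>k. z k 1)" by (simp add: ex.R_eq)
      also have "\<dots> = expansion 3 (\<lambda>k. z (n + k) 1) / of_int 3 ^ n"
      proof (rule expansion_append)
        show "z k 1 \<in> {0..3 - 1}" for k
          using ex.digit_seqsD[of z 1 k] digs[OF u(1)] zP by auto
        show "z k 1 = 0" if "k < n" for k
          using row_nth[OF u(1), of k] that u(2) by (auto simp: z_def row_def)
      qed simp
      also have "\<dots> = y" using x(2) by (simp add: z_def)
      finally show "y \<in> (\<lambda>x. x 1) ` ex.R ` P u" using zP by (metis imageI)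
    qed
  qed (auto simp: ex.R_in_Rd)
  have disj: "ex.R ` P u \<inter> ex.R ` P v = {}"
    if uv: "u \<in> lists row" "v \<in> lists row" "length u = n" "length v = n" "u \<noteq> v" for u v n
  proof (rule ccontr)
    assume "\<not> ?thesis"
    then obtain x y where xy: "x \<in> P u" "y \<in> P v" "ex.R x = ex.R y" by blast
    \<comment> \<open>After the change-over all digits in coordinate 0 vanish, so the abscissa is a
      terminating expansion of length \<open>n\<close> and determines the row word.\<close>
    have val: "ex.R z 0 = of_int (prefix_value 4 (\<lambda>k. z k 0) n) / 4 ^ n" and dig: "z k 0 \<in> {0..4 - 1}"
      and pre: "k < n \<Longrightarrow> z k = w ! k"
      if w: "w \<in> lists row" "length w = n" "z \<in> P w" for z w k
    proof -
      obtain a where a: "a \<in> full_shift (column 3)" "z = splice ((!) w) n a" using w unfolding P_def by blast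
      have D: "z k 0 \<in> {0..4 - 1}" for k using ex.digit_seqsD[of z 0 k] digs[OF w(1)] w(3) by auto
      then show "z k 0 \<in> {0..4 - 1}" .
      have "z (n + k) 0 = 0" for k
      proof -
        have "a k \<in> column 3" using a(1) by (simp add: full_shift_def)
        then show ?thesis by (auto simp: a(2) column_def)
      qed
      then show "ex.R z 0 = of_int (prefix_value 4 (\<lambda>k. z k 0) n) / 4 ^ n"
        using expansion_split[of 4 "\<lambda>k. z k 0" n, OF _ D] by (simp add: ex.R_eq expansion_zero)
      show "k < n \<Longrightarrow> z k = w ! k" by (simp add: a(2))
    qed
    have "real_of_int (prefix_value 4 (\<lambda>k. x k 0) n) / 4 ^ n = of_int (prefix_value 4 (\<lambda>k. y k 0) n) / 4 ^ n"
      using val[OF uv(1,3) xy(1)] val[OF uv(2,4) xy(2)] xy(3) by simp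
    then have pv: "prefix_value 4 (\<lambda>k. x k 0) n = prefix_value 4 (\<lambda>k. y k 0) n" by simp
    have "u ! k = v ! k" if "k < n" for k
    proof -
      have "x k 0 = y k 0"
        by (rule prefix_value_inj[of 4 "\<lambda>k. x k 0" "\<lambda>k. y k 0" n k, OF _ dig[OF uv(1,3) xy(1)] dig[OF uv(2,4) xy(2)] pv that]) simp
      then have "(u ! k) 0 = (v ! k) 0" using pre[OF uv(1,3) xy(1) that] pre[OF uv(2,4) xy(2) that] by simp
      moreover have "u ! k \<in> row" "v ! k \<in> row" using row_nth uv that by auto
      ultimately show ?thesis by (auto simp: row_def)
    qed
    then show False using uv(3-5) nth_equalityI[of u v] by auto
  qed
  have card_row: "card row = 4"
  proof -
    have "inj_on (\<lambda>a. digit a 0) {0..3}" by (rule inj_onI) (metis digit_simps(1))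
    then show ?thesis unfolding row_def by (subst card_image) auto
  qed
  have ge: "ennreal ((4 / 3) ^ n / 2) \<le> Rd.hausdorff_measure 2 1 ?K" for n
  proof -
    let ?F = "{u. set u \<subseteq> row \<and> length u = n}"
    have F: "finite ?F" "card ?F = 4 ^ n"
      using finite_lists_length_eq[OF finite_row_column(1)] card_lists_length_eq[OF finite_row_column(1)]
      by (auto simp: card_row)
    have Fl: "u \<in> lists row" if "u \<in> ?F" for u using that by auto
    have "ennreal ((4 / 3) ^ n / 2) = ennreal (\<Sum>u\<in>?F. (1 / 3 ^ n) / 2)"
      using F(2) by (simp add: power_divide)
    also have "\<dots> = (\<Sum>u\<in>?F. ennreal ((1 / 3 ^ n) / 2))" by (rule sum_ennreal[symmetric]) simp
    also have "\<dots> \<le> (\<Sum>u\<in>?F. Rd.hausdorff_measure 2 1 (ex.R ` P u))" by (intro sum_mono low) auto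
    also have "\<dots> \<le> Rd.hausdorff_measure 2 1 (\<Union>u\<in>?F. ex.R ` P u)"
    proof (rule Rd.hausdorff_measure_disjoint_closed[OF F(1)])
      show "closedin (Rd.mtopology 2) (ex.R ` P u)" if "u \<in> ?F" for u
        using digs[OF Fl[OF that]] unfolding P_def
        by (intro ex.closedin_R_image prefix_compact_splice prefix_compact_full_shift finite_row_column) auto
      show "disjoint_family_on (\<lambda>u. ex.R ` P u) ?F"
        unfolding disjoint_family_on_def using disj Fl by blast
    qed simp
    also have "\<dots> \<le> Rd.hausdorff_measure 2 1 ?K"
    proof (rule Rd.hausdorff_measure_mono, rule UN_least)
      show "ex.R ` P u \<subseteq> ?K" if "u \<in> ?F" for u
        unfolding R_two_step_shift P_def using Fl[OF that] by blast
    qed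
    finally show ?thesis .
  qed
  show ?thesis
  proof (rule ccontr)
    assume "\<not> ?thesis"
    then obtain h where h: "Rd.hausdorff_measure 2 1 ?K = ennreal h" "0 \<le> h"
      by (cases "Rd.hausdorff_measure 2 1 ?K") auto
    obtain n where "2 * h < (4 / 3 :: real) ^ n" using real_arch_pow[of "4 / 3" "2 * h"] by auto
    then show False using ge[of n] h by simp
  qed
qed

text \<open>The points are the origin and those at abscissa \<open>(1 / 3) / 4 ^ n\<close> on the
  horizontal axis. At scale \<open>exp (- t)\<close> only linearly many in \<open>t\<close> are
  distinguished, so all dimensions are 0, while the measure of exponent 0 counts points.\<close>

lemma countable_example:
  defines "Z \<equiv> two_step_shift {digit 0 0} {digit 1 0}"
  shows "Rd.lower_box_dim 2 (ex.R ` Z) = 0" "Rd.upper_box_dim 2 (ex.R ` Z) = 0"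
    "Rd.hausdorff_dim 2 (ex.R ` Z) = 0" "Rd.hausdorff_measure 2 0 (ex.R ` Z) = top"
proof -
  define z where "z n = splice (\<lambda>_. digit 0 0) n (\<lambda>_. digit 1 0)" for n
  define z0 where "z0 = (\<lambda>_::nat. digit 0 0)"
  have Zd: "Z \<subseteq> ex.digit_seqs"
    unfolding Z_def by (rule two_step_shift_example) (auto intro!: digit_in)
  have zZ: "z n \<in> Z" for n by (auto simp: z_def Z_def two_step_shift_def splice_def)
  have Zz: "Z \<subseteq> insert z0 (range z)"
  proof
    fix x assume "x \<in> Z"
    then consider "x \<in> full_shift {digit 0 0}"
      | u y where "u \<in> lists {digit 0 0}" "y \<in> full_shift {digit 1 0}" "x = splice ((!) u) (length u) y"
      unfolding Z_def two_step_shift_eq by blast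
    then show "x \<in> insert z0 (range z)"
    proof cases
      case 1
      then show ?thesis by (auto simp: z0_def full_shift_def)
    next
      case 2
      have "u ! k = digit 0 0" if "k < length u" for k using 2(1) nth_mem[OF that] by auto
      moreover have "y k = digit 1 0" for k using 2(2) by (simp add: full_shift_def)
      ultimately have "x = z (length u)" by (auto simp: 2(3) z_def splice_def fun_eq_iff)
      then show ?thesis by blast
    qed
  qed
  have Zne: "Z \<noteq> {}" using zZ by blast
  have "ereal 0 \<le> Rd.lower_box_dim 2 (ex.R ` Z)"
  proof (rule ex.lower_box_dim_ge[OF Zd ex.finite_code[OF Zd]])
    fix t :: real assume "0 \<le> t"
    then have "0 < card (ex.code t ` Z)" using ex.finite_code[OF Zd] Zne by (simp add: card_gt_0_iff)
    then show "1 * exp (t * 0) \<le> card (ex.code t ` Z)" by simp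
  qed auto
  moreover have "Rd.upper_box_dim 2 (ex.R ` Z) \<le> ereal 0"
  proof (rule ex.upper_box_dim_le[OF Zd ex.finite_code[OF Zd] Zne])
    show "0 < 1 / ln 3 + (1::real)" by (intro add_pos_pos) auto
    fix t :: real assume t: "0 \<le> t"
    let ?L = "ex.level 1 t"
    have L: "ex.level r t \<le> ?L" if "r < 2" for r using that t by (intro ex.level_mono) auto
    have far: "ex.code t (z n) = ex.code t (z ?L)" if "?L \<le> n" for n
      unfolding ex.code_eq_iff[OF t] using L that by (force simp: z_def splice_def)
    have z0: "ex.code t z0 = ex.code t (z ?L)"
      unfolding ex.code_eq_iff[OF t] using L by (force simp: z_def z0_def splice_def)
    have "ex.code t ` Z \<subseteq> (\<lambda>n. ex.code t (z n)) ` {..?L}"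
    proof (rule image_subsetI)
      fix x assume "x \<in> Z"
      then consider "x = z0" | n where "x = z n" using Zz by blast
      then show "ex.code t x \<in> (\<lambda>n. ex.code t (z n)) ` {..?L}"
      proof cases
        case 2
        then show ?thesis using far[of n] by (cases "n \<le> ?L") auto
      qed (use z0 in auto)
    qed
    then have "card (ex.code t ` Z) \<le> card ((\<lambda>n. ex.code t (z n)) ` {..?L})" by (intro card_mono) auto
    also have "\<dots> \<le> card {..?L}" by (rule card_image_le) auto
    finally have "real (card (ex.code t ` Z)) \<le> real ?L + 1" by simp
    also have "\<dots> \<le> t / ln 3 + 1" using ex.level_le[of 1 t] t by simp
    also have "\<dots> \<le> (1 / ln 3 + 1) * (t + 1) ^ 1 * exp (t * 0)"
      using t by (simp add: ring_distribs)
    finally show "card (ex.code t ` Z) \<le> (1 / ln 3 + 1) * (t + 1) ^ 1 * exp (t * 0)" .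
  qed
  moreover note Rd.lower_le_upper_box_dim[of 2 "ex.R ` Z"]
  ultimately show "Rd.lower_box_dim 2 (ex.R ` Z) = 0" "Rd.upper_box_dim 2 (ex.R ` Z) = 0"
    by (auto simp: zero_ereal_def intro: antisym order_trans)
  have inj: "inj (\<lambda>n. ex.R (z n))"
  proof (rule injI)
    fix i j assume eq: "ex.R (z i) = ex.R (z j)"
    define e where "e = expansion 4 (\<lambda>_. 1)"
    have val: "ex.R (z n) 0 = e / 4 ^ n" for n
    proof -
      have "expansion 4 (\<lambda>k. z n k 0) = expansion 4 (\<lambda>k. z n (n + k) 0) / of_int 4 ^ n"
        by (rule expansion_append) (auto simp: z_def splice_def)
      then show ?thesis by (simp add: ex.R_eq e_def z_def)
    qed
    \<comment> \<open>Splitting off the first digit shows that \<open>e\<close> is 1/3; being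
      nonzero, it keeps the points apart.\<close>
    have "e = (1 + e) / 4" unfolding e_def using expansion_split[of 4 "\<lambda>_. 1" 1] by simp
    then have "e \<noteq> 0" by auto
    moreover have "e / 4 ^ i = e / 4 ^ j" using val[of i] val[of j] eq by (simp only:)
    ultimately have "(4::real) ^ i = 4 ^ j" by (simp only: divide_cancel_left simp_thms)
    then show "i = j" by simp
  qed
  have "infinite (range (\<lambda>n. ex.R (z n)))" using inj by (rule range_inj_infinite)
  then have "infinite (ex.R ` Z)" by (rule infinite_super[rotated]) (use zZ in auto)
  then show top: "Rd.hausdorff_measure 2 0 (ex.R ` Z) = top"
    by (rule Rd.hausdorff_measure_0_infinite) (use ex.R_in_Rd in blast)
  show "Rd.hausdorff_dim 2 (ex.R ` Z) = 0"
  proof (rule antisym)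
    have "Rd.hausdorff_measure 2 u (ex.R ` Z) = 0" if u: "0 < u" for u
    proof -
      have "Rd.hausdorff_measure 2 u (\<Union>x\<in>Z. ex.R ` {x}) = 0"
      proof (rule Rd.hausdorff_measure_countable_null)
        show "countable Z" using Zz by (rule countable_subset) auto
        fix x assume x: "x \<in> Z"
        have "Rd.hausdorff_measure 2 0 (ex.R ` {x}) < top"
          by (rule ex.hausdorff_measure_finite[where K = 1]) (use x Zd in auto)
        then show "Rd.hausdorff_measure 2 u (ex.R ` {x}) = 0"
          using u by (rule Rd.hausdorff_measure_zero_exponent_less[OF _ order_refl])
      qed
      moreover have "(\<Union>x\<in>Z. ex.R ` {x}) = ex.R ` Z" by auto
      ultimately show ?thesis by simp
    qed
    then show "Rd.hausdorff_dim 2 (ex.R ` Z) \<le> 0"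
      using Rd.hausdorff_dim_le_finite[of 0 2 "ex.R ` Z"] by (simp add: zero_ereal_def)
    show "0 \<le> Rd.hausdorff_dim 2 (ex.R ` Z)"
      using Rd.hausdorff_dim_ge[of 2 0 "ex.R ` Z"] top by (simp add: zero_ereal_def)
  qed
qed

lemma sofic_set_properties:
  assumes "admissible_diagonal d m" "sofic_subshift (digits d m) X"
  shows "Rd.box_dim_exists d (sofic_set d m X)"
    "Rd.hausdorff_dim d (sofic_set d m X) = Rd.box_dim d (sofic_set d m X) \<Longrightarrow>
      Rd.hausdorff_measure d (dim_exponent d (sofic_set d m X)) (sofic_set d m X) > 0 \<and>
      Rd.hausdorff_sigma_finite_on d (dim_exponent d (sofic_set d m X)) (sofic_set d m X)"
proof -
  obtain V E l where V: "finite (V :: nat set)" "E \<subseteq> V \<times> V" "l \<in> V \<rightarrow> digits d m"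
    "X = {\<lambda>k. l (v k) |v. \<forall>k. v k \<in> V \<and> (v k, v (Suc k)) \<in> E}" and ne: "X \<noteq> {}"
    using assms(2) unfolding sofic_subshift_def subshift_def by blast
  have finE: "finite E" using V(1,2) by (meson finite_SigmaI finite_subset)
  interpret finite_graph E by unfold_locales (rule finE)
  interpret sofic_sponge d m E l X
  proof
    show "admissible_diagonal d m" by (rule assms(1))
    show "l v \<in> digits d m" if "v \<in> Field E" for v using that V(2,3) by (auto simp: Field_def)
    have "infinite_path p \<longleftrightarrow> (\<forall>k. p k \<in> V \<and> (p k, p (Suc k)) \<in> E)" for p
      using V(2) by (auto simp: infinite_path_def)
    then show "X = (\<lambda>p. l \<circ> p) ` {p. infinite_path p}" by (auto simp: V(4) comp_def)
    show "X \<noteq> {}" by (rule ne)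
  qed
  have K: "sofic_set d m X = coding_map d m ` X" by (simp add: sofic_set_def)
  show "Rd.box_dim_exists d (sofic_set d m X)"
    unfolding Rd.box_dim_exists_def K box_dim ..
  assume "Rd.hausdorff_dim d (sofic_set d m X) = Rd.box_dim d (sofic_set d m X)"
  then have dim: "Rd.hausdorff_dim d (coding_map d m ` X) = ereal \<beta>"
    unfolding K Rd.box_dim_def box_dim(2) .
  then show "Rd.hausdorff_measure d (dim_exponent d (sofic_set d m X)) (sofic_set d m X) > 0 \<and>
      Rd.hausdorff_sigma_finite_on d (dim_exponent d (sofic_set d m X)) (sofic_set d m X)"
    using full_dimension[OF dim] by (simp add: dim_exponent_def K)
qed

theorem theorem1p2:
  shows
    "(\<forall>d m X. admissible_diagonal d m \<and> sofic_subshift (digits d m) X \<longrightarrow>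
        (let K = sofic_set d m X; \<gamma> = dim_exponent d K in
           Rd.box_dim_exists d K \<and>
           (Rd.hausdorff_dim d K = Rd.box_dim d K \<longrightarrow>
              Rd.hausdorff_measure d \<gamma> K > 0 \<and> Rd.hausdorff_sigma_finite_on d \<gamma> K)))
     \<and>
     (\<exists>d m X. admissible_diagonal d m \<and> sofic_subshift (digits d m) X \<and>
        (let K = sofic_set d m X; \<gamma> = dim_exponent d K in
           Rd.hausdorff_dim d K = Rd.box_dim d K \<and> Rd.hausdorff_measure d \<gamma> K = \<infinity>))
     \<and>
     (\<exists>d m X. admissible_diagonal d m \<and> sofic_subshift (digits d m) X \<and>
        (let K = sofic_set d m X; \<gamma> = dim_exponent d K in
           Rd.hausdorff_dim d K < Rd.box_dim d K \<and>
           0 < Rd.hausdorff_measure d \<gamma> K \<and> Rd.hausdorff_measure d \<gamma> K < \<infinity>))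
     \<and>
     (\<exists>d m X. admissible_diagonal d m \<and> sofic_subshift (digits d m) X \<and>
        (let K = sofic_set d m X; \<gamma> = dim_exponent d K in
           Rd.hausdorff_dim d K < Rd.box_dim d K \<and>
           Rd.hausdorff_measure d \<gamma> K = \<infinity> \<and> Rd.hausdorff_sigma_finite_on d \<gamma> K))"
proof (intro conjI allI impI)
  fix d m X
  assume *: "admissible_diagonal d m \<and> sofic_subshift (digits d m) X"
  show "let K = sofic_set d m X; \<gamma> = dim_exponent d K in
           Rd.box_dim_exists d K \<and>
           (Rd.hausdorff_dim d K = Rd.box_dim d K \<longrightarrow>
              Rd.hausdorff_measure d \<gamma> K > 0 \<and> Rd.hausdorff_sigma_finite_on d \<gamma> K)"
    unfolding Let_def using sofic_set_properties[of d m X] * by blast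
next
  let ?Z = "two_step_shift {digit 0 0} {digit 1 0}"
  have "sofic_subshift (digits 2 example_m) ?Z"
    by (rule sofic_two_step_shift) (auto intro!: digit_in)
  moreover note countable_example
  ultimately show "\<exists>d m X. admissible_diagonal d m \<and> sofic_subshift (digits d m) X \<and>
        (let K = sofic_set d m X; \<gamma> = dim_exponent d K in
           Rd.hausdorff_dim d K = Rd.box_dim d K \<and> Rd.hausdorff_measure d \<gamma> K = \<infinity>)"
    using admissible_example
    by - (rule exI[of _ 2], rule exI[of _ example_m], rule exI[of _ ?Z],
       simp add: Let_def sofic_set_def dim_exponent_def Rd.box_dim_def)
next
  let ?Z = "two_step_shift row (column 2)"
  have "sofic_subshift (digits 2 example_m) ?Z"
    by (rule sofic_two_step_shift) (simp_all add: finite_row_column row_digits column_digits)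
  moreover have "1 < Rd.upper_box_dim 2 (ex.R ` ?Z)"
    using box_dim_example_gt_1[of 2] Rd.lower_le_upper_box_dim order_less_le_trans by force
  ultimately show "\<exists>d m X. admissible_diagonal d m \<and> sofic_subshift (digits d m) X \<and>
        (let K = sofic_set d m X; \<gamma> = dim_exponent d K in
           Rd.hausdorff_dim d K < Rd.box_dim d K \<and>
           0 < Rd.hausdorff_measure d \<gamma> K \<and> Rd.hausdorff_measure d \<gamma> K < \<infinity>)"
    using admissible_example dim_example[of 2] measure_pos_example measure_example_2_finite
    by - (rule exI[of _ 2], rule exI[of _ example_m], rule exI[of _ ?Z],
       simp add: Let_def sofic_set_def dim_exponent_def Rd.box_dim_def)
next
  let ?Z = "two_step_shift row (column 3)"
  have "sofic_subshift (digits 2 example_m) ?Z"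
    by (rule sofic_two_step_shift) (simp_all add: finite_row_column row_digits column_digits)
  moreover have "1 < Rd.upper_box_dim 2 (ex.R ` ?Z)"
    using box_dim_example_gt_1[of 3] Rd.lower_le_upper_box_dim order_less_le_trans by force
  ultimately show "\<exists>d m X. admissible_diagonal d m \<and> sofic_subshift (digits d m) X \<and>
        (let K = sofic_set d m X; \<gamma> = dim_exponent d K in
           Rd.hausdorff_dim d K < Rd.box_dim d K \<and>
           Rd.hausdorff_measure d \<gamma> K = \<infinity> \<and> Rd.hausdorff_sigma_finite_on d \<gamma> K)"
    using admissible_example dim_example[of 3] measure_example_3_infinite sigma_finite_example[of 3]
    by - (rule exI[of _ 2], rule exI[of _ example_m], rule exI[of _ ?Z],
       simp add: Let_def sofic_set_def dim_exponent_def Rd.box_dim_def)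
qed

end
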